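(* Let $n\ge1$ be an integer, let $\Gamma$ be a discrete group of type $F_{n+1}$, and suppose that $\ker D_{n-1}=\mathcal{SC}_n$. The following conditions are equivalent: (1) For every unitary representation $(\pi,\mathcal{H})$ of $\Gamma$, we have $H^n(\Gamma,\pi)=0$. (2) There exists $\lambda>0$ such that $\Delta_n-\lambda I\in\Sigma^2\mathbb{M}_{k_n}(\mathbb{R}\Gamma)$. (3) There exists $\lambda>0$ such that $(\Delta_{n-1}^+)^2-\lambda\Delta_{n-1}^+\in\Sigma^2\mathbb{M}_{k_{n-1}}(\mathbb{R}\Gamma)$.
   Context: $\mathbb{R}\Gamma$ is the real group algebra with involution $(\sum a_\gamma\gamma)^*=\sum a_\gamma\gamma^{-1}$; $\mathbb{M}_{k\times l}(\mathbb{R}\Gamma)$ denotes $k\times l$ matrices over $\mathbb{R}\Gamma$, $\mathbb{M}_k=\mathbb{M}_{k\times k}$, and for a matrix $x$, $x^*$ is the transpose of $x$ with the involution applied to each entry. $\Sigma^2\mathbb{M}_k(\mathbb{R}\Gamma)$ is the set of finite sums $\sum_i a_i^*a_i$ with $a_i\in\mathbb{M}_k(\mathbb{R}\Gamma)$. $I$ is the identity matrix. Finiteness: $\Gamma$ is of type $F_m$ if it acts freely by simplicial automorphisms on a locally finite contractible simplicial complex $X$ such that, for every $n\le m$, the set $X^{(n)}$ of $n$-simplices has a finite number $k_n$ of $\Gamma$-orbits. Fix such an $X$ (with $m=n+1$). Codifferentials: fix a $\Gamma$-invariant orientation of the simplices of $X$ and representatives $\tau^n_1,\dots,\tau^n_{k_n}$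 of the $\Gamma$-orbits in $X^{(n)}$. Writing the simplicial boundary as $\partial\tau^{n+1}_i=\sum_{j}\sum_{\gamma\in\Gamma}\varepsilon_{ij}(\gamma)\,\gamma\tau^n_j$, let $d_n\in\mathbb{M}_{k_{n+1}\times k_n}(\mathbb{R}\Gamma)$ be the matrix with entries $(d_n)_{ij}=\sum_\gamma\varepsilon_{ij}(\gamma)\gamma$. Then $d_nd_{n-1}=0$. Put $\Delta_n^+=d_n^*d_n$ and, for $n\ge1$, $\Delta_n=d_n^*d_n+d_{n-1}d_{n-1}^*$, both in $\mathbb{M}_{k_n}(\mathbb{R}\Gamma)$. Define $D_n:\mathbb{M}_{k_{n+1}}(\mathbb{R}\Gamma)\to\mathbb{M}_{k_n}(\mathbb{R}\Gamma)$ by $D_n(a)=d_n^*ad_n$, and the split conjugation space $$\mathcal{SC}_n=\{d_n^*x+yd_n:\ x\in\mathbb{M}_{k_{n+1}\times k_n}(\mathbb{R}\Gamma),\ y\in\mathbb{M}_{k_n\times k_{n+1}}(\mathbb{R}\Gamma)\}\subseteq\mathbb{M}_{k_n}(\mathbb{R}\Gamma).$$ Cohomology: for a unitary representation $(\pi,\mathcal{H})$ of $\Gamma$ on a Hilbert space, extend $\pi$ linearly to $\mathbb{R}\Gamma$ and apply it entrywise to matrices, so $\pi(d_n):\mathcal{H}^{k_n}\to\mathcal{H}^{k_{n+1}}$. Group cohomology is $H^n(\Gamma,\pi)=\ker\pi(d_n)/\operatorname{im}\pi(d_{n-1})$. *)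

theory Defs
  imports
    "HOL-Analysis.Analysis"
    "HOL-Combinatorics.Permutations"
    "HOL-Library.Poly_Mapping"
    "HOL-Library.Equipollence"
    "Jordan_Normal_Form.VS_Connect"
begin

no_notation vec_nth (infixl \<open>$\<close> 90)
hide_const (open) Finite_Cartesian_Product.vec

section \<open>Matrices over the real group algebra\<close>

text \<open>
  The group is a type of class \<open>group_add\<close>: a not necessarily commutative group, whose product is
  written \<open>+\<close>, unit \<open>0\<close> and inverse \<open>- g\<close>. The multiplication of \<open>'g \<Rightarrow>\<^sub>0 real\<close> is then convolution,
  so this type is the real group algebra. The scalar \<open>c\<close> is \<open>Poly_Mapping.single 0 c\<close>.
\<close>

type_synonym 'g group_algebra = "'g \<Rightarrow>\<^sub>0 real"

definition involution :: "'g::group_add group_algebra \<Rightarrow> 'g group_algebra" where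
  "involution a =
     (\<Sum>\<gamma>\<in>Poly_Mapping.keys a. Poly_Mapping.single (- \<gamma>) (Poly_Mapping.lookup a \<gamma>))"

definition mat_star :: "'g::group_add group_algebra mat \<Rightarrow> 'g group_algebra mat" where
  "mat_star A = mat (dim_col A) (dim_row A) (\<lambda>(i, j). involution (A $$ (j, i)))"

definition scalar_times ::
    "real \<Rightarrow> 'g::group_add group_algebra mat \<Rightarrow> 'g group_algebra mat" where
  "scalar_times c A = Poly_Mapping.single 0 c \<cdot>\<^sub>m A"

definition sums_of_squares :: "nat \<Rightarrow> 'g::group_add group_algebra mat set" where
  "sums_of_squares k =
     {foldr (+) (map (\<lambda>a. mat_star a * a) as) (0\<^sub>m k k) | as. set as \<subseteq> carrier_mat k k}"

section \<open>Simplicial complexes with a free cofinite action\<close>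

text \<open>
  Complexes are abstract; a simplex is identified with its finite nonempty set of vertices.
\<close>

definition abstract_complex :: "'v set set \<Rightarrow> bool" where
  "abstract_complex K \<longleftrightarrow>
     (\<forall>\<sigma>\<in>K. finite \<sigma> \<and> \<sigma> \<noteq> {}) \<and> (\<forall>\<sigma>\<in>K. \<forall>\<rho>. \<rho> \<subseteq> \<sigma> \<and> \<rho> \<noteq> {} \<longrightarrow> \<rho> \<in> K)"

definition simplices :: "'v set set \<Rightarrow> nat \<Rightarrow> 'v set set" where
  "simplices K p = {\<sigma> \<in> K. card \<sigma> = Suc p}"

definition locally_finite_complex :: "'v set set \<Rightarrow> bool" where
  "locally_finite_complex K \<longleftrightarrow> (\<forall>v\<in>\<Union>K. finite {\<sigma> \<in> K. v \<in> \<sigma>})"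

text \<open>Geometric realization in barycentric coordinates, with the weak topology: a set is open iff
  its trace on every closed simplex is open there.\<close>

definition closed_simplex :: "'v set \<Rightarrow> ('v \<Rightarrow> real) set" where
  "closed_simplex \<sigma> = {x. (\<forall>v. 0 \<le> x v) \<and> (\<forall>v. v \<notin> \<sigma> \<longrightarrow> x v = 0) \<and> sum x \<sigma> = 1}"

definition realization :: "'v set set \<Rightarrow> ('v \<Rightarrow> real) topology" where
  "realization K = topology (\<lambda>U. U \<subseteq> (\<Union>\<sigma>\<in>K. closed_simplex \<sigma>) \<and>
     (\<forall>\<sigma>\<in>K. openin (top_of_set (closed_simplex \<sigma>)) (U \<inter> closed_simplex \<sigma>)))"

lemma openin_realization:
  "openin (realization K) U \<longleftrightarrow> U \<subseteq> (\<Union>\<sigma>\<in>K. closed_simplex \<sigma>) \<and>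
     (\<forall>\<sigma>\<in>K. openin (top_of_set (closed_simplex \<sigma>)) (U \<inter> closed_simplex \<sigma>))"
proof -
  have "istopology (\<lambda>U. U \<subseteq> (\<Union>\<sigma>\<in>K. closed_simplex \<sigma>) \<and>
     (\<forall>\<sigma>\<in>K. openin (top_of_set (closed_simplex \<sigma>)) (U \<inter> closed_simplex \<sigma>)))"
    unfolding istopology_def
  proof (intro conjI allI impI ballI, goal_cases)
    case (1 S T) then show ?case by blast
  next
    case (2 S T \<sigma>)
    then have "openin (top_of_set (closed_simplex \<sigma>)) (S \<inter> closed_simplex \<sigma>)"
      and "openin (top_of_set (closed_simplex \<sigma>)) (T \<inter> closed_simplex \<sigma>)"
      by simp_all
    then have "openin (top_of_set (closed_simplex \<sigma>))
        ((S \<inter> closed_simplex \<sigma>) \<inter> (T \<inter> closed_simplex \<sigma>))"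
      by (rule openin_Int)
    moreover have "S \<inter> T \<inter> closed_simplex \<sigma> = (S \<inter> closed_simplex \<sigma>) \<inter> (T \<inter> closed_simplex \<sigma>)"
      by blast
    ultimately show ?case by (simp only:)
  next
    case (3 \<K>) then show ?case by blast
  next
    case (4 \<K> \<sigma>)
    then have "openin (top_of_set (closed_simplex \<sigma>)) (\<Union>S\<in>\<K>. S \<inter> closed_simplex \<sigma>)"
      by (intro openin_Union) auto
    moreover have "\<Union>\<K> \<inter> closed_simplex \<sigma> = (\<Union>S\<in>\<K>. S \<inter> closed_simplex \<sigma>)"
      by blast
    ultimately show ?case by (simp only:)
  qed
  then show ?thesis
    unfolding realization_def by (simp add: topology_inverse')
qed

lemma topspace_realization: "topspace (realization K) = (\<Union>\<sigma>\<in>K. closed_simplex \<sigma>)"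
proof -
  have "(\<Union>\<rho>\<in>K. closed_simplex \<rho>) \<inter> closed_simplex \<sigma> = closed_simplex \<sigma>" if "\<sigma> \<in> K" for \<sigma>
    using that by blast
  then have "openin (realization K) (\<Union>\<sigma>\<in>K. closed_simplex \<sigma>)"
    unfolding openin_realization by simp
  then have "(\<Union>\<sigma>\<in>K. closed_simplex \<sigma>) \<subseteq> topspace (realization K)"
    by (rule openin_subset)
  moreover have "topspace (realization K) \<subseteq> (\<Union>\<sigma>\<in>K. closed_simplex \<sigma>)"
    using openin_topspace[of "realization K"] unfolding openin_realization by (rule conjunct1)
  ultimately show ?thesis by (rule subset_antisym[rotated])
qed

definition simplicial_action ::
    "'v set set \<Rightarrow> ('g::group_add \<Rightarrow> 'v \<Rightarrow> 'v) \<Rightarrow> bool" where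
  "simplicial_action K act \<longleftrightarrow>
     (\<forall>v\<in>\<Union>K. act 0 v = v) \<and>
     (\<forall>g h. \<forall>v\<in>\<Union>K. act (g + h) v = act g (act h v)) \<and>
     (\<forall>g. \<forall>\<sigma>\<in>K. act g ` \<sigma> \<in> K)"

text \<open>Freeness refers to all points of the realization, not only to vertices. In barycentric
  coordinates, \<open>g\<close> fixes \<open>x\<close> iff \<open>x (act g v) = x v\<close> for every vertex \<open>v\<close>.\<close>

definition free_action ::
    "'v set set \<Rightarrow> ('g::group_add \<Rightarrow> 'v \<Rightarrow> 'v) \<Rightarrow> bool" where
  "free_action K act \<longleftrightarrow>
     (\<forall>g. \<forall>x\<in>topspace (realization K). (\<forall>v\<in>\<Union>K. x (act g v) = x v) \<longrightarrow> g = 0)"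

definition simplex_orbit :: "('g \<Rightarrow> 'v \<Rightarrow> 'v) \<Rightarrow> 'v set \<Rightarrow> 'v set set" where
  "simplex_orbit act \<sigma> = {act g ` \<sigma> | g. True}"

definition orbits :: "'v set set \<Rightarrow> ('g \<Rightarrow> 'v \<Rightarrow> 'v) \<Rightarrow> nat \<Rightarrow> 'v set set set" where
  "orbits K act p = simplex_orbit act ` simplices K p"

text \<open>\<open>K\<close> with the action \<open>act\<close> witnesses that the group is of type $F_m$. Nonemptiness is required
  because \<open>contractible_space\<close> holds for the empty space.\<close>

definition type_F_complex ::
    "nat \<Rightarrow> 'v set set \<Rightarrow> ('g::group_add \<Rightarrow> 'v \<Rightarrow> 'v) \<Rightarrow> bool" where
  "type_F_complex m K act \<longleftrightarrow>
     abstract_complex K \<and> K \<noteq> {} \<and> locally_finite_complex K \<and>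
     contractible_space (realization K) \<and>
     simplicial_action K act \<and> free_action K act \<and>
     (\<forall>p\<le>m. finite (orbits K act p))"

section \<open>Orientations and codifferentials\<close>

text \<open>Sign of the permutation carrying the list \<open>xs\<close> to the list \<open>ys\<close>; meaningful when both are
  enumerations without repetition of the same set.\<close>

definition order_sign :: "'v list \<Rightarrow> 'v list \<Rightarrow> int" where
  "order_sign xs ys = sign (THE q. q permutes {..<length xs} \<and> permute_list q xs = ys)"

text \<open>An orientation of a simplex is an ordering of its vertices up to even permutations; \<open>ori \<sigma>\<close> is
  a representative of the chosen class, so invariance is only required up to an even permutation.\<close>

definition invariant_orientation ::
    "'v set set \<Rightarrow> ('g \<Rightarrow> 'v \<Rightarrow> 'v) \<Rightarrow> ('v set \<Rightarrow> 'v list) \<Rightarrow> bool" where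
  "invariant_orientation K act ori \<longleftrightarrow>
     (\<forall>\<sigma>\<in>K. distinct (ori \<sigma>) \<and> set (ori \<sigma>) = \<sigma>) \<and>
     (\<forall>g. \<forall>\<sigma>\<in>K. order_sign (map (act g) (ori \<sigma>)) (ori (act g ` \<sigma>)) = 1)"

definition orbit_representatives ::
    "nat \<Rightarrow> 'v set set \<Rightarrow> ('g \<Rightarrow> 'v \<Rightarrow> 'v) \<Rightarrow> (nat \<Rightarrow> nat \<Rightarrow> 'v set) \<Rightarrow> bool" where
  "orbit_representatives m K act tau \<longleftrightarrow>
     (\<forall>p\<le>m. (\<forall>i<card (orbits K act p). tau p i \<in> simplices K p) \<and>
       bij_betw (\<lambda>i. simplex_orbit act (tau p i)) {..<card (orbits K act p)} (orbits K act p))"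

text \<open>The coefficient of the oriented simplex \<open>\<rho>\<close> in
  $\partial [v_0, \dots, v_p] = \sum_i (-1)^i [v_0, \dots, \widehat{v_i}, \dots, v_p]$,
  where $[v_0, \dots, v_p]$ is the oriented simplex \<open>\<sigma>\<close>.\<close>

definition boundary_coeff :: "('v set \<Rightarrow> 'v list) \<Rightarrow> 'v set \<Rightarrow> 'v set \<Rightarrow> int" where
  "boundary_coeff ori \<sigma> \<rho> =
     (\<Sum>i<length (ori \<sigma>).
        let f = take i (ori \<sigma>) @ drop (Suc i) (ori \<sigma>)
        in if set f = \<rho> then (-1) ^ i * order_sign f (ori \<rho>) else 0)"

definition codifferential ::
    "'v set set \<Rightarrow> ('g::group_add \<Rightarrow> 'v \<Rightarrow> 'v) \<Rightarrow> ('v set \<Rightarrow> 'v list) \<Rightarrow>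
     (nat \<Rightarrow> nat \<Rightarrow> 'v set) \<Rightarrow> nat \<Rightarrow> 'g group_algebra mat" where
  "codifferential K act ori tau p =
     mat (card (orbits K act (Suc p))) (card (orbits K act p)) (\<lambda>(i, j).
       let \<epsilon> = (\<lambda>\<gamma>. boundary_coeff ori (tau (Suc p) i) (act \<gamma> ` tau p j))
       in \<Sum>\<gamma> | \<epsilon> \<gamma> \<noteq> 0. Poly_Mapping.single \<gamma> (of_int (\<epsilon> \<gamma>)))"

definition upper_laplacian ::
    "(nat \<Rightarrow> 'g::group_add group_algebra mat) \<Rightarrow> nat \<Rightarrow> 'g group_algebra mat" where
  "upper_laplacian d p = mat_star (d p) * d p"

text \<open>Only meaningful for \<open>p \<ge> 1\<close>.\<close>

definition laplacian ::
    "(nat \<Rightarrow> 'g::group_add group_algebra mat) \<Rightarrow> nat \<Rightarrow> 'g group_algebra mat" where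
  "laplacian d p = mat_star (d p) * d p + d (p - 1) * mat_star (d (p - 1))"

definition conjugation ::
    "(nat \<Rightarrow> 'g::group_add group_algebra mat) \<Rightarrow> nat \<Rightarrow> 'g group_algebra mat \<Rightarrow>
     'g group_algebra mat" where
  "conjugation d p a = mat_star (d p) * a * d p"

definition split_conjugation_space ::
    "(nat \<Rightarrow> nat) \<Rightarrow> (nat \<Rightarrow> 'g::group_add group_algebra mat) \<Rightarrow> nat \<Rightarrow>
     'g group_algebra mat set" where
  "split_conjugation_space k d p =
     {mat_star (d p) * x + y * d p | x y.
        x \<in> carrier_mat (k (Suc p)) (k p) \<and> y \<in> carrier_mat (k p) (k (Suc p))}"

section \<open>Unitary representations and cohomology\<close>

text \<open>Hilbert spaces have explicit carriers so that one can quantify over them inside a formula.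
  The ring multiplication and unit inherited from the record \<open>module\<close> are irrelevant. The inner
  product is linear in its first argument.\<close>

record 'h hilbert = "(complex, 'h) module" +
  ip :: "'h \<Rightarrow> 'h \<Rightarrow> complex"

definition hdist :: "('h, 'm) hilbert_scheme \<Rightarrow> 'h \<Rightarrow> 'h \<Rightarrow> real" where
  "hdist H x y = sqrt (Re (ip H (x \<ominus>\<^bsub>H\<^esub> y) (x \<ominus>\<^bsub>H\<^esub> y)))"

locale hilbert_space = vectorspace "class_ring :: complex ring" H
  for H :: "('h, 'm) hilbert_scheme" (structure) +
  assumes ip_commute: "\<lbrakk>x \<in> carrier H; y \<in> carrier H\<rbrakk> \<Longrightarrow> ip H x y = cnj (ip H y x)"
    and ip_add: "\<lbrakk>x \<in> carrier H; y \<in> carrier H; z \<in> carrier H\<rbrakk> \<Longrightarrow>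
      ip H (x \<oplus> y) z = ip H x z + ip H y z"
    and ip_smult: "\<lbrakk>x \<in> carrier H; y \<in> carrier H\<rbrakk> \<Longrightarrow>
      ip H (c \<odot>\<^bsub>H\<^esub> x) y = c * ip H x y"
    and ip_nonneg: "x \<in> carrier H \<Longrightarrow> 0 \<le> Re (ip H x x)"
    and ip_definite: "\<lbrakk>x \<in> carrier H; ip H x x = 0\<rbrakk> \<Longrightarrow> x = \<zero>"
    and complete: "\<lbrakk>\<And>i::nat. X i \<in> carrier H;
        \<And>e. 0 < e \<Longrightarrow> \<exists>N. \<forall>i\<ge>N. \<forall>j\<ge>N. hdist H (X i) (X j) < e\<rbrakk> \<Longrightarrow>
      \<exists>l\<in>carrier H. (\<lambda>i. hdist H (X i) l) \<longlonglongrightarrow> 0"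

definition unitary_operator :: "('h, 'm) hilbert_scheme \<Rightarrow> ('h \<Rightarrow> 'h) \<Rightarrow> bool" where
  "unitary_operator H T \<longleftrightarrow>
     bij_betw T (carrier H) (carrier H) \<and>
     (\<forall>x\<in>carrier H. \<forall>y\<in>carrier H. T (x \<oplus>\<^bsub>H\<^esub> y) = T x \<oplus>\<^bsub>H\<^esub> T y) \<and>
     (\<forall>c. \<forall>x\<in>carrier H. T (c \<odot>\<^bsub>H\<^esub> x) = c \<odot>\<^bsub>H\<^esub> T x) \<and>
     (\<forall>x\<in>carrier H. \<forall>y\<in>carrier H. ip H (T x) (T y) = ip H x y)"

definition unitary_rep ::
    "('h, 'm) hilbert_scheme \<Rightarrow> ('g::group_add \<Rightarrow> 'h \<Rightarrow> 'h) \<Rightarrow> bool" where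
  "unitary_rep H \<pi> \<longleftrightarrow>
     (\<forall>g. unitary_operator H (\<pi> g)) \<and>
     (\<forall>g h. \<forall>x\<in>carrier H. \<pi> (g + h) x = \<pi> g (\<pi> h x))"

definition cochains :: "('h, 'm) hilbert_scheme \<Rightarrow> nat \<Rightarrow> 'h vec set" where
  "cochains H k = {v. dim_vec v = k \<and> (\<forall>i<k. v $ i \<in> carrier H)}"

definition rep_alg ::
    "('h, 'm) hilbert_scheme \<Rightarrow> ('g::group_add \<Rightarrow> 'h \<Rightarrow> 'h) \<Rightarrow> 'g group_algebra \<Rightarrow> 'h \<Rightarrow> 'h" where
  "rep_alg H \<pi> a x =
     (\<Oplus>\<^bsub>H\<^esub>\<gamma>\<in>Poly_Mapping.keys a. complex_of_real (Poly_Mapping.lookup a \<gamma>) \<odot>\<^bsub>H\<^esub> \<pi> \<gamma> x)"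

definition rep_mat ::
    "('h, 'm) hilbert_scheme \<Rightarrow> ('g::group_add \<Rightarrow> 'h \<Rightarrow> 'h) \<Rightarrow> 'g group_algebra mat \<Rightarrow>
     'h vec \<Rightarrow> 'h vec" where
  "rep_mat H \<pi> A v =
     vec (dim_row A) (\<lambda>i. \<Oplus>\<^bsub>H\<^esub>j\<in>{..<dim_col A}. rep_alg H \<pi> (A $$ (i, j)) (v $ j))"

definition rep_ker ::
    "('h, 'm) hilbert_scheme \<Rightarrow> ('g::group_add \<Rightarrow> 'h \<Rightarrow> 'h) \<Rightarrow> 'g group_algebra mat \<Rightarrow>
     'h vec set" where
  "rep_ker H \<pi> A =
     {v \<in> cochains H (dim_col A). rep_mat H \<pi> A v = vec (dim_row A) (\<lambda>i. \<zero>\<^bsub>H\<^esub>)}"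

definition rep_im ::
    "('h, 'm) hilbert_scheme \<Rightarrow> ('g::group_add \<Rightarrow> 'h \<Rightarrow> 'h) \<Rightarrow> 'g group_algebra mat \<Rightarrow>
     'h vec set" where
  "rep_im H \<pi> A = rep_mat H \<pi> A ` cochains H (dim_col A)"

text \<open>For \<open>p \<ge> 1\<close>, the set of cosets of the (not necessarily closed) image of \<open>d (p - 1)\<close> in the
  kernel of \<open>d p\<close>; it vanishes when the image itself, the zero coset, is its only element.\<close>

definition group_cohomology ::
    "('h, 'm) hilbert_scheme \<Rightarrow> ('g::group_add \<Rightarrow> 'h \<Rightarrow> 'h) \<Rightarrow>
     (nat \<Rightarrow> 'g group_algebra mat) \<Rightarrow> nat \<Rightarrow> 'h vec set set" where
  "group_cohomology H \<pi> d p =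
     (\<lambda>v. {vec (dim_vec v) (\<lambda>i. v $ i \<oplus>\<^bsub>H\<^esub> w $ i) | w. w \<in> rep_im H \<pi> (d (p - 1))}) `
       rep_ker H \<pi> (d p)"

definition cohomology_vanishes ::
    "('h, 'm) hilbert_scheme \<Rightarrow> ('g::group_add \<Rightarrow> 'h \<Rightarrow> 'h) \<Rightarrow>
     (nat \<Rightarrow> 'g group_algebra mat) \<Rightarrow> nat \<Rightarrow> bool" where
  "cohomology_vanishes H \<pi> d p \<longleftrightarrow> group_cohomology H \<pi> d p = {rep_im H \<pi> (d (p - 1))}"

end

theory Submission
  imports Defs "HOL-Library.Function_Algebras" "HOL-Homology.Homology"
begin

text \<open>
  A gap makes $\pi(\Delta_n)$ invertible; for a cocycle $v = \Delta_n w$ the summand $d_n^* d_n w$ vanishes, so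
  $v = d_{n-1} d_{n-1}^* w$ is a coboundary. Without a gap, a maximal cone containing the sums of squares and
  $-\Delta_n$ is a half space; the GNS construction for the resulting positive functional gives a nonzero
  harmonic vector, which is a cocycle orthogonal to the coboundaries.

  Conjugating (2) by $d_{n-1}$ gives (3), because $d_n d_{n-1} = 0$. Conversely, the rows of a root of
  $(\Delta_{n-1}^+)^2 - \lambda \Delta_{n-1}^+$ are cycles, so by acyclicity of the complex every root has the form
  $c d_{n-1}$. Hence $d_{n-1} d_{n-1}^* - \lambda I - \sum c^* c$ lies in $\ker D_{n-1} = \mathcal{SC}_n$, and hermitian
  elements of the split conjugation space become sums of squares after adding a multiple of $\Delta_n^+$ and
  an arbitrarily small multiple of the identity.
\<close>

text \<open>Vanishing cohomology is refuted by a Hilbert space inside the given type, whose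
  cardinality is only known to be at least the continuum. So the completion consists of functionals;
  these are determined by their values on countably many vectors and inject into the complex
  sequences. The group is countable because a connected locally finite complex has countably many
  vertices and a free action embeds the group into an orbit.

  Acyclicity is needed for simplicial chains with real coefficients, while contractibility concerns
  the realization. Duality connects them: a row annihilated by all cocycles lies in the row space of
  the codifferential, and cocycles are evaluated on singular simplices through the vertices where
  barycentric coordinates are largest. These vertices span a simplex of the complex only when the
  singular simplex is small, whence the iterated subdivisions. Integral cycles give real ones
  through a basis of the reals over the rationals. In degree zero the augmentation replaces the
  missing boundary.\<close>

no_notation vec_nth (infixl \<open>$\<close> 90)
hide_const (open) Finite_Cartesian_Product.vec
alias lookup = Poly_Mapping.lookup
alias single = Poly_Mapping.single
alias keys = Poly_Mapping.keys

section \<open>The real group algebra\<close>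

lemma sum_single_keys:
  fixes a :: "'g \<Rightarrow>\<^sub>0 'r::comm_monoid_add"
  assumes "finite S" "keys a \<subseteq> S"
  shows "(\<Sum>g\<in>S. single g (lookup a g)) = a"
proof (rule poly_mapping_eqI)
  fix k
  have "lookup (\<Sum>g\<in>S. single g (lookup a g)) k = (\<Sum>g\<in>S. if g = k then lookup a k else 0)"
    by (auto simp: lookup_sum lookup_single when_def intro!: sum.cong)
  also have "\<dots> = lookup a k"
    using assms by (auto simp: in_keys_iff subset_iff)
  finally show "lookup (\<Sum>g\<in>S. single g (lookup a g)) k = lookup a k" .
qed

lemma group_algebra_induct [case_names zero single add]:
  fixes a :: "'g group_algebra"
  assumes "P 0" "\<And>g c. P (single g c)" "\<And>a b. P a \<Longrightarrow> P b \<Longrightarrow> P (a + b)"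
  shows "P a"
proof -
  have "P (\<Sum>g\<in>S. single g (lookup a g))" if "finite S" for S
    using that by induction (auto intro: assms)
  then show ?thesis
    using sum_single_keys[of "keys a" a] by (metis finite_keys order_refl)
qed

lemma lookup_involution [simp]: "lookup (involution a) g = lookup a (- g)"
proof -
  have "lookup (involution a) g = (\<Sum>h\<in>keys a. if h = - g then lookup a (- g) else 0)"
    unfolding involution_def lookup_sum
    by (rule sum.cong) (auto simp: lookup_single when_def)
  also have "\<dots> = lookup a (- g)"
    by (auto simp: in_keys_iff)
  finally show ?thesis .
qed

lemma involution_simps [simp]:
  "involution 0 = 0"
  "involution (a + b) = involution a + involution b"
  "involution (a - b) = involution a - involution b"
  "involution (- a) = - involution a"
  "involution (involution a) = a"
  "involution (single g c) = single (- g) c"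
  by (auto intro!: poly_mapping_eqI simp: lookup_add lookup_minus lookup_single when_def)

lemma involution_1 [simp]: "involution (1 :: 'g::group_add group_algebra) = 1"
  using involution_simps(6)[of "0::'g" 1] by (simp del: involution_simps)

lemma involution_sum: "involution (sum f A) = (\<Sum>x\<in>A. involution (f x))"
  by (induction A rule: infinite_finite_induct) auto

lemma involution_mult [simp]: "involution (a * b) = involution b * involution a"
proof (induction a rule: group_algebra_induct)
  case (single g c)
  show ?case
    by (induction b rule: group_algebra_induct)
      (auto simp: mult_single minus_add algebra_simps)
qed (auto simp: algebra_simps)

lemma single_zero_commute: "single 0 c * a = a * single (0::'g::group_add) (c::real)"
  by (induction a rule: group_algebra_induct) (auto simp: mult_single algebra_simps)

lemma mult_single_zero_mult: "a * (single 0 c * b) = single (0::'g::group_add) (c::real) * (a * b)"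
  by (metis mult.assoc single_zero_commute)

lemma lookup_scalar_mult [simp]: "lookup (single 0 c * a) g = c * lookup a g"
  for a :: "'g::group_add group_algebra"
  by (induction a rule: group_algebra_induct)
    (auto simp: mult_single lookup_single lookup_add when_def algebra_simps)

lemma lookup_single_mult: "lookup (single h c * a) g = c * lookup a (- h + g)"
  for a :: "'g::group_add group_algebra"
proof (induction a rule: group_algebra_induct)
  case (single k d)
  have "h + k = g \<longleftrightarrow> k = - h + g"
    by (metis add.assoc add.left_neutral left_minus right_minus)
  then show ?case
    by (auto simp: mult_single lookup_single when_def)
qed (auto simp: lookup_add algebra_simps)

lemma lookup_mult_sum:
  fixes a b :: "'g::group_add group_algebra"
  assumes "finite S" "keys a \<subseteq> S"
  shows "lookup (a * b) g = (\<Sum>h\<in>S. lookup a h * lookup b (- h + g))"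
proof -
  have "a * b = (\<Sum>h\<in>S. single h (lookup a h) * b)"
    using sum_single_keys[OF assms] by (metis sum_distrib_right)
  then show ?thesis
    by (simp add: lookup_sum lookup_single_mult)
qed

text \<open>The coefficient at the unit is the canonical trace. On \<open>involution a * a\<close>
  it is the squared Euclidean norm of the coefficients, so the trace is faithful; vanishing
  arguments for sums of squares rest on this.\<close>

lemma lookup_star_mult_zero:
  "lookup (involution a * a) 0 = (\<Sum>h\<in>keys a. (lookup a h)\<^sup>2)"
proof -
  have "keys (involution a) \<subseteq> uminus ` keys a"
    by (auto simp: in_keys_iff image_iff) (metis in_keys_iff minus_minus)
  then have "lookup (involution a * a) 0 = (\<Sum>h\<in>uminus ` keys a. lookup a (- h) * lookup a (- h))"
    by (subst lookup_mult_sum[of "uminus ` keys a"]) auto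
  also have "\<dots> = (\<Sum>h\<in>keys a. (lookup a h)\<^sup>2)"
    by (subst sum.reindex) (auto simp: power2_eq_square)
  finally show ?thesis .
qed

lemma lookup_star_mult_zero_nonneg: "0 \<le> lookup (involution a * a) 0"
  by (simp add: lookup_star_mult_zero sum_nonneg)

lemma lookup_star_mult_zero_eq_0: "lookup (involution a * a) 0 = 0 \<longleftrightarrow> a = 0"
  by (simp add: lookup_star_mult_zero sum_nonneg_eq_0_iff)
    (metis in_keys_iff lookup_zero poly_mapping_eqI)

section \<open>Matrices over the group algebra\<close>

lemma dim_mat_star [simp]: "dim_row (mat_star A) = dim_col A" "dim_col (mat_star A) = dim_row A"
  by (auto simp: mat_star_def)

lemma mat_star_carrier [simp]: "mat_star A \<in> carrier_mat m n \<longleftrightarrow> A \<in> carrier_mat n m"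
  using carrier_matD carrier_matI dim_mat_star by metis

lemma index_mat_star [simp]:
  "i < dim_col A \<Longrightarrow> j < dim_row A \<Longrightarrow> mat_star A $$ (i, j) = involution (A $$ (j, i))"
  by (auto simp: mat_star_def)

lemma mat_star_star [simp]: "mat_star (mat_star A) = A"
  by (rule eq_matI) auto

lemma mat_star_add:
  "A \<in> carrier_mat m n \<Longrightarrow> B \<in> carrier_mat m n \<Longrightarrow> mat_star (A + B) = mat_star A + mat_star B"
  by (rule eq_matI) auto

lemma mat_star_minus:
  "A \<in> carrier_mat m n \<Longrightarrow> B \<in> carrier_mat m n \<Longrightarrow> mat_star (A - B) = mat_star A - mat_star B"
  by (rule eq_matI) auto

lemma mat_star_zero [simp]: "mat_star (0\<^sub>m m n) = 0\<^sub>m n m"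
  by (rule eq_matI) auto

lemma mat_star_one [simp]: "mat_star (1\<^sub>m n) = 1\<^sub>m n"
  by (rule eq_matI) auto

lemma mat_star_mult:
  "A \<in> carrier_mat m n \<Longrightarrow> B \<in> carrier_mat n l \<Longrightarrow> mat_star (A * B) = mat_star B * mat_star A"
  by (rule eq_matI) (auto simp: scalar_prod_def involution_sum)

lemma dim_scalar_times [simp]:
  "dim_row (scalar_times c A) = dim_row A" "dim_col (scalar_times c A) = dim_col A"
  by (auto simp: scalar_times_def)

lemma scalar_times_carrier [simp]: "scalar_times c A \<in> carrier_mat m n \<longleftrightarrow> A \<in> carrier_mat m n"
  using carrier_matD carrier_matI dim_scalar_times by metis

lemma index_scalar_times [simp]:
  "i < dim_row A \<Longrightarrow> j < dim_col A \<Longrightarrow> scalar_times c A $$ (i, j) = single 0 c * A $$ (i, j)"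
  by (auto simp: scalar_times_def)

lemma mat_star_scalar_times: "mat_star (scalar_times c A) = scalar_times c (mat_star A)"
  by (rule eq_matI) (auto simp: single_zero_commute[where a = "involution _"])

lemma scalar_times_mult_left:
  "A \<in> carrier_mat m n \<Longrightarrow> B \<in> carrier_mat n l \<Longrightarrow> scalar_times c A * B = scalar_times c (A * B)"
  by (rule eq_matI) (auto simp: scalar_prod_def sum_distrib_left mult.assoc)

lemma scalar_times_mult_right:
  "A \<in> carrier_mat m n \<Longrightarrow> B \<in> carrier_mat n l \<Longrightarrow> A * scalar_times c B = scalar_times c (A * B)"
  by (rule eq_matI)
    (auto simp: scalar_prod_def sum_distrib_left mult_single_zero_mult)

lemma scalar_times_scalar_times: "scalar_times c (scalar_times e A) = scalar_times (c * e) A"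
  by (rule eq_matI) (auto simp flip: mult.assoc simp: mult_single)

lemma scalar_times_1 [simp]: "scalar_times 1 A = A"
  by (rule eq_matI) auto

lemma scalar_times_0: "A \<in> carrier_mat m n \<Longrightarrow> scalar_times 0 A = 0\<^sub>m m n"
  by (rule eq_matI) auto

lemma scalar_times_minus:
  "A \<in> carrier_mat m n \<Longrightarrow> B \<in> carrier_mat m n \<Longrightarrow>
    scalar_times c (A - B) = scalar_times c A - scalar_times c B"
  by (rule eq_matI) (auto simp: algebra_simps)

lemma scalar_times_add_scalar: "scalar_times (c + e) A = scalar_times c A + scalar_times e A"
  by (rule eq_matI) (auto simp: single_add algebra_simps)

section \<open>Sums of squares\<close>

text \<open>The fold inside \<open>sums_of_squares\<close>, but with roots that need not be square.
  This allows a root to be multiplied by a codifferential or factored through one.\<close>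

definition sum_squares :: "nat \<Rightarrow> 'g::group_add group_algebra mat list \<Rightarrow> 'g group_algebra mat" where
  "sum_squares n as = foldr (+) (map (\<lambda>a. mat_star a * a) as) (0\<^sub>m n n)"

lemma sum_squares_simps [simp]:
  "sum_squares n [] = 0\<^sub>m n n"
  "sum_squares n (a # as) = mat_star a * a + sum_squares n as"
  by (auto simp: sum_squares_def)

lemma sum_squares_carrier [simp]:
  "set as \<subseteq> carrier_mat m n \<Longrightarrow> sum_squares n as \<in> carrier_mat n n"
  by (induction as) auto

lemma star_mult_carrier [simp]:
  "a \<in> carrier_mat m n \<Longrightarrow> mat_star a * a \<in> carrier_mat n n"
  by (metis mat_star_carrier mult_carrier_mat)

lemma index_star_mult:
  assumes "A \<in> carrier_mat m n" "p < n" "q < n"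
  shows "(mat_star A * A) $$ (p, q) = (\<Sum>i<m. involution (A $$ (i, p)) * A $$ (i, q))"
  using assms by (auto simp: scalar_prod_def atLeast0LessThan intro!: sum.cong)

lemma sum_squares_append:
  "set as \<subseteq> carrier_mat m n \<Longrightarrow> set bs \<subseteq> carrier_mat m n \<Longrightarrow>
     sum_squares n (as @ bs) = sum_squares n as + sum_squares n bs"
proof (induction as)
  case Nil
  then show ?case by (simp add: left_add_zero_mat[OF sum_squares_carrier])
next
  case (Cons a as)
  then show ?case
    using assoc_add_mat[OF star_mult_carrier sum_squares_carrier sum_squares_carrier, of a m n as m bs m]
    by simp
qed

lemma conjugate_sum_squares:
  assumes "X \<in> carrier_mat n l"
  shows "set as \<subseteq> carrier_mat m n \<Longrightarrow>
     mat_star X * sum_squares n as * X = sum_squares l (map (\<lambda>a. a * X) as)"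
proof (induction as)
  case Nil
  then show ?case using assms by simp
next
  case (Cons a as)
  then have a: "a \<in> carrier_mat m n" and as: "set as \<subseteq> carrier_mat m n" by auto
  have X': "mat_star X \<in> carrier_mat l n" using assms by simp
  have aX: "a * X \<in> carrier_mat m l" and a': "mat_star a \<in> carrier_mat n m" using a assms by auto
  have "mat_star X * (mat_star a * a) * X = mat_star X * (mat_star a * (a * X))"
    using assoc_mult_mat[OF X' star_mult_carrier[OF a] assms] assoc_mult_mat[OF a' a assms] by simp
  also have "\<dots> = mat_star (a * X) * (a * X)"
    using mat_star_mult[OF a assms] assoc_mult_mat[OF X' a' aX] by simp
  finally show ?case
    using Cons.IH[OF as]
      mult_add_distrib_mat[OF X' star_mult_carrier[OF a] sum_squares_carrier[OF as]]
      add_mult_distrib_mat[OF mult_carrier_mat[OF X' star_mult_carrier[OF a]]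
        mult_carrier_mat[OF X' sum_squares_carrier[OF as]] assms]
    by simp
qed

lemma trace_sum_squares_nonneg:
  assumes "set as \<subseteq> carrier_mat m n" "j < n"
  shows "0 \<le> lookup (sum_squares n as $$ (j, j)) 0"
  using assms(1)
proof (induction as)
  case (Cons a as)
  then show ?case using assms(2) sum_squares_carrier[of as m n]
    by (auto simp: scalar_prod_def lookup_sum lookup_add intro!: add_nonneg_nonneg sum_nonneg
        lookup_star_mult_zero_nonneg)
qed (use assms(2) in auto)

text \<open>The trace of the diagonal entry \<open>(j, j)\<close> is the sum, over all roots, of the
  squared norms of the entries in column \<open>j\<close>. It is zero only if all these entries
  are.\<close>

lemma sum_squares_eq_0:
  assumes "set as \<subseteq> carrier_mat m n" "sum_squares n as = 0\<^sub>m n n" "a \<in> set as"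
  shows "a = 0\<^sub>m m n"
  using assms
proof (induction as)
  case (Cons b as)
  have b: "b \<in> carrier_mat m n" and as: "set as \<subseteq> carrier_mat m n" using Cons.prems by auto
  have "b = 0\<^sub>m m n"
  proof (rule eq_matI)
    fix i j assume ij: "i < dim_row (0\<^sub>m m n)" "j < dim_col (0\<^sub>m m n)"
    have "lookup ((mat_star b * b) $$ (j, j)) 0 + lookup (sum_squares n as $$ (j, j)) 0
        = lookup (sum_squares n (b # as) $$ (j, j)) 0"
      using ij b sum_squares_carrier[OF as] by (simp add: lookup_add)
    also have "\<dots> = 0" using Cons.prems(2) ij by simp
    finally have "lookup ((mat_star b * b) $$ (j, j)) 0 \<le> 0"
      using trace_sum_squares_nonneg[OF as, of j] ij by simp
    moreover have "lookup ((mat_star b * b) $$ (j, j)) 0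
        = (\<Sum>i<m. lookup (involution (b $$ (i, j)) * b $$ (i, j)) 0)"
      using b ij by (auto simp: scalar_prod_def lookup_sum atLeast0LessThan)
    ultimately have "(\<Sum>i<m. lookup (involution (b $$ (i, j)) * b $$ (i, j)) 0) = 0"
      by (simp add: antisym sum_nonneg lookup_star_mult_zero_nonneg)
    then have "lookup (involution (b $$ (i, j)) * b $$ (i, j)) 0 = 0"
      using ij by (subst (asm) sum_nonneg_eq_0_iff) (auto simp: lookup_star_mult_zero_nonneg)
    then show "b $$ (i, j) = 0\<^sub>m m n $$ (i, j)"
      using ij by (simp add: lookup_star_mult_zero_eq_0)
  qed (use b in auto)
  moreover from this have "sum_squares n as = 0\<^sub>m n n"
    using Cons.prems(2) left_add_zero_mat[OF sum_squares_carrier[OF as]] by simp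
  ultimately show ?case using Cons.IH[OF as] Cons.prems(3) by auto
qed auto

lemma star_mult_self_eq_0:
  assumes "mat_star a * a = 0\<^sub>m n n" "a \<in> carrier_mat m n"
  shows "a = 0\<^sub>m m n"
  by (rule sum_squares_eq_0[of "[a]"]) (use assms in auto)

lemma sums_of_squares_alt:
  "sums_of_squares k = {sum_squares k as | as. set as \<subseteq> carrier_mat k k}"
  by (simp add: sums_of_squares_def sum_squares_def)

lemma sums_of_squares_carrier: "A \<in> sums_of_squares k \<Longrightarrow> A \<in> carrier_mat k k"
  by (auto simp: sums_of_squares_alt)

lemma sums_of_squares_0 [simp]: "0\<^sub>m k k \<in> sums_of_squares k"
  by (force simp: sums_of_squares_alt intro: exI[of _ "[]"])

lemma sums_of_squares_add:
  assumes "A \<in> sums_of_squares k" "B \<in> sums_of_squares k"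
  shows "A + B \<in> sums_of_squares k"
proof -
  obtain as bs where "set as \<subseteq> carrier_mat k k" "A = sum_squares k as"
    "set bs \<subseteq> carrier_mat k k" "B = sum_squares k bs"
    using assms by (auto simp: sums_of_squares_alt)
  then show ?thesis
    by (auto simp: sums_of_squares_alt sum_squares_append intro!: exI[of _ "as @ bs"])
qed

lemma square_in_sums_of_squares:
  "a \<in> carrier_mat k k \<Longrightarrow> mat_star a * a \<in> sums_of_squares k"
  using right_add_zero_mat[OF star_mult_carrier, of a k k]
  by (auto simp: sums_of_squares_alt intro!: exI[of _ "[a]"])

text \<open>A rectangular matrix is cut into its rows, each of which is the only nonzero row of a
  square matrix.\<close>

lemma star_mult_in_sums_of_squares:
  assumes A: "A \<in> carrier_mat m k"
  shows "mat_star A * A \<in> sums_of_squares k"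
\<comment> \<open>Placing a row in a square matrix requires a row with index
  \<open>0\<close>.\<close>
proof (cases "k = 0")
  case True
  then have "mat_star A * A = 0\<^sub>m k k" using A by (intro eq_matI) auto
  then show ?thesis by simp
next
  case False
  \<comment> \<open>\<open>B l\<close> is the part of the product contributed by the first
    \<open>l\<close> rows.\<close>
  define B where "B l = mat k k (\<lambda>(p, q). \<Sum>i<l. involution (A $$ (i, p)) * A $$ (i, q))" for l
  have "B l \<in> sums_of_squares k" for l
  proof (induction l)
    case 0
    have "B 0 = 0\<^sub>m k k" by (rule eq_matI) (auto simp: B_def)
    then show ?case by simp
  next
    case (Suc l)
    define R where "R = mat k k (\<lambda>(i, q). if i = 0 then A $$ (l, q) else 0)"
    have "B (Suc l) = B l + mat_star R * R"
    proof (rule eq_matI)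
      fix p q assume pq: "p < dim_row (B l + mat_star R * R)" "q < dim_col (B l + mat_star R * R)"
      have "(mat_star R * R) $$ (p, q) = (\<Sum>i<k. involution (R $$ (i, p)) * R $$ (i, q))"
        using pq by (intro index_star_mult) (auto simp: R_def)
      also have "\<dots> = (\<Sum>i<k. if i = 0 then involution (A $$ (l, p)) * A $$ (l, q) else 0)"
        using pq by (intro sum.cong) (auto simp: R_def)
      also have "\<dots> = involution (A $$ (l, p)) * A $$ (l, q)" using False by simp
      finally show "B (Suc l) $$ (p, q) = (B l + mat_star R * R) $$ (p, q)"
        using pq by (auto simp: B_def R_def)
    qed (auto simp: B_def R_def)
    then show ?case
      using Suc square_in_sums_of_squares[of R k] sums_of_squares_add by (auto simp: R_def)
  qed
  moreover have "mat_star A * A = B m"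
    using A by (intro eq_matI) (auto simp: B_def scalar_prod_def atLeast0LessThan)
  ultimately show ?thesis by simp
qed

lemma sum_squares_in_sums_of_squares:
  "set as \<subseteq> carrier_mat m k \<Longrightarrow> sum_squares k as \<in> sums_of_squares k"
  by (induction as) (auto intro: sums_of_squares_add star_mult_in_sums_of_squares)

lemma conjugate_sums_of_squares:
  assumes "A \<in> sums_of_squares k" "X \<in> carrier_mat k l"
  shows "mat_star X * A * X \<in> sums_of_squares l"
proof -
  obtain as where "set as \<subseteq> carrier_mat k k" "A = sum_squares k as"
    using assms by (auto simp: sums_of_squares_alt)
  then show ?thesis
    using conjugate_sum_squares[OF assms(2)]
    by (auto intro!: sum_squares_in_sums_of_squares[where m = k] mult_carrier_mat[OF _ assms(2)])
qed

lemma mat_star_sums_of_squares: "A \<in> sums_of_squares k \<Longrightarrow> mat_star A = A"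
proof -
  have "mat_star (sum_squares k as) = sum_squares k as" if "set as \<subseteq> carrier_mat k k"
    for as :: "'a group_algebra mat list"
    using that
  proof (induction as)
    case (Cons a as)
    then show ?case
      using mat_star_add[OF star_mult_carrier sum_squares_carrier, of a k k as k]
        mat_star_mult[of "mat_star a" k k a k] by simp
  qed auto
  then show "A \<in> sums_of_squares k \<Longrightarrow> mat_star A = A" by (auto simp: sums_of_squares_alt)
qed

text \<open>Scaling by a nonnegative real is conjugation by its square root times the
  identity.\<close>

lemma scalar_times_sums_of_squares:
  assumes "0 \<le> c" "A \<in> sums_of_squares k"
  shows "scalar_times c A \<in> sums_of_squares k"
proof -
  have A: "A \<in> carrier_mat k k" by (rule sums_of_squares_carrier) fact
  let ?X = "scalar_times (sqrt c) (1\<^sub>m k)"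
  have "mat_star ?X * A = scalar_times (sqrt c) A"
    using A by (simp add: mat_star_scalar_times scalar_times_mult_left[OF one_carrier_mat A])
  then have "mat_star ?X * A * ?X = scalar_times c A"
    using assms(1) A
    by (simp add: scalar_times_mult_right[where m = k and n = k and l = k]
        scalar_times_scalar_times)
  then show ?thesis
    using conjugate_sums_of_squares[OF assms(2), of ?X k] by simp
qed

text \<open>The identity is an order unit for the cone of sums of squares. The claim is additive in
  the matrix, so one entry \<open>single g c\<close> at \<open>(i, j)\<close> suffices. There the
  square of a row with entries \<open>1\<close> at \<open>i\<close> and plus or minus
  \<open>g\<close> at \<open>j\<close> has the required cross terms, and projections complete the
  diagonal.\<close>

lemma unit_bounded_below:
  assumes "A \<in> carrier_mat k k"
  shows "\<exists>t\<ge>0. scalar_times t (1\<^sub>m k) + (A + mat_star A) \<in> sums_of_squares k"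
proof -
  let ?P = "\<lambda>A::'a group_algebra mat. A \<in> carrier_mat k k \<and>
    (\<exists>t\<ge>0. scalar_times t (1\<^sub>m k) + (A + mat_star A) \<in> sums_of_squares k)"
  have add: "?P (A + B)" if PA: "?P A" and PB: "?P B" for A B
  proof -
    obtain s t where st: "s \<ge> 0" "scalar_times s (1\<^sub>m k) + (A + mat_star A) \<in> sums_of_squares k"
      "t \<ge> 0" "scalar_times t (1\<^sub>m k) + (B + mat_star B) \<in> sums_of_squares k"
      using PA PB by auto
    have "scalar_times (s + t) (1\<^sub>m k) + (A + B + mat_star (A + B))
      = (scalar_times s (1\<^sub>m k) + (A + mat_star A)) + (scalar_times t (1\<^sub>m k) + (B + mat_star B))"
      using PA PB by (intro eq_matI) (auto simp: single_add algebra_simps)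
    then show ?thesis
      using PA PB st sums_of_squares_add by (intro conjI exI[of _ "s + t"]) auto
  qed
  have zero: "?P (0\<^sub>m k k)"
    by (intro conjI exI[of _ 0]) (auto simp: scalar_times_0[of _ k k])
  define E where "E i j a = mat k k (\<lambda>(p, q). if p = i \<and> q = j then a else 0)"
    for i j and a :: "'a group_algebra"
  have E_single: "?P (E i j (single g c))" if "i < k" "j < k" for i j g c
  proof -
    \<comment> \<open>The sign of \<open>c\<close>. The row \<open>y\<close> carries it, so the
      cross terms of \<open>mat_star y * y\<close> have coefficient \<open>s\<close>, and scaling by
      \<open>\<bar>c\<bar>\<close> restores \<open>c\<close>.\<close>
    define s :: real where "s = (if c < 0 then - 1 else 1)"
    have s: "s * s = 1" "c = \<bar>c\<bar> * s" by (auto simp: s_def)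
    define y where "y = mat 1 k (\<lambda>(r::nat, q). (if q = i then 1 else 0) + (if q = j then single g s else 0))"
    \<comment> \<open>The identity with the diagonal entry \<open>l\<close> deleted, a projection
      and hence its own square. Apart from the cross terms, \<open>y\<close> only fills the diagonal
      places \<open>i\<close> and \<open>j\<close>, and adding \<open>Q i + Q j\<close> completes
      the diagonal to twice the identity.\<close>
    define Q where "Q l = mat k k (\<lambda>(p, q). if p = q \<and> p \<noteq> l then (1::'a group_algebra) else 0)" for l :: nat
    have QQ: "mat_star (Q l) * Q l = Q l" for l
    proof (rule eq_matI)
      fix p q assume "p < dim_row (Q l)" "q < dim_col (Q l)"
      then have "(mat_star (Q l) * Q l) $$ (p, q) =
          (\<Sum>r<k. involution (Q l $$ (r, p)) * Q l $$ (r, q))"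
        by (intro index_star_mult) (auto simp: Q_def)
      also have "\<dots> = (\<Sum>r<k. if r = p then (if p = q \<and> p \<noteq> l then 1 else 0) else 0)"
        using \<open>p < dim_row (Q l)\<close> \<open>q < dim_col (Q l)\<close> by (intro sum.cong) (auto simp: Q_def)
      finally show "(mat_star (Q l) * Q l) $$ (p, q) = Q l $$ (p, q)"
        using \<open>p < dim_row (Q l)\<close> \<open>q < dim_col (Q l)\<close> by (auto simp: Q_def)
    qed (auto simp: Q_def)
    have Q: "Q l \<in> sums_of_squares k" for l
      using square_in_sums_of_squares[of "Q l" k] unfolding QQ by (auto simp: Q_def)
    have y: "mat_star y * y \<in> sums_of_squares k"
      by (rule star_mult_in_sums_of_squares[of _ 1]) (auto simp: y_def)
    have "scalar_times (2 * \<bar>c\<bar>) (1\<^sub>m k) + (E i j (single g c) + mat_star (E i j (single g c)))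
        = scalar_times \<bar>c\<bar> (mat_star y * y + (Q i + Q j))"
    proof (rule eq_matI)
      fix p q assume "p < dim_row (scalar_times \<bar>c\<bar> (mat_star y * y + (Q i + Q j)))"
        "q < dim_col (scalar_times \<bar>c\<bar> (mat_star y * y + (Q i + Q j)))"
      then have pq: "p < k" "q < k" by (auto simp: Q_def)
      have yy: "(mat_star y * y) $$ (p, q) =
          ((if p = i then 1 else 0) + (if p = j then single (- g) s else 0)) *
          ((if q = i then 1 else 0) + (if q = j then single g s else 0))"
        if "p < k" "q < k" for p q
        using that by (auto simp: y_def scalar_prod_def)
      have c2: "single (0::'a) (2 * \<bar>c\<bar>) = single 0 \<bar>c\<bar> + single 0 \<bar>c\<bar>"
        by (simp flip: single_add)
      have cg: "single h c = single 0 \<bar>c\<bar> * single h s" for h :: 'a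
        using s(2) by (simp add: mult_single)
      have ydim: "dim_row y = 1" "dim_col y = k" by (auto simp: y_def)
      have ss: "single (- g) s * single g s = 1" by (simp add: mult_single s(1))
      show "(scalar_times (2 * \<bar>c\<bar>) (1\<^sub>m k) + (E i j (single g c) + mat_star (E i j (single g c)))) $$ (p, q)
          = scalar_times \<bar>c\<bar> (mat_star y * y + (Q i + Q j)) $$ (p, q)"
        using pq
        by (cases "p = i"; cases "p = j"; cases "q = i"; cases "q = j")
          (simp_all add: mult_2_right yy ydim E_def Q_def distrib_left distrib_right c2 cg[of g] ss
            single_zero_commute[of "\<bar>c\<bar>" "single (- g) s", symmetric] del: index_mult_mat(1))
    qed (auto simp: E_def y_def Q_def)
    moreover have "scalar_times \<bar>c\<bar> (mat_star y * y + (Q i + Q j)) \<in> sums_of_squares k"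
      by (intro scalar_times_sums_of_squares sums_of_squares_add y Q) auto
    ultimately show ?thesis
      by (intro conjI exI[of _ "2 * \<bar>c\<bar>"]) (auto simp: E_def)
  qed
  have E: "?P (E i j a)" if "i < k" "j < k" for i j a
  proof (induction a rule: group_algebra_induct)
    case zero
    have "E i j 0 = 0\<^sub>m k k" by (rule eq_matI) (auto simp: E_def)
    then show ?case using \<open>?P (0\<^sub>m k k)\<close> by metis
  next
    case (add a b)
    have "E i j (a + b) = E i j a + E i j b" by (rule eq_matI) (auto simp: E_def)
    then show ?case using add.IH \<open>\<And>B A. ?P A \<Longrightarrow> ?P B \<Longrightarrow> ?P (A + B)\<close> by metis
  qed (use E_single that in auto)
  have "?P (mat k k (\<lambda>x. if x \<in> S then A $$ x else 0))" if "finite S" for S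
    using that
  proof (induction S)
    case empty
    have "mat k k (\<lambda>x. if x \<in> {} then A $$ x else 0) = 0\<^sub>m k k" by (rule eq_matI) auto
    then show ?case using zero by simp
  next
    case (insert x S)
    obtain i j where x: "x = (i, j)" by (cases x)
    show ?case
    proof (cases "i < k \<and> j < k")
      case True
      have "mat k k (\<lambda>y. if y \<in> insert x S then A $$ y else 0) =
          E i j (A $$ x) + mat k k (\<lambda>x. if x \<in> S then A $$ x else 0)"
        using insert.hyps by (intro eq_matI) (auto simp: E_def x)
      then show ?thesis using add[OF E insert.IH] True by simp
    next
      case False
      have "mat k k (\<lambda>y. if y \<in> insert x S then A $$ y else 0) =
          mat k k (\<lambda>x. if x \<in> S then A $$ x else 0)"
        using False by (intro eq_matI) (auto simp: x)
      then show ?thesis using insert.IH by simp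
    qed
  qed
  from this[of "{..<k} \<times> {..<k}"] have "?P (mat k k (\<lambda>x. if x \<in> {..<k} \<times> {..<k} then A $$ x else 0))"
    by simp
  moreover have "mat k k (\<lambda>x. if x \<in> {..<k} \<times> {..<k} then A $$ x else 0) = A"
    using assms by (intro eq_matI) auto
  ultimately show ?thesis by simp
qed

lemma hermitian_bounded:
  assumes "A \<in> carrier_mat k k" "mat_star A = A"
  shows "\<exists>t\<ge>0. scalar_times t (1\<^sub>m k) - A \<in> sums_of_squares k"
proof -
  \<comment> \<open>The factor \<open>- 1 / 2\<close> makes the matrix plus its star equal to
    \<open>- A\<close>.\<close>
  obtain t where t: "t \<ge> 0" "scalar_times t (1\<^sub>m k) +
      (scalar_times (- 1 / 2) A + mat_star (scalar_times (- 1 / 2) A)) \<in> sums_of_squares k"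
    using unit_bounded_below[of "scalar_times (- 1 / 2) A" k] assms by auto
  have "scalar_times t (1\<^sub>m k) + (scalar_times (- 1 / 2) A + mat_star (scalar_times (- 1 / 2) A))
      = scalar_times t (1\<^sub>m k) - A"
    unfolding mat_star_scalar_times assms(2)
    using assms(1) by (intro eq_matI) (auto intro!: poly_mapping_eqI simp: lookup_add lookup_minus)
  then show ?thesis using t by auto
qed

section \<open>Conjugation by rectangular matrices and the passage between the two gaps\<close>

lemma conjugate_add:
  assumes "X \<in> carrier_mat n l" "A \<in> carrier_mat n n" "B \<in> carrier_mat n n"
  shows "mat_star X * (A + B) * X = mat_star X * A * X + mat_star X * B * X"
proof -
  have X': "mat_star X \<in> carrier_mat l n" using assms by simp
  show ?thesis
    using mult_add_distrib_mat[OF X' assms(2,3)]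
      add_mult_distrib_mat[OF mult_carrier_mat[OF X' assms(2)] mult_carrier_mat[OF X' assms(3)] assms(1)]
    by simp
qed

lemma conjugate_minus:
  assumes "X \<in> carrier_mat n l" "A \<in> carrier_mat n n" "B \<in> carrier_mat n n"
  shows "mat_star X * (A - B) * X = mat_star X * A * X - mat_star X * B * X"
proof -
  have X': "mat_star X \<in> carrier_mat l n" using assms by simp
  show ?thesis
    using mult_minus_distrib_mat[OF X' assms(2,3)]
      minus_mult_distrib_mat[OF mult_carrier_mat[OF X' assms(2)] mult_carrier_mat[OF X' assms(3)] assms(1)]
    by simp
qed

lemma conjugate_scalar_one:
  assumes "X \<in> carrier_mat n l"
  shows "mat_star X * scalar_times c (1\<^sub>m n) * X = scalar_times c (mat_star X * X)"
proof -
  have X': "mat_star X \<in> carrier_mat l n" using assms by simp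
  have "mat_star X * scalar_times c (1\<^sub>m n) = scalar_times c (mat_star X)"
    using scalar_times_mult_right[OF X' one_carrier_mat[of n]] X' by simp
  then show ?thesis using scalar_times_mult_left[OF X' assms] by simp
qed

lemma conjugate_self:
  assumes "X \<in> carrier_mat n l"
  shows "mat_star X * (X * mat_star X) * X = mat_star X * X * (mat_star X * X)"
proof -
  have X': "mat_star X \<in> carrier_mat l n" using assms by simp
  show ?thesis
    using assoc_mult_mat[OF mult_carrier_mat[OF X' assms] X' assms] assoc_mult_mat[OF X' assms X']
    by simp
qed

lemma upper_gap_of_laplacian_gap:
  fixes d0 d1 :: "'g::group_add group_algebra mat"
  assumes d0: "d0 \<in> carrier_mat k1 k0" and d1: "d1 \<in> carrier_mat k2 k1"
    and dd: "d1 * d0 = 0\<^sub>m k2 k0"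
    and gap: "mat_star d1 * d1 + d0 * mat_star d0 - scalar_times c (1\<^sub>m k1) \<in> sums_of_squares k1"
  shows "mat_star d0 * d0 * (mat_star d0 * d0) - scalar_times c (mat_star d0 * d0)
    \<in> sums_of_squares k0"
proof -
  have d0': "mat_star d0 \<in> carrier_mat k0 k1" and d1': "mat_star d1 \<in> carrier_mat k1 k2"
    using d0 d1 by auto
  have P: "mat_star d1 * d1 \<in> carrier_mat k1 k1" and Q: "d0 * mat_star d0 \<in> carrier_mat k1 k1"
    using d1 mult_carrier_mat[OF d0 d0'] by auto
  have "mat_star d0 * (mat_star d1 * d1) * d0 = mat_star d0 * (mat_star d1 * (d1 * d0))"
    using assoc_mult_mat[OF d0' P d0] assoc_mult_mat[OF d1' d1 d0] by simp
  also have "\<dots> = 0\<^sub>m k0 k0" using dd d0' d1' by simp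
  finally have "mat_star d0 * (mat_star d1 * d1 + d0 * mat_star d0 - scalar_times c (1\<^sub>m k1)) * d0
      = 0\<^sub>m k0 k0 + mat_star d0 * d0 * (mat_star d0 * d0) - scalar_times c (mat_star d0 * d0)"
    using conjugate_minus[OF d0 add_carrier_mat[OF Q, of "mat_star d1 * d1"], of "scalar_times c (1\<^sub>m k1)"]
      conjugate_add[OF d0 P Q]
    by (simp add: conjugate_scalar_one[OF d0] conjugate_self[OF d0])
  also have "\<dots> = mat_star d0 * d0 * (mat_star d0 * d0) - scalar_times c (mat_star d0 * d0)"
    using left_add_zero_mat[OF mult_carrier_mat[OF star_mult_carrier[OF d0] star_mult_carrier[OF d0]]]
    by simp
  finally show ?thesis using conjugate_sums_of_squares[OF gap d0] by simp
qed

text \<open>For \<open>e > 0\<close> the hermitian element \<open>d* w + w* d\<close> of the split conjugation space is the square of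
  \<open>d / e + e w\<close> minus \<open>d* d / e\<^sup>2\<close> and the small term \<open>e\<^sup>2 w* w\<close>, which the gap absorbs.\<close>

lemma laplacian_gap_of_split:
  fixes d0 d1 :: "'g::group_add group_algebra mat"
  assumes d0: "d0 \<in> carrier_mat k1 k0" and d1: "d1 \<in> carrier_mat k2 k1"
    and x: "x \<in> carrier_mat k2 k1" and y: "y \<in> carrier_mat k1 k2"
    and S: "S \<in> sums_of_squares k1" and "c > 0"
    and eq: "d0 * mat_star d0 - scalar_times c (1\<^sub>m k1) - S = mat_star d1 * x + y * d1"
  shows "\<exists>c>0. mat_star d1 * d1 + d0 * mat_star d0 - scalar_times c (1\<^sub>m k1) \<in> sums_of_squares k1"
proof -
  have carr: "mat_star d1 \<in> carrier_mat k1 k2" "mat_star y \<in> carrier_mat k2 k1"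
    "mat_star x \<in> carrier_mat k1 k2" "S \<in> carrier_mat k1 k1"
    "d0 * mat_star d0 \<in> carrier_mat k1 k1"
    using d1 y x sums_of_squares_carrier[OF S] mult_carrier_mat[OF d0, of "mat_star d0" k1] d0
    by auto
  \<comment> \<open>Averaging the hermitian element \<open>Z\<close> with its star brings it to the
    form \<open>mat_star d1 * w + mat_star w * d1\<close>.\<close>
  define w where "w = scalar_times (1 / 2) (x + mat_star y)"
  have w: "w \<in> carrier_mat k2 k1" using x carr by (simp add: w_def)
  have w': "mat_star w \<in> carrier_mat k1 k2" using w by simp
  obtain M where M: "M \<ge> 0" "scalar_times M (1\<^sub>m k1) - mat_star w * w \<in> sums_of_squares k1"
    using hermitian_bounded[OF star_mult_carrier[OF w]] mat_star_mult[OF w' w] by auto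
  \<comment> \<open>The bound by \<open>1\<close> makes \<open>1 / e\<^sup>2\<close> at least
    \<open>1\<close>, as the final rescaling requires; the other bound makes the loss
    \<open>e\<^sup>2 * M\<close> at most half of the gap \<open>c\<close>.\<close>
  define e where "e = min 1 (sqrt (c / (2 * (M + 1))))"
  have e: "0 < e" "e \<le> 1" "e\<^sup>2 * M \<le> c / 2"
  proof -
    show "0 < e" "e \<le> 1" using \<open>c > 0\<close> M by (auto simp: e_def)
    have "e\<^sup>2 \<le> (sqrt (c / (2 * (M + 1))))\<^sup>2"
      using \<open>0 < e\<close> by (intro power_mono) (auto simp: e_def)
    also have "\<dots> = c / (2 * (M + 1))" using \<open>c > 0\<close> M by simp
    finally have "e\<^sup>2 * M \<le> c / (2 * (M + 1)) * M" using M by (intro mult_right_mono) auto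
    also have "\<dots> \<le> c / 2" using \<open>c > 0\<close> M by (simp add: field_simps)
    finally show "e\<^sup>2 * M \<le> c / 2" .
  qed
  define z where "z = scalar_times (1 / e) d1 + scalar_times e w"
  have z: "z \<in> carrier_mat k2 k1" using d1 w by (simp add: z_def)
  define Z where "Z = mat_star d1 * x + y * d1"
  have Z: "Z \<in> carrier_mat k1 k1"
    using mult_carrier_mat[OF carr(1) x] mult_carrier_mat[OF y d1] by (simp add: Z_def)
  \<comment> \<open>By \<open>eq\<close>, \<open>Z\<close> is a difference of hermitian
    matrices.\<close>
  have "mat_star Z = Z"
    unfolding Z_def eq[symmetric] using carr d0 mat_star_mult[OF d0, of "mat_star d0" k1]
    by (subst mat_star_minus[of _ k1 k1])
      (auto simp: mat_star_minus[of _ k1 k1] mat_star_scalar_times mat_star_sums_of_squares[OF S])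
  have "mat_star Z = mat_star x * d1 + mat_star d1 * mat_star y"
    unfolding Z_def
    using mat_star_add[OF mult_carrier_mat[OF carr(1) x] mult_carrier_mat[OF y d1]]
      mat_star_mult[OF carr(1) x] mat_star_mult[OF y d1] by simp
  have "Z = mat_star d1 * w + mat_star w * d1"
  proof -
    have "mat_star d1 * w = scalar_times (1 / 2) (mat_star d1 * x + mat_star d1 * mat_star y)"
      unfolding w_def using x carr
      by (simp add: scalar_times_mult_right[OF carr(1), of _ k1] mult_add_distrib_mat[OF carr(1) x carr(2)])
    moreover have "mat_star w * d1 = scalar_times (1 / 2) (mat_star x * d1 + y * d1)"
      unfolding w_def using x carr y d1
      by (simp add: mat_star_scalar_times mat_star_add[OF x carr(2)]
          scalar_times_mult_left[of _ k1 k2 d1 k1] add_mult_distrib_mat[OF carr(3) y d1])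
    moreover have "scalar_times (1 / 2) (p + s) + scalar_times (1 / 2) (r + q)
        = scalar_times (1 / 2) ((p + q) + (r + s))"
      if "p \<in> carrier_mat k1 k1" "q \<in> carrier_mat k1 k1" "r \<in> carrier_mat k1 k1" "s \<in> carrier_mat k1 k1"
      for p q r s :: "'g group_algebra mat"
      using that by (intro eq_matI) (auto simp: algebra_simps)
    ultimately have "mat_star d1 * w + mat_star w * d1 = scalar_times (1 / 2) (Z + mat_star Z)"
      using \<open>mat_star Z = mat_star x * d1 + mat_star d1 * mat_star y\<close>
        mult_carrier_mat[OF carr(1) x] mult_carrier_mat[OF y d1]
        mult_carrier_mat[OF carr(3) d1] mult_carrier_mat[OF carr(1,2)]
      by (simp add: Z_def)
    also have "\<dots> = Z"
      unfolding \<open>mat_star Z = Z\<close> using Z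
      by (intro eq_matI) (auto intro!: poly_mapping_eqI simp: lookup_add)
    finally show ?thesis by simp
  qed
  define P Q W U V where "P = mat_star d1 * d1" and "Q = d0 * mat_star d0" and "W = mat_star w * w"
    and "U = mat_star d1 * w" and "V = mat_star w * d1"
  have PQWUV: "P \<in> carrier_mat k1 k1" "Q \<in> carrier_mat k1 k1" "W \<in> carrier_mat k1 k1"
    "U \<in> carrier_mat k1 k1" "V \<in> carrier_mat k1 k1"
    unfolding P_def Q_def W_def U_def V_def using d1 w carr(5)
      mult_carrier_mat[OF carr(1) w] mult_carrier_mat[OF w' d1] by auto
  have "mat_star z * z = scalar_times ((1 / e)\<^sup>2) P + U + (V + scalar_times (e\<^sup>2) W)"
  proof -
    have z': "mat_star z = scalar_times (1 / e) (mat_star d1) + scalar_times e (mat_star w)"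
      using d1 w by (simp add: z_def mat_star_add[of _ k2 k1] mat_star_scalar_times)
    have s: "scalar_times a (mat_star d1) * z = scalar_times (a * (1 / e)) P + scalar_times (a * e) U"
      "scalar_times a (mat_star w) * z = scalar_times (a * (1 / e)) V + scalar_times (a * e) W" for a
      unfolding z_def P_def U_def V_def W_def using d1 w carr(1) w'
      by (simp_all add: mult_add_distrib_mat[of _ k1 k2 _ k1] scalar_times_mult_left[of _ k1 k2 _ k1]
          scalar_times_mult_right[of _ k1 k2 _ k1] scalar_times_scalar_times mult.commute
          mult_carrier_mat[of _ k1 k2 _ k1])
    have "mat_star z * z = scalar_times (1 / e) (mat_star d1) * z + scalar_times e (mat_star w) * z"
      unfolding z' using carr(1) w' z by (intro add_mult_distrib_mat[of _ k1 k2 _ _ k1]) auto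
    then show ?thesis
      unfolding s using e(1) by (simp add: power2_eq_square)
  qed
  then have zz: "scalar_times ((1 / e)\<^sup>2) P + U + (V + scalar_times (e\<^sup>2) W) \<in> sums_of_squares k1"
    using star_mult_in_sums_of_squares[OF z] by simp
  have eq': "Q - scalar_times c (1\<^sub>m k1) - S = U + V"
    using eq \<open>Z = mat_star d1 * w + mat_star w * d1\<close> by (simp add: Z_def Q_def U_def V_def)
  define C where "C = (1 / e)\<^sup>2"
  have C: "1 \<le> C" using e by (simp add: C_def field_simps power_le_one)
  define c' where "c' = c - e\<^sup>2 * M"
  have c': "c' > 0" using e(3) \<open>c > 0\<close> by (simp add: c'_def)
  have QSOS: "Q \<in> sums_of_squares k1"
    using star_mult_in_sums_of_squares[of "mat_star d0" k0 k1] d0 by (simp add: Q_def)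
  have Qe: "Q = U + V + S + scalar_times c (1\<^sub>m k1)"
  proof -
    have "Q = (Q - scalar_times c (1\<^sub>m k1) - S) + S + scalar_times c (1\<^sub>m k1)"
      using PQWUV carr(4) by (intro eq_matI) auto
    then show ?thesis unfolding eq' .
  qed
  let ?I = "1\<^sub>m k1 :: 'g group_algebra mat"
  \<comment> \<open>The square of \<open>z\<close> brings in the unwanted multiple
    \<open>e\<^sup>2\<close> of \<open>W\<close>. It is traded for \<open>e\<^sup>2 * M\<close>
    times the identity, which lowers \<open>c\<close> to \<open>c'\<close>.\<close>
  have "scalar_times C P + Q - scalar_times c' ?I
     = scalar_times C P + U + (V + scalar_times (e\<^sup>2) W) + S
       + scalar_times (e\<^sup>2) (scalar_times M ?I - W)"
    unfolding Qe using PQWUV carr(4)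
    by (intro eq_matI)
      (auto intro!: poly_mapping_eqI simp del: index_one_mat(1)
        simp: lookup_add lookup_minus c'_def algebra_simps)
  then have 1: "scalar_times C P + Q - scalar_times c' ?I \<in> sums_of_squares k1"
    using zz S M(2) by (auto simp: C_def W_def intro!: sums_of_squares_add scalar_times_sums_of_squares)
  \<comment> \<open>Division by \<open>C\<close> normalizes the coefficient of \<open>P\<close> but
    leaves too little of \<open>Q\<close>. As \<open>C \<ge> 1\<close>, the missing multiple of
    \<open>Q\<close> is a sum of squares.\<close>
  have "P + Q - scalar_times (c' / C) ?I
     = scalar_times (1 / C) ((scalar_times C P + Q - scalar_times c' ?I) + scalar_times (C - 1) Q)"
    using PQWUV C
    by (intro eq_matI)
      (auto intro!: poly_mapping_eqI simp del: index_one_mat(1)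
        simp: lookup_add lookup_minus field_simps)
  also have "\<dots> \<in> sums_of_squares k1"
    using C by (intro scalar_times_sums_of_squares sums_of_squares_add 1 QSOS) auto
  finally show ?thesis
    using c' C by (intro exI[of _ "c' / C"]) (auto simp: P_def Q_def)
qed

text \<open>Topology enters only through \<open>factor\<close>, which lets the roots be divided by
  \<open>d0\<close> on the right. The squares of the quotients then differ from \<open>b\<close> by
  an element of the kernel described by \<open>ker\<close>.\<close>

lemma laplacian_gap_of_upper_gap:
  fixes d0 d1 :: "'g::group_add group_algebra mat"
  assumes d0: "d0 \<in> carrier_mat k1 k0" and d1: "d1 \<in> carrier_mat k2 k1"
    and ker: "\<And>a. a \<in> carrier_mat k1 k1 \<Longrightarrow> mat_star d0 * a * d0 = 0\<^sub>m k0 k0 \<Longrightarrow>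
      \<exists>x\<in>carrier_mat k2 k1. \<exists>y\<in>carrier_mat k1 k2. a = mat_star d1 * x + y * d1"
    and factor: "\<And>as b a. set as \<subseteq> carrier_mat k0 k0 \<Longrightarrow> b \<in> carrier_mat k1 k1 \<Longrightarrow>
      sum_squares k0 as = mat_star d0 * b * d0 \<Longrightarrow> a \<in> set as \<Longrightarrow>
      \<exists>c\<in>carrier_mat k0 k1. a = c * d0"
    and "c > 0"
    and gap: "mat_star d0 * d0 * (mat_star d0 * d0) - scalar_times c (mat_star d0 * d0)
      \<in> sums_of_squares k0"
  shows "\<exists>c>0. mat_star d1 * d1 + d0 * mat_star d0 - scalar_times c (1\<^sub>m k1) \<in> sums_of_squares k1"
proof -
  have d0': "mat_star d0 \<in> carrier_mat k0 k1" using d0 by simp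
  have Q: "d0 * mat_star d0 \<in> carrier_mat k1 k1" using mult_carrier_mat[OF d0 d0'] .
  \<comment> \<open>Chosen so that its conjugate by \<open>d0\<close> is the expression in
    \<open>gap\<close>.\<close>
  define b where "b = d0 * mat_star d0 - scalar_times c (1\<^sub>m k1)"
  have b: "b \<in> carrier_mat k1 k1" using Q by (simp add: b_def minus_carrier_mat)
  have bD: "mat_star d0 * b * d0
      = mat_star d0 * d0 * (mat_star d0 * d0) - scalar_times c (mat_star d0 * d0)"
    unfolding b_def by (simp add: conjugate_minus[OF d0 Q] conjugate_scalar_one[OF d0] conjugate_self[OF d0])
  then obtain as where as: "set as \<subseteq> carrier_mat k0 k0" "sum_squares k0 as = mat_star d0 * b * d0"
    using gap by (auto simp: sums_of_squares_alt)
  obtain g where g: "\<And>a. a \<in> set as \<Longrightarrow> g a \<in> carrier_mat k0 k1 \<and> a = g a * d0"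
    using factor[OF as(1) b as(2)] by metis
  define S where "S = sum_squares k1 (map g as)"
  have gas: "set (map g as) \<subseteq> carrier_mat k0 k1" using g by auto
  have S: "S \<in> sums_of_squares k1"
    unfolding S_def using sum_squares_in_sums_of_squares[OF gas] .
  have "map (\<lambda>a. a * d0) (map g as) = as"
    using g by (simp add: map_idI)
  then have "mat_star d0 * S * d0 = sum_squares k0 as"
    unfolding S_def conjugate_sum_squares[OF d0 gas] by simp
  then have "mat_star d0 * (b - S) * d0 = 0\<^sub>m k0 k0"
    using as(2) sum_squares_carrier[OF as(1)]
    unfolding conjugate_minus[OF d0 b sums_of_squares_carrier[OF S]]
    by (metis minus_r_inv_mat)
  then obtain x y where "x \<in> carrier_mat k2 k1" "y \<in> carrier_mat k1 k2"
      "b - S = mat_star d1 * x + y * d1"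
    using ker[of "b - S"] minus_carrier_mat[OF sums_of_squares_carrier[OF S]] by metis
  then show ?thesis
    using laplacian_gap_of_split[OF d0 d1 _ _ S \<open>c > 0\<close>] by (simp add: b_def)
qed

section \<open>Hilbert spaces\<close>

text \<open>The axioms of \<open>hilbert_space\<close> except completeness, so that the calculus of
  norms and distances is at hand when completeness of powers and completions is proved.\<close>

locale pre_hilbert_space = vectorspace "class_ring :: complex ring" H
  for H :: "('h, 'm) hilbert_scheme" (structure) +
  assumes ip_commute: "\<lbrakk>x \<in> carrier H; y \<in> carrier H\<rbrakk> \<Longrightarrow> ip H x y = cnj (ip H y x)"
    and ip_add: "\<lbrakk>x \<in> carrier H; y \<in> carrier H; z \<in> carrier H\<rbrakk> \<Longrightarrow>
      ip H (x \<oplus> y) z = ip H x z + ip H y z"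
    and ip_smult: "\<lbrakk>x \<in> carrier H; y \<in> carrier H\<rbrakk> \<Longrightarrow>
      ip H (c \<odot>\<^bsub>H\<^esub> x) y = c * ip H x y"
    and ip_nonneg: "x \<in> carrier H \<Longrightarrow> 0 \<le> Re (ip H x x)"
    and ip_definite: "\<lbrakk>x \<in> carrier H; ip H x x = 0\<rbrakk> \<Longrightarrow> x = \<zero>"
begin

lemma smult_in_carrier [simp]: "x \<in> carrier H \<Longrightarrow> c \<odot>\<^bsub>H\<^esub> x \<in> carrier H"
  using smult_closed[of c x] by simp

lemma smult_class_ring [simp]:
  assumes "x \<in> carrier H"
  shows "1 \<odot>\<^bsub>H\<^esub> x = x" "(a * b) \<odot>\<^bsub>H\<^esub> x = a \<odot>\<^bsub>H\<^esub> (b \<odot>\<^bsub>H\<^esub> x)"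
    "(a + b) \<odot>\<^bsub>H\<^esub> x = a \<odot>\<^bsub>H\<^esub> x \<oplus> b \<odot>\<^bsub>H\<^esub> x"
  using assms smult_one[of x] smult_assoc1[of a b x] smult_l_distr[of a b x] by simp_all

lemma minus_in_carrier [simp]: "x \<in> carrier H \<Longrightarrow> y \<in> carrier H \<Longrightarrow> x \<ominus> y \<in> carrier H"
  by (rule M.minus_closed)

lemma ip_zero_left [simp]: "y \<in> carrier H \<Longrightarrow> ip H \<zero> y = 0"
  using ip_add[of \<zero> \<zero> y] by simp

lemma ip_zero_right [simp]: "y \<in> carrier H \<Longrightarrow> ip H y \<zero> = 0"
  using ip_commute[of y \<zero>] by simp

lemma ip_add_right:
  "\<lbrakk>x \<in> carrier H; y \<in> carrier H; z \<in> carrier H\<rbrakk> \<Longrightarrow> ip H z (x \<oplus> y) = ip H z x + ip H z y"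
  using ip_commute[of z "x \<oplus> y"] ip_commute[of z x] ip_commute[of z y] by (simp add: ip_add)

lemma ip_smult_right:
  "\<lbrakk>x \<in> carrier H; y \<in> carrier H\<rbrakk> \<Longrightarrow> ip H y (c \<odot>\<^bsub>H\<^esub> x) = cnj c * ip H y x"
  using ip_commute[of y "c \<odot>\<^bsub>H\<^esub> x"] ip_commute[of y x] by (simp add: ip_smult)

lemma ip_minus_left:
  assumes "x \<in> carrier H" "y \<in> carrier H" "z \<in> carrier H"
  shows "ip H (x \<ominus> y) z = ip H x z - ip H y z"
proof -
  have "ip H (x \<ominus> y) z + ip H y z = ip H (x \<ominus> y \<oplus> y) z"
    using assms by (simp add: ip_add)
  also have "x \<ominus> y \<oplus> y = x"
    using assms by (simp add: a_minus_def M.a_assoc M.l_neg)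
  finally show ?thesis by (simp add: algebra_simps)
qed

lemma ip_minus_right:
  "\<lbrakk>x \<in> carrier H; y \<in> carrier H; z \<in> carrier H\<rbrakk> \<Longrightarrow> ip H z (x \<ominus> y) = ip H z x - ip H z y"
  using ip_commute[of z "x \<ominus> y"] ip_commute[of z x] ip_commute[of z y] by (simp add: ip_minus_left)

lemma ip_a_inv_left: "x \<in> carrier H \<Longrightarrow> z \<in> carrier H \<Longrightarrow> ip H (\<ominus> x) z = - ip H x z"
  using ip_add[of "\<ominus> x" x z] by (simp add: M.l_neg eq_neg_iff_add_eq_0)

lemma ip_a_inv_right: "x \<in> carrier H \<Longrightarrow> z \<in> carrier H \<Longrightarrow> ip H z (\<ominus> x) = - ip H z x"
  using ip_commute[of z "\<ominus> x"] ip_commute[of z x] by (simp add: ip_a_inv_left)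

lemmas ip_simps = ip_a_inv_left ip_a_inv_right ip_add ip_add_right ip_smult ip_smult_right ip_minus_left ip_minus_right

lemma eq_of_minus_eq_zero:
  assumes "x \<in> carrier H" "y \<in> carrier H" "x \<ominus> y = \<zero>"
  shows "x = y"
proof -
  have "x = (x \<ominus> y) \<oplus> y" using assms(1,2) by (simp add: a_minus_def M.a_assoc M.l_neg)
  also have "\<dots> = \<zero> \<oplus> y" using assms(3) by (rule arg_cong)
  also have "\<dots> = y" using assms(2) by simp
  finally show ?thesis .
qed

text \<open>Tests vectors by inner products, so that later identities in the carrier reduce to
  arithmetic with complex numbers.\<close>

lemma ip_eqI:
  assumes "x \<in> carrier H" "y \<in> carrier H" "\<And>z. z \<in> carrier H \<Longrightarrow> ip H x z = ip H y z"
  shows "x = y"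
proof -
  have "ip H (x \<ominus> y) (x \<ominus> y) = 0"
    using ip_minus_left[OF assms(1,2)] assms(3) minus_in_carrier[OF assms(1,2)] by simp
  then have "x \<ominus> y = \<zero>" by (rule ip_definite[OF minus_in_carrier[OF assms(1,2)]])
  then show ?thesis by (rule eq_of_minus_eq_zero[OF assms(1,2)])
qed

lemma ip_finsum:
  assumes "f \<in> A \<rightarrow> carrier H" "z \<in> carrier H"
  shows "ip H (finsum H f A) z = (\<Sum>a\<in>A. ip H (f a) z)"
  using assms
proof (induction A rule: infinite_finite_induct)
  case (insert a A)
  then have "f \<in> A \<rightarrow> carrier H" "f a \<in> carrier H" by auto
  then show ?case using insert by (simp add: ip_add)
qed auto

definition norm2 :: "'h \<Rightarrow> real" where "norm2 x = Re (ip H x x)"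

lemma ip_self: "x \<in> carrier H \<Longrightarrow> ip H x x = complex_of_real (norm2 x)"
  using ip_commute[of x x] by (auto simp: norm2_def complex_eq_iff)

lemma norm2_nonneg [simp]: "x \<in> carrier H \<Longrightarrow> 0 \<le> norm2 x"
  by (simp add: norm2_def ip_nonneg)

lemma norm2_eq_0: "x \<in> carrier H \<Longrightarrow> norm2 x = 0 \<longleftrightarrow> x = \<zero>"
  by (metis M.zero_closed ip_definite ip_self ip_zero_left of_real_eq_0_iff)

lemma norm2_smult: "x \<in> carrier H \<Longrightarrow> norm2 (c \<odot>\<^bsub>H\<^esub> x) = (cmod c)\<^sup>2 * norm2 x"
proof -
  assume x: "x \<in> carrier H"
  have "ip H (c \<odot>\<^bsub>H\<^esub> x) (c \<odot>\<^bsub>H\<^esub> x) = c * cnj c * ip H x x"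
    using x by (simp add: ip_simps)
  also have "\<dots> = complex_of_real ((cmod c)\<^sup>2 * norm2 x)"
    using x by (simp add: ip_self complex_norm_square del: of_real_power)
  finally show ?thesis by (simp add: norm2_def[of "c \<odot>\<^bsub>H\<^esub> x"])
qed

lemma cauchy_schwarz:
  assumes "x \<in> carrier H" "y \<in> carrier H"
  shows "(cmod (ip H x y))\<^sup>2 \<le> norm2 x * norm2 y"
proof (cases "norm2 y = 0")
  case True
  then show ?thesis using assms norm2_eq_0[of y] by simp
next
  case False
  then have y: "norm2 y > 0" using norm2_nonneg[OF assms(2)] by linarith
  define c where "c = ip H x y / complex_of_real (norm2 y)"
  have "ip H (x \<ominus> c \<odot>\<^bsub>H\<^esub> y) (x \<ominus> c \<odot>\<^bsub>H\<^esub> y)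
      = ip H x x - cnj c * ip H x y - c * cnj (ip H x y) + c * cnj c * ip H y y"
    using assms ip_commute[OF assms(2,1)] by (simp add: ip_simps algebra_simps)
  also have "\<dots> = complex_of_real (norm2 x) - ip H x y * cnj (ip H x y) / complex_of_real (norm2 y)"
    using y by (simp add: ip_self assms c_def field_simps)
  also have "\<dots> = complex_of_real (norm2 x - (cmod (ip H x y))\<^sup>2 / norm2 y)"
    by (simp flip: complex_norm_square)
  finally have "norm2 (x \<ominus> c \<odot>\<^bsub>H\<^esub> y) = norm2 x - (cmod (ip H x y))\<^sup>2 / norm2 y"
    by (simp add: norm2_def[of "x \<ominus> c \<odot>\<^bsub>H\<^esub> y"])
  then have "0 \<le> norm2 x - (cmod (ip H x y))\<^sup>2 / norm2 y"
    using norm2_nonneg[of "x \<ominus> c \<odot>\<^bsub>H\<^esub> y"] assms by simp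
  then show ?thesis using y by (simp add: field_simps)
qed

lemma norm2_triangle:
  assumes "x \<in> carrier H" "y \<in> carrier H"
  shows "sqrt (norm2 (x \<oplus> y)) \<le> sqrt (norm2 x) + sqrt (norm2 y)"
proof -
  have "ip H (x \<oplus> y) (x \<oplus> y) = ip H x x + ip H y y + (ip H x y + cnj (ip H x y))"
    using assms ip_commute[OF assms(2,1)] by (simp add: ip_simps)
  then have "norm2 (x \<oplus> y) = norm2 x + norm2 y + 2 * Re (ip H x y)"
    by (simp add: norm2_def)
  also have "Re (ip H x y) \<le> cmod (ip H x y)" by (rule complex_Re_le_cmod)
  also have "cmod (ip H x y) \<le> sqrt (norm2 x * norm2 y)"
    using cauchy_schwarz[OF assms] by (rule real_le_rsqrt)
  finally have "norm2 (x \<oplus> y) \<le> (sqrt (norm2 x) + sqrt (norm2 y))\<^sup>2"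
    using assms by (simp add: power2_sum real_sqrt_mult)
  then show ?thesis using assms by (simp add: real_le_lsqrt)
qed

lemma hdist_eq: "hdist H x y = sqrt (norm2 (x \<ominus> y))"
  by (simp add: hdist_def norm2_def)

lemma hdist_power2: "x \<in> carrier H \<Longrightarrow> y \<in> carrier H \<Longrightarrow> (hdist H x y)\<^sup>2 = norm2 (x \<ominus> y)"
  unfolding hdist_eq by (rule real_sqrt_pow2[OF norm2_nonneg[OF minus_in_carrier]])

lemma hdist_nonneg: "x \<in> carrier H \<Longrightarrow> y \<in> carrier H \<Longrightarrow> 0 \<le> hdist H x y"
  unfolding hdist_eq by (rule real_sqrt_ge_zero[OF norm2_nonneg[OF minus_in_carrier]])

lemma norm2_minus:
  assumes "x \<in> carrier H" "y \<in> carrier H"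
  shows "norm2 (x \<ominus> y) = Re (ip H x x) - Re (ip H x y) - Re (ip H y x) + Re (ip H y y)"
  unfolding norm2_def ip_minus_left[OF assms minus_in_carrier[OF assms]]
    ip_minus_right[OF assms assms(1)] ip_minus_right[OF assms assms(2)] by simp

lemma norm2_minus_commute:
  assumes "x \<in> carrier H" "y \<in> carrier H"
  shows "norm2 (x \<ominus> y) = norm2 (y \<ominus> x)"
  using assms by (simp only: norm2_minus)

lemma hdist_triangle:
  assumes "x \<in> carrier H" "y \<in> carrier H" "z \<in> carrier H"
  shows "hdist H x z \<le> hdist H x y + hdist H y z"
proof -
  have "x \<ominus> z = (x \<ominus> y) \<oplus> (y \<ominus> z)"
    using assms by (intro ip_eqI) (auto simp: ip_simps)
  then show ?thesis using norm2_triangle[of "x \<ominus> y" "y \<ominus> z"] assms by (simp add: hdist_eq)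
qed

end

sublocale hilbert_space \<subseteq> pre_hilbert_space
  by unfold_locales (auto simp: ip_commute[symmetric] ip_add ip_smult ip_nonneg ip_definite intro: ip_commute)

lemma hilbert_spaceI:
  assumes "pre_hilbert_space H"
    and "\<And>X. \<lbrakk>\<And>i::nat. X i \<in> carrier H;
        \<And>e. 0 < e \<Longrightarrow> \<exists>N. \<forall>i\<ge>N. \<forall>j\<ge>N. hdist H (X i) (X j) < e\<rbrakk> \<Longrightarrow>
      \<exists>l\<in>carrier H. (\<lambda>i. hdist H (X i) l) \<longlonglongrightarrow> 0"
  shows "hilbert_space H"
proof -
  interpret pre_hilbert_space H by fact
  show ?thesis
    by unfold_locales (use assms(2) in \<open>auto simp: ip_add ip_smult ip_nonneg ip_definite intro: ip_commute\<close>)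
qed

text \<open>The relaxation \<open>w + t (v - T w)\<close> contracts the residual \<open>v - T w\<close>.\<close>

lemma (in hilbert_space) surjective_of_contraction:
  assumes T: "\<And>x. x \<in> carrier H \<Longrightarrow> T x \<in> carrier H"
    and add: "\<And>x y. x \<in> carrier H \<Longrightarrow> y \<in> carrier H \<Longrightarrow> T (x \<oplus> y) = T x \<oplus> T y"
    and scale: "\<And>c x. x \<in> carrier H \<Longrightarrow> T (c \<odot>\<^bsub>H\<^esub> x) = c \<odot>\<^bsub>H\<^esub> T x"
    and bounded: "\<And>x. x \<in> carrier H \<Longrightarrow> norm2 (T x) \<le> C * norm2 x"
    and contract: "\<And>x. x \<in> carrier H \<Longrightarrow> norm2 (x \<ominus> complex_of_real t \<odot>\<^bsub>H\<^esub> T x) \<le> q * norm2 x"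
    and q: "0 \<le> q" "q < 1" and v: "v \<in> carrier H"
  shows "\<exists>w\<in>carrier H. T w = v"
proof -
  have Tminus: "T (x \<ominus> y) = T x \<ominus> T y" if "x \<in> carrier H" "y \<in> carrier H" for x y
  proof -
    have "T x = T (x \<ominus> y \<oplus> y)" using that by (simp add: a_minus_def M.a_assoc M.l_neg)
    also have "\<dots> = T (x \<ominus> y) \<oplus> T y" using that by (intro add) auto
    finally show ?thesis using that T by (intro ip_eqI) (auto simp: ip_simps)
  qed
  define w where "w = rec_nat \<zero> (\<lambda>_ w. w \<oplus> complex_of_real t \<odot>\<^bsub>H\<^esub> (v \<ominus> T w))"
  have w0: "w 0 = \<zero>" and wS: "w (Suc j) = w j \<oplus> complex_of_real t \<odot>\<^bsub>H\<^esub> (v \<ominus> T (w j))" for j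
    by (auto simp: w_def)
  have w: "w j \<in> carrier H" for j by (induction j) (auto simp: w0 wS T v)
  define r where "r j = v \<ominus> T (w j)" for j
  have r: "r j \<in> carrier H" for j by (simp add: r_def T v w)
  \<comment> \<open>The new residual is the image of the old one under the operator
    \<open>1 - t T\<close>, to which \<open>contract\<close> applies.\<close>
  have rS: "r (Suc j) = r j \<ominus> complex_of_real t \<odot>\<^bsub>H\<^esub> T (r j)" for j
    using v w T
    by (intro ip_eqI) (auto simp: r_def wS add scale Tminus ip_simps algebra_simps)
  have nr: "norm2 (r j) \<le> q ^ j * norm2 (r 0)" for j
  proof (induction j)
    case (Suc j)
    have "norm2 (r (Suc j)) \<le> q * norm2 (r j)" unfolding rS by (rule contract[OF r])
    also have "\<dots> \<le> q * (q ^ j * norm2 (r 0))" using Suc q by (intro mult_left_mono) auto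
    finally show ?case by simp
  qed simp
  \<comment> \<open>\<open>q\<close> governs squared norms, so distances decay with ratio
    \<open>s\<close>.\<close>
  define s where "s = sqrt q"
  have s: "0 \<le> s" "s < 1" using q by (auto simp: s_def)
  have sr: "sqrt (norm2 (r j)) \<le> s ^ j * sqrt (norm2 (r 0))" for j
    using real_sqrt_le_mono[OF nr[of j]] by (simp add: s_def real_sqrt_mult real_sqrt_power)
  define K where "K = \<bar>t\<bar> * sqrt (norm2 (r 0))"
  have K: "K \<ge> 0" by (simp add: K_def r)
  have step: "hdist H (w (Suc j)) (w j) \<le> K * s ^ j" for j
  proof -
    have "w (Suc j) \<ominus> w j = complex_of_real t \<odot>\<^bsub>H\<^esub> r j"
      using w r by (intro ip_eqI) (auto simp: wS r_def[symmetric] ip_simps)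
    then have "hdist H (w (Suc j)) (w j) = \<bar>t\<bar> * sqrt (norm2 (r j))"
      by (simp add: hdist_eq norm2_smult[OF r] real_sqrt_mult)
    also have "\<dots> \<le> \<bar>t\<bar> * (s ^ j * sqrt (norm2 (r 0)))"
      using sr by (intro mult_left_mono) auto
    finally show ?thesis by (simp add: K_def mult_ac)
  qed
  have hd0: "hdist H x x = 0" if "x \<in> carrier H" for x
    using that by (simp add: hdist_def ip_simps)
  have hsym: "hdist H x y = hdist H y x" if "x \<in> carrier H" "y \<in> carrier H" for x y
    using that by (simp add: hdist_eq norm2_minus_commute)
  have far: "hdist H (w (i + m)) (w i) \<le> K / (1 - s) * s ^ i" for i m
  proof -
    \<comment> \<open>Keeping the subtracted term makes the induction on \<open>m\<close> telescope;
      it is dropped afterwards.\<close>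
    have "hdist H (w (i + m)) (w i) \<le> K / (1 - s) * (s ^ i - s ^ (i + m))"
    proof (induction m)
      case (Suc m)
      have "hdist H (w (i + Suc m)) (w i) \<le> hdist H (w (Suc (i + m))) (w (i + m)) + hdist H (w (i + m)) (w i)"
        using hdist_triangle[OF w w w] by simp
      also have "\<dots> \<le> K * s ^ (i + m) + K / (1 - s) * (s ^ i - s ^ (i + m))"
        using step Suc by (intro add_mono)
      also have "\<dots> = K / (1 - s) * (s ^ i - s ^ (i + Suc m))"
        using s by (simp add: field_simps)
      finally show ?case .
    qed (simp add: hd0 w)
    also have "\<dots> \<le> K / (1 - s) * s ^ i"
      using K s by (intro mult_left_mono) auto
    finally show ?thesis .
  qed
  have lim: "(\<lambda>i. K / (1 - s) * s ^ i) \<longlonglongrightarrow> 0"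
    using s by (intro tendsto_mult_right_zero LIMSEQ_realpow_zero)
  have "\<exists>l\<in>carrier H. (\<lambda>i. hdist H (w i) l) \<longlonglongrightarrow> 0"
  proof (rule complete[OF w])
    fix e :: real assume "0 < e"
    then have "eventually (\<lambda>i. K / (1 - s) * s ^ i < e) sequentially"
      using order_tendstoD(2)[OF lim] by blast
    then obtain N where N: "\<And>i. i \<ge> N \<Longrightarrow> K / (1 - s) * s ^ i < e"
      by (auto simp: eventually_sequentially)
    have "hdist H (w i) (w j) < e" if "i \<ge> N" "j \<ge> N" for i j
    proof (cases "i \<le> j")
      case True
      then show ?thesis
        using far[of i "j - i"] N[OF that(1)] hsym[OF w w, of i j] by simp
    next
      case False
      then show ?thesis using far[of j "i - j"] N[OF that(2)] by simp
    qed
    then show "\<exists>N. \<forall>i\<ge>N. \<forall>j\<ge>N. hdist H (w i) (w j) < e" by blast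
  qed
  then obtain l where l: "l \<in> carrier H" "(\<lambda>i. hdist H (w i) l) \<longlonglongrightarrow> 0" by blast
  have C: "norm2 (T x) \<le> \<bar>C\<bar> * norm2 x" if "x \<in> carrier H" for x
    using bounded[OF that] mult_right_mono[OF abs_ge_self[of C] norm2_nonneg[OF that]] by linarith
  \<comment> \<open>The left side does not depend on \<open>i\<close>, while the right side tends to
    zero: the residuals decay and \<open>T\<close> is bounded.\<close>
  have "sqrt (norm2 (v \<ominus> T l)) \<le> s ^ i * sqrt (norm2 (r 0)) + sqrt \<bar>C\<bar> * hdist H (w i) l" for i
  proof -
    have "v \<ominus> T l = r i \<oplus> T (w i \<ominus> l)"
      using v l w T by (intro ip_eqI) (auto simp: r_def Tminus ip_simps)
    then have "sqrt (norm2 (v \<ominus> T l)) \<le> sqrt (norm2 (r i)) + sqrt (norm2 (T (w i \<ominus> l)))"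
      using norm2_triangle[OF r, of "T (w i \<ominus> l)" i] T w l by simp
    also have "sqrt (norm2 (T (w i \<ominus> l))) \<le> sqrt \<bar>C\<bar> * hdist H (w i) l"
      using real_sqrt_le_mono[OF C[of "w i \<ominus> l"]] w l by (simp add: hdist_eq real_sqrt_mult)
    finally show ?thesis using sr[of i] by simp
  qed
  moreover have "(\<lambda>i. s ^ i * sqrt (norm2 (r 0)) + sqrt \<bar>C\<bar> * hdist H (w i) l) \<longlonglongrightarrow> 0 * sqrt (norm2 (r 0)) + sqrt \<bar>C\<bar> * 0"
    using s by (intro tendsto_intros LIMSEQ_realpow_zero l)
  ultimately have "sqrt (norm2 (v \<ominus> T l)) \<le> 0 * sqrt (norm2 (r 0)) + sqrt \<bar>C\<bar> * 0"
    by (intro LIMSEQ_le_const) auto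
  then have "norm2 (v \<ominus> T l) = 0"
    using norm2_nonneg[OF minus_in_carrier[OF v T[OF l(1)]]] by simp
  then have "v \<ominus> T l = \<zero>"
    using norm2_eq_0[OF minus_in_carrier[OF v T[OF l(1)]]] by (simp only: simp_thms)
  then have "v = T l" by (rule eq_of_minus_eq_zero[OF v T[OF l(1)]])
  then show ?thesis using l by auto
qed

text \<open>The orthogonal sum of \<open>k\<close> copies of \<open>H\<close>, on which a square
  matrix over the group algebra acts as one operator. The fields \<open>mult\<close> and
  \<open>one\<close> are irrelevant, as in every \<open>hilbert\<close> record.\<close>

definition hilbert_power :: "('h, 'm) hilbert_scheme \<Rightarrow> nat \<Rightarrow> 'h vec hilbert" where
  "hilbert_power H k = \<lparr>carrier = cochains H k, mult = undefined, one = undefined,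
     ring.zero = vec k (\<lambda>i. \<zero>\<^bsub>H\<^esub>), add = (\<lambda>v w. vec k (\<lambda>i. v $ i \<oplus>\<^bsub>H\<^esub> w $ i)),
     smult = (\<lambda>c v. vec k (\<lambda>i. c \<odot>\<^bsub>H\<^esub> v $ i)), ip = (\<lambda>v w. \<Sum>i<k. ip H (v $ i) (w $ i))\<rparr>"

lemma hilbert_power_simps:
  "carrier (hilbert_power H k) = cochains H k"
  "\<zero>\<^bsub>hilbert_power H k\<^esub> = vec k (\<lambda>i. \<zero>\<^bsub>H\<^esub>)"
  "v \<oplus>\<^bsub>hilbert_power H k\<^esub> w = vec k (\<lambda>i. v $ i \<oplus>\<^bsub>H\<^esub> w $ i)"
  "c \<odot>\<^bsub>hilbert_power H k\<^esub> v = vec k (\<lambda>i. c \<odot>\<^bsub>H\<^esub> v $ i)"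
  "ip (hilbert_power H k) v w = (\<Sum>i<k. ip H (v $ i) (w $ i))"
  by (auto simp: hilbert_power_def)

lemma (in hilbert_space) cochains_component: "v \<in> cochains H k \<Longrightarrow> i < k \<Longrightarrow> v $ i \<in> carrier H"
  by (simp add: cochains_def)

lemma (in hilbert_space) pre_hilbert_space_power: "pre_hilbert_space (hilbert_power H k)"
proof -
  have "module class_ring (hilbert_power H k)"
  proof (rule module_criteria, goal_cases)
    case 1 then show ?case using class_field.field_axioms[where ?'a = complex] by (simp add: field_def domain_def)
  next
    case 4
    show ?case
    proof
      fix v assume "v \<in> carrier (hilbert_power H k)"
      then show "\<exists>w\<in>carrier (hilbert_power H k). v \<oplus>\<^bsub>hilbert_power H k\<^esub> w = \<zero>\<^bsub>hilbert_power H k\<^esub>"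
        by (intro bexI[of _ "vec k (\<lambda>i. \<ominus> (v $ i))"])
          (auto simp: hilbert_power_simps cochains_def M.r_neg)
    qed
  qed (auto simp: hilbert_power_simps cochains_def M.a_ac smult_r_distr intro!: eq_vecI)
  then have "vectorspace class_ring (hilbert_power H k)"
    by (simp add: vectorspace_def class_field.field_axioms)
  moreover have "pre_hilbert_space_axioms (hilbert_power H k)"
  proof (unfold_locales, goal_cases)
    case (1 x y)
    then show ?case by (auto simp: hilbert_power_simps cochains_def intro!: sum.cong ip_commute)
  next
    case (5 x)
    have "complex_of_real (\<Sum>i<k. norm2 (x $ i)) = (\<Sum>i<k. ip H (x $ i) (x $ i))"
      using 5 by (auto simp: hilbert_power_simps cochains_def ip_self intro!: sum.cong)
    then have "complex_of_real (\<Sum>i<k. norm2 (x $ i)) = 0"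
      using 5(2) unfolding hilbert_power_simps by (simp only:)
    then have "(\<Sum>i<k. norm2 (x $ i)) = 0" by (simp only: of_real_eq_0_iff)
    then have "\<And>i. i < k \<Longrightarrow> norm2 (x $ i) = 0"
      using 5 by (subst (asm) sum_nonneg_eq_0_iff) (auto simp: hilbert_power_simps cochains_def)
    then show ?case
      using 5 by (auto simp: hilbert_power_simps cochains_def norm2_eq_0 intro!: eq_vecI)
  qed (auto simp: hilbert_power_simps cochains_def ip_add ip_smult sum.distrib sum_distrib_left ip_nonneg
      intro!: sum_nonneg)
  ultimately show ?thesis by (simp add: pre_hilbert_space_def)
qed

lemma (in hilbert_space) hdist_power:
  assumes "v \<in> cochains H k" "w \<in> cochains H k"
  shows "(hdist (hilbert_power H k) v w)\<^sup>2 = (\<Sum>i<k. (hdist H (v $ i) (w $ i))\<^sup>2)"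
proof -
  interpret P: pre_hilbert_space "hilbert_power H k" by (rule pre_hilbert_space_power)
  have vw: "v \<in> carrier (hilbert_power H k)" "w \<in> carrier (hilbert_power H k)"
    using assms by (auto simp: hilbert_power_simps)
  have "P.norm2 (v \<ominus>\<^bsub>hilbert_power H k\<^esub> w) = (\<Sum>i<k. norm2 (v $ i \<ominus> w $ i))"
    unfolding P.norm2_minus[OF vw] hilbert_power_simps(5) Re_sum
      sum_subtractf[symmetric] sum.distrib[symmetric]
    by (rule sum.cong[OF refl], rule norm2_minus[symmetric])
      (use assms in \<open>auto intro: cochains_component\<close>)
  then show ?thesis
    unfolding P.hdist_power2[OF vw]
    using assms by (auto intro!: sum.cong simp only: hdist_power2 cochains_component lessThan_iff)
qed

text \<open>The coordinates of a Cauchy sequence are Cauchy, and finitely many coordinatewise limits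
  give a limit in norm.\<close>

lemma (in hilbert_space) hilbert_space_power: "hilbert_space (hilbert_power H k)"
proof (rule hilbert_spaceI[OF pre_hilbert_space_power])
  fix X :: "nat \<Rightarrow> 'h vec"
  assume X: "\<And>i. X i \<in> carrier (hilbert_power H k)"
    and Cau: "\<And>e. 0 < e \<Longrightarrow> \<exists>N. \<forall>i\<ge>N. \<forall>j\<ge>N. hdist (hilbert_power H k) (X i) (X j) < e"
  interpret P: pre_hilbert_space "hilbert_power H k" by (rule pre_hilbert_space_power)
  have Xc: "X i \<in> cochains H k" for i using X by (simp add: hilbert_power_simps)
  have nn: "0 \<le> hdist (hilbert_power H k) v w" if "v \<in> cochains H k" "w \<in> cochains H k" for v w
    using that P.hdist_nonneg unfolding hilbert_power_simps by blast
  have "\<exists>l\<in>carrier H. (\<lambda>i. hdist H (X i $ m) l) \<longlonglongrightarrow> 0" if m: "m < k" for m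
  proof (rule complete)
    show "X i $ m \<in> carrier H" for i using cochains_component[OF Xc m] .
    fix e :: real assume "0 < e"
    then obtain N where N: "\<And>i j. i \<ge> N \<Longrightarrow> j \<ge> N \<Longrightarrow> hdist (hilbert_power H k) (X i) (X j) < e"
      using Cau by metis
    have "hdist H (X i $ m) (X j $ m) < e" if "i \<ge> N" "j \<ge> N" for i j
    proof -
      have "(hdist H (X i $ m) (X j $ m))\<^sup>2 \<le> (hdist (hilbert_power H k) (X i) (X j))\<^sup>2"
        unfolding hdist_power[OF Xc Xc] using m by (intro member_le_sum) auto
      then have "hdist H (X i $ m) (X j $ m) \<le> hdist (hilbert_power H k) (X i) (X j)"
        using nn[OF Xc Xc] by (rule power2_le_imp_le)
      then show ?thesis using N[OF that] by simp
    qed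
    then show "\<exists>N. \<forall>i\<ge>N. \<forall>j\<ge>N. hdist H (X i $ m) (X j $ m) < e" by blast
  qed
  then obtain l where l: "\<And>m. m < k \<Longrightarrow> l m \<in> carrier H \<and> (\<lambda>i. hdist H (X i $ m) (l m)) \<longlonglongrightarrow> 0"
    by metis
  define L where "L = vec k l"
  have L: "L \<in> cochains H k" using l by (auto simp: L_def cochains_def)
  have "(\<lambda>i. sqrt (\<Sum>m<k. (hdist H (X i $ m) (L $ m))\<^sup>2)) \<longlonglongrightarrow> sqrt (\<Sum>m<k. 0\<^sup>2)"
    using l by (intro tendsto_intros) (auto simp: L_def)
  then have "(\<lambda>i. hdist (hilbert_power H k) (X i) L) \<longlonglongrightarrow> 0"
    using nn[OF Xc L] by (simp add: real_sqrt_unique flip: hdist_power[OF Xc L])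
  then show "\<exists>l\<in>carrier (hilbert_power H k). (\<lambda>i. hdist (hilbert_power H k) (X i) l) \<longlonglongrightarrow> 0"
    using L by (auto simp: hilbert_power_simps)
qed

section \<open>Unitary representations\<close>

locale unitary_representation = hilbert_space H for H :: "('h, 'm) hilbert_scheme" (structure) +
  fixes \<pi> :: "'g::group_add \<Rightarrow> 'h \<Rightarrow> 'h"
  assumes unitary_rep: "unitary_rep H \<pi>"
begin

lemma rep_closed [simp]: "x \<in> carrier H \<Longrightarrow> \<pi> g x \<in> carrier H"
  using unitary_rep unfolding unitary_rep_def unitary_operator_def bij_betw_def by blast

lemma rep_add: "x \<in> carrier H \<Longrightarrow> \<pi> (g + h) x = \<pi> g (\<pi> h x)"
  using unitary_rep by (auto simp: unitary_rep_def)

lemma rep_smult: "x \<in> carrier H \<Longrightarrow> \<pi> g (c \<odot>\<^bsub>H\<^esub> x) = c \<odot>\<^bsub>H\<^esub> \<pi> g x"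
  using unitary_rep by (auto simp: unitary_rep_def unitary_operator_def)

text \<open>The unit acts as an injective idempotent, hence as the identity.\<close>

lemma rep_zero: 
  assumes "x \<in> carrier H"
  shows "\<pi> 0 x = x"
proof -
  have "inj_on (\<pi> 0) (carrier H)"
    using unitary_rep by (auto simp: unitary_rep_def unitary_operator_def bij_betw_def)
  then show ?thesis using rep_add[OF assms, of 0 0] assms by (auto dest: inj_onD)
qed

lemma rep_adjoint:
  assumes "x \<in> carrier H" "y \<in> carrier H"
  shows "ip H (\<pi> g x) y = ip H x (\<pi> (- g) y)"
proof -
  have "ip H (\<pi> g x) (\<pi> g (\<pi> (- g) y)) = ip H x (\<pi> (- g) y)"
    using unitary_rep assms by (auto simp: unitary_rep_def unitary_operator_def)
  then show ?thesis using assms by (simp add: rep_zero flip: rep_add)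
qed

lemma rep_alg_closed [simp]: "x \<in> carrier H \<Longrightarrow> rep_alg H \<pi> a x \<in> carrier H"
  unfolding rep_alg_def by (intro M.finsum_closed) auto

lemma ip_rep_alg:
  assumes "x \<in> carrier H" "z \<in> carrier H" "finite S" "keys a \<subseteq> S"
  shows "ip H (rep_alg H \<pi> a x) z = (\<Sum>g\<in>S. complex_of_real (lookup a g) * ip H (\<pi> g x) z)"
proof -
  have "ip H (rep_alg H \<pi> a x) z = (\<Sum>g\<in>keys a. complex_of_real (lookup a g) * ip H (\<pi> g x) z)"
    unfolding rep_alg_def using assms by (subst ip_finsum) (auto simp: ip_smult)
  also have "\<dots> = (\<Sum>g\<in>S. complex_of_real (lookup a g) * ip H (\<pi> g x) z)"
    using assms by (intro sum.mono_neutral_left) (auto simp: in_keys_iff)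
  finally show ?thesis .
qed

lemma rep_alg_zero: "x \<in> carrier H \<Longrightarrow> rep_alg H \<pi> 0 x = \<zero>"
  by (simp add: rep_alg_def)

lemma rep_alg_single:
  "x \<in> carrier H \<Longrightarrow> rep_alg H \<pi> (single g c) x = complex_of_real c \<odot>\<^bsub>H\<^esub> \<pi> g x"
  by (rule ip_eqI) (auto simp: ip_rep_alg[of _ _ "{g}"] ip_smult)

lemma ip_rep_alg_add:
  assumes "x \<in> carrier H" "z \<in> carrier H"
  shows "ip H (rep_alg H \<pi> (a + b) x) z = ip H (rep_alg H \<pi> a x) z + ip H (rep_alg H \<pi> b x) z"
proof -
  have "keys (a + b) \<subseteq> keys a \<union> keys b" by (rule Poly_Mapping.keys_add)
  then show ?thesis
    using assms
    by (simp add: ip_rep_alg[of _ _ "keys a \<union> keys b"] lookup_add sum.distrib distrib_right)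
qed

lemma rep_alg_add:
  "x \<in> carrier H \<Longrightarrow> rep_alg H \<pi> (a + b) x = rep_alg H \<pi> a x \<oplus> rep_alg H \<pi> b x"
  by (rule ip_eqI) (auto simp: ip_rep_alg_add ip_add)

lemma rep_alg_adjoint:
  assumes "x \<in> carrier H" "y \<in> carrier H"
  shows "ip H (rep_alg H \<pi> a x) y = ip H x (rep_alg H \<pi> (involution a) y)"
proof (induction a rule: group_algebra_induct)
  case (single g c)
  then show ?case
    using assms by (simp add: rep_alg_single ip_smult ip_smult_right rep_adjoint)
qed (use assms in \<open>auto simp: rep_alg_zero rep_alg_add ip_add ip_add_right\<close>)

lemma rep_alg_add_right:
  "x \<in> carrier H \<Longrightarrow> y \<in> carrier H \<Longrightarrow> rep_alg H \<pi> a (x \<oplus> y) = rep_alg H \<pi> a x \<oplus> rep_alg H \<pi> a y"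
  by (rule ip_eqI) (auto simp: rep_alg_adjoint ip_add)

lemma rep_alg_smult_right:
  "x \<in> carrier H \<Longrightarrow> rep_alg H \<pi> a (c \<odot>\<^bsub>H\<^esub> x) = c \<odot>\<^bsub>H\<^esub> rep_alg H \<pi> a x"
  by (rule ip_eqI) (auto simp: rep_alg_adjoint ip_smult)

lemma rep_alg_mult:
  assumes "x \<in> carrier H"
  shows "rep_alg H \<pi> (a * b) x = rep_alg H \<pi> a (rep_alg H \<pi> b x)"
proof (induction a rule: group_algebra_induct)
  case (single g c)
  show ?case
  proof (induction b rule: group_algebra_induct)
    case (single h d)
    then show ?case
      using assms by (simp add: mult_single rep_alg_single rep_smult rep_add)
  next
    case zero
    then show ?case
      using assms by (simp add: rep_alg_zero, intro ip_eqI) (auto simp: rep_alg_adjoint)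
  next
    case (add b b')
    then show ?case using assms by (simp add: distrib_left rep_alg_add rep_alg_add_right)
  qed
qed (use assms in \<open>auto simp: rep_alg_zero rep_alg_add distrib_right\<close>)

lemma rep_mat_closed:
  "A \<in> carrier_mat m n \<Longrightarrow> v \<in> cochains H n \<Longrightarrow> rep_mat H \<pi> A v \<in> cochains H m"
  by (auto simp: rep_mat_def cochains_def intro!: M.finsum_closed)

lemma ip_rep_mat:
  assumes "A \<in> carrier_mat m n" "v \<in> cochains H n" "i < m" "z \<in> carrier H"
  shows "ip H (rep_mat H \<pi> A v $ i) z = (\<Sum>j<n. ip H (rep_alg H \<pi> (A $$ (i, j)) (v $ j)) z)"
  using assms by (auto simp: rep_mat_def cochains_def ip_finsum)

lemma cochains_eqI:
  assumes "v \<in> cochains H m" "w \<in> cochains H m"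
    and "\<And>i z. i < m \<Longrightarrow> z \<in> carrier H \<Longrightarrow> ip H (v $ i) z = ip H (w $ i) z"
  shows "v = w"
  using assms by (intro eq_vecI ip_eqI) (auto simp: cochains_def)

lemma ip_rep_alg_sum:
  assumes "x \<in> carrier H" "z \<in> carrier H"
  shows "ip H (rep_alg H \<pi> (sum f S) x) z = (\<Sum>s\<in>S. ip H (rep_alg H \<pi> (f s) x) z)"
  by (induction S rule: infinite_finite_induct) (auto simp: assms ip_rep_alg_add rep_alg_zero)

lemma rep_mat_mult:
  assumes A: "A \<in> carrier_mat m n" and B: "B \<in> carrier_mat n l" and v: "v \<in> cochains H l"
  shows "rep_mat H \<pi> (A * B) v = rep_mat H \<pi> A (rep_mat H \<pi> B v)"
proof (rule cochains_eqI)
  have Bv: "rep_mat H \<pi> B v \<in> cochains H n" using rep_mat_closed[OF B v] .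
  have vc: "v $ j \<in> carrier H" if "j < l" for j using v that by (simp add: cochains_def)
  have Bvc: "rep_mat H \<pi> B v $ j \<in> carrier H" if "j < n" for j using Bv that by (simp add: cochains_def)
  show "rep_mat H \<pi> (A * B) v \<in> cochains H m" "rep_mat H \<pi> A (rep_mat H \<pi> B v) \<in> cochains H m"
    using rep_mat_closed A Bv v mult_carrier_mat[OF A B] by blast+
  fix i z assume i: "i < m" and z: "z \<in> carrier H"
  have "ip H (rep_mat H \<pi> (A * B) v $ i) z =
      (\<Sum>j<l. \<Sum>k<n. ip H (rep_alg H \<pi> (A $$ (i, k)) (rep_alg H \<pi> (B $$ (k, j)) (v $ j))) z)"
    unfolding ip_rep_mat[OF mult_carrier_mat[OF A B] v i z]
    using A B i z vc
    by (auto simp: scalar_prod_def atLeast0LessThan ip_rep_alg_sum rep_alg_mult intro!: sum.cong)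
  also have "\<dots> = (\<Sum>k<n. \<Sum>j<l. ip H (rep_alg H \<pi> (B $$ (k, j)) (v $ j)) (rep_alg H \<pi> (involution (A $$ (i, k))) z))"
    unfolding sum.swap[of _ "{..<l}"] using z vc by (auto simp: rep_alg_adjoint intro!: sum.cong)
  also have "\<dots> = (\<Sum>k<n. ip H (rep_mat H \<pi> B v $ k) (rep_alg H \<pi> (involution (A $$ (i, k))) z))"
    using z by (intro sum.cong refl ip_rep_mat[OF B v, symmetric]) auto
  also have "\<dots> = ip H (rep_mat H \<pi> A (rep_mat H \<pi> B v) $ i) z"
    unfolding ip_rep_mat[OF A Bv i z]
    by (intro sum.cong refl rep_alg_adjoint[symmetric] Bvc z) auto
  finally show "ip H (rep_mat H \<pi> (A * B) v $ i) z = ip H (rep_mat H \<pi> A (rep_mat H \<pi> B v) $ i) z" .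
qed

text \<open>The inner product of \<open>hilbert_power H k\<close>, available without interpreting
  that space.\<close>

definition cip :: "nat \<Rightarrow> 'h vec \<Rightarrow> 'h vec \<Rightarrow> complex" where
  "cip k v w = (\<Sum>i<k. ip H (v $ i) (w $ i))"

lemma cip_rep_mat:
  assumes "A \<in> carrier_mat m n" "v \<in> cochains H n" "w \<in> cochains H m"
  shows "cip m (rep_mat H \<pi> A v) w = (\<Sum>i<m. \<Sum>j<n. ip H (rep_alg H \<pi> (A $$ (i, j)) (v $ j)) (w $ i))"
  unfolding cip_def using assms
  by (intro sum.cong refl ip_rep_mat) (auto simp: cochains_def)

lemma cip_commute: "v \<in> cochains H m \<Longrightarrow> w \<in> cochains H m \<Longrightarrow> cip m v w = cnj (cip m w v)"
  by (auto simp: cip_def cochains_def intro!: sum.cong ip_commute)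

lemma rep_mat_adjoint:
  assumes A: "A \<in> carrier_mat m n" and v: "v \<in> cochains H n" and w: "w \<in> cochains H m"
  shows "cip m (rep_mat H \<pi> A v) w = cip n v (rep_mat H \<pi> (mat_star A) w)"
proof -
  have A': "mat_star A \<in> carrier_mat n m" using A by simp
  have vw: "v $ j \<in> carrier H" "w $ i \<in> carrier H" if "j < n" "i < m" for i j
    using v w that by (auto simp: cochains_def)
  have "cip n v (rep_mat H \<pi> (mat_star A) w)
      = cnj (\<Sum>j<n. \<Sum>i<m. ip H (rep_alg H \<pi> (involution (A $$ (i, j))) (w $ i)) (v $ j))"
    unfolding cip_commute[OF v rep_mat_closed[OF A' w]] cip_rep_mat[OF A' w v]
    using A by (auto intro!: sum.cong)
  also have "\<dots> = (\<Sum>j<n. \<Sum>i<m. ip H (v $ j) (rep_alg H \<pi> (involution (A $$ (i, j))) (w $ i)))"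
    unfolding cnj_sum
    by (intro sum.cong refl ip_commute[symmetric] rep_alg_closed vw) auto
  also have "\<dots> = (\<Sum>i<m. \<Sum>j<n. ip H (rep_alg H \<pi> (A $$ (i, j)) (v $ j)) (w $ i))"
    unfolding sum.swap[of _ "{..<n}"]
    by (intro sum.cong refl rep_alg_adjoint[symmetric] vw) auto
  finally show ?thesis unfolding cip_rep_mat[OF A v w] by simp
qed

lemma cip_rep_mat_add:
  assumes "A \<in> carrier_mat m n" "B \<in> carrier_mat m n" "v \<in> cochains H n" "w \<in> cochains H m"
  shows "cip m (rep_mat H \<pi> (A + B) v) w = cip m (rep_mat H \<pi> A v) w + cip m (rep_mat H \<pi> B v) w"
  unfolding cip_rep_mat[OF assms(1,3,4)] cip_rep_mat[OF assms(2,3,4)]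
    cip_rep_mat[OF add_carrier_mat[OF assms(2)] assms(3,4)] sum.distrib[symmetric]
  using assms by (intro sum.cong) (auto simp: ip_rep_alg_add cochains_def)

lemma cip_rep_mat_scalar_one:
  assumes v: "v \<in> cochains H n" and w: "w \<in> cochains H n"
  shows "cip n (rep_mat H \<pi> (scalar_times c (1\<^sub>m n)) v) w = complex_of_real c * cip n v w"
proof -
  have "cip n (rep_mat H \<pi> (scalar_times c (1\<^sub>m n)) v) w
      = (\<Sum>i<n. \<Sum>j<n. if j = i then complex_of_real c * ip H (v $ i) (w $ i) else 0)"
    unfolding cip_rep_mat[OF iffD2[OF scalar_times_carrier one_carrier_mat] v w]
    using v w by (intro sum.cong refl)
      (auto simp: cochains_def rep_alg_zero rep_alg_single rep_zero ip_smult)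
  then show ?thesis by (simp add: cip_def sum_distrib_left)
qed

lemma cip_star_mult:
  assumes a: "a \<in> carrier_mat m n" and v: "v \<in> cochains H n" and w: "w \<in> cochains H n"
  shows "cip n (rep_mat H \<pi> (mat_star a * a) v) w = cip m (rep_mat H \<pi> a v) (rep_mat H \<pi> a w)"
proof -
  have a': "mat_star a \<in> carrier_mat n m" using a by simp
  show ?thesis
    using rep_mat_mult[OF a' a v] rep_mat_adjoint[OF a' rep_mat_closed[OF a v] w] by simp
qed

lemma cip_self_nonneg: "v \<in> cochains H n \<Longrightarrow> 0 \<le> Re (cip n v v)"
  by (auto simp: cip_def cochains_def intro!: sum_nonneg ip_nonneg)

lemma cip_self_eq_0:
  assumes "v \<in> cochains H n" "Re (cip n v v) = 0"
  shows "v = vec n (\<lambda>i. \<zero>)"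
proof (rule eq_vecI)
  fix i assume i: "i < dim_vec (vec n (\<lambda>i. \<zero>))"
  have "(\<Sum>i<n. norm2 (v $ i)) = 0" using assms(2) by (simp add: cip_def norm2_def)
  then have "norm2 (v $ i) = 0"
    using i assms(1) by (subst (asm) sum_nonneg_eq_0_iff) (auto simp: cochains_def)
  then show "v $ i = vec n (\<lambda>i. \<zero>) $ i" using i assms(1) by (simp add: norm2_eq_0 cochains_def)
qed (use assms in \<open>auto simp: cochains_def\<close>)

text \<open>The quadratic form of \<open>mat_star a * a\<close> is the squared norm of the image
  under \<open>a\<close>. Inequalities modulo sums of squares thereby become operator inequalities
  in every representation.\<close>

lemma sums_of_squares_nonneg:
  assumes "A \<in> sums_of_squares n" and v: "v \<in> cochains H n"
  shows "0 \<le> Re (cip n (rep_mat H \<pi> A v) v)"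
proof -
  have "0 \<le> Re (cip n (rep_mat H \<pi> (sum_squares n as) v) v)" if "set as \<subseteq> carrier_mat n n" for as
    using that
  proof (induction as)
    case Nil
    have "cip n (rep_mat H \<pi> (0\<^sub>m n n) v) v = (\<Sum>i<n. \<Sum>j<n. 0)"
      unfolding cip_rep_mat[OF zero_carrier_mat v v]
      using v by (intro sum.cong refl) (auto simp: cochains_def rep_alg_zero)
    then show ?case by simp
  next
    case (Cons a as)
    then have a: "a \<in> carrier_mat n n" and as: "sum_squares n as \<in> carrier_mat n n" by auto
    have "cip n (rep_mat H \<pi> (sum_squares n (a # as)) v) v
        = cip n (rep_mat H \<pi> a v) (rep_mat H \<pi> a v) + cip n (rep_mat H \<pi> (sum_squares n as) v) v"
      by (simp add: cip_rep_mat_add[OF star_mult_carrier[OF a] as v v] cip_star_mult[OF a v v])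
    then show ?case
      using Cons cip_self_nonneg[OF rep_mat_closed[OF a v]] by simp
  qed
  then show ?thesis using assms(1) by (auto simp: sums_of_squares_alt)
qed

lemma bounded_below_of_sums_of_squares:
  assumes "A - scalar_times c (1\<^sub>m n) \<in> sums_of_squares n" "A \<in> carrier_mat n n" and v: "v \<in> cochains H n"
  shows "c * Re (cip n v v) \<le> Re (cip n (rep_mat H \<pi> A v) v)"
proof -
  let ?c = "scalar_times c (1\<^sub>m n) :: 'g group_algebra mat"
  have "A = (A - ?c) + ?c" using assms(2) by (intro eq_matI) auto
  then have "cip n (rep_mat H \<pi> A v) v = cip n (rep_mat H \<pi> ((A - ?c) + ?c) v) v" by simp
  also have "\<dots> = cip n (rep_mat H \<pi> (A - ?c) v) v + complex_of_real c * cip n v v"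
    using cip_rep_mat_add[OF sums_of_squares_carrier[OF assms(1)] _ v v, of ?c]
    by (simp add: cip_rep_mat_scalar_one[OF v v])
  finally show ?thesis using sums_of_squares_nonneg[OF assms(1) v] by simp
qed

lemma bounded_above_of_sums_of_squares:
  assumes "scalar_times c (1\<^sub>m n) - A \<in> sums_of_squares n" "A \<in> carrier_mat n n" and v: "v \<in> cochains H n"
  shows "Re (cip n (rep_mat H \<pi> A v) v) \<le> c * Re (cip n v v)"
proof -
  let ?c = "scalar_times c (1\<^sub>m n) :: 'g group_algebra mat"
  have "?c = (?c - A) + A" using assms(2) by (intro eq_matI) auto
  then have "cip n (rep_mat H \<pi> ?c v) v = cip n (rep_mat H \<pi> ((?c - A) + A) v) v" by simp
  also have "\<dots> = cip n (rep_mat H \<pi> (?c - A) v) v + cip n (rep_mat H \<pi> A v) v"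
    by (rule cip_rep_mat_add[OF sums_of_squares_carrier[OF assms(1)] assms(2) v v])
  finally have "Re (cip n (rep_mat H \<pi> ?c v) v)
      = Re (cip n (rep_mat H \<pi> (?c - A) v) v) + Re (cip n (rep_mat H \<pi> A v) v)" by simp
  then show ?thesis
    using sums_of_squares_nonneg[OF assms(1) v] by (simp add: cip_rep_mat_scalar_one[OF v v])
qed

lemma rep_mat_add_right:
  assumes A: "A \<in> carrier_mat m n" and v: "v \<in> cochains H n" and w: "w \<in> cochains H n"
  shows "rep_mat H \<pi> A (vec n (\<lambda>i. v $ i \<oplus> w $ i)) = vec m (\<lambda>i. rep_mat H \<pi> A v $ i \<oplus> rep_mat H \<pi> A w $ i)"
proof (rule cochains_eqI)
  have vw: "vec n (\<lambda>i. v $ i \<oplus> w $ i) \<in> cochains H n" using v w by (auto simp: cochains_def)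
  show "rep_mat H \<pi> A (vec n (\<lambda>i. v $ i \<oplus> w $ i)) \<in> cochains H m" by (rule rep_mat_closed[OF A vw])
  show "vec m (\<lambda>i. rep_mat H \<pi> A v $ i \<oplus> rep_mat H \<pi> A w $ i) \<in> cochains H m"
    using rep_mat_closed[OF A v] rep_mat_closed[OF A w] by (auto simp: cochains_def)
  fix i z assume i: "i < m" and z: "z \<in> carrier H"
  have c: "rep_mat H \<pi> A v $ i \<in> carrier H" "rep_mat H \<pi> A w $ i \<in> carrier H"
    using rep_mat_closed[OF A v] rep_mat_closed[OF A w] i by (auto simp: cochains_def)
  have "ip H (rep_mat H \<pi> A (vec n (\<lambda>i. v $ i \<oplus> w $ i)) $ i) z = (\<Sum>j<n.
      ip H (rep_alg H \<pi> (A $$ (i, j)) (v $ j)) z + ip H (rep_alg H \<pi> (A $$ (i, j)) (w $ j)) z)"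
    unfolding ip_rep_mat[OF A vw i z]
    using v w z by (intro sum.cong refl) (simp add: cochains_def rep_alg_add_right ip_add)
  also have "\<dots> = ip H (rep_mat H \<pi> A v $ i) z + ip H (rep_mat H \<pi> A w $ i) z"
    unfolding sum.distrib ip_rep_mat[OF A v i z] ip_rep_mat[OF A w i z] by (rule refl)
  also have "\<dots> = ip H (vec m (\<lambda>i. rep_mat H \<pi> A v $ i \<oplus> rep_mat H \<pi> A w $ i) $ i) z"
    using i ip_add[OF c z] by simp
  finally show "ip H (rep_mat H \<pi> A (vec n (\<lambda>i. v $ i \<oplus> w $ i)) $ i) z
    = ip H (vec m (\<lambda>i. rep_mat H \<pi> A v $ i \<oplus> rep_mat H \<pi> A w $ i) $ i) z" .
qed

lemma rep_mat_smult_right: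
  assumes A: "A \<in> carrier_mat m n" and v: "v \<in> cochains H n"
  shows "rep_mat H \<pi> A (vec n (\<lambda>i. c \<odot>\<^bsub>H\<^esub> v $ i)) = vec m (\<lambda>i. c \<odot>\<^bsub>H\<^esub> rep_mat H \<pi> A v $ i)"
proof (rule cochains_eqI)
  have cv: "vec n (\<lambda>i. c \<odot>\<^bsub>H\<^esub> v $ i) \<in> cochains H n" using v by (auto simp: cochains_def)
  show "rep_mat H \<pi> A (vec n (\<lambda>i. c \<odot>\<^bsub>H\<^esub> v $ i)) \<in> cochains H m" by (rule rep_mat_closed[OF A cv])
  show "vec m (\<lambda>i. c \<odot>\<^bsub>H\<^esub> rep_mat H \<pi> A v $ i) \<in> cochains H m"
    using rep_mat_closed[OF A v] by (auto simp: cochains_def)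
  fix i z assume i: "i < m" and z: "z \<in> carrier H"
  have c: "rep_mat H \<pi> A v $ i \<in> carrier H" using rep_mat_closed[OF A v] i by (auto simp: cochains_def)
  have "ip H (rep_mat H \<pi> A (vec n (\<lambda>i. c \<odot>\<^bsub>H\<^esub> v $ i)) $ i) z
      = (\<Sum>j<n. c * ip H (rep_alg H \<pi> (A $$ (i, j)) (v $ j)) z)"
    unfolding ip_rep_mat[OF A cv i z]
    using v z by (intro sum.cong refl) (simp add: cochains_def rep_alg_smult_right ip_smult)
  also have "\<dots> = c * ip H (rep_mat H \<pi> A v $ i) z"
    unfolding sum_distrib_left[symmetric] ip_rep_mat[OF A v i z] by (rule refl)
  also have "\<dots> = ip H (vec m (\<lambda>i. c \<odot>\<^bsub>H\<^esub> rep_mat H \<pi> A v $ i) $ i) z"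
    using i ip_smult[OF c z] by simp
  finally show "ip H (rep_mat H \<pi> A (vec n (\<lambda>i. c \<odot>\<^bsub>H\<^esub> v $ i)) $ i) z
    = ip H (vec m (\<lambda>i. c \<odot>\<^bsub>H\<^esub> rep_mat H \<pi> A v $ i) $ i) z" .
qed

lemma rep_mat_zero_right:
  assumes A: "A \<in> carrier_mat m n"
  shows "rep_mat H \<pi> A (vec n (\<lambda>i. \<zero>)) = vec m (\<lambda>i. \<zero>)"
proof (rule cochains_eqI)
  have z0: "vec n (\<lambda>i. \<zero>) \<in> cochains H n" by (auto simp: cochains_def)
  show "rep_mat H \<pi> A (vec n (\<lambda>i. \<zero>)) \<in> cochains H m" by (rule rep_mat_closed[OF A z0])
  show "vec m (\<lambda>i. \<zero>) \<in> cochains H m" by (auto simp: cochains_def)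
  fix i z assume i: "i < m" and z: "z \<in> carrier H"
  show "ip H (rep_mat H \<pi> A (vec n (\<lambda>i. \<zero>)) $ i) z = ip H (vec m (\<lambda>i. \<zero>) $ i) z"
    using i z by (simp add: ip_rep_mat[OF A z0 i z] rep_alg_adjoint)
qed

lemma ker_subset_im_of_gap:
  assumes d0: "d0 \<in> carrier_mat k1 k0" and d1: "d1 \<in> carrier_mat k2 k1"
    and dd: "d1 * d0 = 0\<^sub>m k2 k0" and "c > 0"
    and gap: "mat_star d1 * d1 + d0 * mat_star d0 - scalar_times c (1\<^sub>m k1) \<in> sums_of_squares k1"
  shows "rep_ker H \<pi> d1 \<subseteq> rep_im H \<pi> d0"
proof
  fix v assume "v \<in> rep_ker H \<pi> d1"
  then have v: "v \<in> cochains H k1" and d1v: "rep_mat H \<pi> d1 v = vec k2 (\<lambda>i. \<zero>)"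
    using d1 by (auto simp: rep_ker_def)
  interpret P: hilbert_space "hilbert_power H k1" by (rule hilbert_space_power)
  have n2: "P.norm2 x = Re (cip k1 x x)" for x
    by (simp add: P.norm2_def hilbert_power_simps(5) cip_def)
  have d0': "mat_star d0 \<in> carrier_mat k0 k1" and d1': "mat_star d1 \<in> carrier_mat k1 k2"
    using d0 d1 by auto
  define L where "L = mat_star d1 * d1 + d0 * mat_star d0"
  have dd0: "d0 * mat_star d0 \<in> carrier_mat k1 k1" using mult_carrier_mat[OF d0 d0'] .
  have L: "L \<in> carrier_mat k1 k1" using dd0 by (simp add: L_def)
  have L': "mat_star L \<in> carrier_mat k1 k1" using L by simp
  have gap': "L - scalar_times c (1\<^sub>m k1) \<in> sums_of_squares k1" using gap by (simp add: L_def)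
  obtain C where C: "C \<ge> 0" "scalar_times C (1\<^sub>m k1) - mat_star L * L \<in> sums_of_squares k1"
    using hermitian_bounded[OF star_mult_carrier[OF L]] mat_star_mult[OF L' L] by auto
  define T where "T = rep_mat H \<pi> L"
  have T: "T x \<in> cochains H k1" if "x \<in> cochains H k1" for x
    unfolding T_def by (rule rep_mat_closed[OF L that])
  have Tbound: "P.norm2 (T x) \<le> C * P.norm2 x" if x: "x \<in> cochains H k1" for x
    using bounded_above_of_sums_of_squares[OF C(2) star_mult_carrier[OF L] x]
    by (simp add: n2 T_def cip_star_mult[OF L x x])
  \<comment> \<open>With lower bound \<open>c\<close> for the form of \<open>T\<close> and bound
    \<open>C\<close> for its squared norm, the squared norm of \<open>x - t T x\<close> is at most
    \<open>1 - 2 t c + t\<^sup>2 C\<close> times that of \<open>x\<close>. This \<open>t\<close> has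
    \<open>t * C \<le> c\<close>, which leaves the factor \<open>1 - t * c\<close>; the summand
    \<open>c\<^sup>2\<close> ensures \<open>t * c \<le> 1\<close>.\<close>
  define t where "t = c / (C + c\<^sup>2)"
  have pos: "C + c\<^sup>2 > 0" using C(1) \<open>c > 0\<close> by (simp add: add_nonneg_pos)
  have t: "t > 0" "t * C \<le> c" "t * c \<le> 1"
    using pos C(1) \<open>c > 0\<close> by (auto simp: t_def field_simps power2_eq_square)
  have contract: "P.norm2 (x \<ominus>\<^bsub>hilbert_power H k1\<^esub> complex_of_real t \<odot>\<^bsub>hilbert_power H k1\<^esub> T x)
      \<le> (1 - t * c) * P.norm2 x" if x: "x \<in> cochains H k1" for x
  proof -
    have xP: "x \<in> carrier (hilbert_power H k1)" and TP: "T x \<in> carrier (hilbert_power H k1)"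
      using x T by (auto simp: hilbert_power_simps)
    have "P.norm2 (x \<ominus>\<^bsub>hilbert_power H k1\<^esub> complex_of_real t \<odot>\<^bsub>hilbert_power H k1\<^esub> T x)
      = P.norm2 x - 2 * t * Re (cip k1 (T x) x) + t\<^sup>2 * P.norm2 (T x)"
      unfolding P.norm2_minus[OF xP P.smult_in_carrier[OF TP]]
      unfolding P.norm2_def P.ip_smult[OF TP xP] P.ip_smult[OF TP P.smult_in_carrier[OF TP]]
        P.ip_smult_right[OF TP xP] P.ip_smult_right[OF TP TP] P.ip_commute[OF xP TP]
      by (simp add: power2_eq_square hilbert_power_simps(5) cip_def)
    also have "\<dots> \<le> P.norm2 x - 2 * t * (c * P.norm2 x) + t\<^sup>2 * (C * P.norm2 x)"
      using bounded_below_of_sums_of_squares[OF gap' L x] Tbound[OF x] t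
      by (intro add_mono diff_mono mult_left_mono) (auto simp: T_def n2)
    also have "t\<^sup>2 * (C * P.norm2 x) = t * (t * C) * P.norm2 x" by (simp add: power2_eq_square)
    also have "\<dots> \<le> t * c * P.norm2 x"
      using t P.norm2_nonneg[OF xP] by (intro mult_right_mono mult_left_mono) auto
    finally show ?thesis by (simp add: algebra_simps)
  qed
  have "\<exists>w\<in>carrier (hilbert_power H k1). T w = v"
    by (rule P.surjective_of_contraction[where t = t and q = "1 - t * c" and C = C])
      (use T Tbound contract t \<open>c > 0\<close> v rep_mat_add_right[OF L] rep_mat_smult_right[OF L]
        in \<open>auto simp: hilbert_power_simps T_def\<close>)
  then obtain w where w: "w \<in> cochains H k1" "T w = v" by (auto simp: hilbert_power_simps)
  define u where "u = rep_mat H \<pi> (mat_star d1 * d1) w"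
  define z where "z = rep_mat H \<pi> d0 (rep_mat H \<pi> (mat_star d0) w)"
  have u: "u \<in> cochains H k1" unfolding u_def by (rule rep_mat_closed[OF star_mult_carrier[OF d1] w(1)])
  have d0w: "rep_mat H \<pi> (mat_star d0) w \<in> cochains H k0" by (rule rep_mat_closed[OF d0' w(1)])
  have z: "z \<in> cochains H k1" unfolding z_def by (rule rep_mat_closed[OF d0 d0w])
  have "d1 * L = d1 * (mat_star d1 * d1)"
  proof -
    have "d1 * (d0 * mat_star d0) = 0\<^sub>m k2 k1"
      using assoc_mult_mat[OF d1 d0 d0'] dd d0' by simp
    then show ?thesis
      unfolding L_def mult_add_distrib_mat[OF d1 star_mult_carrier[OF d1] dd0]
      using mult_carrier_mat[OF d1 star_mult_carrier[OF d1]] by simp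
  qed
  then have "rep_mat H \<pi> d1 u = rep_mat H \<pi> d1 v"
    using rep_mat_mult[OF d1 star_mult_carrier[OF d1] w(1)] rep_mat_mult[OF d1 L w(1)] w(2)
    by (simp add: u_def T_def)
  then have d1u: "rep_mat H \<pi> d1 u = vec k2 (\<lambda>i. \<zero>)" using d1v by simp
  \<comment> \<open>The adjoint moves one \<open>d1\<close> across, and \<open>u\<close> has the
    same image under \<open>d1\<close> as the cocycle \<open>v\<close>, namely zero.\<close>
  have "cip k1 u u = cip k2 (rep_mat H \<pi> d1 w) (rep_mat H \<pi> d1 u)"
    unfolding u_def[symmetric] using cip_star_mult[OF d1 w(1) u] by (simp add: u_def)
  also have "\<dots> = 0"
    unfolding d1u using rep_mat_closed[OF d1 w(1)] by (auto simp: cip_def cochains_def)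
  finally have "u = vec k1 (\<lambda>i. \<zero>)" by (intro cip_self_eq_0[OF u]) simp
  have "v = z"
  proof (rule cochains_eqI[OF v z])
    fix i y assume i: "i < k1" and y: "y \<in> carrier H"
    have "ip H (v $ i) y = (\<Sum>j<k1. ip H (rep_alg H \<pi> (L $$ (i, j)) (w $ j)) y)"
      unfolding w(2)[symmetric] T_def by (rule ip_rep_mat[OF L w(1) i y])
    also have "\<dots> = (\<Sum>j<k1. ip H (rep_alg H \<pi> ((mat_star d1 * d1) $$ (i, j)) (w $ j)) y
        + ip H (rep_alg H \<pi> ((d0 * mat_star d0) $$ (i, j)) (w $ j)) y)"
    proof (rule sum.cong[OF refl])
      fix j assume j: "j \<in> {..<k1}"
      have "L $$ (i, j) = (mat_star d1 * d1) $$ (i, j) + (d0 * mat_star d0) $$ (i, j)"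
        using i j dd0 by (simp add: L_def del: index_mult_mat)
      moreover have "w $ j \<in> carrier H" using w(1) j by (simp add: cochains_def)
      ultimately show "ip H (rep_alg H \<pi> (L $$ (i, j)) (w $ j)) y
        = ip H (rep_alg H \<pi> ((mat_star d1 * d1) $$ (i, j)) (w $ j)) y
        + ip H (rep_alg H \<pi> ((d0 * mat_star d0) $$ (i, j)) (w $ j)) y"
        using y by (simp add: ip_rep_alg_add del: index_mult_mat)
    qed
    also have "\<dots> = ip H (u $ i) y + ip H (z $ i) y"
      unfolding sum.distrib u_def z_def ip_rep_mat[OF star_mult_carrier[OF d1] w(1) i y]
      using ip_rep_mat[OF dd0 w(1) i y] rep_mat_mult[OF d0 d0' w(1)] by simp
    also have "ip H (u $ i) y = 0" unfolding \<open>u = vec k1 (\<lambda>i. \<zero>)\<close> using i y by simp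
    finally show "ip H (v $ i) y = ip H (z $ i) y" by simp
  qed
  then show "v \<in> rep_im H \<pi> d0"
    using d0 d0w by (auto simp: rep_im_def z_def)
qed

text \<open>Each kernel vector lies in its own coset, and the coset of a vector of the image is the
  image. The zero vector keeps the set of cosets nonempty, as equality with a singleton
  requires.\<close>

lemma cohomology_vanishes_iff:
  assumes d0: "d (p - 1) \<in> carrier_mat k1 k0" and d1: "d p \<in> carrier_mat k2 k1"
  shows "cohomology_vanishes H \<pi> d p \<longleftrightarrow> rep_ker H \<pi> (d p) \<subseteq> rep_im H \<pi> (d (p - 1))"
proof -
  let ?im = "rep_im H \<pi> (d (p - 1))" and ?ker = "rep_ker H \<pi> (d p)"
  define coset where "coset v = {vec (dim_vec v) (\<lambda>i. v $ i \<oplus> w $ i) | w. w \<in> ?im}" for v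
  have im: "\<exists>w\<in>cochains H k0. v = rep_mat H \<pi> (d (p - 1)) w" if "v \<in> ?im" for v
    using that d0 by (auto simp: rep_im_def)
  have imI: "rep_mat H \<pi> (d (p - 1)) w \<in> ?im" if "w \<in> cochains H k0" for w
    using that d0 by (auto simp: rep_im_def)
  have imc: "v \<in> cochains H k1" if "v \<in> ?im" for v
    using im[OF that] rep_mat_closed[OF d0] by auto
  have zc: "vec k (\<lambda>i. \<zero>) \<in> cochains H k" for k by (auto simp: cochains_def)
  have zim: "vec k1 (\<lambda>i. \<zero>) \<in> ?im"
    using imI[OF zc] rep_mat_zero_right[OF d0] by simp
  have zker: "vec k1 (\<lambda>i. \<zero>) \<in> ?ker"
    using d1 zc rep_mat_zero_right[OF d1] by (auto simp: rep_ker_def)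
  have add_im: "vec k1 (\<lambda>i. v $ i \<oplus> w $ i) \<in> ?im" if vw: "v \<in> ?im" "w \<in> ?im" for v w
  proof -
    obtain v' w' where v': "v' \<in> cochains H k0" "v = rep_mat H \<pi> (d (p - 1)) v'"
      and w': "w' \<in> cochains H k0" "w = rep_mat H \<pi> (d (p - 1)) w'" using im vw by metis
    have "vec k0 (\<lambda>i. v' $ i \<oplus> w' $ i) \<in> cochains H k0" using v' w' by (auto simp: cochains_def)
    then show ?thesis using imI rep_mat_add_right[OF d0 v'(1) w'(1)] v' w' by metis
  qed
  have neg_im: "vec k1 (\<lambda>i. (- 1) \<odot>\<^bsub>H\<^esub> v $ i) \<in> ?im" if v: "v \<in> ?im" for v
  proof -
    obtain v' where v': "v' \<in> cochains H k0" "v = rep_mat H \<pi> (d (p - 1)) v'" using im v by metis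
    have "vec k0 (\<lambda>i. (- 1) \<odot>\<^bsub>H\<^esub> v' $ i) \<in> cochains H k0" using v' by (auto simp: cochains_def)
    then show ?thesis using imI rep_mat_smult_right[OF d0 v'(1)] v' by metis
  qed
  have coset_im: "coset v = ?im" if v: "v \<in> ?im" for v
  proof (intro subset_antisym subsetI)
    have dv: "dim_vec v = k1" using imc[OF v] by (simp add: cochains_def)
    fix x assume "x \<in> coset v"
    then show "x \<in> ?im" using add_im[OF v] dv by (auto simp: coset_def)
  next
    have dv: "dim_vec v = k1" using imc[OF v] by (simp add: cochains_def)
    fix x assume x: "x \<in> ?im"
    let ?nv = "vec k1 (\<lambda>i. (- 1) \<odot>\<^bsub>H\<^esub> v $ i)" 
    let ?y = "vec k1 (\<lambda>i. ?nv $ i \<oplus> x $ i)"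
    have y: "?y \<in> ?im" by (rule add_im[OF neg_im[OF v] x])
    have "x = vec (dim_vec v) (\<lambda>i. v $ i \<oplus> ?y $ i)"
    proof (rule eq_vecI)
      fix i assume "i < dim_vec (vec (dim_vec v) (\<lambda>i. v $ i \<oplus> ?y $ i))"
      then have i: "i < k1" using dv by simp
      have c: "v $ i \<in> carrier H" "x $ i \<in> carrier H"
        using imc[OF v] imc[OF x] i by (auto simp: cochains_def)
      have "v $ i \<oplus> ((- 1) \<odot>\<^bsub>H\<^esub> v $ i \<oplus> x $ i) = x $ i"
        using c by (intro ip_eqI) (auto simp: ip_add ip_smult)
      then show "x $ i = vec (dim_vec v) (\<lambda>i. v $ i \<oplus> ?y $ i) $ i" using i dv by simp
    qed (use dv imc[OF x] in \<open>auto simp: cochains_def\<close>)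
    then show "x \<in> coset v" using y unfolding coset_def by blast
  qed
  have self: "v \<in> coset v" if v: "v \<in> ?ker" for v
  proof -
    have v: "v \<in> cochains H k1" using that d1 by (auto simp: rep_ker_def)
    have "v = vec (dim_vec v) (\<lambda>i. v $ i \<oplus> vec k1 (\<lambda>i. \<zero>) $ i)"
      using v by (intro eq_vecI) (auto simp: cochains_def)
    then show ?thesis using zim unfolding coset_def by blast
  qed
  have "cohomology_vanishes H \<pi> d p \<longleftrightarrow> coset ` ?ker = {?im}"
    by (simp add: cohomology_vanishes_def group_cohomology_def coset_def)
  also have "\<dots> \<longleftrightarrow> ?ker \<subseteq> ?im"
    using self coset_im zker by blast
  finally show ?thesis .
qed

end

section \<open>Positive functionals\<close>

text \<open>A cone that is maximal among those avoiding \<open>- u\<close> is a half space.\<close>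

lemma positive_functional_exists:
  fixes P :: "'b::ab_group_add set" and sc :: "real \<Rightarrow> 'b \<Rightarrow> 'b"
  assumes "vector_space sc"
    and P_add: "\<And>x y. x \<in> P \<Longrightarrow> y \<in> P \<Longrightarrow> x + y \<in> P"
    and P_sc: "\<And>c x. 0 \<le> c \<Longrightarrow> x \<in> P \<Longrightarrow> sc c x \<in> P"
    and unit: "\<And>x. \<exists>t. sc t u + x \<in> P"
    and neg: "- u \<notin> P"
  obtains \<phi> :: "'b \<Rightarrow> real" where "\<And>x y. \<phi> (x + y) = \<phi> x + \<phi> y" "\<And>c x. \<phi> (sc c x) = c * \<phi> x"
    "\<And>x. x \<in> P \<Longrightarrow> 0 \<le> \<phi> x" "\<phi> u = 1"
proof -
  interpret vector_space sc by fact
  define cone where "cone Q \<longleftrightarrow> (\<forall>x\<in>Q. \<forall>y\<in>Q. x + y \<in> Q) \<and> (\<forall>c\<ge>0. \<forall>x\<in>Q. sc c x \<in> Q)" for Q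
  define A where "A = {Q. P \<subseteq> Q \<and> cone Q \<and> - u \<notin> Q}"
  have "\<exists>Q\<in>A. \<forall>R\<in>A. Q \<subseteq> R \<longrightarrow> R = Q"
  proof (rule subset_Zorn_nonempty)
    have "cone P" unfolding cone_def using P_add P_sc by simp
    then have "P \<in> A" using neg by (simp add: A_def)
    then show "A \<noteq> {}" by blast
    fix \<C> assume \<C>: "\<C> \<noteq> {}" "subset.chain A \<C>"
    have sub: "P \<subseteq> R \<and> cone R \<and> - u \<notin> R" if "R \<in> \<C>" for R
      using \<C>(2) that unfolding subset.chain_def A_def by blast
    have "x + y \<in> \<Union>\<C>" if xy: "x \<in> \<Union>\<C>" "y \<in> \<Union>\<C>" for x y
    proof -
      obtain R S where RS: "R \<in> \<C>" "S \<in> \<C>" "x \<in> R" "y \<in> S" using xy by blast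
      then have "R \<subseteq> S \<or> S \<subseteq> R" using \<C>(2) unfolding subset_chain_def by blast
      then have "x \<in> R \<and> y \<in> R \<or> x \<in> S \<and> y \<in> S" using RS by blast
      then have "x + y \<in> R \<or> x + y \<in> S"
        using RS sub[of R] sub[of S] by (auto simp: cone_def)
      then show ?thesis using RS by blast
    qed
    moreover have "sc c x \<in> \<Union>\<C>" if "0 \<le> c" "x \<in> \<Union>\<C>" for c x
    proof -
      obtain R where "R \<in> \<C>" "x \<in> R" using \<open>x \<in> \<Union>\<C>\<close> by blast
      then have "sc c x \<in> R" using sub[of R] \<open>0 \<le> c\<close> by (simp add: cone_def)
      then show ?thesis using \<open>R \<in> \<C>\<close> by blast
    qed
    moreover have "P \<subseteq> \<Union>\<C>" "- u \<notin> \<Union>\<C>" using \<C>(1) sub by blast+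
    ultimately show "\<Union>\<C> \<in> A" by (simp add: A_def cone_def)
  qed
  then obtain Q where "Q \<in> A" and Qmax: "\<And>R. R \<in> A \<Longrightarrow> Q \<subseteq> R \<Longrightarrow> R = Q" by blast
  then have PQ: "P \<subseteq> Q" and Qadd: "\<And>x y. x \<in> Q \<Longrightarrow> y \<in> Q \<Longrightarrow> x + y \<in> Q"
    and Qsc: "\<And>c x. 0 \<le> c \<Longrightarrow> x \<in> Q \<Longrightarrow> sc c x \<in> Q" and Qneg: "- u \<notin> Q"
    by (simp_all add: A_def cone_def)
  \<comment> \<open>By maximality the cone generated by \<open>Q\<close> and \<open>x\<close> must
    contain \<open>- u\<close>; the coefficient of \<open>x\<close> is positive because
    \<open>Q\<close> itself avoids \<open>- u\<close>.\<close>
  have ext: "\<exists>q\<in>Q. \<exists>c>0. - u = q + sc c x" if "x \<notin> Q" for x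
  proof -
    define R where "R = {q + sc c x | q c. q \<in> Q \<and> 0 \<le> c}"
    obtain p where "p \<in> Q" using unit PQ by blast
    then have Q0: "0 \<in> Q" using Qsc[of 0 p] by simp
    have QR: "Q \<subseteq> R" unfolding R_def by (force intro: exI[of _ 0])
    moreover have "x \<in> R" unfolding R_def using Q0 by (force intro: exI[of _ 0] exI[of _ 1])
    ultimately have "R \<notin> A" using Qmax[of R] that by auto
    moreover have "cone R"
      unfolding cone_def
    proof (intro conjI ballI allI impI)
      fix y z assume "y \<in> R" "z \<in> R"
      then obtain q c q' c' where "y = q + sc c x" "z = q' + sc c' x" "q \<in> Q" "q' \<in> Q" "0 \<le> c" "0 \<le> c'"
        by (auto simp: R_def)
      then show "y + z \<in> R"
        unfolding R_def
        by (intro CollectI exI[of _ "q + q'"] exI[of _ "c + c'"]) (auto simp: Qadd scale_left_distrib)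
    next
      fix b :: real and y assume "0 \<le> b" "y \<in> R"
      then obtain q c where "y = q + sc c x" "q \<in> Q" "0 \<le> c" by (auto simp: R_def)
      then show "sc b y \<in> R"
        unfolding R_def using \<open>0 \<le> b\<close>
        by (intro CollectI exI[of _ "sc b q"] exI[of _ "b * c"]) (auto simp: Qsc scale_right_distrib)
    qed
    ultimately have "- u \<in> R" using QR PQ by (auto simp: A_def)
    then obtain q c where "- u = q + sc c x" "q \<in> Q" "0 \<le> c" by (auto simp: R_def)
    moreover have "c \<noteq> 0" using calculation Qneg by auto
    ultimately show ?thesis by (metis less_eq_real_def)
  qed
  \<comment> \<open>If both \<open>x\<close> and \<open>- x\<close> were missing, the two resulting
    expressions for \<open>- u\<close>, weighted by \<open>c'\<close> and \<open>c\<close>, would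
    add up with \<open>x\<close> cancelled and place a positive multiple of \<open>- u\<close> in
    \<open>Q\<close>.\<close>
  have total: "x \<in> Q \<or> - x \<in> Q" for x
  proof (rule ccontr)
    assume "\<not> (x \<in> Q \<or> - x \<in> Q)"
    then obtain q c q' c' where q: "q \<in> Q" "c > 0" "- u = q + sc c x" "q' \<in> Q" "c' > 0" "- u = q' + sc c' (- x)"
      using ext[of x] ext[of "- x"] by auto
    have "sc c' (- u) = sc c' q + sc (c' * c) x"
      unfolding q(3) by (simp add: scale_right_distrib)
    moreover have "sc c (- u) = sc c q' - sc (c' * c) x"
      unfolding q(6) by (simp add: scale_right_distrib scale_right_diff_distrib mult.commute)
    moreover have "sc (c + c') (- u) = sc c' (- u) + sc c (- u)"
      by (simp only: scale_left_distrib add.commute)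
    ultimately have "sc (c + c') (- u) = sc c' q + sc c q'" by simp
    then have "sc (c + c') (- u) \<in> Q" using q(1,2,4,5) Qadd Qsc by (metis less_imp_le)
    moreover have "0 \<le> 1 / (c + c')" using q(2,5) by simp
    ultimately have "sc (1 / (c + c')) (sc (c + c') (- u)) \<in> Q" by (metis Qsc)
    moreover have "sc (1 / (c + c')) (sc (c + c') (- u)) = - u"
      using q(2,5) by (subst scale_scale) simp
    ultimately show False using Qneg by metis
  qed
  have uQ: "u \<in> Q" using total Qneg by auto
  have negsc: "sc r u \<notin> Q" if "r < 0" for r
  proof
    assume "sc r u \<in> Q"
    moreover have "0 \<le> - 1 / r" using that by (simp add: divide_nonpos_neg)
    ultimately have "sc (- 1 / r) (sc r u) \<in> Q" by (metis Qsc)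
    moreover have "sc (- 1 / r) (sc r u) = - u" using that by (subst scale_scale) simp
    ultimately show False using Qneg by metis
  qed
  \<comment> \<open>In the order of \<open>Q\<close>, the vector \<open>x\<close> lies between
    \<open>sc (a - e) u\<close> and \<open>sc (a + e) u\<close> for every \<open>e > 0\<close>. Such
    an \<open>a\<close> is unique and is taken as the value of the functional at
    \<open>x\<close>.\<close>
  define good where "good x a \<longleftrightarrow> (\<forall>e>0. sc (a + e) u - x \<in> Q \<and> x - sc (a - e) u \<in> Q)" for x a
  have unique: "a = b" if "good x a" "good x b" for x a b
  proof -
    have "\<not> a < b" if "good x a" "good x b" for a b
    proof
      assume "a < b"
      define e where "e = (b - a) / 4"
      have "e > 0" using \<open>a < b\<close> by (simp add: e_def)
      then have "sc (a + e) u - x \<in> Q" "x - sc (b - e) u \<in> Q"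
        using that unfolding good_def by blast+
      then have "(sc (a + e) u - x) + (x - sc (b - e) u) \<in> Q" by (rule Qadd)
      moreover have "(sc (a + e) u - x) + (x - sc (b - e) u) = sc (a + e - (b - e)) u"
        by (simp only: scale_left_diff_distrib[of "a + e" "b - e" u]) simp
      ultimately show False using negsc[of "a + e - (b - e)"] \<open>a < b\<close> by (simp add: e_def field_simps)
    qed
    then show ?thesis using that by (meson linorder_less_linear)
  qed
  have "\<exists>a. good x a" for x
  proof -
    define S where "S = {t. sc t u - x \<in> Q}"
    obtain t where "sc t u + - x \<in> P" using unit by blast
    then have ne: "t \<in> S" using PQ by (auto simp: S_def)
    obtain s where s: "sc s u + x \<in> P" using unit by blast
    have lower: "- s \<le> t" if "t \<in> S" for t
    proof (rule ccontr)
      assume "\<not> - s \<le> t"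
      have "sc t u - x \<in> Q" "sc s u + x \<in> Q" using that s PQ by (auto simp: S_def)
      then have "(sc t u - x) + (sc s u + x) \<in> Q" by (rule Qadd)
      then show False using negsc[of "t + s"] \<open>\<not> - s \<le> t\<close> by (simp add: scale_left_distrib)
    qed
    then have bdd: "bdd_below S" by (rule bdd_belowI)
    have up: "t' \<in> S" if "t \<in> S" "t \<le> t'" for t t'
    proof -
      have "(sc t u - x) + sc (t' - t) u \<in> Q" using that uQ by (auto simp: S_def intro!: Qadd Qsc)
      then show ?thesis by (simp add: S_def scale_left_diff_distrib algebra_simps)
    qed
    \<comment> \<open>\<open>S\<close> is upward closed, and bounded below through
      \<open>unit\<close>. Above its infimum, multiples of \<open>u\<close> dominate
      \<open>x\<close>; below it, totality of \<open>Q\<close> reverses the inequality.\<close>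
    have "good x (Inf S)"
      unfolding good_def
    proof (intro allI impI conjI)
      fix e :: real assume "e > 0"
      then obtain t where "t \<in> S" "t < Inf S + e"
        using cInf_less_iff[OF _ bdd, of "Inf S + e"] ne by auto
      then show "sc (Inf S + e) u - x \<in> Q" using up by (auto simp: S_def)
      have "Inf S - e \<notin> S" using cInf_lower[OF _ bdd, of "Inf S - e"] \<open>e > 0\<close> by auto
      then show "x - sc (Inf S - e) u \<in> Q" using total[of "sc (Inf S - e) u - x"] by (auto simp: S_def)
    qed
    then show ?thesis by blast
  qed
  then obtain \<phi> where \<phi>: "\<And>x. good x (\<phi> x)" by metis
  have eqI: "\<phi> x = a" if "good x a" for x a using unique[OF \<phi> that] .
  have add: "\<phi> (x + y) = \<phi> x + \<phi> y" for x y
  proof (rule eqI, unfold good_def, intro allI impI conjI)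
    fix e :: real assume "e > 0"
    then have *: "sc (\<phi> x + e / 2) u - x \<in> Q" "x - sc (\<phi> x - e / 2) u \<in> Q"
      "sc (\<phi> y + e / 2) u - y \<in> Q" "y - sc (\<phi> y - e / 2) u \<in> Q"
      using \<phi>[of x] \<phi>[of y] by (auto simp: good_def)
    have "sc (\<phi> x + \<phi> y + e) u = sc ((\<phi> x + e / 2) + (\<phi> y + e / 2)) u"
      "sc (\<phi> x + \<phi> y - e) u = sc ((\<phi> x - e / 2) + (\<phi> y - e / 2)) u"
      by (simp_all add: algebra_simps)
    then have "sc (\<phi> x + \<phi> y + e) u - (x + y) = (sc (\<phi> x + e / 2) u - x) + (sc (\<phi> y + e / 2) u - y)"
      "(x + y) - sc (\<phi> x + \<phi> y - e) u = (x - sc (\<phi> x - e / 2) u) + (y - sc (\<phi> y - e / 2) u)"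
      by (simp_all only: scale_left_distrib, simp_all add: algebra_simps)
    then show "sc (\<phi> x + \<phi> y + e) u - (x + y) \<in> Q" "(x + y) - sc (\<phi> x + \<phi> y - e) u \<in> Q"
      using * Qadd by metis+
  qed
  have scpos: "\<phi> (sc c x) = c * \<phi> x" if "c > 0" for c x
  proof (rule eqI, unfold good_def, intro allI impI conjI)
    fix e :: real assume "e > 0"
    then have *: "sc (\<phi> x + e / c) u - x \<in> Q" "x - sc (\<phi> x - e / c) u \<in> Q"
      using \<phi>[of x] that by (auto simp: good_def)
    have "sc c (sc (\<phi> x + e / c) u - x) = sc (c * \<phi> x + e) u - sc c x"
      "sc c (x - sc (\<phi> x - e / c) u) = sc c x - sc (c * \<phi> x - e) u"
      using that by (simp_all add: scale_right_diff_distrib distrib_left right_diff_distrib)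
    then show "sc (c * \<phi> x + e) u - sc c x \<in> Q" "sc c x - sc (c * \<phi> x - e) u \<in> Q"
      using * Qsc[of c] that by (metis less_imp_le)+
  qed
  have zero: "\<phi> 0 = 0" using add[of 0 0] by simp
  have minus: "\<phi> (- x) = - \<phi> x" for x using add[of x "- x"] zero by simp
  have scale: "\<phi> (sc c x) = c * \<phi> x" for c x
  proof -
    consider "c > 0" | "c = 0" | "c < 0" by linarith
    then show ?thesis
    proof cases
      case 3
      then have "\<phi> (sc (- c) x) = - c * \<phi> x" by (intro scpos) auto
      then show ?thesis using minus[of "sc c x"] by simp
    qed (auto simp: zero scpos)
  qed
  have pos: "0 \<le> \<phi> x" if "x \<in> P" for x
  proof (rule ccontr)
    assume "\<not> 0 \<le> \<phi> x"
    then have "- \<phi> x / 2 > 0" by simp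
    then have "sc (\<phi> x + - \<phi> x / 2) u - x \<in> Q" using \<phi>[of x] unfolding good_def by blast
    then have "(sc (\<phi> x + - \<phi> x / 2) u - x) + x \<in> Q" using that PQ by (intro Qadd) auto
    then show False using negsc[of "\<phi> x + - \<phi> x / 2"] \<open>\<not> 0 \<le> \<phi> x\<close> by simp
  qed
  have "\<phi> u = 1"
  proof (rule eqI, unfold good_def, intro allI impI conjI)
    fix e :: real assume "e > 0"
    have "sc (1 + e) u - u = sc e u" "u - sc (1 - e) u = sc e u"
      by (simp_all add: scale_left_distrib scale_left_diff_distrib)
    then show "sc (1 + e) u - u \<in> Q" "u - sc (1 - e) u \<in> Q" using Qsc uQ \<open>e > 0\<close> by auto
  qed
  then show ?thesis using that add scale pos by blast
qed

section \<open>Completion of a real semi-inner product space\<close>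

text \<open>The form may be degenerate. No quotient is formed: a null vector \<open>y\<close> gives
  the zero functional \<open>B y\<close>.\<close>

locale semi_inner_product = vector_space sc
  for sc :: "real \<Rightarrow> 'v::ab_group_add \<Rightarrow> 'v" +
  fixes B :: "'v \<Rightarrow> 'v \<Rightarrow> real"
  assumes B_add: "B (x + y) z = B x z + B y z"
    and B_sc: "B (sc c x) z = c * B x z"
    and B_sym: "B x y = B y x"
    and B_nonneg: "0 \<le> B x x"
begin

lemma B_add_right: "B z (x + y) = B z x + B z y"
  using B_add[of x y z] by (simp add: B_sym)

lemma B_sc_right: "B z (sc c x) = c * B z x"
  using B_sc[of c x z] by (simp add: B_sym)

lemma B_minus: "B (x - y) z = B x z - B y z"
  using B_add[of "x - y" y z] by simp

lemma B_minus_right: "B z (x - y) = B z x - B z y"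
  using B_minus[of x y z] by (simp add: B_sym)

definition nB :: "'v \<Rightarrow> real" where "nB x = sqrt (B x x)"

lemma nB_nonneg [simp]: "0 \<le> nB x" by (simp add: nB_def B_nonneg)

lemma nB_power2: "(nB x)\<^sup>2 = B x x" by (simp add: nB_def B_nonneg)

lemma Cauchy_Schwarz_B: "\<bar>B x y\<bar> \<le> nB x * nB y"
proof -
  have quad: "0 \<le> B x x + 2 * t * B x y + t\<^sup>2 * B y y" for t
    using B_nonneg[of "x + sc t y"]
    by (simp add: B_add B_add_right B_sc B_sc_right B_sym[of y x] power2_eq_square algebra_simps)
  have "(B x y)\<^sup>2 \<le> B x x * B y y"
  proof (cases "B y y = 0")
    case True
    have "B x y = 0"
    proof (rule ccontr)
      assume "B x y \<noteq> 0"
      \<comment> \<open>For \<open>B y y = 0\<close> the expression in \<open>quad\<close> is affine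
        in \<open>t\<close>, and this value of \<open>t\<close> makes it \<open>- 1\<close>.\<close>
      then have "B x x + 2 * (- (B x x + 1) / (2 * B x y)) * B x y = - 1" by (simp add: field_simps)
      then show False using quad[of "- (B x x + 1) / (2 * B x y)"] True by simp
    qed
    then show ?thesis using True by simp
  next
    case False
    then have "B y y > 0" using B_nonneg[of y] by simp
    then have "B x x + 2 * (- B x y / B y y) * B x y + (- B x y / B y y)\<^sup>2 * B y y
        = B x x - (B x y)\<^sup>2 / B y y"
      by (simp add: field_simps power2_eq_square)
    then have "0 \<le> B x x - (B x y)\<^sup>2 / B y y" using quad by metis
    then show ?thesis using \<open>B y y > 0\<close> by (simp add: field_simps)
  qed
  then have "(B x y)\<^sup>2 \<le> (nB x * nB y)\<^sup>2" by (simp add: power_mult_distrib nB_power2)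
  then have "\<bar>B x y\<bar>\<^sup>2 \<le> (nB x * nB y)\<^sup>2" by simp
  then show ?thesis by (rule power2_le_imp_le) simp
qed

text \<open>The completion consists of the functionals that are limits, in the dual norm, of functionals
  \<open>B y\<close>.\<close>

definition approx :: "real \<Rightarrow> 'v \<Rightarrow> ('v \<Rightarrow> real) \<Rightarrow> bool" where
  "approx e y f \<longleftrightarrow> (\<forall>w. \<bar>f w - B y w\<bar> \<le> e * nB w)"

definition completion :: "('v \<Rightarrow> real) set" where
  "completion = {f. \<forall>e>0. \<exists>y. approx e y f}"

lemma approx_self: "0 \<le> e \<Longrightarrow> approx e y (B y)"
  by (simp add: approx_def)

lemma B_in_completion: "B y \<in> completion"
  by (auto simp: completion_def intro!: exI[of _ y] approx_self)

lemma approx_add: "approx e y f \<Longrightarrow> approx e' y' g \<Longrightarrow> approx (e + e') (y + y') (\<lambda>w. f w + g w)"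
  unfolding approx_def
proof (intro allI)
  fix w assume "\<forall>w. \<bar>f w - B y w\<bar> \<le> e * nB w" "\<forall>w. \<bar>g w - B y' w\<bar> \<le> e' * nB w"
  then have "\<bar>f w - B y w\<bar> \<le> e * nB w" "\<bar>g w - B y' w\<bar> \<le> e' * nB w" by auto
  then show "\<bar>f w + g w - B (y + y') w\<bar> \<le> (e + e') * nB w"
    by (simp add: B_add distrib_right)
qed

lemma approx_sc:
  assumes "approx e y f"
  shows "approx (\<bar>c\<bar> * e) (sc c y) (\<lambda>w. c * f w)"
  unfolding approx_def
proof
  fix w
  have "\<bar>c * f w - B (sc c y) w\<bar> = \<bar>c\<bar> * \<bar>f w - B y w\<bar>"
    by (simp add: B_sc flip: abs_mult right_diff_distrib)
  also have "\<dots> \<le> \<bar>c\<bar> * (e * nB w)"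
    using assms by (intro mult_left_mono) (auto simp: approx_def)
  finally show "\<bar>c * f w - B (sc c y) w\<bar> \<le> \<bar>c\<bar> * e * nB w" by simp
qed

lemma completion_add:
  assumes "f \<in> completion" "g \<in> completion"
  shows "(\<lambda>w. f w + g w) \<in> completion"
  unfolding completion_def
proof (intro CollectI allI impI)
  fix e :: real assume "e > 0"
  then have "e / 2 > 0" by simp
  then obtain y y' where "approx (e / 2) y f" "approx (e / 2) y' g"
    using assms unfolding completion_def by blast
  then show "\<exists>y. approx e y (\<lambda>w. f w + g w)" using approx_add by fastforce
qed

lemma completion_sc:
  assumes "f \<in> completion"
  shows "(\<lambda>w. c * f w) \<in> completion"
  unfolding completion_def
proof (intro CollectI allI impI)
  fix e :: real assume "e > 0"
  then have "e / (\<bar>c\<bar> + 1) > 0" by (simp add: add_nonneg_pos)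
  then obtain y where y: "approx (e / (\<bar>c\<bar> + 1)) y f" using assms by (auto simp: completion_def)
  have "\<bar>c\<bar> * (e / (\<bar>c\<bar> + 1)) \<le> e" using \<open>e > 0\<close> by (simp add: field_simps)
  then have "\<bar>c\<bar> * (e / (\<bar>c\<bar> + 1)) * nB w \<le> e * nB w" for w by (rule mult_right_mono) simp
  then show "\<exists>y. approx e y (\<lambda>w. c * f w)"
    using approx_sc[OF y, of c] unfolding approx_def by (meson order_trans)
qed

text \<open>Both approximations are evaluated at \<open>y - y'\<close> itself, which bounds its
  squared seminorm by \<open>e + e'\<close> times its seminorm.\<close>

lemma approx_diff:
  assumes "approx e y f" "approx e' y' f" "0 \<le> e" "0 \<le> e'"
  shows "nB (y - y') \<le> e + e'"
proof (cases "nB (y - y') = 0")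
  case True
  then show ?thesis using assms by simp
next
  case False
  let ?w = "y - y'"
  have "B ?w ?w = (f ?w - B y' ?w) - (f ?w - B y ?w)" by (simp add: B_minus)
  also have "\<dots> \<le> e' * nB ?w + e * nB ?w"
    using assms unfolding approx_def by (smt (verit) abs_le_iff)
  finally have "nB ?w * nB ?w \<le> (e + e') * nB ?w"
    by (simp add: nB_power2[symmetric] power2_eq_square distrib_right add.commute)
  then show ?thesis using False nB_nonneg[of ?w] by (simp add: mult_le_cancel_right)
qed

lemma nB_triangle: "nB (x + y) \<le> nB x + nB y"
proof -
  have "B (x + y) (x + y) = (nB x)\<^sup>2 + 2 * B x y + (nB y)\<^sup>2"
    by (simp add: nB_power2 B_add B_add_right B_sym[of y x])
  also have "\<dots> \<le> (nB x + nB y)\<^sup>2"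
    using Cauchy_Schwarz_B[of x y] by (simp add: power2_sum)
  finally have "(nB (x + y))\<^sup>2 \<le> (nB x + nB y)\<^sup>2" by (simp add: nB_power2)
  then show ?thesis by (rule power2_le_imp_le) simp
qed

lemma completion_diff:
  "f \<in> completion \<Longrightarrow> g \<in> completion \<Longrightarrow> (\<lambda>w. f w - g w) \<in> completion"
  using completion_add[of f "\<lambda>w. (- 1) * g w"] completion_sc[of g "- 1"] by simp

lemma approx_bound:
  assumes "approx e y f"
  shows "\<bar>f w\<bar> \<le> (e + nB y) * nB w"
proof -
  have "(e + nB y) * nB w = e * nB w + nB y * nB w" by (rule distrib_right)
  moreover have "\<bar>f w - B y w\<bar> \<le> e * nB w" using assms unfolding approx_def by blast
  ultimately show ?thesis using Cauchy_Schwarz_B[of y w] by linarith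
qed

lemma completion_bounded:
  assumes "f \<in> completion"
  obtains C where "0 \<le> C" "\<And>w. \<bar>f w\<bar> \<le> C * nB w"
proof -
  have "(0::real) < 1" by simp
  then obtain y where "approx 1 y f" using assms unfolding completion_def by blast
  then show ?thesis using that[of "1 + nB y"] approx_bound by (simp add: add_nonneg_nonneg)
qed

text \<open>Linearity is not written into \<open>completion\<close>; it is inherited from the
  functionals \<open>B z\<close>, since the defect is at most every positive
  \<open>e\<close>.\<close>

lemma completion_arg_diff:
  assumes "f \<in> completion"
  shows "f (x - y) = f x - f y"
proof -
  \<comment> \<open>The sum of the seminorms in the error estimate. Approximating to within
    \<open>e / (K + 1)\<close> makes the total error at most \<open>e\<close>, also when
    \<open>K = 0\<close>.\<close>
  define K where "K = nB (x - y) + nB x + nB y"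
  have "\<bar>f (x - y) - (f x - f y)\<bar> \<le> 0 + e" if "e > 0" for e
  proof -
    have K: "K \<ge> 0" by (simp add: K_def)
    then have "e / (K + 1) > 0" using that by simp
    then obtain z where z: "approx (e / (K + 1)) z f" using assms by (auto simp: completion_def)
    have "\<bar>f (x - y) - (f x - f y)\<bar>
        \<le> \<bar>f (x - y) - B z (x - y)\<bar> + \<bar>f x - B z x\<bar> + \<bar>f y - B z y\<bar>"
      by (simp add: B_minus_right)
    also have "\<dots> \<le> e / (K + 1) * nB (x - y) + e / (K + 1) * nB x + e / (K + 1) * nB y"
      using z unfolding approx_def by (intro add_mono) auto
    also have "\<dots> = e / (K + 1) * K" by (simp add: K_def distrib_left)
    also have "\<dots> \<le> e" using K that by (simp add: field_simps)
    finally show ?thesis by simp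
  qed
  then have "\<bar>f (x - y) - (f x - f y)\<bar> \<le> 0" by (rule field_le_epsilon)
  then show ?thesis by simp
qed

lemma completion_arg_sc:
  assumes "f \<in> completion"
  shows "f (sc c x) = c * f x"
proof -
  define K where "K = nB (sc c x) + \<bar>c\<bar> * nB x"
  have "\<bar>f (sc c x) - c * f x\<bar> \<le> 0 + e" if "e > 0" for e
  proof -
    have K: "K \<ge> 0" by (simp add: K_def)
    then have "e / (K + 1) > 0" using that by simp
    then obtain z where z: "approx (e / (K + 1)) z f" using assms by (auto simp: completion_def)
    have "\<bar>c * (f x - B z x)\<bar> \<le> \<bar>c\<bar> * (e / (K + 1) * nB x)"
      unfolding abs_mult using z unfolding approx_def by (intro mult_left_mono) auto
    moreover have "\<bar>f (sc c x) - B z (sc c x)\<bar> \<le> e / (K + 1) * nB (sc c x)"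
      using z unfolding approx_def by blast
    moreover have "f (sc c x) - c * f x = (f (sc c x) - B z (sc c x)) - c * (f x - B z x)"
      by (simp add: B_sc_right right_diff_distrib)
    ultimately have "\<bar>f (sc c x) - c * f x\<bar>
        \<le> e / (K + 1) * nB (sc c x) + \<bar>c\<bar> * (e / (K + 1) * nB x)" by linarith
    also have "\<dots> = e / (K + 1) * K"
      unfolding K_def by (simp only: distrib_left mult.left_commute[of "\<bar>c\<bar>"])
    also have "\<dots> \<le> e" using K that by (simp add: field_simps)
    finally show ?thesis by simp
  qed
  then have "\<bar>f (sc c x) - c * f x\<bar> \<le> 0" by (rule field_le_epsilon)
  then show ?thesis by simp
qed

definition representing :: "('v \<Rightarrow> real) \<Rightarrow> nat \<Rightarrow> 'v" where
  "representing f n = (SOME y. approx (1 / real (Suc n)) y f)"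

lemma representing:
  assumes "f \<in> completion"
  shows "approx (1 / real (Suc n)) (representing f n) f"
proof -
  have "\<exists>y. approx (1 / real (Suc n)) y f" using assms by (simp add: completion_def)
  then show ?thesis unfolding representing_def by (rule someI_ex)
qed

lemma inverse_Suc_tendsto: "(\<lambda>n. 1 / real (Suc n)) \<longlonglongrightarrow> 0"
  using LIMSEQ_inverse_real_of_nat by (simp add: inverse_eq_divide)

text \<open>For \<open>f = B x\<close> the inner product with \<open>g\<close> is
  \<open>g x\<close>; in general \<open>g\<close> is evaluated along approximants of
  \<open>f\<close>.\<close>

definition rip :: "('v \<Rightarrow> real) \<Rightarrow> ('v \<Rightarrow> real) \<Rightarrow> real" where
  "rip f g = lim (\<lambda>n. g (representing f n))"

text \<open>Functionals in the completion are Lipschitz for the seminorm, and approximants of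
  \<open>f\<close> are close to each other by \<open>approx_diff\<close>. So the limit exists and
  does not depend on the approximants chosen.\<close>

lemma approx_tendsto_rip:
  assumes f: "f \<in> completion" and g: "g \<in> completion"
    and X: "\<And>n. approx (e n) (X n) f" and e: "\<And>n. 0 \<le> e n" "e \<longlonglongrightarrow> 0"
  shows "(\<lambda>n. g (X n)) \<longlonglongrightarrow> rip f g"
proof -
  obtain C where C: "0 \<le> C" "\<And>w. \<bar>g w\<bar> \<le> C * nB w" using completion_bounded[OF g] by blast
  have dist: "\<bar>g y - g y'\<bar> \<le> C * (a + b)" if "approx a y f" "approx b y' f" "0 \<le> a" "0 \<le> b" for a b y y'
  proof -
    have "\<bar>g y - g y'\<bar> \<le> C * nB (y - y')" using C(2)[of "y - y'"] by (simp add: completion_arg_diff[OF g])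
    also have "\<dots> \<le> C * (a + b)" using approx_diff[OF that] C(1) by (rule mult_left_mono)
    finally show ?thesis .
  qed
  let ?a = "\<lambda>n. g (representing f n)"
  have "Cauchy ?a"
  proof (rule metric_CauchyI)
    fix d :: real assume "d > 0"
    have "(\<lambda>n. C * (1 / real (Suc n))) \<longlonglongrightarrow> C * 0" by (intro tendsto_intros inverse_Suc_tendsto)
    then have "eventually (\<lambda>n. C * (1 / real (Suc n)) < d / 2) sequentially"
      using \<open>d > 0\<close> by (intro order_tendstoD(2)) auto
    then obtain N where N: "\<And>n. n \<ge> N \<Longrightarrow> C * (1 / real (Suc n)) < d / 2"
      unfolding eventually_sequentially by blast
    have "dist (?a m) (?a n) < d" if "m \<ge> N" "n \<ge> N" for m n
    proof -
      have "\<bar>?a m - ?a n\<bar> \<le> C * (1 / real (Suc m) + 1 / real (Suc n))"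
        by (intro dist representing[OF f]) auto
      then show ?thesis using N[OF that(1)] N[OF that(2)] unfolding dist_real_def distrib_left by linarith
    qed
    then show "\<exists>M. \<forall>m\<ge>M. \<forall>n\<ge>M. dist (?a m) (?a n) < d" by blast
  qed
  then have lim: "?a \<longlonglongrightarrow> rip f g"
    unfolding rip_def by (simp add: Cauchy_convergent_iff convergent_LIMSEQ_iff)
  have "(\<lambda>n. g (X n) - ?a n) \<longlonglongrightarrow> 0"
  proof (rule Lim_null_comparison)
    show "eventually (\<lambda>n. norm (g (X n) - ?a n) \<le> C * (e n + 1 / real (Suc n))) sequentially"
      using dist[OF X representing[OF f] e(1)] by (intro always_eventually) auto
    have "(\<lambda>n. C * (e n + 1 / real (Suc n))) \<longlonglongrightarrow> C * (0 + 0)"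
      by (intro tendsto_intros inverse_Suc_tendsto e)
    then show "(\<lambda>n. C * (e n + 1 / real (Suc n))) \<longlonglongrightarrow> 0" by simp
  qed
  from tendsto_add[OF this lim] show ?thesis by simp
qed

lemma representing_tendsto_rip:
  assumes "f \<in> completion" "g \<in> completion"
  shows "(\<lambda>n. g (representing f n)) \<longlonglongrightarrow> rip f g"
  by (rule approx_tendsto_rip[OF assms representing[OF assms(1)] _ inverse_Suc_tendsto]) simp

lemma representing_bounded:
  assumes "f \<in> completion"
  obtains K where "0 \<le> K" "\<And>n. nB (representing f n) \<le> K"
proof
  show "0 \<le> nB (representing f 0) + 2" by (simp add: add_nonneg_nonneg)
  fix n
  have "nB (representing f n - representing f 0) \<le> 1 / real (Suc n) + 1 / real (Suc 0)"
    by (intro approx_diff[of _ _ f] representing assms) auto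
  also have "\<dots> \<le> 2" by simp
  finally show "nB (representing f n) \<le> nB (representing f 0) + 2"
    using nB_triangle[of "representing f n - representing f 0" "representing f 0"] by simp
qed

lemma rip_B: "g \<in> completion \<Longrightarrow> rip (B x) g = g x"
  using approx_tendsto_rip[OF B_in_completion, of g "\<lambda>_. 0" "\<lambda>_. x" x] approx_self[of 0 x]
  by (simp add: LIMSEQ_const_iff)

text \<open>With approximants \<open>x\<close> of \<open>f\<close> and \<open>y\<close> of
  \<open>g\<close>, both \<open>g x\<close> and \<open>f y\<close> differ from \<open>B x y\<close>
  by a vanishing amount.\<close>

lemma rip_sym:
  assumes f: "f \<in> completion" and g: "g \<in> completion"
  shows "rip f g = rip g f"
proof -
  obtain K where K: "0 \<le> K" "\<And>n. nB (representing f n) \<le> K" using representing_bounded[OF f] by blast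
  obtain L where L: "0 \<le> L" "\<And>n. nB (representing g n) \<le> L" using representing_bounded[OF g] by blast
  have "(\<lambda>n. g (representing f n) - f (representing g n)) \<longlonglongrightarrow> 0"
  proof (rule Lim_null_comparison)
    have "\<bar>g (representing f n) - f (representing g n)\<bar> \<le> 1 / real (Suc n) * (K + L)" for n
    proof -
      let ?x = "representing f n" and ?y = "representing g n"
      have "\<bar>g ?x - B ?y ?x\<bar> \<le> 1 / real (Suc n) * nB ?x" "\<bar>f ?y - B ?x ?y\<bar> \<le> 1 / real (Suc n) * nB ?y"
        using representing[OF f] representing[OF g] unfolding approx_def by blast+
      moreover have "1 / real (Suc n) * nB ?x \<le> 1 / real (Suc n) * K"
        "1 / real (Suc n) * nB ?y \<le> 1 / real (Suc n) * L"
        using K L by (intro mult_left_mono; simp)+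
      ultimately show ?thesis unfolding distrib_left using B_sym[of ?x ?y] by linarith
    qed
    then show "eventually (\<lambda>n. norm (g (representing f n) - f (representing g n))
        \<le> 1 / real (Suc n) * (K + L)) sequentially"
      by (intro always_eventually) auto
    show "(\<lambda>n. 1 / real (Suc n) * (K + L)) \<longlonglongrightarrow> 0"
      using tendsto_mult_left_zero[OF inverse_Suc_tendsto, of "K + L"] .
  qed
  moreover have "(\<lambda>n. g (representing f n) - f (representing g n)) \<longlonglongrightarrow> rip f g - rip g f"
    by (intro tendsto_diff representing_tendsto_rip f g)
  ultimately show ?thesis using LIMSEQ_unique by fastforce
qed

lemma rip_add_right:
  assumes "f \<in> completion" "g \<in> completion" "h \<in> completion"
  shows "rip f (\<lambda>w. g w + h w) = rip f g + rip f h"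
  using LIMSEQ_unique[OF representing_tendsto_rip[OF assms(1) completion_add[OF assms(2,3)]]
    tendsto_add[OF representing_tendsto_rip[OF assms(1,2)] representing_tendsto_rip[OF assms(1,3)]]] .

lemma rip_sc_right:
  assumes "f \<in> completion" "g \<in> completion"
  shows "rip f (\<lambda>w. c * g w) = c * rip f g"
  using LIMSEQ_unique[OF representing_tendsto_rip[OF assms(1) completion_sc[OF assms(2)]]
    tendsto_mult_left[OF representing_tendsto_rip[OF assms(1,2)]]] .

lemma rip_diff_right:
  assumes "f \<in> completion" "g \<in> completion" "h \<in> completion"
  shows "rip f (\<lambda>w. g w - h w) = rip f g - rip f h"
  using LIMSEQ_unique[OF representing_tendsto_rip[OF assms(1) completion_diff[OF assms(2,3)]]
    tendsto_diff[OF representing_tendsto_rip[OF assms(1,2)] representing_tendsto_rip[OF assms(1,3)]]] .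

lemma rip_add_left:
  assumes "f \<in> completion" "g \<in> completion" "h \<in> completion"
  shows "rip (\<lambda>w. g w + h w) f = rip g f + rip h f"
  using rip_add_right[OF assms] assms by (simp add: rip_sym completion_add)

lemma rip_sc_left:
  assumes "f \<in> completion" "g \<in> completion"
  shows "rip (\<lambda>w. c * g w) f = c * rip g f"
  using rip_sc_right[OF assms] assms by (simp add: rip_sym completion_sc)

lemma rip_diff_left:
  assumes "f \<in> completion" "g \<in> completion" "h \<in> completion"
  shows "rip (\<lambda>w. g w - h w) f = rip g f - rip h f"
  using rip_diff_right[OF assms] assms by (simp add: rip_sym completion_diff)

lemma nB_representing_tendsto:
  assumes f: "f \<in> completion"
  shows "(\<lambda>n. (nB (representing f n))\<^sup>2) \<longlonglongrightarrow> rip f f"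
proof -
  obtain K where K: "0 \<le> K" "\<And>n. nB (representing f n) \<le> K" using representing_bounded[OF f] by blast
  have "(\<lambda>n. (nB (representing f n))\<^sup>2 - f (representing f n)) \<longlonglongrightarrow> 0"
  proof (rule Lim_null_comparison)
    have "\<bar>(nB (representing f n))\<^sup>2 - f (representing f n)\<bar> \<le> 1 / real (Suc n) * K" for n
    proof -
      have "\<bar>f (representing f n) - B (representing f n) (representing f n)\<bar>
          \<le> 1 / real (Suc n) * nB (representing f n)"
        using representing[OF f] unfolding approx_def by blast
      also have "\<dots> \<le> 1 / real (Suc n) * K" using K by (intro mult_left_mono) auto
      finally show ?thesis by (simp add: nB_power2 abs_minus_commute)
    qed
    then show "eventually (\<lambda>n. norm ((nB (representing f n))\<^sup>2 - f (representing f n))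
        \<le> 1 / real (Suc n) * K) sequentially"
      by (intro always_eventually) auto
    show "(\<lambda>n. 1 / real (Suc n) * K) \<longlonglongrightarrow> 0"
      using tendsto_mult_left_zero[OF inverse_Suc_tendsto, of K] .
  qed
  from tendsto_add[OF this representing_tendsto_rip[OF f f]] show ?thesis by simp
qed

lemma rip_nonneg: "f \<in> completion \<Longrightarrow> 0 \<le> rip f f"
  by (rule LIMSEQ_le_const[OF nB_representing_tendsto]) auto

lemma nB_representing_tendsto_sqrt:
  assumes f: "f \<in> completion"
  shows "(\<lambda>n. nB (representing f n)) \<longlonglongrightarrow> sqrt (rip f f)"
  using tendsto_real_sqrt[OF nB_representing_tendsto[OF f]] by simp

lemma abs_le_rip:
  assumes f: "f \<in> completion"
  shows "\<bar>f w\<bar> \<le> sqrt (rip f f) * nB w"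
proof -
  have "(\<lambda>n. B (representing f n) w - f w) \<longlonglongrightarrow> 0"
  proof (rule Lim_null_comparison)
    show "eventually (\<lambda>n. norm (B (representing f n) w - f w) \<le> 1 / real (Suc n) * nB w) sequentially"
      using representing[OF f] unfolding approx_def
      by (intro always_eventually) (auto simp: abs_minus_commute)
    show "(\<lambda>n. 1 / real (Suc n) * nB w) \<longlonglongrightarrow> 0"
      using tendsto_mult_left_zero[OF inverse_Suc_tendsto, of "nB w"] .
  qed
  from tendsto_add[OF this tendsto_const[of "f w"]]
  have "(\<lambda>n. B (representing f n) w) \<longlonglongrightarrow> f w" by simp
  then have "(\<lambda>n. \<bar>B (representing f n) w\<bar>) \<longlonglongrightarrow> \<bar>f w\<bar>" by (rule tendsto_rabs)
  then show ?thesis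
    by (rule LIMSEQ_le[OF _ tendsto_mult_right[OF nB_representing_tendsto_sqrt[OF f]]])
      (auto intro: Cauchy_Schwarz_B)
qed

lemma rip_definite: "f \<in> completion \<Longrightarrow> rip f f = 0 \<Longrightarrow> f w = 0"
  using abs_le_rip[of f w] by simp

text \<open>Converse of \<open>abs_le_rip\<close>: together they identify the norm of
  \<open>rip\<close> with the dual norm, so that convergence can be treated by pointwise
  estimates.\<close>

lemma rip_le:
  assumes g: "g \<in> completion" and e: "\<And>w. \<bar>g w\<bar> \<le> e * nB w" "0 \<le> e"
  shows "rip g g \<le> e\<^sup>2"
proof -
  have "rip g g \<le> e * sqrt (rip g g)"
    by (rule LIMSEQ_le[OF representing_tendsto_rip[OF g g] tendsto_mult_left[OF nB_representing_tendsto_sqrt[OF g]]])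
      (use e(1) abs_ge_self order_trans in blast)
  then have le: "sqrt (rip g g) * sqrt (rip g g) \<le> e * sqrt (rip g g)"
    using rip_nonneg[OF g] by simp
  have "sqrt (rip g g) \<le> e"
  proof (cases "rip g g = 0")
    case False
    then have "0 < sqrt (rip g g)" using rip_nonneg[OF g] by simp
    with le show ?thesis by (rule mult_right_le_imp_le)
  qed (use e(2) in simp)
  then have "(sqrt (rip g g))\<^sup>2 \<le> e\<^sup>2" using rip_nonneg[OF g] by (intro power_mono) auto
  then show ?thesis using rip_nonneg[OF g] by simp
qed

text \<open>The limit is taken pointwise. The estimates are uniform relative to \<open>nB\<close>,
  so the limit is again approximated by functionals \<open>B y\<close>, and convergence holds in
  norm.\<close>

lemma completion_complete:
  assumes X: "\<And>i::nat. X i \<in> completion"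
    and Cau: "\<And>e. 0 < e \<Longrightarrow> \<exists>N. \<forall>i\<ge>N. \<forall>j\<ge>N. rip (\<lambda>w. X i w - X j w) (\<lambda>w. X i w - X j w) < e\<^sup>2"
  obtains f where "f \<in> completion" "(\<lambda>i. rip (\<lambda>w. X i w - f w) (\<lambda>w. X i w - f w)) \<longlonglongrightarrow> 0"
proof -
  have close: "\<exists>N. \<forall>i\<ge>N. \<forall>j\<ge>N. \<forall>w. \<bar>X i w - X j w\<bar> \<le> e * nB w" if e: "e > 0" for e
  proof -
    obtain N where N: "\<forall>i\<ge>N. \<forall>j\<ge>N. rip (\<lambda>w. X i w - X j w) (\<lambda>w. X i w - X j w) < e\<^sup>2"
      using Cau[OF e] by blast
    have "\<bar>X i w - X j w\<bar> \<le> e * nB w" if "i \<ge> N" "j \<ge> N" for i j w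
    proof -
      have c: "(\<lambda>w. X i w - X j w) \<in> completion" by (intro completion_diff X)
      have "sqrt (rip (\<lambda>w. X i w - X j w) (\<lambda>w. X i w - X j w)) \<le> e"
        using N that e rip_nonneg[OF c] by (intro real_le_lsqrt) (auto intro: less_imp_le)
      then have "sqrt (rip (\<lambda>w. X i w - X j w) (\<lambda>w. X i w - X j w)) * nB w \<le> e * nB w"
        by (rule mult_right_mono) simp
      then show ?thesis using abs_le_rip[OF c, of w] by linarith
    qed
    then show ?thesis by blast
  qed
  have "Cauchy (\<lambda>i. X i w)" for w
  proof (rule metric_CauchyI)
    fix d :: real assume "d > 0"
    have pos: "nB w + 1 > 0" by (simp add: add_nonneg_pos)
    then have "d / (nB w + 1) > 0" using \<open>d > 0\<close> by simp
    from close[OF this] obtain N where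
      N: "\<And>i j. i \<ge> N \<Longrightarrow> j \<ge> N \<Longrightarrow> \<bar>X i w - X j w\<bar> \<le> d / (nB w + 1) * nB w"
      by blast
    have "d / (nB w + 1) * nB w < d" using \<open>d > 0\<close> pos by (simp add: field_simps)
    then have "dist (X i w) (X j w) < d" if "i \<ge> N" "j \<ge> N" for i j
      using N[OF that] by (simp add: dist_real_def)
    then show "\<exists>M. \<forall>m\<ge>M. \<forall>n\<ge>M. dist (X m w) (X n w) < d" by blast
  qed
  then have "\<exists>l. (\<lambda>i. X i w) \<longlonglongrightarrow> l" for w by (simp add: Cauchy_convergent_iff convergent_def)
  then obtain f where f: "\<And>w. (\<lambda>i. X i w) \<longlonglongrightarrow> f w" by metis
  have closef: "\<exists>N. \<forall>i\<ge>N. \<forall>w. \<bar>X i w - f w\<bar> \<le> e * nB w" if e: "e > 0" for e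
  proof -
    obtain N where N: "\<forall>i\<ge>N. \<forall>j\<ge>N. \<forall>w. \<bar>X i w - X j w\<bar> \<le> e * nB w" using close[OF e] by blast
    have "\<bar>X i w - f w\<bar> \<le> e * nB w" if "i \<ge> N" for i w
    proof (rule LIMSEQ_le_const2)
      show "(\<lambda>j. \<bar>X i w - X j w\<bar>) \<longlonglongrightarrow> \<bar>X i w - f w\<bar>" by (intro tendsto_intros f)
      show "\<exists>N. \<forall>n\<ge>N. \<bar>X i w - X n w\<bar> \<le> e * nB w" using N that by blast
    qed
    then show ?thesis by blast
  qed
  have fc: "f \<in> completion"
    unfolding completion_def
  proof (intro CollectI allI impI)
    fix e :: real assume "e > 0"
    then have e2: "e / 2 > 0" by simp
    obtain i where i: "\<And>w. \<bar>X i w - f w\<bar> \<le> e / 2 * nB w" using closef[OF e2] by blast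
    obtain y where y: "approx (e / 2) y (X i)" using X[of i] e2 unfolding completion_def by blast
    have "\<bar>f w - B y w\<bar> \<le> e * nB w" for w
    proof -
      have "\<bar>X i w - B y w\<bar> \<le> e / 2 * nB w" using y unfolding approx_def by blast
      then show ?thesis using i[of w] by linarith
    qed
    then show "\<exists>y. approx e y f" unfolding approx_def by blast
  qed
  have "(\<lambda>i. rip (\<lambda>w. X i w - f w) (\<lambda>w. X i w - f w)) \<longlonglongrightarrow> 0"
  proof (rule LIMSEQ_I)
    fix r :: real assume "r > 0"
    then have r: "sqrt (r / 2) > 0" by simp
    obtain N where N: "\<And>i w. i \<ge> N \<Longrightarrow> \<bar>X i w - f w\<bar> \<le> sqrt (r / 2) * nB w" using closef[OF r] by blast
    have "norm (rip (\<lambda>w. X i w - f w) (\<lambda>w. X i w - f w) - 0) < r" if "i \<ge> N" for i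
    proof -
      have c: "(\<lambda>w. X i w - f w) \<in> completion" by (intro completion_diff X fc)
      have "rip (\<lambda>w. X i w - f w) (\<lambda>w. X i w - f w) \<le> (sqrt (r / 2))\<^sup>2"
        by (rule rip_le[OF c N[OF that]]) (use \<open>r > 0\<close> in simp)
      then show ?thesis using rip_nonneg[OF c] \<open>r > 0\<close> by simp
    qed
    then show "\<exists>no. \<forall>n\<ge>no. norm (rip (\<lambda>w. X n w - f w) (\<lambda>w. X n w - f w) - 0) < r" by blast
  qed
  then show ?thesis using that fc by blast
qed

end

section \<open>Complexification of the completion\<close>

context semi_inner_product
begin

lemma completion_zero: "(\<lambda>w. 0) \<in> completion"
  using completion_sc[OF B_in_completion[of 0], of 0] by simp

lemma rip_zero_left: "f \<in> completion \<Longrightarrow> rip (\<lambda>w. 0) f = 0"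
  using rip_sc_left[of f "\<lambda>w. 0" 0] completion_zero by simp

lemma rip_zero_right: "f \<in> completion \<Longrightarrow> rip f (\<lambda>w. 0) = 0"
  using rip_sc_right[of f "\<lambda>w. 0" 0] completion_zero by simp

text \<open>A complex functional represents the element of the complexified completion whose real and
  imaginary parts it consists of.\<close>

definition ccompletion :: "('v \<Rightarrow> complex) set" where
  "ccompletion = {f. (\<lambda>w. Re (f w)) \<in> completion \<and> (\<lambda>w. Im (f w)) \<in> completion}"

text \<open>The sesquilinear extension of \<open>rip\<close> to functionals with real and imaginary
  parts, linear in the first argument.\<close>

definition hip :: "('v \<Rightarrow> complex) \<Rightarrow> ('v \<Rightarrow> complex) \<Rightarrow> complex" where
  "hip f g = Complex
     (rip (\<lambda>w. Re (f w)) (\<lambda>w. Re (g w)) + rip (\<lambda>w. Im (f w)) (\<lambda>w. Im (g w)))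
     (rip (\<lambda>w. Im (f w)) (\<lambda>w. Re (g w)) - rip (\<lambda>w. Re (f w)) (\<lambda>w. Im (g w)))"

lemma ccompletionD:
  "f \<in> ccompletion \<Longrightarrow> (\<lambda>w. Re (f w)) \<in> completion"
  "f \<in> ccompletion \<Longrightarrow> (\<lambda>w. Im (f w)) \<in> completion"
  by (auto simp: ccompletion_def)

lemma ccompletion_zero: "(\<lambda>w. 0) \<in> ccompletion"
  by (simp add: ccompletion_def completion_zero)

lemma ccompletion_add: "f \<in> ccompletion \<Longrightarrow> g \<in> ccompletion \<Longrightarrow> (\<lambda>w. f w + g w) \<in> ccompletion"
  by (simp add: ccompletion_def completion_add)

lemma ccompletion_diff: "f \<in> ccompletion \<Longrightarrow> g \<in> ccompletion \<Longrightarrow> (\<lambda>w. f w - g w) \<in> ccompletion"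
  by (simp add: ccompletion_def completion_diff)

lemma ccompletion_sc: "f \<in> ccompletion \<Longrightarrow> (\<lambda>w. c * f w) \<in> ccompletion"
  by (simp add: ccompletion_def completion_add completion_diff completion_sc)

lemma hip_commute: "f \<in> ccompletion \<Longrightarrow> g \<in> ccompletion \<Longrightarrow> hip f g = cnj (hip g f)"
  by (simp add: hip_def complex_eq_iff rip_sym ccompletionD)

lemma hip_add:
  "f \<in> ccompletion \<Longrightarrow> g \<in> ccompletion \<Longrightarrow> h \<in> ccompletion \<Longrightarrow>
    hip (\<lambda>w. f w + g w) h = hip f h + hip g h"
  by (simp add: hip_def complex_eq_iff rip_add_left ccompletionD)

lemma hip_sc:
  assumes "f \<in> ccompletion" "g \<in> ccompletion"
  shows "hip (\<lambda>w. c * f w) g = c * hip f g"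
  using ccompletionD[OF assms(1)] ccompletionD[OF assms(2)]
  by (simp add: hip_def complex_eq_iff rip_add_left rip_diff_left rip_sc_left completion_sc
      algebra_simps)

lemma Re_hip_self: "Re (hip f f) = rip (\<lambda>w. Re (f w)) (\<lambda>w. Re (f w)) + rip (\<lambda>w. Im (f w)) (\<lambda>w. Im (f w))"
  by (simp add: hip_def)

lemma hip_nonneg: "f \<in> ccompletion \<Longrightarrow> 0 \<le> Re (hip f f)"
  by (simp add: Re_hip_self rip_nonneg ccompletionD)

lemma hip_definite:
  assumes "f \<in> ccompletion" "hip f f = 0"
  shows "f = (\<lambda>w. 0)"
proof -
  have "rip (\<lambda>w. Re (f w)) (\<lambda>w. Re (f w)) + rip (\<lambda>w. Im (f w)) (\<lambda>w. Im (f w)) = 0"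
    using assms(2) Re_hip_self[of f] by simp
  then have "rip (\<lambda>w. Re (f w)) (\<lambda>w. Re (f w)) = 0" "rip (\<lambda>w. Im (f w)) (\<lambda>w. Im (f w)) = 0"
    using rip_nonneg[OF ccompletionD(1)[OF assms(1)]] rip_nonneg[OF ccompletionD(2)[OF assms(1)]]
    by linarith+
  then have "Re (f w) = 0" "Im (f w) = 0" for w
    using rip_definite[OF ccompletionD(1)[OF assms(1)], of w]
      rip_definite[OF ccompletionD(2)[OF assms(1)], of w] by auto
  then show ?thesis by (auto simp: complex_eq_iff)
qed

lemma ccompletion_complete:
  assumes X: "\<And>i::nat. X i \<in> ccompletion"
    and Cau: "\<And>e. 0 < e \<Longrightarrow> \<exists>N. \<forall>i\<ge>N. \<forall>j\<ge>N. Re (hip (\<lambda>w. X i w - X j w) (\<lambda>w. X i w - X j w)) < e\<^sup>2"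
  obtains f where "f \<in> ccompletion" "(\<lambda>i. Re (hip (\<lambda>w. X i w - f w) (\<lambda>w. X i w - f w))) \<longlonglongrightarrow> 0"
proof -
  have re: "\<And>i. (\<lambda>w. Re (X i w)) \<in> completion" and im: "\<And>i. (\<lambda>w. Im (X i w)) \<in> completion"
    using ccompletionD X by auto
  have nn: "0 \<le> rip (\<lambda>w. Re (X i w) - Re (X j w)) (\<lambda>w. Re (X i w) - Re (X j w))"
    "0 \<le> rip (\<lambda>w. Im (X i w) - Im (X j w)) (\<lambda>w. Im (X i w) - Im (X j w))" for i j
    using rip_nonneg completion_diff re im by blast+
  obtain a where a: "a \<in> completion"
    "(\<lambda>i. rip (\<lambda>w. Re (X i w) - a w) (\<lambda>w. Re (X i w) - a w)) \<longlonglongrightarrow> 0"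
  proof (rule completion_complete[OF re])
    fix e :: real assume "0 < e"
    from Cau[OF this] obtain N where
      "\<forall>i\<ge>N. \<forall>j\<ge>N. Re (hip (\<lambda>w. X i w - X j w) (\<lambda>w. X i w - X j w)) < e\<^sup>2" by blast
    then show "\<exists>N. \<forall>i\<ge>N. \<forall>j\<ge>N. rip (\<lambda>w. Re (X i w) - Re (X j w)) (\<lambda>w. Re (X i w) - Re (X j w)) < e\<^sup>2"
      unfolding Re_hip_self minus_complex.simps using nn by (smt (verit))
  qed
  obtain b where b: "b \<in> completion"
    "(\<lambda>i. rip (\<lambda>w. Im (X i w) - b w) (\<lambda>w. Im (X i w) - b w)) \<longlonglongrightarrow> 0"
  proof (rule completion_complete[OF im])
    fix e :: real assume "0 < e"
    from Cau[OF this] obtain N where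
      "\<forall>i\<ge>N. \<forall>j\<ge>N. Re (hip (\<lambda>w. X i w - X j w) (\<lambda>w. X i w - X j w)) < e\<^sup>2" by blast
    then show "\<exists>N. \<forall>i\<ge>N. \<forall>j\<ge>N. rip (\<lambda>w. Im (X i w) - Im (X j w)) (\<lambda>w. Im (X i w) - Im (X j w)) < e\<^sup>2"
      unfolding Re_hip_self minus_complex.simps using nn by (smt (verit))
  qed
  show ?thesis
  proof (rule that[of "\<lambda>w. Complex (a w) (b w)"])
    show "(\<lambda>w. Complex (a w) (b w)) \<in> ccompletion" using a b by (simp add: ccompletion_def)
    show "(\<lambda>i. Re (hip (\<lambda>w. X i w - Complex (a w) (b w)) (\<lambda>w. X i w - Complex (a w) (b w)))) \<longlonglongrightarrow> 0"
      using tendsto_add[OF a(2) b(2)] by (simp add: Re_hip_self)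
  qed
qed

end

text \<open>Transports the completion along an injection into \<open>'h\<close>, since the
  representations to be tested live on subsets of a fixed type.\<close>

locale embedded_completion = semi_inner_product sc B
  for sc :: "real \<Rightarrow> 'v::ab_group_add \<Rightarrow> 'v" and B +
  fixes \<iota> :: "('v \<Rightarrow> complex) \<Rightarrow> 'h"
  assumes inj: "inj_on \<iota> ccompletion"
begin

definition \<delta> :: "'h \<Rightarrow> 'v \<Rightarrow> complex" where "\<delta> = the_inv_into ccompletion \<iota>"

definition space :: "'h hilbert" where
  "space = \<lparr>carrier = \<iota> ` ccompletion, mult = undefined, one = undefined,
     ring.zero = \<iota> (\<lambda>w. 0), add = (\<lambda>x y. \<iota> (\<lambda>w. \<delta> x w + \<delta> y w)),
     smult = (\<lambda>c x. \<iota> (\<lambda>w. c * \<delta> x w)), ip = (\<lambda>x y. hip (\<delta> x) (\<delta> y))\<rparr>"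

lemma \<delta>_\<iota> [simp]: "f \<in> ccompletion \<Longrightarrow> \<delta> (\<iota> f) = f"
  unfolding \<delta>_def by (rule the_inv_into_f_f[OF inj])

lemma carrier_space: "carrier space = \<iota> ` ccompletion"
  by (simp add: space_def)

lemma space_simps:
  "f \<in> ccompletion \<Longrightarrow> \<iota> f \<in> carrier space"
  "\<zero>\<^bsub>space\<^esub> = \<iota> (\<lambda>w. 0)"
  "f \<in> ccompletion \<Longrightarrow> g \<in> ccompletion \<Longrightarrow> \<iota> f \<oplus>\<^bsub>space\<^esub> \<iota> g = \<iota> (\<lambda>w. f w + g w)"
  "f \<in> ccompletion \<Longrightarrow> c \<odot>\<^bsub>space\<^esub> \<iota> f = \<iota> (\<lambda>w. c * f w)"
  "f \<in> ccompletion \<Longrightarrow> g \<in> ccompletion \<Longrightarrow> ip space (\<iota> f) (\<iota> g) = hip f g"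
  by (simp_all add: space_def)

lemmas ccompletion_closed = ccompletion_zero ccompletion_add ccompletion_sc

lemma pre_hilbert_space_space: "pre_hilbert_space space"
proof -
  have "module class_ring space"
  proof (rule module_criteria, goal_cases)
    case 1
    then show ?case
      using class_field.field_axioms[where ?'a = complex] by (simp add: field_def domain_def)
  next
    case 4
    show ?case
    proof
      fix v assume "v \<in> carrier space"
      then obtain f where f: "f \<in> ccompletion" "v = \<iota> f" by (auto simp: carrier_space)
      then have "v \<oplus>\<^bsub>space\<^esub> \<iota> (\<lambda>w. - 1 * f w) = \<zero>\<^bsub>space\<^esub>"
        using ccompletion_sc[OF f(1), of "- 1"] by (simp add: space_simps)
      then show "\<exists>w\<in>carrier space. v \<oplus>\<^bsub>space\<^esub> w = \<zero>\<^bsub>space\<^esub>"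
        using ccompletion_sc[OF f(1), of "- 1"] space_simps(1) by blast
    qed
  qed (auto simp: carrier_space space_simps ccompletion_closed algebra_simps)
  then have "vectorspace class_ring space"
    by (simp add: vectorspace_def class_field.field_axioms)
  moreover have "pre_hilbert_space_axioms space"
  proof (unfold_locales, goal_cases)
    case (1 x y)
    then show ?case by (auto simp: carrier_space space_simps intro: hip_commute)
  next
    case (5 x)
    then show ?case by (auto simp: carrier_space space_simps dest: hip_definite)
  qed (auto simp: carrier_space space_simps ccompletion_closed hip_add hip_sc hip_nonneg)
  ultimately show ?thesis by (simp add: pre_hilbert_space_def)
qed

lemma hdist_space:
  assumes "f \<in> ccompletion" "g \<in> ccompletion"
  shows "hdist space (\<iota> f) (\<iota> g) = sqrt (Re (hip (\<lambda>w. f w - g w) (\<lambda>w. f w - g w)))"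
proof -
  interpret S: pre_hilbert_space "space" by (rule pre_hilbert_space_space)
  have d: "(\<lambda>w. f w - g w) \<in> ccompletion" using assms by (rule ccompletion_diff)
  have "\<iota> f = \<iota> (\<lambda>w. f w - g w) \<oplus>\<^bsub>space\<^esub> \<iota> g" using d assms by (simp add: space_simps)
  then have "\<iota> f \<ominus>\<^bsub>space\<^esub> \<iota> g = \<iota> (\<lambda>w. f w - g w)"
    using space_simps(1)[OF d] space_simps(1)[OF assms(2)]
    by (simp add: a_minus_def S.M.a_assoc S.M.r_neg)
  then show ?thesis using d by (simp add: hdist_def space_simps)
qed

lemma hilbert_space_space: "hilbert_space space"
proof (rule hilbert_spaceI[OF pre_hilbert_space_space])
  fix X :: "nat \<Rightarrow> 'h"
  assume X: "\<And>i. X i \<in> carrier space"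
    and Cau: "\<And>e. 0 < e \<Longrightarrow> \<exists>N. \<forall>i\<ge>N. \<forall>j\<ge>N. hdist space (X i) (X j) < e"
  have "\<forall>i. \<exists>f\<in>ccompletion. X i = \<iota> f" using X by (auto simp: carrier_space)
  then obtain F where F: "\<And>i. F i \<in> ccompletion" "\<And>i. X i = \<iota> (F i)" by metis
  obtain f where f: "f \<in> ccompletion" "(\<lambda>i. Re (hip (\<lambda>w. F i w - f w) (\<lambda>w. F i w - f w))) \<longlonglongrightarrow> 0"
  proof (rule ccompletion_complete[OF F(1)])
    fix e :: real assume e: "0 < e"
    from Cau[OF e] obtain N where N: "\<And>i j. i \<ge> N \<Longrightarrow> j \<ge> N \<Longrightarrow> hdist space (X i) (X j) < e" by blast
    have "Re (hip (\<lambda>w. F i w - F j w) (\<lambda>w. F i w - F j w)) < e\<^sup>2" if "i \<ge> N" "j \<ge> N" for i j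
    proof -
      have nn: "0 \<le> Re (hip (\<lambda>w. F i w - F j w) (\<lambda>w. F i w - F j w))"
        by (rule hip_nonneg[OF ccompletion_diff[OF F(1) F(1)]])
      have "sqrt (Re (hip (\<lambda>w. F i w - F j w) (\<lambda>w. F i w - F j w))) < e"
        using N[OF that] by (simp add: F hdist_space)
      then have "(sqrt (Re (hip (\<lambda>w. F i w - F j w) (\<lambda>w. F i w - F j w))))\<^sup>2 < e\<^sup>2"
        using nn by (intro power_strict_mono) auto
      then show ?thesis using nn by simp
    qed
    then show "\<exists>N. \<forall>i\<ge>N. \<forall>j\<ge>N. Re (hip (\<lambda>w. F i w - F j w) (\<lambda>w. F i w - F j w)) < e\<^sup>2" by blast
  qed
  have "(\<lambda>i. hdist space (X i) (\<iota> f)) \<longlonglongrightarrow> 0"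
    using tendsto_real_sqrt[OF f(2)] by (simp add: F f(1) hdist_space)
  then show "\<exists>l\<in>carrier space. (\<lambda>i. hdist space (X i) l) \<longlonglongrightarrow> 0"
    using space_simps(1)[OF f(1)] by blast
qed

definition embed :: "'v \<Rightarrow> 'h" where "embed x = \<iota> (\<lambda>w. complex_of_real (B x w))"

lemma of_real_B: "(\<lambda>w. complex_of_real (B x w)) \<in> ccompletion"
  by (simp add: ccompletion_def completion_zero B_in_completion)

lemma embed_closed: "embed x \<in> carrier space"
  unfolding embed_def by (rule space_simps(1)[OF of_real_B])

lemma ip_embed: "ip space (embed x) (embed y) = complex_of_real (B x y)"
  by (simp add: embed_def space_simps of_real_B hip_def rip_B[OF B_in_completion] B_sym[of y x]
      rip_zero_left rip_zero_right completion_zero B_in_completion complex_eq_iff)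

lemma embed_add: "embed (x + y) = embed x \<oplus>\<^bsub>space\<^esub> embed y"
  by (simp add: embed_def space_simps of_real_B B_add)

lemma embed_sc: "embed (sc c x) = complex_of_real c \<odot>\<^bsub>space\<^esub> embed x"
  by (simp add: embed_def space_simps of_real_B B_sc)

section \<open>Extension of an isometric action to the completion\<close>

context
  fixes U :: "'g::group_add \<Rightarrow> 'v \<Rightarrow> 'v"
  assumes U0: "\<And>x. U 0 x = x" and U_add: "\<And>g h x. U (g + h) x = U g (U h x)"
    and U_iso: "\<And>g x y. B (U g x) (U g y) = B x y"
begin

lemma U_cancel: "U g (U (- g) x) = x" "U (- g) (U g x) = x"
  using U_add[of g "- g" x] U_add[of "- g" g x] by (auto simp: U0)

lemma B_U: "B (U g x) w = B x (U (- g) w)"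
  using U_iso[of g x "U (- g) w"] by (simp add: U_cancel)

lemma approx_shift: "approx e y f \<Longrightarrow> approx e (U g y) (\<lambda>w. f (U (- g) w))"
  unfolding approx_def B_U nB_def using U_iso[of "- g"] by metis

lemma completion_shift: "f \<in> completion \<Longrightarrow> (\<lambda>w. f (U (- g) w)) \<in> completion"
  unfolding completion_def using approx_shift by blast

text \<open>The isometry \<open>U g\<close> carries approximants of \<open>f\<close> to approximants
  of the shifted functional, on which the shift of \<open>h\<close> takes the same values.\<close>

lemma rip_shift:
  assumes f: "f \<in> completion" and h: "h \<in> completion"
  shows "rip (\<lambda>w. f (U (- g) w)) (\<lambda>w. h (U (- g) w)) = rip f h"
proof -
  have "(\<lambda>n. h (U (- g) (U g (representing f n)))) \<longlonglongrightarrow> rip (\<lambda>w. f (U (- g) w)) (\<lambda>w. h (U (- g) w))"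
    by (rule approx_tendsto_rip[OF completion_shift[OF f] completion_shift[OF h]
          approx_shift[OF representing[OF f]] _ inverse_Suc_tendsto]) simp
  then show ?thesis
    using LIMSEQ_unique[OF representing_tendsto_rip[OF f h]] by (simp add: U_cancel)
qed

text \<open>Precomposition with \<open>U (- g)\<close> maps \<open>B x\<close> to
  \<open>B (U g x)\<close>, so it extends \<open>U g\<close> from the embedded vectors to the
  completion.\<close>

definition rep :: "'g \<Rightarrow> 'h \<Rightarrow> 'h" where "rep g x = \<iota> (\<lambda>w. \<delta> x (U (- g) w))"

lemma ccompletion_shift: "f \<in> ccompletion \<Longrightarrow> (\<lambda>w. f (U (- g) w)) \<in> ccompletion"
  unfolding ccompletion_def using completion_shift by fast

lemma hip_shift:
  assumes "f \<in> ccompletion" "h \<in> ccompletion"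
  shows "hip (\<lambda>w. f (U (- g) w)) (\<lambda>w. h (U (- g) w)) = hip f h"
  unfolding hip_def
  using assms[THEN ccompletionD(1)] assms[THEN ccompletionD(2)]
    rip_shift[of "\<lambda>w. Re (f w)" "\<lambda>w. Re (h w)" g] rip_shift[of "\<lambda>w. Im (f w)" "\<lambda>w. Im (h w)" g]
    rip_shift[of "\<lambda>w. Re (f w)" "\<lambda>w. Im (h w)" g] rip_shift[of "\<lambda>w. Im (f w)" "\<lambda>w. Re (h w)" g]
  by simp

lemma rep_\<iota>: "f \<in> ccompletion \<Longrightarrow> rep g (\<iota> f) = \<iota> (\<lambda>w. f (U (- g) w))"
  by (simp add: rep_def)

lemma rep_embed: "rep g (embed x) = embed (U g x)"
  by (simp add: embed_def rep_\<iota> of_real_B B_U)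

lemma unitary_rep_space: "unitary_rep space rep"
  unfolding unitary_rep_def unitary_operator_def
proof (intro conjI allI ballI)
  fix g
  have cl: "rep g x \<in> carrier space" if "x \<in> carrier space" for g x
    using that ccompletion_shift by (auto simp: carrier_space rep_\<iota>)
  have comp: "rep (g + h) x = rep g (rep h x)" if "x \<in> carrier space" for g h x
  proof -
    have "U (- h - g) w = U (- h) (U (- g) w)" for w using U_add[of "- h" "- g" w] by simp
    then show ?thesis using that by (auto simp: carrier_space rep_\<iota> ccompletion_shift minus_add)
  qed
  have id: "rep 0 x = x" if "x \<in> carrier space" for x
    using that by (auto simp: carrier_space rep_\<iota> U0)
  show "bij_betw (rep g) (carrier space) (carrier space)"
    by (rule bij_betw_byWitness[where f' = "rep (- g)"])
      (use cl id in \<open>auto simp flip: comp\<close>)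
  show "rep (g + h) x = rep g (rep h x)" if "x \<in> carrier space" for h x using comp that by blast
qed (auto simp: carrier_space rep_\<iota> space_simps ccompletion_shift ccompletion_closed hip_shift)

end

end

text \<open>A real is coded by a set of naturals. A sequence of complex numbers is then one set of
  triples consisting of an index, a choice of real or imaginary part, and a natural; the triples are
  countable.\<close>

lemma complex_sequences_lepoll_reals: "(UNIV :: (nat \<Rightarrow> complex) set) \<lesssim> (UNIV :: real set)"
proof -
  obtain e :: "real \<Rightarrow> nat set" where e: "inj e"
    using nat_sets_eqpoll_reals by (metis eqpoll_def bij_betw_def eqpoll_sym)
  define F where "F c = {(n, b, m). m \<in> e (if b then Re (c n) else Im (c n))}" for c :: "nat \<Rightarrow> complex"
  have "inj F"
  proof (rule injI)
    fix c c' assume "F c = F c'"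
    then have *: "m \<in> e (if b then Re (c n) else Im (c n)) \<longleftrightarrow> m \<in> e (if b then Re (c' n) else Im (c' n))" for n b m
      unfolding F_def by blast
    have "e (Re (c n)) = e (Re (c' n))" "e (Im (c n)) = e (Im (c' n))" for n
      using *[of _ True n] *[of _ False n] by auto
    then show "c = c'" using e by (auto simp: complex_eq_iff inj_eq)
  qed
  then have "inj (\<lambda>c. to_nat ` F c)"
    by (simp add: inj_def inj_image_eq_iff)
  then have "(UNIV :: (nat \<Rightarrow> complex) set) \<lesssim> (UNIV :: nat set set)"
    unfolding lepoll_def by blast
  then show ?thesis
    using nat_sets_eqpoll_reals by (meson lepoll_trans eqpoll_imp_lepoll)
qed

section \<open>Harmonic vectors from the failure of the spectral gap\<close>

text \<open>Rows and matrices are handled here as functions on indices: these form a real vector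
  space on a whole type, whereas matrices form one only for each fixed size.\<close>

definition scale_fun :: "real \<Rightarrow> ('i \<Rightarrow> 'g::group_add group_algebra) \<Rightarrow> 'i \<Rightarrow> 'g group_algebra" where
  "scale_fun c F = (\<lambda>i. single 0 c * F i)"

lemma vector_space_scale_fun: "vector_space (scale_fun :: real \<Rightarrow> ('i \<Rightarrow> 'g::group_add group_algebra) \<Rightarrow> _)"
  by unfold_locales
    (auto simp: scale_fun_def fun_eq_iff distrib_left distrib_right single_add mult_single
      simp flip: mult.assoc)

text \<open>The rank one product of the star of the row \<open>y\<close> with the row
  \<open>x\<close>. For \<open>x = y\<close> it is a square, which makes the form derived from it
  positive.\<close>

definition gram :: "(nat \<Rightarrow> 'g::group_add group_algebra) \<Rightarrow> (nat \<Rightarrow> 'g group_algebra) \<Rightarrow>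
    nat \<times> nat \<Rightarrow> 'g group_algebra" where
  "gram x y = (\<lambda>(i, j). involution (y i) * x j)"

lemma positive_functional_of_no_gap:
  fixes L :: "'g::group_add group_algebra mat"
  assumes L: "L \<in> sums_of_squares k"
    and no_gap: "\<And>c. c > 0 \<Longrightarrow> L - scalar_times c (1\<^sub>m k) \<notin> sums_of_squares k"
  obtains \<phi> :: "(nat \<times> nat \<Rightarrow> 'g group_algebra) \<Rightarrow> real" where
    "\<And>F G. \<phi> (F + G) = \<phi> F + \<phi> G" "\<And>c F. \<phi> (scale_fun c F) = c * \<phi> F"
    "\<And>F. mat k k F + mat_star (mat k k F) \<in> sums_of_squares k \<Longrightarrow> 0 \<le> \<phi> F"
    "\<phi> (\<lambda>(i, j). if i = j then 1 else 0) = 1"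
    "\<phi> (\<lambda>x. L $$ x) \<le> 0"
proof -
  have Lc: "L \<in> carrier_mat k k" and Ls: "mat_star L = L"
    using L by (rule sums_of_squares_carrier, rule mat_star_sums_of_squares)
  \<comment> \<open>Twice the hermitian part. Through it the cone can be placed in the space of all
    functions, and the functional to be found sees only hermitian parts.\<close>
  define S where "S F = mat k k F + mat_star (mat k k F)" for F :: "nat \<times> nat \<Rightarrow> 'g group_algebra"
  have Sc: "S F \<in> carrier_mat k k" for F by (simp add: S_def)
  have S_add: "S (F + G) = S F + S G" for F G
    by (rule eq_matI) (auto simp: S_def algebra_simps)
  have S_sc: "S (scale_fun c F) = scalar_times c (S F)" for c F
    by (rule eq_matI)
      (auto simp: S_def scale_fun_def distrib_left single_zero_commute[where a = "involution _"])
  \<comment> \<open>The cone generated by the squares and \<open>- L\<close>, pulled back along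
    \<open>S\<close>.\<close>
  define P where "P = {F. \<exists>A t. A \<in> sums_of_squares k \<and> 0 \<le> t \<and> S F = A - scalar_times t L}"
  let ?u = "\<lambda>(i::nat, j). if i = j then (1::'g group_algebra) else 0"
  have two: "single 0 2 = (2 :: 'g group_algebra)" by (metis one_add_one single_add single_one)
  have Su: "S ?u = scalar_times 2 (1\<^sub>m k)"
    by (rule eq_matI) (auto simp: S_def two)
  have P_add: "F + G \<in> P" if FG: "F \<in> P" "G \<in> P" for F G
  proof -
    obtain A t A' t' where *: "A \<in> sums_of_squares k" "0 \<le> t" "S F = A - scalar_times t L"
      "A' \<in> sums_of_squares k" "0 \<le> t'" "S G = A' - scalar_times t' L"
      using FG unfolding P_def by blast
    have "S (F + G) = (A + A') - scalar_times (t + t') L"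
      unfolding S_add *(3,6) using Lc sums_of_squares_carrier[OF *(1)] sums_of_squares_carrier[OF *(4)]
      by (intro eq_matI) (auto simp: single_add algebra_simps)
    then show ?thesis
      unfolding P_def using * sums_of_squares_add[OF *(1,4)]
      by (intro CollectI exI[of _ "A + A'"] exI[of _ "t + t'"]) auto
  qed
  have P_sc: "scale_fun c F \<in> P" if cF: "0 \<le> c" "F \<in> P" for c F
  proof -
    obtain A t where *: "A \<in> sums_of_squares k" "0 \<le> t" "S F = A - scalar_times t L"
      using cF unfolding P_def by blast
    have "S (scale_fun c F) = scalar_times c A - scalar_times (c * t) L"
      unfolding S_sc *(3) using Lc sums_of_squares_carrier[OF *(1)]
      by (simp add: scalar_times_minus[of _ k k] scalar_times_scalar_times)
    then show ?thesis
      unfolding P_def using * scalar_times_sums_of_squares[OF cF(1) *(1)] cF(1)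
      by (intro CollectI exI[of _ "scalar_times c A"] exI[of _ "c * t"]) auto
  qed
  have SOS_P: "F \<in> P" if "S F \<in> sums_of_squares k" for F
    unfolding P_def using that Lc Sc[of F]
    by (intro CollectI exI[of _ "S F"] exI[of _ 0]) (auto simp: scalar_times_0[OF Lc] intro!: eq_matI)
  have unit: "\<exists>t. scale_fun t ?u + F \<in> P" for F
  proof -
    obtain t where t: "scalar_times t (1\<^sub>m k) + S F \<in> sums_of_squares k"
      using unit_bounded_below[of "mat k k F" k] by (auto simp: S_def)
    have "S (scale_fun (t / 2) ?u + F) = scalar_times t (1\<^sub>m k) + S F"
      unfolding S_add S_sc Su scalar_times_scalar_times by simp
    then show ?thesis using SOS_P t by metis
  qed
  \<comment> \<open>Otherwise \<open>scalar_times t L - scalar_times 2 (1\<^sub>m k)\<close> is a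
    sum of squares for some \<open>t \<ge> 0\<close>. If \<open>t > 0\<close>, dividing by
    \<open>t\<close> gives the gap \<open>2 / t\<close>; if \<open>t = 0\<close>, adding
    \<open>L\<close> gives the gap \<open>2\<close>.\<close>
  have neg: "- ?u \<notin> P"
  proof
    assume "- ?u \<in> P"
    moreover have "- ?u = scale_fun (- 1) ?u"
      by (auto simp: scale_fun_def fun_eq_iff single_uminus single_one)
    ultimately have "S (scale_fun (- 1) ?u) \<in> S ` P" by auto
    then obtain A t where *: "A \<in> sums_of_squares k" "0 \<le> t"
      "scalar_times (- 2) (1\<^sub>m k) = A - scalar_times t L"
      unfolding S_sc Su scalar_times_scalar_times P_def by auto
    have Ac: "A \<in> carrier_mat k k" using *(1) by (rule sums_of_squares_carrier)
    have "A = scalar_times t L - scalar_times 2 (1\<^sub>m k)"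
    proof -
      have "A = (A - scalar_times t L) + scalar_times t L" using Ac Lc by (intro eq_matI) auto
      also have "\<dots> = scalar_times t L - scalar_times 2 (1\<^sub>m k)"
        unfolding *(3)[symmetric] using Lc
        by (intro eq_matI) (auto simp: single_uminus)
      finally show ?thesis .
    qed
    then have A: "scalar_times t L - scalar_times 2 (1\<^sub>m k) \<in> sums_of_squares k" using *(1) by simp
    show False
    proof (cases "t = 0")
      case True
      have "L - scalar_times 2 (1\<^sub>m k) = L + (scalar_times t L - scalar_times 2 (1\<^sub>m k))"
        using Lc True by (intro eq_matI) auto
      then show False using no_gap[of 2] sums_of_squares_add[OF L A] by simp
    next
      case False
      then have "scalar_times (1 / t) (scalar_times t L - scalar_times 2 (1\<^sub>m k))
          = L - scalar_times (2 / t) (1\<^sub>m k)"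
        using Lc by (simp add: scalar_times_minus[of _ k k] scalar_times_scalar_times)
      then show False
        using no_gap[of "2 / t"] scalar_times_sums_of_squares[OF _ A, of "1 / t"] \<open>0 \<le> t\<close> False by simp
    qed
  qed
  obtain \<phi> :: "(nat \<times> nat \<Rightarrow> 'g group_algebra) \<Rightarrow> real" where \<phi>:
    "\<And>F G. \<phi> (F + G) = \<phi> F + \<phi> G" "\<And>c F. \<phi> (scale_fun c F) = c * \<phi> F"
    "\<And>F. F \<in> P \<Longrightarrow> 0 \<le> \<phi> F" "\<phi> ?u = 1"
    using positive_functional_exists[OF vector_space_scale_fun P_add P_sc unit neg] by blast
  have "scale_fun (- 1) (\<lambda>x. L $$ x) \<in> P"
  proof -
    have "mat k k (\<lambda>x. L $$ x) = L" using Lc by (intro eq_matI) auto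
    then have "S (\<lambda>x. L $$ x) = scalar_times 2 L"
      using scalar_times_add_scalar[of 1 1 L] by (simp add: S_def Ls)
    then have "S (scale_fun (- 1) (\<lambda>x. L $$ x)) = scalar_times (- 2) L"
      by (simp add: S_sc scalar_times_scalar_times)
    also have "\<dots> = 0\<^sub>m k k - scalar_times 2 L"
      using Lc by (intro eq_matI) (simp_all add: single_uminus)
    finally have "S (scale_fun (- 1) (\<lambda>x. L $$ x)) = 0\<^sub>m k k - scalar_times 2 L" .
    then show ?thesis
      unfolding P_def by (intro CollectI exI[of _ "0\<^sub>m k k"] exI[of _ 2]) auto
  qed
  then have "\<phi> (\<lambda>x. L $$ x) \<le> 0" using \<phi>(3) \<phi>(2)[of "- 1" "\<lambda>x. L $$ x"] by fastforce
  then show ?thesis using that \<phi> SOS_P unfolding S_def by blast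
qed

lemma harmonic_vector_of_no_gap:
  fixes d0 d1 :: "'g::group_add group_algebra mat"
  assumes d0: "d0 \<in> carrier_mat k1 k0" and d1: "d1 \<in> carrier_mat k2 k1"
    and no_gap: "\<And>c. c > 0 \<Longrightarrow>
      mat_star d1 * d1 + d0 * mat_star d0 - scalar_times c (1\<^sub>m k1) \<notin> sums_of_squares k1"
    and countable: "countable (UNIV :: 'g set)"
    and big: "(UNIV :: real set) \<lesssim> (UNIV :: 'h set)"
  obtains H :: "'h hilbert" and \<pi> :: "'g \<Rightarrow> 'h \<Rightarrow> 'h" where
    "hilbert_space H" "unitary_rep H \<pi>" "\<not> rep_ker H \<pi> d1 \<subseteq> rep_im H \<pi> d0"
proof -
  define k where "k = k1"
  have d0': "mat_star d0 \<in> carrier_mat k0 k" and d1k: "d1 \<in> carrier_mat k2 k" using d0 d1 by (auto simp: k_def)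
  define L where "L = mat_star d1 * d1 + d0 * mat_star d0"
  have LSOS: "L \<in> sums_of_squares k"
    using sums_of_squares_add[OF star_mult_in_sums_of_squares[OF d1k] star_mult_in_sums_of_squares[OF d0']]
    by (simp add: L_def)
  have no_gap': "L - scalar_times c (1\<^sub>m k) \<notin> sums_of_squares k" if "c > 0" for c
    using no_gap[OF that] by (simp add: L_def k_def)
  obtain \<phi> where \<phi>_add: "\<And>F G. \<phi> (F + G) = \<phi> F + \<phi> G" and \<phi>_sc: "\<And>c F. \<phi> (scale_fun c F) = c * \<phi> F"
    and \<phi>_pos: "\<And>F. mat k k F + mat_star (mat k k F) \<in> sums_of_squares k \<Longrightarrow> 0 \<le> \<phi> F"
    and \<phi>_one: "\<phi> (\<lambda>(i, j). if i = j then 1 else 0) = 1" and \<phi>_L: "\<phi> (\<lambda>x. L $$ x) \<le> 0"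
    using positive_functional_of_no_gap[OF LSOS no_gap'] by blast
  interpret fun_space: vector_space "scale_fun :: real \<Rightarrow> (nat \<times> nat \<Rightarrow> 'g group_algebra) \<Rightarrow> _"
    by (rule vector_space_scale_fun)
  have \<phi>_neg: "\<phi> (- F) = - \<phi> F" for F
    using \<phi>_sc[of "- 1" F] by simp
  \<comment> \<open>If the hermitian part vanishes on the block, both the function and its negative
    have nonnegative value. Hence \<open>\<phi>\<close> depends only on the \<open>k\<close> by
    \<open>k\<close> block and is invariant under the star.\<close>
  have \<phi>_0: "\<phi> F = 0" if "\<And>i j. i < k \<Longrightarrow> j < k \<Longrightarrow> F (i, j) + involution (F (j, i)) = 0" for F
  proof -
    have "mat k k F + mat_star (mat k k F) = 0\<^sub>m k k" using that by (intro eq_matI) auto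
    moreover have "mat k k (- F) + mat_star (mat k k (- F)) = 0\<^sub>m k k"
    proof (rule eq_matI)
      fix i j assume ij: "i < dim_row (0\<^sub>m k k)" "j < dim_col (0\<^sub>m k k)"
      have "F (i, j) = - involution (F (j, i))"
        using that[of i j] ij by (simp add: eq_neg_iff_add_eq_0)
      then show "(mat k k (- F) + mat_star (mat k k (- F))) $$ (i, j) = 0\<^sub>m k k $$ (i, j)"
        using ij by simp
    qed auto
    ultimately have "0 \<le> \<phi> F" "0 \<le> \<phi> (- F)" using \<phi>_pos by auto
    then show ?thesis using \<phi>_neg by simp
  qed
  have \<phi>_diff: "\<phi> (F - G) = \<phi> F - \<phi> G" for F G
    using \<phi>_add[of F "- G"] \<phi>_neg[of G] by simp
  have \<phi>_cong: "\<phi> F = \<phi> G" if "\<And>i j. i < k \<Longrightarrow> j < k \<Longrightarrow> F (i, j) = G (i, j)" for F G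
    using \<phi>_0[of "F - G"] that by (simp add: \<phi>_diff)
  have \<phi>_star: "\<phi> F = \<phi> (\<lambda>(i, j). involution (F (j, i)))" for F
    using \<phi>_0[of "F - (\<lambda>(i, j). involution (F (j, i)))"] by (simp add: \<phi>_diff)
  have \<phi>_zero: "\<phi> 0 = 0" using \<phi>_0[of 0] by simp
  have \<phi>_sum: "\<phi> (sum G A) = (\<Sum>x\<in>A. \<phi> (G x))" for G and A :: "nat set"
    by (induction A rule: infinite_finite_induct)
      (simp_all only: sum.infinite sum.empty sum.insert \<phi>_add \<phi>_zero not_False_eq_True)
  \<comment> \<open>The GNS form on rows. It is symmetric because \<open>\<phi>\<close> is real
    valued and invariant under the star.\<close>
  define B where "B x y = \<phi> (gram x y)" for x y
  interpret W: semi_inner_product "scale_fun :: real \<Rightarrow> (nat \<Rightarrow> 'g group_algebra) \<Rightarrow> _" B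
  proof (unfold semi_inner_product_def semi_inner_product_axioms_def, intro conjI allI)
    show "vector_space (scale_fun :: real \<Rightarrow> (nat \<Rightarrow> 'g group_algebra) \<Rightarrow> _)"
      by (rule vector_space_scale_fun)
    fix x y z :: "nat \<Rightarrow> 'g group_algebra" and c :: real
    have "gram (x + y) z = gram x z + gram y z" by (auto simp: gram_def fun_eq_iff distrib_left)
    then show "B (x + y) z = B x z + B y z" by (simp add: B_def \<phi>_add)
    have "gram (scale_fun c x) z = scale_fun c (gram x z)"
      by (auto simp: gram_def scale_fun_def fun_eq_iff mult_single_zero_mult)
    then show "B (scale_fun c x) z = c * B x z" by (simp add: B_def \<phi>_sc)
    show "B x y = B y x"
      unfolding B_def by (subst \<phi>_star, rule arg_cong[where f = \<phi>]) (auto simp: gram_def fun_eq_iff)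
    let ?R = "mat 1 k (\<lambda>(i, j). x j)"
    have R: "?R \<in> carrier_mat 1 k" by simp
    have "mat k k (gram x x) = mat_star ?R * ?R"
    proof (rule eq_matI)
      fix i j assume "i < dim_row (mat_star ?R * ?R)" "j < dim_col (mat_star ?R * ?R)"
      then have ij: "i < k" "j < k" by simp_all
      show "mat k k (gram x x) $$ (i, j) = (mat_star ?R * ?R) $$ (i, j)"
        unfolding index_star_mult[OF R ij] using ij by (simp add: gram_def)
    qed simp_all
    then show "0 \<le> B x x"
      unfolding B_def
      using \<phi>_pos[of "gram x x"] star_mult_in_sums_of_squares[OF R]
        mat_star_sums_of_squares[OF star_mult_in_sums_of_squares[OF R]]
        sums_of_squares_add by metis
  qed
  define e where "e j a = (\<lambda>i. if i = j then a else 0)" for j :: nat and a :: "'g group_algebra"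
  have e_add: "e j (a + b) = e j a + e j b" for j a b by (auto simp: e_def fun_eq_iff)
  have e_single: "e j (single g c) = scale_fun c (e j (single g 1))" for j g c
    by (auto simp: e_def scale_fun_def fun_eq_iff mult_single)
  have nB0: "W.nB w = 0" if "\<And>j. j < k \<Longrightarrow> w j = 0" for w
  proof -
    have "\<phi> (gram w w) = \<phi> 0" by (rule \<phi>_cong) (use that in \<open>simp add: gram_def\<close>)
    then show ?thesis by (simp add: W.nB_def B_def \<phi>_zero)
  qed
  \<comment> \<open>A functional in the completion is real linear, so its values on the unit rows
    \<open>e j (single g 1)\<close> determine it on finitely supported rows; what a row has at
    indices from \<open>k\<close> on is of seminorm zero.\<close>
  have determined: "f w = 0"
    if f: "f \<in> W.completion" and z: "\<And>j g. f (e j (single g 1)) = 0" for f w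
  proof -
    have add: "f (x + y) = f x + f y" for x y
      using W.completion_arg_diff[OF f, of "x + y" y] by simp
    have ea: "f (e j a) = 0" for j a
    proof (induction a rule: group_algebra_induct)
      case zero
      have "e j 0 = scale_fun 0 (e j (single 0 1))" using e_single[of j 0 0] by (simp only: single_zero)
      then show ?case by (simp only: W.completion_arg_sc[OF f] mult_zero_left)
    next
      case (single g c)
      show ?case by (subst e_single) (simp only: W.completion_arg_sc[OF f] z mult_zero_right)
    next
      case (add a b)
      then show ?case by (simp only: e_add \<open>\<And>x y. f (x + y) = f x + f y\<close> add_0_left)
    qed
    define T where "T m = (\<lambda>j. if j < m then w j else 0)" for m :: nat
    have "f (T m) = 0" for m
    proof (induction m)
      case 0
      have "T 0 = e 0 0" by (auto simp: T_def e_def)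
      then show ?case using ea by simp
    next
      case (Suc m)
      have "T (Suc m) = T m + e m (w m)" by (auto simp: T_def e_def fun_eq_iff less_Suc_eq)
      then show ?case by (simp only: Suc ea add add_0_left)
    qed
    moreover have "W.nB (w - T k) = 0" by (rule nB0) (simp add: T_def)
    then have "f (w - T k) = 0" using W.abs_le_rip[OF f, of "w - T k"] by simp
    ultimately show ?thesis using W.completion_arg_diff[OF f, of w "T k"] by simp
  qed
  obtain J :: "(nat \<Rightarrow> complex) \<Rightarrow> 'h" where J: "inj J"
    using lepoll_trans[OF complex_sequences_lepoll_reals big] unfolding lepoll_def by blast
  have cnt: "countable (UNIV :: (nat \<times> 'g) set)"
    using countable_SIGMA[of "UNIV :: nat set" "\<lambda>_. UNIV :: 'g set"] countable by simp
  \<comment> \<open>Records a functional by its values on the countable family of unit rows, coded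
    as a sequence and then as an element of \<open>'h\<close>.\<close>
  define \<iota> :: "((nat \<Rightarrow> 'g group_algebra) \<Rightarrow> complex) \<Rightarrow> 'h" where
    "\<iota> f = J (\<lambda>m. f (case from_nat_into (UNIV :: (nat \<times> 'g) set) m of (j, g) \<Rightarrow> e j (single g 1)))" for f
  interpret E: embedded_completion scale_fun B \<iota>
  proof
    show "inj_on \<iota> W.ccompletion"
    proof (rule inj_onI)
      fix f f' assume f: "f \<in> W.ccompletion" "f' \<in> W.ccompletion" and "\<iota> f = \<iota> f'"
      then have eq: "f (case from_nat_into (UNIV :: (nat \<times> 'g) set) m of (j, g) \<Rightarrow> e j (single g 1))
          = f' (case from_nat_into (UNIV :: (nat \<times> 'g) set) m of (j, g) \<Rightarrow> e j (single g 1))" for m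
        using J unfolding \<iota>_def inj_eq[OF J] by metis
      have eq': "f (e j (single g 1)) = f' (e j (single g 1))" for j g
      proof -
        obtain m where "from_nat_into (UNIV :: (nat \<times> 'g) set) m = (j, g)"
          using from_nat_into_surj[OF cnt UNIV_I] by metis
        then show ?thesis using eq[of m] by simp
      qed
      have "Re (f w) - Re (f' w) = 0" "Im (f w) - Im (f' w) = 0" for w
        by (rule determined[OF W.completion_diff[OF W.ccompletionD(1)[OF f(1)] W.ccompletionD(1)[OF f(2)]]])
          (simp add: eq', rule determined[OF W.completion_diff[OF W.ccompletionD(2)[OF f(1)] W.ccompletionD(2)[OF f(2)]]],
            simp add: eq')
      then show "f = f'" by (auto simp: complex_eq_iff fun_eq_iff)
    qed
  qed
  \<comment> \<open>Left multiplication of a row by a group element. It is isometric since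
    \<open>single (- g) 1 * single g 1\<close> cancels inside \<open>gram\<close>.\<close>
  define U where "U g x = (\<lambda>j. single g 1 * x j)" for g :: 'g and x :: "nat \<Rightarrow> 'g group_algebra"
  have U0: "U 0 x = x" for x by (simp add: U_def)
  have U_add: "U (g + h) x = U g (U h x)" for g h x
    by (simp add: U_def mult_single flip: mult.assoc)
  have U_iso: "B (U g x) (U g y) = B x y" for g x y
  proof -
    have "involution (single g 1 * y i) * (single g 1 * x j)
      = involution (y i) * ((single (- g) 1 * single g 1) * x j)" for i j
      by (simp only: involution_mult involution_simps mult.assoc)
    then have "gram (U g x) (U g y) = gram x y" by (simp add: gram_def U_def mult_single fun_eq_iff)
    then show ?thesis by (simp add: B_def)
  qed
  let ?H = E.space
  define \<pi> where "\<pi> = E.rep U"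
  have rep: "unitary_rep ?H \<pi>" unfolding \<pi>_def by (rule E.unitary_rep_space[OF U0 U_add U_iso])
  have HH: "hilbert_space ?H" by (rule E.hilbert_space_space)
  interpret R: unitary_representation ?H \<pi>
    using HH rep by (simp add: unitary_representation_def unitary_representation_axioms_def)
  have \<pi>_embed: "\<pi> g (E.embed x) = E.embed (U g x)" for g x
    unfolding \<pi>_def by (rule E.rep_embed[OF U0 U_add U_iso])
  have embed_0: "E.embed x = \<zero>\<^bsub>?H\<^esub>" if "B x x = 0" for x
    by (rule R.ip_definite) (use that in \<open>auto simp: E.embed_closed E.ip_embed\<close>)
  have B00: "B 0 0 = 0" using W.B_sc[of 0 0 0] by simp
  have alg_embed: "rep_alg ?H \<pi> a (E.embed x) = E.embed (\<lambda>j. a * x j)" for a x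
  proof (induction a rule: group_algebra_induct)
    case zero
    have "(\<lambda>j. 0 * x j) = 0" by auto
    then show ?case using embed_0[OF B00] by (simp add: R.rep_alg_zero E.embed_closed zero_fun_def)
  next
    case (single g c)
    have "(\<lambda>j. single g c * x j) = scale_fun c (U g x)"
      by (auto simp: scale_fun_def U_def mult_single fun_eq_iff simp flip: mult.assoc)
    then show ?case by (simp add: R.rep_alg_single E.embed_closed \<pi>_embed E.embed_sc)
  next
    case (add a b)
    have "(\<lambda>j. (a + b) * x j) = (\<lambda>j. a * x j) + (\<lambda>j. b * x j)"
      by (auto simp: distrib_right fun_eq_iff)
    then show ?case using add by (simp add: R.rep_alg_add E.embed_closed E.embed_add)
  qed
  \<comment> \<open>The harmonic vector, a tuple of classes of unit rows: applying a matrix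
    \<open>D\<close> to it gives the classes of the rows of \<open>D\<close>.\<close>
  define v where "v = vec k (\<lambda>j. E.embed (e j 1))"
  have v: "v \<in> cochains ?H k" by (auto simp: v_def cochains_def E.embed_closed)
  define row where "row D l = (\<lambda>j. if j < k then D $$ (l, j) else 0)" for D :: "'g group_algebra mat" and l
  have mat_embed: "rep_mat ?H \<pi> D v $ l = E.embed (row D l)"
    if D: "D \<in> carrier_mat m k" and l: "l < m" for D m l
  proof -
    have "(\<Oplus>\<^bsub>?H\<^esub>j\<in>{..<m}. rep_alg ?H \<pi> (D $$ (l, j)) (v $ j))
        = E.embed (\<lambda>j. if j < m then D $$ (l, j) else 0)" if "m \<le> k" for m
      using that
    proof (induction m)
      case 0
      then show ?case using embed_0[OF B00] by (simp add: zero_fun_def)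
    next
      case (Suc m)
      have "rep_alg ?H \<pi> (D $$ (l, j)) (v $ j) \<in> carrier ?H" if "j < k" for j
        using v that by (simp add: cochains_def)
      then have "(\<Oplus>\<^bsub>?H\<^esub>j\<in>{..<Suc m}. rep_alg ?H \<pi> (D $$ (l, j)) (v $ j))
          = rep_alg ?H \<pi> (D $$ (l, m)) (v $ m) \<oplus>\<^bsub>?H\<^esub> (\<Oplus>\<^bsub>?H\<^esub>j\<in>{..<m}. rep_alg ?H \<pi> (D $$ (l, j)) (v $ j))"
        using Suc.prems unfolding lessThan_Suc by (intro R.M.finsum_insert) auto
      also have "\<dots> = E.embed ((\<lambda>j. D $$ (l, m) * e m 1 j) + (\<lambda>j. if j < m then D $$ (l, j) else 0))"
        using Suc by (simp add: v_def alg_embed E.embed_add)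
      also have "(\<lambda>j. D $$ (l, m) * e m 1 j) + (\<lambda>j. if j < m then D $$ (l, j) else 0)
          = (\<lambda>j. if j < Suc m then D $$ (l, j) else 0)"
        by (auto simp: e_def fun_eq_iff less_Suc_eq)
      finally show ?case .
    qed
    from this[of k] show ?thesis using D l by (simp add: rep_mat_def row_def)
  qed
  \<comment> \<open>So the value of \<open>\<phi>\<close> at \<open>mat_star D * D\<close> is the
    squared norm of \<open>D\<close> applied to \<open>v\<close>.\<close>
  have \<phi>_star_mult: "\<phi> (\<lambda>x. (mat_star D * D) $$ x) = (\<Sum>l<m. B (row D l) (row D l))"
    if D: "D \<in> carrier_mat m k" for D m
    unfolding B_def \<phi>_sum[symmetric]
  proof (rule \<phi>_cong)
    have ev: "(\<Sum>l\<in>A. G l) x = (\<Sum>l\<in>A. G l x)" for A :: "nat set" and G :: "nat \<Rightarrow> nat \<times> nat \<Rightarrow> 'g group_algebra" and x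
      by (induction A rule: infinite_finite_induct) auto
    fix i j assume "i < k" "j < k"
    then show "(mat_star D * D) $$ (i, j) = (\<Sum>l<m. gram (row D l) (row D l)) (i, j)"
      unfolding ev index_star_mult[OF D \<open>i < k\<close> \<open>j < k\<close>] by (simp add: gram_def row_def)
  qed
  \<comment> \<open>Written with \<open>mat_star (mat_star d0)\<close>, \<open>L\<close> is a sum of
    two squares. The value of \<open>\<phi>\<close> at \<open>L\<close> is at most zero, so the
    squared norms of both images of \<open>v\<close> vanish.\<close>
  have "\<phi> (\<lambda>x. L $$ x) = \<phi> ((\<lambda>x. (mat_star d1 * d1) $$ x) + (\<lambda>x. (mat_star (mat_star d0) * mat_star d0) $$ x))"
    by (rule \<phi>_cong) (use d0 d1 in \<open>simp add: L_def k_def del: index_mult_mat(1)\<close>)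
  then have "(\<Sum>l<k2. B (row d1 l) (row d1 l)) + (\<Sum>l<k0. B (row (mat_star d0) l) (row (mat_star d0) l)) \<le> 0"
    using \<phi>_L by (simp only: \<phi>_add \<phi>_star_mult[OF d1k] \<phi>_star_mult[OF d0'])
  moreover have "0 \<le> (\<Sum>l<k2. B (row d1 l) (row d1 l))"
    "0 \<le> (\<Sum>l<k0. B (row (mat_star d0) l) (row (mat_star d0) l))"
    by (intro sum_nonneg W.B_nonneg)+
  ultimately have "(\<Sum>l<k2. B (row d1 l) (row d1 l)) = 0"
    "(\<Sum>l<k0. B (row (mat_star d0) l) (row (mat_star d0) l)) = 0" by linarith+
  then have z1: "\<And>l. l < k2 \<Longrightarrow> B (row d1 l) (row d1 l) = 0"
    and z0: "\<And>l. l < k0 \<Longrightarrow> B (row (mat_star d0) l) (row (mat_star d0) l) = 0"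
    by (auto simp: sum_nonneg_eq_0_iff W.B_nonneg)
  have "rep_mat ?H \<pi> d1 v = vec k2 (\<lambda>i. \<zero>\<^bsub>?H\<^esub>)"
    using R.rep_mat_closed[OF d1k v]
    by (intro eq_vecI) (auto simp: cochains_def mat_embed[OF d1k] embed_0 z1)
  then have ker: "v \<in> rep_ker ?H \<pi> d1" using d1k v by (auto simp: rep_ker_def)
  have d0v: "rep_mat ?H \<pi> (mat_star d0) v $ l = \<zero>\<^bsub>?H\<^esub>" if "l < k0" for l
    using that by (simp add: mat_embed[OF d0'] embed_0 z0)
  have "v \<notin> rep_im ?H \<pi> d0"
  proof
    assume "v \<in> rep_im ?H \<pi> d0"
    then obtain w where w: "w \<in> cochains ?H k0" "v = rep_mat ?H \<pi> d0 w"
      using d0 by (auto simp: rep_im_def)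
    have "R.cip k v v = R.cip k0 w (rep_mat ?H \<pi> (mat_star d0) v)"
      using R.rep_mat_adjoint[OF d0 w(1)] v w(2) by (simp add: k_def)
    also have "\<dots> = 0" using w(1) d0v by (simp add: R.cip_def cochains_def)
    finally have "R.cip k v v = 0" .
    moreover have "R.cip k v v = complex_of_real (\<Sum>j<k. B (e j 1) (e j 1))"
      by (simp add: R.cip_def v_def E.ip_embed)
    \<comment> \<open>The squared norm of \<open>v\<close> is the value of \<open>\<phi>\<close> at
      the identity matrix, so \<open>v\<close> is nonzero.\<close>
    moreover have "(\<Sum>j<k. B (e j 1) (e j 1)) = 1"
    proof -
      have ev: "(\<Sum>l\<in>A. G l) x = (\<Sum>l\<in>A. G l x)" for A :: "nat set" and G :: "nat \<Rightarrow> nat \<times> nat \<Rightarrow> 'g group_algebra" and x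
        by (induction A rule: infinite_finite_induct) auto
      have "\<phi> (\<Sum>j<k. gram (e j 1) (e j 1)) = \<phi> (\<lambda>(i, j). if i = j then 1 else 0)"
      proof (rule \<phi>_cong)
        fix i j assume ij: "i < k" "j < k"
        have "(\<Sum>l<k. gram (e l 1) (e l 1)) (i, j) = (\<Sum>l<k. if l = i then (if i = j then 1 else 0) else 0)"
          unfolding ev by (rule sum.cong) (auto simp: gram_def e_def)
        then show "(\<Sum>l<k. gram (e l 1) (e l 1)) (i, j) = (case (i, j) of (i, j) \<Rightarrow> if i = j then 1 else 0)"
          using ij by simp
      qed
      then show ?thesis unfolding B_def \<phi>_sum[symmetric] using \<phi>_one by simp
    qed
    ultimately show False by simp
  qed
  then show ?thesis using that[OF HH rep] ker by blast
qed

section \<open>Signs of vertex lists\<close>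

definition rank_sign :: "('v \<Rightarrow> nat) \<Rightarrow> 'v \<Rightarrow> 'v \<Rightarrow> int" where
  "rank_sign r x y = sgn (int (r y) - int (r x))"

text \<open>The sign of the permutation that sorts the list by \<open>r\<close>, as a product over
  pairs of positions. It also makes sense for lists with repetitions, where it is zero; these occur
  as vertex lists of degenerate simplices.\<close>

fun list_sign :: "('v \<Rightarrow> nat) \<Rightarrow> 'v list \<Rightarrow> int" where
  "list_sign r [] = 1"
| "list_sign r (x # xs) = (\<Prod>y\<leftarrow>xs. rank_sign r x y) * list_sign r xs"

definition drop_nth :: "nat \<Rightarrow> 'a list \<Rightarrow> 'a list" where
  "drop_nth i xs = take i xs @ drop (Suc i) xs"

lemma rank_sign_swap: "rank_sign r y x = - rank_sign r x y"
  by (simp add: rank_sign_def sgn_if)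

lemma list_sign_move:
  "list_sign r (xs @ x # ys) = (- 1) ^ length xs * list_sign r (x # xs @ ys)"
proof (induction xs)
  case (Cons z zs)
  have "(\<Prod>y\<leftarrow>zs @ x # ys. rank_sign r z y) = - rank_sign r x z * (\<Prod>y\<leftarrow>zs @ ys. rank_sign r z y)"
    by (simp add: rank_sign_swap[of r z x])
  then show ?case using Cons by simp
qed simp

text \<open>Both entries are moved to the front. What remains is symmetric in them except for the
  single factor comparing them.\<close>

lemma list_sign_swap:
  "list_sign r (xs @ x # ys @ y # zs) = - list_sign r (xs @ y # ys @ x # zs)"
proof -
  define P where "P x = (\<Prod>z\<leftarrow>xs @ ys @ zs. rank_sign r x z)" for x
  define S where "S = list_sign r (xs @ ys @ zs)"
  have *: "list_sign r (xs @ x # ys @ y # zs) =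
      (- 1) ^ length xs * (- 1) ^ (length xs + length ys) * (rank_sign r x y * (P x * P y * S))" for x y
  proof -
    have "list_sign r (xs @ x # ys @ y # zs) = (- 1) ^ length xs *
        ((\<Prod>z\<leftarrow>xs @ ys @ y # zs. rank_sign r x z) * list_sign r ((xs @ ys) @ y # zs))"
      unfolding list_sign_move[of r xs x] by simp
    also have "(\<Prod>z\<leftarrow>xs @ ys @ y # zs. rank_sign r x z) = rank_sign r x y * P x"
      by (simp add: P_def)
    also have "list_sign r ((xs @ ys) @ y # zs) = (- 1) ^ (length xs + length ys) * (P y * S)"
      unfolding list_sign_move[of r "xs @ ys" y] by (simp add: P_def S_def)
    finally show ?thesis by (simp only: ac_simps)
  qed
  show ?thesis unfolding *[of x y] *[of y x] rank_sign_swap[of r y x] by (simp add: ac_simps)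
qed

lemma list_sign_not_distinct:
  assumes "\<not> distinct xs"
  shows "list_sign r xs = 0"
proof -
  obtain as x bs cs where "xs = as @ [x] @ bs @ [x] @ cs" using not_distinct_decomp[OF assms] by blast
  then have "list_sign r xs = - list_sign r xs" using list_sign_swap[of r as x bs x cs] by simp
  then show ?thesis by simp
qed

lemma square_eq_1_mult: "a * a = 1 \<Longrightarrow> b * b = 1 \<Longrightarrow> a * b * (a * b) = (1 :: int)"
proof -
  assume "a * a = 1" "b * b = 1"
  moreover have "a * b * (a * b) = (a * a) * (b * b)" by (simp only: ac_simps)
  ultimately show ?thesis by simp
qed

lemma list_sign_square:
  assumes "distinct xs" "inj_on r (set xs)"
  shows "list_sign r xs * list_sign r xs = 1"
  using assms
proof (induction xs)
  case (Cons x xs)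
  have prod: "(\<Prod>y\<leftarrow>ys. rank_sign r x y) * (\<Prod>y\<leftarrow>ys. rank_sign r x y) = 1" if "set ys \<subseteq> set xs" for ys
    using that
  proof (induction ys)
    case (Cons y ys)
    then have "r y \<noteq> r x" using \<open>distinct (x # xs)\<close> \<open>inj_on r (set (x # xs))\<close> by (auto simp: inj_on_def)
    then have "rank_sign r x y * rank_sign r x y = 1" by (simp add: rank_sign_def sgn_if)
    moreover have "(\<Prod>y\<leftarrow>ys. rank_sign r x y) * (\<Prod>y\<leftarrow>ys. rank_sign r x y) = 1" using Cons by simp
    ultimately show ?case unfolding list.map prod_list.Cons by (rule square_eq_1_mult)
  qed simp
  have "list_sign r xs * list_sign r xs = 1" using Cons by (simp add: inj_on_def)
  with prod[of xs] show ?case unfolding list_sign.simps by (blast intro: square_eq_1_mult)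
qed simp

lemma list_sign_permute_transpose:
  assumes "a < b" "b < length xs"
  shows "list_sign r (permute_list (Transposition.transpose a b) xs) = - list_sign r xs"
proof -
  define A B C where "A = take a xs" and "B = take (b - Suc a) (drop (Suc a) xs)" and "C = drop (Suc b) xs"
  have xs: "xs = A @ xs ! a # B @ xs ! b # C"
  proof -
    have "drop (Suc a) xs = B @ xs ! b # C"
      using id_take_nth_drop[of "b - Suc a" "drop (Suc a) xs"] assms by (simp add: B_def C_def)
    then show ?thesis using id_take_nth_drop[of a xs] assms by (simp add: A_def)
  qed
  have len: "length A = a" "length B = b - Suc a" using assms by (auto simp: A_def B_def)
  have "permute_list (Transposition.transpose a b) xs = A @ xs ! b # B @ xs ! a # C"
  proof (rule nth_equalityI)
    show l: "length (permute_list (Transposition.transpose a b) xs) = length (A @ xs ! b # B @ xs ! a # C)"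
      using arg_cong[OF xs, of length] by simp
    fix i assume "i < length (permute_list (Transposition.transpose a b) xs)"
    then have i: "i < length xs" by simp
    have p: "Transposition.transpose a b permutes {..<length xs}"
      using assms by (intro permutes_swap_id) auto
    have "(A @ xs ! b # B @ xs ! a # C) ! i = xs ! Transposition.transpose a b i"
    proof -
      consider "i = a" | "i = b" | "i \<noteq> a" "i \<noteq> b" by blast
      then show ?thesis
      proof cases
        case 3
        have "(A @ xs ! b # B @ xs ! a # C) ! i = (A @ xs ! a # B @ xs ! b # C) ! i"
          using 3 assms len by (auto simp: nth_append nth_Cons' )
        then show ?thesis using 3 xs by (metis transpose_apply_other)
      qed (use assms len in \<open>auto simp: nth_append\<close>)
    qed
    then show "permute_list (Transposition.transpose a b) xs ! i = (A @ xs ! b # B @ xs ! a # C) ! i"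
      using permute_list_nth[OF p i] by simp
  qed
  then show ?thesis using list_sign_swap[of r A "xs ! b" B "xs ! a" C] xs by metis
qed

lemma list_sign_permute:
  assumes "p permutes {..<n}" "length xs = n"
  shows "list_sign r (permute_list p xs) = sign p * list_sign r xs"
  using assms(1) finite_lessThan assms(2)
proof (induction p arbitrary: xs rule: permutes_induct)
  case id
  then show ?case by (simp add: sign_id)
next
  case (swap a b p)
  have p: "p permutes {..<length xs}" using swap by simp
  have t: "list_sign r (permute_list (Transposition.transpose a b) xs) = - list_sign r xs"
  proof -
    consider "a < b" | "b < a" using swap by linarith
    then show ?thesis
      using list_sign_permute_transpose[of a b xs r] list_sign_permute_transpose[of b a xs r] swap
      by cases (auto simp: Transposition.transpose_commute[of b a])
  qed
  have "permute_list (Transposition.transpose a b \<circ> p) xs = permute_list p (permute_list (Transposition.transpose a b) xs)"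
    by (rule permute_list_compose[OF p])
  moreover have "sign (Transposition.transpose a b \<circ> p) = - sign p"
    using swap p permutation_permutes[of p]
    by (subst sign_compose) (auto simp: permutation_swap_id sign_swap_id)
  moreover have "list_sign r (permute_list p (permute_list (Transposition.transpose a b) xs))
      = sign p * list_sign r (permute_list (Transposition.transpose a b) xs)"
    using swap by simp
  ultimately show ?case unfolding t by (simp only: mult_minus_left mult_minus_right)
qed

text \<open>Eliminates the definite description in \<open>order_sign\<close>: the permutation
  between distinct lists is unique, and its sign splits into the signs of the two lists with respect
  to a fixed order \<open>r\<close>.\<close>

lemma order_sign_eq:
  assumes d: "distinct xs" "distinct ys" and s: "set xs = set ys" and inj: "inj_on r (set xs)"
  shows "order_sign xs ys = list_sign r xs * list_sign r ys"
proof -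
  have "mset ys = mset xs" using d s by (simp add: set_eq_iff_mset_eq_distinct)
  then obtain q where q: "q permutes {..<length xs}" "permute_list q xs = ys"
    by (rule mset_eq_permutation)
  have "q' = q" if q': "q' permutes {..<length xs}" "permute_list q' xs = ys" for q'
  proof
    fix i
    show "q' i = q i"
    proof (cases "i < length xs")
      case True
      have "xs ! q' i = ys ! i" using permute_list_nth[OF q'(1) True] unfolding q'(2) by (rule sym)
      also have "\<dots> = xs ! q i" using permute_list_nth[OF q(1) True] unfolding q(2) .
      finally have "xs ! q' i = xs ! q i" .
      moreover have "q' i < length xs" "q i < length xs"
        using permutes_in_image[OF q(1), of i] permutes_in_image[OF q'(1), of i] True by auto
      ultimately show ?thesis using d(1) by (simp add: nth_eq_iff_index_eq)
    next
      case False
      then show ?thesis using permutes_not_in[OF q(1), of i] permutes_not_in[OF q'(1), of i] by simp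
    qed
  qed
  then have "(THE q. q permutes {..<length xs} \<and> permute_list q xs = ys) = q"
    using q by (intro the_equality) blast+
  then have "order_sign xs ys = sign q" by (simp add: order_sign_def)
  moreover have "list_sign r ys = sign q * list_sign r xs"
    using list_sign_permute[OF q(1), of xs r] q(2) by simp
  ultimately show ?thesis
    using list_sign_square[OF d(1) inj] by (simp add: mult.left_commute)
qed

text \<open>For injective \<open>r\<close> and \<open>v\<close> outside \<open>\<rho>\<close> this
  is \<open>- 1\<close> to the power of the position of \<open>v\<close> in
  \<open>insert v \<rho>\<close> sorted by \<open>r\<close>, that is, the incidence number of the
  face \<open>\<rho>\<close> in a simplex oriented by \<open>r\<close>.\<close>

definition vertex_sign :: "('v \<Rightarrow> nat) \<Rightarrow> 'v \<Rightarrow> 'v set \<Rightarrow> int" where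
  "vertex_sign r v \<rho> = (\<Prod>y\<in>\<rho>. rank_sign r v y)"

lemma drop_nth_distinct:
  assumes "distinct xs" "i < length xs"
  shows "distinct (drop_nth i xs)" "set (drop_nth i xs) = set xs - {xs ! i}"
    "length (drop_nth i xs) = length xs - 1"
proof -
  have xs: "xs = take i xs @ xs ! i # drop (Suc i) xs" using id_take_nth_drop[OF assms(2)] .
  have "distinct (take i xs @ xs ! i # drop (Suc i) xs)" using xs assms(1) by metis
  then show "distinct (drop_nth i xs)" by (simp add: drop_nth_def)
  have "set xs = set (take i xs) \<union> {xs ! i} \<union> set (drop (Suc i) xs)"
    using arg_cong[OF xs, of set] by auto
  then show "set (drop_nth i xs) = set xs - {xs ! i}"
    using \<open>distinct (take i xs @ xs ! i # drop (Suc i) xs)\<close> by (auto simp: drop_nth_def)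
  show "length (drop_nth i xs) = length xs - 1" using assms by (simp add: drop_nth_def)
qed

lemma list_sign_drop_nth:
  assumes "i < length xs"
  shows "list_sign r xs = (- 1) ^ i * ((\<Prod>y\<leftarrow>drop_nth i xs. rank_sign r (xs ! i) y) * list_sign r (drop_nth i xs))"
  using list_sign_move[of r "take i xs" "xs ! i" "drop (Suc i) xs"] assms
  by (simp add: drop_nth_def flip: id_take_nth_drop)

lemma vertex_sign_square:
  assumes "inj_on r (insert v \<rho>)" "v \<notin> \<rho>"
  shows "vertex_sign r v \<rho> * vertex_sign r v \<rho> = 1"
proof -
  have "rank_sign r v y * rank_sign r v y = 1" if "y \<in> \<rho>" for y
  proof -
    have "r y \<noteq> r v" using assms that by (auto simp: inj_on_def)
    then show ?thesis by (simp add: rank_sign_def sgn_if)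
  qed
  then show ?thesis unfolding vertex_sign_def prod.distrib[symmetric] by (simp add: prod.neutral)
qed

text \<open>Compares the alternating sign of the \<open>i\<close>-th face in the given enumeration
  with its incidence number in the order \<open>r\<close>; the enumeration enters only through
  \<open>list_sign\<close>.\<close>

lemma alternating_drop_nth:
  assumes "distinct xs" "inj_on r (set xs)" "i < length xs"
  shows "(- 1) ^ i * list_sign r (drop_nth i xs) = list_sign r xs * vertex_sign r (xs ! i) (set xs - {xs ! i})"
proof -
  note dn = drop_nth_distinct[OF assms(1,3)]
  have p: "(\<Prod>y\<leftarrow>drop_nth i xs. rank_sign r (xs ! i) y) = vertex_sign r (xs ! i) (set xs - {xs ! i})"
    unfolding vertex_sign_def dn(2)[symmetric] by (rule prod.distinct_set_conv_list[OF dn(1), symmetric])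
  have "insert (xs ! i) (set xs - {xs ! i}) = set xs" using assms(3) by auto
  then have sq: "vertex_sign r (xs ! i) (set xs - {xs ! i}) * vertex_sign r (xs ! i) (set xs - {xs ! i}) = 1"
    using vertex_sign_square[of r "xs ! i" "set xs - {xs ! i}"] assms(2) by simp
  have "list_sign r xs * vertex_sign r (xs ! i) (set xs - {xs ! i})
      = (vertex_sign r (xs ! i) (set xs - {xs ! i}) * vertex_sign r (xs ! i) (set xs - {xs ! i}))
        * ((- 1) ^ i * list_sign r (drop_nth i xs))"
    unfolding list_sign_drop_nth[OF assms(3), of r] p by (simp only: ac_simps)
  then show ?thesis unfolding sq by simp
qed

text \<open>Relative to one order \<open>r\<close>, the boundary coefficient is an incidence number
  corrected by the signs of the two chosen orientations. The freedom in \<open>r\<close> is used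
  again for invariance under the action.\<close>

lemma boundary_coeff_eq:
  assumes \<sigma>: "distinct (ori \<sigma>)" "set (ori \<sigma>) = \<sigma>" and \<rho>: "distinct (ori \<rho>)" "set (ori \<rho>) = \<rho>"
    and inj: "inj_on r \<sigma>"
  shows "boundary_coeff ori \<sigma> \<rho> =
    (\<Sum>v\<in>\<sigma>. if \<sigma> - {v} = \<rho> then list_sign r (ori \<sigma>) * list_sign r (ori \<rho>) * vertex_sign r v \<rho> else 0)"
proof -
  let ?l = "ori \<sigma>"
  have "boundary_coeff ori \<sigma> \<rho> =
      (\<Sum>i<length ?l. if \<sigma> - {?l ! i} = \<rho>
        then list_sign r (ori \<sigma>) * list_sign r (ori \<rho>) * vertex_sign r (?l ! i) \<rho> else 0)"
    unfolding boundary_coeff_def Let_def drop_nth_def[symmetric]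
  proof (intro sum.cong refl)
    fix i assume "i \<in> {..<length ?l}"
    then have i: "i < length ?l" by simp
    note dn = drop_nth_distinct[OF \<sigma>(1) i]
    show "(if set (drop_nth i ?l) = \<rho> then (- 1) ^ i * order_sign (drop_nth i ?l) (ori \<rho>) else 0)
      = (if \<sigma> - {?l ! i} = \<rho> then list_sign r ?l * list_sign r (ori \<rho>) * vertex_sign r (?l ! i) \<rho> else 0)"
    proof (cases "\<sigma> - {?l ! i} = \<rho>")
      case True
      then have "order_sign (drop_nth i ?l) (ori \<rho>) = list_sign r (drop_nth i ?l) * list_sign r (ori \<rho>)"
        using dn \<sigma>(2) \<rho> inj by (intro order_sign_eq) (auto intro: inj_on_subset)
      moreover have "(- 1) ^ i * list_sign r (drop_nth i ?l) = list_sign r ?l * vertex_sign r (?l ! i) \<rho>"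
        using alternating_drop_nth[OF \<sigma>(1) _ i, of r] inj \<sigma>(2) True by simp
      moreover have "(- 1) ^ i * (list_sign r (drop_nth i ?l) * list_sign r (ori \<rho>))
          = ((- 1) ^ i * list_sign r (drop_nth i ?l)) * list_sign r (ori \<rho>)" by (simp only: mult.assoc)
      ultimately have "(- 1) ^ i * order_sign (drop_nth i ?l) (ori \<rho>)
          = list_sign r ?l * list_sign r (ori \<rho>) * vertex_sign r (?l ! i) \<rho>" by (simp add: ac_simps)
      then show ?thesis using True dn(2) \<sigma>(2) by simp
    qed (use dn(2) \<sigma>(2) in auto)
  qed
  also have "\<dots> = (\<Sum>v\<in>\<sigma>. if \<sigma> - {v} = \<rho> then list_sign r (ori \<sigma>) * list_sign r (ori \<rho>) * vertex_sign r v \<rho> else 0)"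
    using bij_betw_nth[OF \<sigma>(1) refl \<sigma>(2)[symmetric]]
    by (rule sum.reindex_bij_betw)
  finally show ?thesis .
qed

text \<open>A function on simplices extends to vertex lists as an alternating cochain. The cocycle
  identity survives for lists with a repetition: only the two faces that drop one of the equal
  entries can contribute, and these cancel.\<close>

lemma cocycle_on_lists:
  fixes f :: "'v set \<Rightarrow> real"
  assumes inj: "inj_on r (set xs)"
    and cocycle: "distinct xs \<Longrightarrow> (\<Sum>v\<in>set xs. of_int (vertex_sign r v (set xs - {v})) * f (set xs - {v})) = 0"
  shows "(\<Sum>i<length xs. (- 1) ^ i * (of_int (list_sign r (drop_nth i xs)) * f (set (drop_nth i xs)))) = 0"
proof (cases "distinct xs")
  case True
  have "(\<Sum>i<length xs. (- 1) ^ i * (of_int (list_sign r (drop_nth i xs)) * f (set (drop_nth i xs))))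
    = (\<Sum>i<length xs. of_int (list_sign r xs) *
        (of_int (vertex_sign r (xs ! i) (set xs - {xs ! i})) * f (set xs - {xs ! i})))"
  proof (intro sum.cong refl)
    fix i assume "i \<in> {..<length xs}"
    then have i: "i < length xs" by simp
    have "(- 1) ^ i * real_of_int (list_sign r (drop_nth i xs))
        = real_of_int (list_sign r xs) * of_int (vertex_sign r (xs ! i) (set xs - {xs ! i}))"
      using arg_cong[OF alternating_drop_nth[OF True inj i], of real_of_int] by simp
    then show "(- 1) ^ i * (of_int (list_sign r (drop_nth i xs)) * f (set (drop_nth i xs)))
      = of_int (list_sign r xs) * (of_int (vertex_sign r (xs ! i) (set xs - {xs ! i})) * f (set xs - {xs ! i}))"
      using drop_nth_distinct(2)[OF True i] by (simp flip: mult.assoc)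
  qed
  also have "\<dots> = (\<Sum>v\<in>set xs. of_int (list_sign r xs) * (of_int (vertex_sign r v (set xs - {v})) * f (set xs - {v})))"
    by (rule sum.reindex_bij_betw[OF bij_betw_nth[OF True refl refl]])
  also have "\<dots> = 0" using cocycle[OF True] by (simp flip: sum_distrib_left)
  finally show ?thesis .
next
  case False
  obtain as x bs cs where "xs = as @ [x] @ bs @ [x] @ cs" using not_distinct_decomp[OF False] by blast
  then have xs: "xs = as @ x # bs @ x # cs" by simp
  define a b where "a = length as" and "b = length as + Suc (length bs)"
  let ?t = "\<lambda>i. (- 1) ^ i * (real_of_int (list_sign r (drop_nth i xs)) * f (set (drop_nth i xs)))"
  have ab: "a < length xs" "b < length xs" "a \<noteq> b" by (auto simp: a_def b_def xs)
  have "\<not> distinct (drop_nth i xs)" if i: "i < length xs" "i \<noteq> a" "i \<noteq> b" for i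
  proof
    assume dist: "distinct (drop_nth i xs)"
    \<comment> \<open>The position in \<open>drop_nth i xs\<close> of the entry that had position
      \<open>m\<close>.\<close>
    define g where "g m = (if m < i then m else m - 1)" for m
    have g: "drop_nth i xs ! g m = xs ! m" "g m < length (drop_nth i xs)" if "m < length xs" "m \<noteq> i" for m
      using that i(1) by (auto simp: drop_nth_def nth_append g_def min_def)
    have "xs ! a = x" "xs ! b = x" by (auto simp: xs a_def b_def nth_append)
    then have "g a = g b"
      using g[OF ab(1)] g[OF ab(2)] i dist by (metis nth_eq_iff_index_eq)
    then show False using ab(3) i by (auto simp: g_def split: if_splits)
  qed
  then have "(\<Sum>i<length xs. ?t i) = (\<Sum>i\<in>{a, b}. ?t i)"
    using ab by (intro sum.mono_neutral_right) (auto simp: list_sign_not_distinct)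
  also have "\<dots> = ?t a + ?t b" using ab(3) by simp
  also have "\<dots> = 0"
  proof -
    have da: "drop_nth a xs = as @ bs @ x # cs" by (simp add: drop_nth_def xs a_def)
    have db: "drop_nth b xs = as @ x # bs @ cs" by (simp add: drop_nth_def xs b_def)
    have "list_sign r (as @ bs @ x # cs) = (- 1) ^ (length as + length bs) * list_sign r (x # as @ bs @ cs)"
      using list_sign_move[of r "as @ bs" x cs] by simp
    moreover have "list_sign r (as @ x # bs @ cs) = (- 1) ^ length as * list_sign r (x # as @ bs @ cs)"
      by (rule list_sign_move)
    moreover have "set (as @ bs @ x # cs) = set (as @ x # bs @ cs)" by auto
    ultimately show ?thesis unfolding da db
      by (simp add: a_def b_def power_add)
  qed
  finally show ?thesis .
qed

section \<open>A vertex map on the realization\<close>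

text \<open>Not continuous, but points close to \<open>x\<close> are sent into the carrier of \<open>x\<close>.\<close>

definition peak :: "('v \<Rightarrow> real) \<Rightarrow> 'v" where
  "peak x = (SOME v. 0 < x v \<and> (\<forall>u. x u \<le> x v))"

definition vertex_point :: "'v \<Rightarrow> 'v \<Rightarrow> real" where
  "vertex_point v = (\<lambda>u. if u = v then 1 else 0)"

lemma peak:
  assumes x: "x \<in> closed_simplex \<sigma>" and "finite \<sigma>"
  shows "0 < x (peak x)" "x u \<le> x (peak x)" "peak x \<in> \<sigma>"
proof -
  have sum1: "sum x \<sigma> = 1" and nn: "\<And>v. 0 \<le> x v" and off: "\<And>v. v \<notin> \<sigma> \<Longrightarrow> x v = 0"
    using x by (auto simp: closed_simplex_def)
  have ne: "\<sigma> \<noteq> {}" using sum1 by auto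
  have "Max (x ` \<sigma>) \<in> x ` \<sigma>" using ne \<open>finite \<sigma>\<close> by (intro Max_in) auto
  then obtain v where v: "v \<in> \<sigma>" "x v = Max (x ` \<sigma>)" by auto
  have le: "x u \<le> x v" for u
  proof (cases "u \<in> \<sigma>")
    case True
    then show ?thesis using v(2) \<open>finite \<sigma>\<close> by simp
  next
    case False
    then show ?thesis using off nn by simp
  qed
  have "x v \<noteq> 0"
  proof
    assume "x v = 0"
    then have "x u = 0" for u using le[of u] nn[of u] by simp
    then show False using sum1 by simp
  qed
  then have "0 < x v \<and> (\<forall>u. x u \<le> x v)" using le nn[of v] by auto
  then have *: "0 < x (peak x) \<and> (\<forall>u. x u \<le> x (peak x))" unfolding peak_def by (rule someI)
  then show "0 < x (peak x)" "x u \<le> x (peak x)" by auto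
  show "peak x \<in> \<sigma>" using * off[of "peak x"] by auto
qed

lemma vertex_point_in_closed_simplex: "vertex_point v \<in> closed_simplex {v}"
  by (auto simp: vertex_point_def closed_simplex_def)

lemma peak_vertex_point: "peak (vertex_point v) = v"
  using peak(3)[OF vertex_point_in_closed_simplex] by simp

locale simplicial_complex =
  fixes K :: "'v set set"
  assumes complex: "abstract_complex K"
begin

abbreviation "X \<equiv> realization K"

lemma finite_simplex: "\<sigma> \<in> K \<Longrightarrow> finite \<sigma>" and nonempty_simplex: "\<sigma> \<in> K \<Longrightarrow> \<sigma> \<noteq> {}"
  and face_simplex: "\<sigma> \<in> K \<Longrightarrow> \<rho> \<subseteq> \<sigma> \<Longrightarrow> \<rho> \<noteq> {} \<Longrightarrow> \<rho> \<in> K"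
  using complex unfolding abstract_complex_def by blast+

lemma vertex_simplex: "v \<in> \<Union>K \<Longrightarrow> {v} \<in> K"
  using face_simplex by blast

lemma in_topspace_iff: "x \<in> topspace X \<longleftrightarrow> (\<exists>\<sigma>\<in>K. x \<in> closed_simplex \<sigma>)"
  by (auto simp: topspace_realization)

lemma support_simplex:
  assumes "x \<in> topspace X"
  shows "{v. 0 < x v} \<in> K"
proof -
  obtain \<sigma> where \<sigma>: "\<sigma> \<in> K" "x \<in> closed_simplex \<sigma>" using assms by (auto simp: in_topspace_iff)
  have "{v. 0 < x v} \<subseteq> \<sigma>" using \<sigma>(2) by (auto simp: closed_simplex_def)
  moreover have "peak x \<in> {v. 0 < x v}" using peak(1)[OF \<sigma>(2) finite_simplex[OF \<sigma>(1)]] by simp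
  ultimately show ?thesis using face_simplex[OF \<sigma>(1)] by blast
qed

text \<open>Points with a coordinate at some vertex of the carrier of \<open>x\<close> that exceeds
  all coordinates outside the carrier. Their largest coordinate then belongs to the carrier, and the
  condition is open in the weak topology.\<close>

definition star_nbhd :: "('v \<Rightarrow> real) \<Rightarrow> ('v \<Rightarrow> real) set" where
  "star_nbhd x = {y \<in> topspace X. \<exists>u. 0 < x u \<and> 0 < y u \<and> (\<forall>v. x v = 0 \<longrightarrow> y v < y u)}"

lemma openin_star_nbhd: "openin X (star_nbhd x)"
  unfolding openin_realization
proof (intro conjI ballI)
  show "star_nbhd x \<subseteq> (\<Union>\<sigma>\<in>K. closed_simplex \<sigma>)" by (auto simp: star_nbhd_def topspace_realization)
  fix \<sigma> assume \<sigma>: "\<sigma> \<in> K"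
  \<comment> \<open>Within one simplex only its finitely many vertices matter, so the condition
    becomes a union of finite intersections of open sets given by strict inequalities between
    coordinates.\<close>
  define V where "V = (\<Union>u\<in>{u. 0 < x u}. {y :: 'v \<Rightarrow> real. 0 < y u} \<inter> (\<Inter>v\<in>{v\<in>\<sigma>. x v = 0}. {y. y v < y u}))"
  have "open V"
    unfolding V_def using finite_simplex[OF \<sigma>]
    by (intro open_UN ballI open_Int open_INT open_Collect_less continuous_on_const
        continuous_on_product_coordinates) auto
  moreover have "star_nbhd x \<inter> closed_simplex \<sigma> = closed_simplex \<sigma> \<inter> V"
  proof (intro subset_antisym subsetI)
    fix y assume "y \<in> star_nbhd x \<inter> closed_simplex \<sigma>"
    then show "y \<in> closed_simplex \<sigma> \<inter> V" unfolding star_nbhd_def V_def by blast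
  next
    fix y assume y: "y \<in> closed_simplex \<sigma> \<inter> V"
    then obtain u where u: "0 < x u" "0 < y u" "\<And>v. v \<in> \<sigma> \<Longrightarrow> x v = 0 \<Longrightarrow> y v < y u"
      unfolding V_def by blast
    have "y v < y u" if "x v = 0" for v
      using u(2) u(3)[of v] that y by (cases "v \<in> \<sigma>") (auto simp: closed_simplex_def)
    then show "y \<in> star_nbhd x \<inter> closed_simplex \<sigma>"
      using u y \<sigma> unfolding star_nbhd_def in_topspace_iff by blast
  qed
  ultimately show "openin (top_of_set (closed_simplex \<sigma>)) (star_nbhd x \<inter> closed_simplex \<sigma>)"
    by (auto simp: openin_open)
qed

lemma in_star_nbhd:
  assumes "x \<in> topspace X"
  shows "x \<in> star_nbhd x"
proof -
  obtain \<sigma> where \<sigma>: "\<sigma> \<in> K" "x \<in> closed_simplex \<sigma>" using assms by (auto simp: in_topspace_iff)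
  show ?thesis
    using assms peak(1)[OF \<sigma>(2) finite_simplex[OF \<sigma>(1)]]
    by (auto simp: star_nbhd_def intro!: exI[of _ "peak x"])
qed

lemma peak_star_nbhd:
  assumes "y \<in> star_nbhd x" "x \<in> topspace X"
  shows "0 < x (peak y)"
proof -
  obtain u where u: "\<And>v. x v = 0 \<Longrightarrow> y v < y u" and y: "y \<in> topspace X"
    using assms(1) by (auto simp: star_nbhd_def)
  obtain \<sigma> where \<sigma>: "\<sigma> \<in> K" "y \<in> closed_simplex \<sigma>" using y by (auto simp: in_topspace_iff)
  have "x (peak y) \<noteq> 0" using u[of "peak y"] peak(2)[OF \<sigma>(2) finite_simplex[OF \<sigma>(1)], of u] by auto
  moreover have "0 \<le> x (peak y)" using assms(2) by (auto simp: in_topspace_iff closed_simplex_def)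
  ultimately show ?thesis by simp
qed

text \<open>Points of \<open>star_nbhd x\<close> have their peak in the carrier of \<open>x\<close>,
  where any two vertices span an edge. So \<open>f\<close> composed with \<open>peak\<close> is
  locally constant on a connected space.\<close>

lemma constant_on_vertices:
  assumes conn: "connected_space X" and f: "\<And>u v. {u, v} \<in> K \<Longrightarrow> f u = f v"
    and uv: "u \<in> \<Union>K" "v \<in> \<Union>K"
  shows "f u = f v"
proof -
  define T where "T = {y \<in> topspace X. f (peak y) = f v}"
  have loc: "f (peak y) = f (peak x)" if x: "x \<in> topspace X" and y: "y \<in> star_nbhd x" for x y
  proof -
    have "{peak y, peak x} \<subseteq> {v. 0 < x v}"
      using peak_star_nbhd[OF y x] peak_star_nbhd[OF in_star_nbhd[OF x] x] by simp
    then have "{peak y, peak x} \<in> K" using face_simplex[OF support_simplex[OF x]] by blast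
    then show ?thesis by (rule f)
  qed
  have op: "openin X {y \<in> topspace X. P (f (peak y))}" for P
  proof (subst openin_subopen, intro ballI)
    fix x assume x: "x \<in> {y \<in> topspace X. P (f (peak y))}"
    have "star_nbhd x \<subseteq> {y \<in> topspace X. P (f (peak y))}"
    proof
      fix y assume y: "y \<in> star_nbhd x"
      then have "y \<in> topspace X" by (simp add: star_nbhd_def)
      then show "y \<in> {y \<in> topspace X. P (f (peak y))}" using loc[OF _ y] x by simp
    qed
    then show "\<exists>U. openin X U \<and> x \<in> U \<and> U \<subseteq> {y \<in> topspace X. P (f (peak y))}"
      using openin_star_nbhd in_star_nbhd x by blast
  qed
  have "topspace X - T = {y \<in> topspace X. f (peak y) \<noteq> f v}" by (auto simp: T_def)
  then have "closedin X T" using op[of "\<lambda>a. a \<noteq> f v"] by (auto simp: closedin_def T_def)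
  moreover have "openin X T" unfolding T_def by (rule op)
  moreover have vp: "vertex_point w \<in> topspace X" if "w \<in> \<Union>K" for w
    unfolding in_topspace_iff
    by (rule bexI[where x = "{w}"]) (rule vertex_point_in_closed_simplex, rule vertex_simplex[OF that])
  moreover have "vertex_point v \<in> T" using vp[OF uv(2)] by (simp add: T_def peak_vertex_point)
  ultimately have "T = topspace X" using conn unfolding connected_space_clopen_in by (metis empty_iff)
  then have "vertex_point u \<in> T" using vp[OF uv(1)] by simp
  then show ?thesis by (simp add: T_def peak_vertex_point)
qed

section \<open>Singular simplices and vertex lists\<close>

text \<open>The affine singular simplex through the listed vertices, repetitions allowed;
  \<open>restrict\<close> is there because singular simplices are extensional functions.\<close>

definition affine_simplex :: "'v list \<Rightarrow> (nat \<Rightarrow> real) \<Rightarrow> 'v \<Rightarrow> real" where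
  "affine_simplex l = restrict (\<lambda>t v. \<Sum>i<length l. if l ! i = v then t i else 0)
     (standard_simplex (length l - 1))"

definition basis_point :: "nat \<Rightarrow> nat \<Rightarrow> real" where
  "basis_point i = (\<lambda>j. if j = i then 1 else 0)"

text \<open>Sends a singular simplex to the peaks of its corners. It commutes with faces, which is
  what evaluating cochains requires.\<close>

definition vertex_list :: "nat \<Rightarrow> ((nat \<Rightarrow> real) \<Rightarrow> 'v \<Rightarrow> real) \<Rightarrow> 'v list" where
  "vertex_list p g = map (\<lambda>i. peak (g (basis_point i))) [0..<Suc p]"

lemma basis_point_simplex: "basis_point i \<in> standard_simplex p \<longleftrightarrow> i \<le> p"
  unfolding basis_point_def by (rule basis_in_standard_simplex)

lemma affine_simplex_closed_simplex:
  assumes l: "length l = Suc p" and t: "t \<in> standard_simplex p"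
  shows "affine_simplex l t \<in> closed_simplex (set l)"
proof -
  have eq: "affine_simplex l t = (\<lambda>v. \<Sum>i<length l. if l ! i = v then t i else 0)"
    using l t by (simp add: affine_simplex_def)
  have nn: "0 \<le> (\<Sum>i<length l. if l ! i = v then t i else 0)" for v
    using t by (intro sum_nonneg) (auto simp: standard_simplex_def)
  have off: "(\<Sum>i<length l. if l ! i = v then t i else 0) = 0" if "v \<notin> set l" for v
    using that by (intro sum.neutral) auto
  have "(\<Sum>v\<in>set l. \<Sum>i<length l. if l ! i = v then t i else 0) = (\<Sum>i<length l. \<Sum>v\<in>set l. if l ! i = v then t i else 0)"
    by (rule sum.swap)
  also have "\<dots> = (\<Sum>i<length l. t i)" by (intro sum.cong) auto
  also have "\<dots> = 1" using t unfolding l by (simp only: standard_simplex_def lessThan_Suc_atMost mem_Collect_eq)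
  finally show ?thesis unfolding eq closed_simplex_def using nn off by blast
qed

lemma singular_simplex_affine:
  assumes l: "length l = Suc p" and K: "set l \<in> K"
  shows "singular_simplex p (subtopology X (closed_simplex (set l))) (affine_simplex l)"
proof -
  \<comment> \<open>Inclusion of a closed simplex, with its subspace topology as a set of functions,
    into the realization is continuous by the definition of the weak topology.\<close>
  have incl: "continuous_map (top_of_set (closed_simplex (set l))) X id"
    unfolding continuous_map_def
  proof (intro conjI allI impI)
    show "id \<in> topspace (top_of_set (closed_simplex (set l))) \<rightarrow> topspace X"
      using K by (auto simp: topspace_realization)
    fix U assume "openin X U"
    then have "openin (top_of_set (closed_simplex (set l))) (U \<inter> closed_simplex (set l))"
      using K by (simp add: openin_realization)
    moreover have "{x \<in> topspace (top_of_set (closed_simplex (set l))). id x \<in> U} = U \<inter> closed_simplex (set l)"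
      by auto
    ultimately show "openin (top_of_set (closed_simplex (set l)))
        {x \<in> topspace (top_of_set (closed_simplex (set l))). id x \<in> U}" by simp
  qed
  let ?S = "subtopology (powertop_real UNIV) (standard_simplex p)"
  have "continuous_map ?S euclidean (\<lambda>t v. \<Sum>i<length l. if l ! i = v then t i else 0)"
    unfolding euclidean_product_topology[symmetric] continuous_map_componentwise_UNIV
  proof
    fix v
    have "continuous_map (powertop_real UNIV) euclideanreal (\<lambda>t. if l ! i = v then t i else 0)" for i
      by (cases "l ! i = v") (auto intro: continuous_map_product_projection)
    then show "continuous_map ?S euclideanreal (\<lambda>t. \<Sum>i<length l. if l ! i = v then t i else 0)"
      by (intro continuous_map_sum continuous_map_from_subtopology) auto
  qed
  then have "continuous_map ?S euclidean (affine_simplex l)"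
    by (rule continuous_map_eq) (simp add: affine_simplex_def l)
  then have "continuous_map ?S (top_of_set (closed_simplex (set l))) (affine_simplex l)"
    using affine_simplex_closed_simplex[OF l] by (auto simp: continuous_map_in_subtopology)
  then have "continuous_map ?S X (id \<circ> affine_simplex l)" using incl by (rule continuous_map_compose)
  then have "singular_simplex p X (affine_simplex l)"
    by (simp add: singular_simplex_def affine_simplex_def l)
  then show ?thesis
    using affine_simplex_closed_simplex[OF l] by (auto simp: singular_simplex_subtopology)
qed

lemma drop_nth_nth:
  assumes "k < length l" "i < length l - 1"
  shows "drop_nth k l ! i = l ! (if i < k then i else Suc i)"
  using assms by (auto simp: drop_nth_def nth_append min_def)

lemma length_drop_nth: "k < length l \<Longrightarrow> length (drop_nth k l) = length l - 1"
  by (simp add: drop_nth_def)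

lemma singular_face_affine:
  assumes l: "length l = Suc p" and "1 \<le> p" "k \<le> p"
  shows "singular_face p k (affine_simplex l) = affine_simplex (drop_nth k l)"
proof
  fix t
  have len: "length (drop_nth k l) - 1 = p - Suc 0" "length (drop_nth k l) = p"
    using l assms by (simp_all add: length_drop_nth)
  show "singular_face p k (affine_simplex l) t = affine_simplex (drop_nth k l) t"
  proof (cases "t \<in> standard_simplex (p - Suc 0)")
    case True
    then have ft: "simplical_face k t \<in> standard_simplex p"
      using simplical_face_in_standard_simplex assms by blast
    show ?thesis
    proof
      fix v
      let ?\<phi> = "\<lambda>i. if i < k then i else Suc i"
      have bij: "bij_betw ?\<phi> {..<p} ({..<Suc p} - {k})"
        by (rule bij_betw_byWitness[where f' = "\<lambda>i. if i < k then i else i - 1"])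
          (use assms in \<open>auto split: if_splits\<close>)
      have "singular_face p k (affine_simplex l) t v = (\<Sum>i<Suc p. if l ! i = v then simplical_face k t i else 0)"
        using True ft l by (simp add: singular_face_def affine_simplex_def)
      also have "\<dots> = (\<Sum>i\<in>{..<Suc p} - {k}. if l ! i = v then simplical_face k t i else 0)"
        by (intro sum.mono_neutral_right) (auto simp: simplical_face_def)
      also have "\<dots> = (\<Sum>i<p. if l ! ?\<phi> i = v then simplical_face k t (?\<phi> i) else 0)"
        by (rule sum.reindex_bij_betw[OF bij, symmetric])
      also have "\<dots> = (\<Sum>i<p. if drop_nth k l ! i = v then t i else 0)"
        using assms by (intro sum.cong refl) (auto simp: drop_nth_nth simplical_face_def)
      also have "\<dots> = affine_simplex (drop_nth k l) t v"
        using True len by (simp add: affine_simplex_def)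
      finally show "singular_face p k (affine_simplex l) t v = affine_simplex (drop_nth k l) t v" .
    qed
  next
    case False
    then show ?thesis using len by (simp add: singular_face_def affine_simplex_def)
  qed
qed

lemma length_vertex_list [simp]: "length (vertex_list p g) = Suc p"
  by (simp add: vertex_list_def)

lemma vertex_list_face:
  assumes "k \<le> Suc p"
  shows "vertex_list p (singular_face (Suc p) k g) = drop_nth k (vertex_list (Suc p) g)"
proof (rule nth_equalityI)
  show "length (vertex_list p (singular_face (Suc p) k g)) = length (drop_nth k (vertex_list (Suc p) g))"
    using assms by (simp add: length_drop_nth)
  fix i assume "i < length (vertex_list p (singular_face (Suc p) k g))"
  then have i: "i < Suc p" by simp
  have "simplical_face k (basis_point i) = basis_point (if i < k then i else Suc i)"
    by (auto simp: simplical_face_def basis_point_def fun_eq_iff)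
  moreover have "basis_point i \<in> standard_simplex p" using i by (simp add: basis_point_simplex)
  ultimately have "singular_face (Suc p) k g (basis_point i) = g (basis_point (if i < k then i else Suc i))"
    by (simp add: singular_face_def)
  then show "vertex_list p (singular_face (Suc p) k g) ! i = drop_nth k (vertex_list (Suc p) g) ! i"
    using i assms by (simp add: drop_nth_nth vertex_list_def del: upt_Suc)
qed

lemma vertex_list_affine:
  assumes l: "length l = Suc p"
  shows "vertex_list p (affine_simplex l) = l"
proof (rule nth_equalityI)
  fix i assume "i < length (vertex_list p (affine_simplex l))"
  then have i: "i \<le> p" by simp
  have "affine_simplex l (basis_point i) = vertex_point (l ! i)"
  proof
    fix v
    have "(\<Sum>m<length l. if l ! m = v then basis_point i m else 0)
        = (\<Sum>m<length l. if m = i then (if l ! i = v then 1 else 0) else 0)"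
      by (intro sum.cong) (auto simp: basis_point_def)
    then show "affine_simplex l (basis_point i) v = vertex_point (l ! i) v"
      using i l by (auto simp: affine_simplex_def basis_point_simplex vertex_point_def)
  qed
  then show "vertex_list p (affine_simplex l) ! i = l ! i"
    using i by (simp add: vertex_list_def peak_vertex_point del: upt_Suc)
qed (simp add: l)

section \<open>Evaluation of cochains on singular chains through vertex lists\<close>

definition pairing :: "('v list \<Rightarrow> real) \<Rightarrow> nat \<Rightarrow> ('v \<Rightarrow> real) chain \<Rightarrow> real" where
  "pairing w p c = (\<Sum>g\<in>Poly_Mapping.keys c. of_int (lookup c g) * w (vertex_list p g))"

lemma pairing_superset:
  "finite S \<Longrightarrow> Poly_Mapping.keys c \<subseteq> S \<Longrightarrow> pairing w p c = (\<Sum>g\<in>S. of_int (lookup c g) * w (vertex_list p g))"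
  unfolding pairing_def by (intro sum.mono_neutral_left) (auto simp: in_keys_iff)

lemma pairing_add: "pairing w p (a + b) = pairing w p a + pairing w p b"
proof -
  have "Poly_Mapping.keys (a + b) \<subseteq> Poly_Mapping.keys a \<union> Poly_Mapping.keys b" by (rule Poly_Mapping.keys_add)
  then show ?thesis
    by (simp add: pairing_superset[of "Poly_Mapping.keys a \<union> Poly_Mapping.keys b"] lookup_add
        sum.distrib distrib_right)
qed

lemma pairing_zero [simp]: "pairing w p 0 = 0"
  by (simp add: pairing_def)

lemma pairing_diff: "pairing w p (a - b) = pairing w p a - pairing w p b"
  using pairing_add[of w p "a - b" b] by simp

lemma pairing_sum: "pairing w p (sum f A) = (\<Sum>x\<in>A. pairing w p (f x))"
  by (induction A rule: infinite_finite_induct) (auto simp: pairing_add)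

lemma pairing_cmul_of: "pairing w p (frag_cmul c (frag_of g)) = of_int c * w (vertex_list p g)"
  by (subst pairing_superset[of "{g}"]) (use keys_cmul[of c "frag_of g"] in \<open>auto simp: lookup_single\<close>)

text \<open>The condition on \<open>c\<close> is what allows the cocycle identity to be applied to
  each vertex list; for a large singular simplex the peaks of the corners need not span a
  simplex.\<close>

lemma pairing_boundary_eq_0:
  assumes inj: "inj_on r (\<Union>K)"
    and cocycle: "\<And>\<sigma>. \<sigma> \<in> simplices K (Suc p) \<Longrightarrow> (\<Sum>v\<in>\<sigma>. of_int (vertex_sign r v (\<sigma> - {v})) * f (\<sigma> - {v})) = 0"
    and c: "Poly_Mapping.keys c \<subseteq> {g. set (vertex_list (Suc p) g) \<in> K}"
  shows "pairing (\<lambda>l. of_int (list_sign r l) * f (set l)) p (chain_boundary (Suc p) c) = 0"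
  using c
proof (induction c rule: frag_induction)
  case (one g)
  let ?l = "vertex_list (Suc p) g"
  have K: "set ?l \<in> K" using one by simp
  have "pairing (\<lambda>l. of_int (list_sign r l) * f (set l)) p (chain_boundary (Suc p) (frag_of g))
    = (\<Sum>k\<le>Suc p. (- 1) ^ k * (of_int (list_sign r (drop_nth k ?l)) * f (set (drop_nth k ?l))))"
    unfolding chain_boundary_of if_not_P[OF nat.simps(3)] pairing_sum pairing_cmul_of
    by (intro sum.cong refl) (simp add: vertex_list_face)
  also have "\<dots> = (\<Sum>k<length ?l. (- 1) ^ k * (of_int (list_sign r (drop_nth k ?l)) * f (set (drop_nth k ?l))))"
    by (simp only: length_vertex_list lessThan_Suc_atMost)
  also have "\<dots> = 0"
  proof (rule cocycle_on_lists)
    show "inj_on r (set ?l)" using K inj by (meson Sup_upper inj_on_subset)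
    assume "distinct ?l"
    then have "set ?l \<in> simplices K (Suc p)" using K by (simp add: simplices_def distinct_card)
    then show "(\<Sum>v\<in>set ?l. of_int (vertex_sign r v (set ?l - {v})) * f (set ?l - {v})) = 0"
      by (rule cocycle)
  qed
  finally show ?case .
qed (auto simp: chain_boundary_diff pairing_diff)

lemma singular_chain_subdivision_power:
  "singular_chain p Y c \<Longrightarrow> singular_chain p Y ((singular_subdivision p ^^ n) c)"
  by (induction n) (auto intro: singular_chain_singular_subdivision)

lemma chain_boundary_subdivision_power:
  "singular_chain (Suc p) Y c \<Longrightarrow>
    chain_boundary (Suc p) ((singular_subdivision (Suc p) ^^ n) c) = (singular_subdivision p ^^ n) (chain_boundary (Suc p) c)"
  by (induction n)
    (simp_all add: chain_boundary_singular_subdivision[OF singular_chain_subdivision_power])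

lemma vertex_list_in_complex:
  assumes "\<sigma> \<in> K" "\<And>i. i \<le> p \<Longrightarrow> peak (g (basis_point i)) \<in> \<sigma>"
  shows "set (vertex_list p g) \<in> K"
  by (rule face_simplex[OF assms(1)]) (use assms(2) in \<open>auto simp: vertex_list_def\<close>)

text \<open>Modulo boundaries of chains whose simplices have their peaks in one simplex of the complex, a
  chain of affine simplices may be subdivided, and so may a chain that it bounds.\<close>

lemma affine_cycle_pairing_eq_0:
  assumes contr: "contractible_space X" and p: "1 \<le> p" and inj: "inj_on r (\<Union>K)"
    and cocycle: "\<And>\<sigma>. \<sigma> \<in> simplices K (Suc p) \<Longrightarrow> (\<Sum>v\<in>\<sigma>. of_int (vertex_sign r v (\<sigma> - {v})) * f (\<sigma> - {v})) = 0"
    and c: "Poly_Mapping.keys c \<subseteq> affine_simplex ` {l. length l = Suc p \<and> set l \<in> K}"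
    and cycle: "chain_boundary p c = 0"
  shows "pairing (\<lambda>l. of_int (list_sign r l) * f (set l)) p c = 0"
proof -
  let ?w = "\<lambda>l. of_int (list_sign r l) * f (set l)"
  have cX: "singular_chain p X c"
    unfolding singular_chain_def using c singular_simplex_affine
    by (force simp: singular_simplex_subtopology)
  have "singular_relcycle p X {} c" using cX cycle by (simp add: singular_cycle)
  then have "homologous_rel_set p X {} c \<in> carrier (homology_group (int p) X)"
    by (simp add: carrier_relative_homology_group)
  moreover have "trivial_group (homology_group (int p) X)"
    using trivial_reduced_homology_group_contractible_space[OF contr, of "int p"] p
    by (simp add: un_reduced_homology_group)
  ultimately have "homologous_rel_set p X {} c = singular_relboundary_set p X {}"
    by (simp add: trivial_group_def)
  moreover have "c \<in> homologous_rel_set p X {} c" by simp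
  ultimately have "singular_relboundary p X {} c" by simp
  then obtain b where b: "singular_chain (Suc p) X b" "chain_boundary (Suc p) b = c"
    unfolding singular_boundary by blast
  have "topspace X \<subseteq> \<Union>(star_nbhd ` topspace X)" using in_star_nbhd by blast
  \<comment> \<open>After enough subdivisions every simplex of \<open>b\<close> lies in one star
    neighbourhood, so that the peaks of its corners span a simplex of the complex.\<close>
  then obtain n where n: "\<And>m g. \<lbrakk>n \<le> m; g \<in> Poly_Mapping.keys ((singular_subdivision (Suc p) ^^ m) b)\<rbrakk>
      \<Longrightarrow> \<exists>V\<in>star_nbhd ` topspace X. g \<in> standard_simplex (Suc p) \<rightarrow> V"
    using sufficient_iterated_singular_subdivision_exists[of "star_nbhd ` topspace X" X "Suc p" b]
      openin_star_nbhd b(1) by blast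
  let ?sb = "(singular_subdivision (Suc p) ^^ n) b"
  have "Poly_Mapping.keys ?sb \<subseteq> {g. set (vertex_list (Suc p) g) \<in> K}"
  proof
    fix g assume "g \<in> Poly_Mapping.keys ?sb"
    then obtain x where x: "x \<in> topspace X" "g \<in> standard_simplex (Suc p) \<rightarrow> star_nbhd x"
      using n[OF order_refl] by blast
    have "set (vertex_list (Suc p) g) \<in> K"
    proof (rule vertex_list_in_complex[OF support_simplex[OF x(1)]])
      fix i assume "i \<le> Suc p"
      then have "g (basis_point i) \<in> star_nbhd x" using x(2) by (auto simp: basis_point_simplex)
      then show "peak (g (basis_point i)) \<in> {v. 0 < x v}" using peak_star_nbhd x(1) by simp
    qed
    then show "g \<in> {g. set (vertex_list (Suc p) g) \<in> K}" by simp
  qed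
  then have "pairing ?w p (chain_boundary (Suc p) ?sb) = 0"
    using pairing_boundary_eq_0[where f = f, OF inj] cocycle by blast
  \<comment> \<open>The subdivision of \<open>c\<close> is the boundary of the subdivision of
    \<open>b\<close>, since subdivision is a chain map.\<close>
  then have small: "pairing ?w p ((singular_subdivision p ^^ n) c) = 0"
    using chain_boundary_subdivision_power[OF b(1)] b(2) by simp
  \<comment> \<open>The chain homotopy from the identity to the iterated subdivision respects
    subspaces: applied to an affine simplex it stays inside the closed simplex on the same vertices,
    so the corner peaks are vertices of that simplex.\<close>
  obtain h where h0: "\<And>p. h p 0 = (0 :: ('v \<Rightarrow> real) chain)"
    and hdiff: "\<And>p c1 c2. h p (c1 - c2) = h p c1 - h p c2"
    and hch: "\<And>p Y c. singular_chain p Y c \<Longrightarrow> singular_chain (Suc p) Y (h p c)"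
    and hb: "\<And>p Y c. singular_chain p Y c
         \<Longrightarrow> chain_boundary (Suc p) (h p c) + h (p - Suc 0) (chain_boundary p c) = (singular_subdivision p ^^ n) c - c"
    by (rule chain_homotopic_iterated_singular_subdivision[where n = n and 'a = "'v \<Rightarrow> real"], rule that)
  have "Poly_Mapping.keys (h p c) \<subseteq> {g. set (vertex_list (Suc p) g) \<in> K}"
    using c
  proof (induction c rule: frag_induction)
    case (one g)
    then obtain l where l: "length l = Suc p" "set l \<in> K" "g = affine_simplex l" by auto
    have "singular_chain (Suc p) (subtopology X (closed_simplex (set l))) (h p (frag_of g))"
      using singular_simplex_affine[OF l(1,2)] l(3) by (intro hch) (simp add: singular_chain_of)
    then have im: "\<And>g'. g' \<in> Poly_Mapping.keys (h p (frag_of g)) \<Longrightarrow> g' ` standard_simplex (Suc p) \<subseteq> closed_simplex (set l)"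
      by (auto simp: singular_chain_subtopology)
    show ?case
    proof
      fix g' assume g': "g' \<in> Poly_Mapping.keys (h p (frag_of g))"
      have "set (vertex_list (Suc p) g') \<in> K"
      proof (rule vertex_list_in_complex[OF l(2)])
        fix i assume "i \<le> Suc p"
        then have "g' (basis_point i) \<in> closed_simplex (set l)" using im[OF g'] by (auto simp: basis_point_simplex)
        then show "peak (g' (basis_point i)) \<in> set l" by (rule peak(3)) simp
      qed
      then show "g' \<in> {g. set (vertex_list (Suc p) g) \<in> K}" by simp
    qed
  next
    case (diff a b)
    then show ?case unfolding hdiff using keys_diff[of "h p a" "h p b"] by blast
  qed (simp add: h0)
  then have "pairing ?w p (chain_boundary (Suc p) (h p c)) = 0"
    using pairing_boundary_eq_0[where f = f, OF inj] cocycle by blast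
  moreover have "chain_boundary (Suc p) (h p c) = (singular_subdivision p ^^ n) c - c"
    using hb[OF cX] cycle h0 by simp
  ultimately show ?thesis using small by (simp add: pairing_diff)
qed

end

section \<open>Acyclicity of contractible complexes\<close>

definition ordered_list :: "('v \<Rightarrow> nat) \<Rightarrow> 'v set \<Rightarrow> 'v list" where
  "ordered_list r \<sigma> = map (inv_into \<sigma> r) (sorted_list_of_set (r ` \<sigma>))"

lemma ordered_list:
  assumes "finite \<sigma>" "inj_on r \<sigma>"
  shows "set (ordered_list r \<sigma>) = \<sigma>" "distinct (ordered_list r \<sigma>)"
    "map r (ordered_list r \<sigma>) = sorted_list_of_set (r ` \<sigma>)"
proof -
  have set: "set (sorted_list_of_set (r ` \<sigma>)) = r ` \<sigma>" using assms(1) by simp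
  show "map r (ordered_list r \<sigma>) = sorted_list_of_set (r ` \<sigma>)"
    unfolding ordered_list_def map_map
    by (rule map_idI) (use assms in \<open>auto simp: f_inv_into_f\<close>)
  show "set (ordered_list r \<sigma>) = \<sigma>"
    unfolding ordered_list_def set_map set using assms by (simp add: inv_into_image_cancel)
  show "distinct (ordered_list r \<sigma>)"
    unfolding ordered_list_def using assms
    by (simp add: distinct_map inj_on_inv_into)
qed

lemma ordered_list_unique:
  assumes "distinct l" "inj_on r (set l)" "sorted (map r l)"
  shows "l = ordered_list r (set l)"
proof -
  have "map r l = sorted_list_of_set (r ` set l)"
    using assms sorted_distinct_set_unique[of "map r l" "sorted_list_of_set (r ` set l)"]
    by (simp add: distinct_map)
  then have "map r l = map r (ordered_list r (set l))"
    using ordered_list(3)[OF _ assms(2)] by simp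
  moreover have "inj_on r (set l \<union> set (ordered_list r (set l)))"
    using ordered_list(1)[OF _ assms(2)] assms(2) by simp
  ultimately show ?thesis by (metis inj_on_map_eq_map)
qed

lemma list_sign_sorted:
  "distinct l \<Longrightarrow> inj_on r (set l) \<Longrightarrow> sorted (map r l) \<Longrightarrow> list_sign r l = 1"
proof (induction l)
  case (Cons x xs)
  have "rank_sign r x y = 1" if "y \<in> set xs" for y
  proof -
    have "r x \<le> r y" "r x \<noteq> r y" using Cons.prems that by (auto simp: inj_on_def)
    then show ?thesis by (simp add: rank_sign_def)
  qed
  then have "map (rank_sign r x) xs = map (\<lambda>_. 1) xs" by simp
  moreover have "prod_list (map (\<lambda>_. 1 :: int) xs) = 1" by (induction xs) auto
  ultimately have "prod_list (map (rank_sign r x) xs) = 1" by metis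
  moreover have "list_sign r xs = 1" using Cons by (simp add: inj_on_def)
  ultimately show ?case by simp
qed simp

lemma list_sign_ordered_list:
  "finite \<sigma> \<Longrightarrow> inj_on r \<sigma> \<Longrightarrow> list_sign r (ordered_list r \<sigma>) = 1"
  by (rule list_sign_sorted) (simp_all add: ordered_list)

lemma drop_nth_ordered_list:
  assumes "finite \<sigma>" "inj_on r \<sigma>" "k < length (ordered_list r \<sigma>)"
  shows "drop_nth k (ordered_list r \<sigma>) = ordered_list r (\<sigma> - {ordered_list r \<sigma> ! k})"
proof -
  note o = ordered_list[OF assms(1,2)]
  note d = drop_nth_distinct[OF o(2) assms(3)]
  have "map r (drop_nth k (ordered_list r \<sigma>)) = drop_nth k (sorted_list_of_set (r ` \<sigma>))"
    unfolding drop_nth_def o(3)[symmetric] by (simp add: take_map drop_map)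
  moreover have "sorted (drop_nth k xs)" if "sorted xs" for xs :: "nat list"
  proof -
    have "sorted (take k xs @ drop k xs)" using that by simp
    then show ?thesis
      unfolding drop_nth_def sorted_append using that set_drop_subset_set_drop[of k "Suc k" xs]
      by (auto simp: sorted_wrt_drop)
  qed
  ultimately have "sorted (map r (drop_nth k (ordered_list r \<sigma>)))" by simp
  then show ?thesis
    using ordered_list_unique[OF d(1)] d(2) o(1) assms(2) by (simp add: inj_on_diff)
qed

context simplicial_complex
begin

text \<open>A simplicial cycle becomes a singular one when each simplex is parametrized affinely
  with its vertices in increasing order. The list signs are then \<open>1\<close>, and the singular
  boundary has the incidence numbers as coefficients.\<close>

lemma integral_cycle_pairing_eq_0:
  fixes c :: "'v set \<Rightarrow> int" and f :: "'v set \<Rightarrow> real"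
  assumes contr: "contractible_space X" and p: "1 \<le> p" and inj: "inj_on r (\<Union>K)"
    and cocycle: "\<And>\<sigma>. \<sigma> \<in> simplices K (Suc p) \<Longrightarrow> (\<Sum>v\<in>\<sigma>. of_int (vertex_sign r v (\<sigma> - {v})) * f (\<sigma> - {v})) = 0"
    and S: "finite S" "S \<subseteq> simplices K p"
    and cycle: "\<And>\<rho>. (\<Sum>\<sigma>\<in>S. \<Sum>v\<in>\<sigma>. if \<sigma> - {v} = \<rho> then vertex_sign r v \<rho> * c \<sigma> else 0) = 0"
  shows "(\<Sum>\<sigma>\<in>S. of_int (c \<sigma>) * f \<sigma>) = 0"
proof -
  let ?w = "\<lambda>l. real_of_int (list_sign r l) * f (set l)"
  let ?A = "\<lambda>\<sigma>. affine_simplex (ordered_list r \<sigma>)"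
  define z where "z = (\<Sum>\<sigma>\<in>S. frag_cmul (c \<sigma>) (frag_of (?A \<sigma>)))"
  have SK: "\<sigma> \<in> K" "finite \<sigma>" "inj_on r \<sigma>" "card \<sigma> = Suc p" if "\<sigma> \<in> S" for \<sigma>
    using that S(2) finite_simplex inj by (auto simp: simplices_def intro: inj_on_subset)
  note o = ordered_list[OF SK(2,3)]
  have len: "length (ordered_list r \<sigma>) = Suc p" if "\<sigma> \<in> S" for \<sigma>
    using distinct_card[OF o(2)[OF that that]] o(1)[OF that that] SK(4)[OF that] by simp
  have keys: "Poly_Mapping.keys z \<subseteq> affine_simplex ` {l. length l = Suc p \<and> set l \<in> K}"
  proof -
    have "Poly_Mapping.keys (frag_cmul (c \<sigma>) (frag_of (?A \<sigma>))) \<subseteq> affine_simplex ` {l. length l = Suc p \<and> set l \<in> K}"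
      if "\<sigma> \<in> S" for \<sigma>
    proof -
      have "ordered_list r \<sigma> \<in> {l. length l = Suc p \<and> set l \<in> K}"
        using len[OF that] o(1)[OF that that] SK(1)[OF that] by (simp only: mem_Collect_eq simp_thms)
      then have "?A \<sigma> \<in> affine_simplex ` {l. length l = Suc p \<and> set l \<in> K}" by (rule imageI)
      moreover have "Poly_Mapping.keys (frag_cmul (c \<sigma>) (frag_of (?A \<sigma>))) \<subseteq> {?A \<sigma>}"
        using keys_cmul[of "c \<sigma>" "frag_of (?A \<sigma>)"] by (simp only: keys_frag_of)
      ultimately show ?thesis by blast
    qed
    then have "(\<Union>\<sigma>\<in>S. Poly_Mapping.keys (frag_cmul (c \<sigma>) (frag_of (?A \<sigma>))))
        \<subseteq> affine_simplex ` {l. length l = Suc p \<and> set l \<in> K}" by (rule UN_least)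
    then show ?thesis unfolding z_def
      using Poly_Mapping.keys_sum[of "\<lambda>\<sigma>. frag_cmul (c \<sigma>) (frag_of (?A \<sigma>))" S] by (rule order_trans[rotated])
  qed
  have "chain_boundary p z = 0"
  proof -
    have bd: "chain_boundary p (frag_cmul (c \<sigma>) (frag_of (?A \<sigma>)))
        = (\<Sum>v\<in>\<sigma>. frag_cmul (vertex_sign r v (\<sigma> - {v}) * c \<sigma>) (frag_of (?A (\<sigma> - {v}))))" if "\<sigma> \<in> S" for \<sigma>
    proof -
      let ?l = "ordered_list r \<sigma>"
      have "chain_boundary p (frag_cmul (c \<sigma>) (frag_of (?A \<sigma>)))
        = (\<Sum>k\<le>p. frag_cmul (c \<sigma>) (frag_cmul ((- 1) ^ k) (frag_of (singular_face p k (?A \<sigma>)))))"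
        using p by (simp add: chain_boundary_cmul chain_boundary_of frag_cmul_sum)
      also have "\<dots> = (\<Sum>k<length ?l. frag_cmul (vertex_sign r (?l ! k) (\<sigma> - {?l ! k}) * c \<sigma>) (frag_of (?A (\<sigma> - {?l ! k}))))"
        unfolding len[OF that] lessThan_Suc_atMost
      proof (intro sum.cong refl)
        fix k assume "k \<in> {..p}"
        then have k: "k < length ?l" "k \<le> p" using len[OF that] by auto
        note dn = drop_nth_ordered_list[OF SK(2)[OF that] SK(3)[OF that] k(1)]
        have i: "inj_on r (\<sigma> - {?l ! k})"
          using SK(3)[OF that] by (rule inj_on_subset) blast
        have f: "finite (\<sigma> - {?l ! k})" using SK(2)[OF that] by simp
        have ir: "inj_on r (set ?l)" using SK(3)[OF that] o(1)[OF that that] by simp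
        have "(- 1) ^ k = vertex_sign r (?l ! k) (\<sigma> - {?l ! k})"
          using alternating_drop_nth[OF o(2)[OF that that] ir k(1)]
          unfolding dn list_sign_ordered_list[OF f i] list_sign_ordered_list[OF SK(2)[OF that] SK(3)[OF that]]
            o(1)[OF that that] by simp
        moreover have "singular_face p k (?A \<sigma>) = ?A (\<sigma> - {?l ! k})"
          using singular_face_affine[OF len[OF that] p k(2)] unfolding dn .
        ultimately show "frag_cmul (c \<sigma>) (frag_cmul ((- 1) ^ k) (frag_of (singular_face p k (?A \<sigma>))))
          = frag_cmul (vertex_sign r (?l ! k) (\<sigma> - {?l ! k}) * c \<sigma>) (frag_of (?A (\<sigma> - {?l ! k})))"
          by (simp add: mult.commute)
      qed
      also have "\<dots> = (\<Sum>v\<in>\<sigma>. frag_cmul (vertex_sign r v (\<sigma> - {v}) * c \<sigma>) (frag_of (?A (\<sigma> - {v}))))"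
        using bij_betw_nth[OF o(2)[OF that that] refl refl] unfolding o(1)[OF that that]
        by (rule sum.reindex_bij_betw)
      finally show ?thesis .
    qed
    \<comment> \<open>All faces that occur. Summing over them collects the coefficient of each face,
      which \<open>cycle\<close> makes zero.\<close>
    define R where "R = (\<Union>\<sigma>\<in>S. (\<lambda>v. \<sigma> - {v}) ` \<sigma>)"
    have R: "finite R" using S(1) SK(2) by (auto simp: R_def)
    show ?thesis
    proof (rule poly_mapping_eqI)
      fix g
      have "lookup (chain_boundary p z) g
        = (\<Sum>\<sigma>\<in>S. \<Sum>v\<in>\<sigma>. vertex_sign r v (\<sigma> - {v}) * c \<sigma> * lookup (frag_of (?A (\<sigma> - {v}))) g)"
        unfolding z_def chain_boundary_sum using bd by (simp add: lookup_sum)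
      also have "\<dots> = (\<Sum>\<sigma>\<in>S. \<Sum>v\<in>\<sigma>. \<Sum>\<rho>\<in>R. (if \<sigma> - {v} = \<rho> then vertex_sign r v \<rho> * c \<sigma> else 0) * lookup (frag_of (?A \<rho>)) g)"
      proof (intro sum.cong refl)
        fix \<sigma> v assume "\<sigma> \<in> S" "v \<in> \<sigma>"
        then have "\<sigma> - {v} \<in> R" by (auto simp: R_def)
        have "(\<Sum>\<rho>\<in>R. (if \<sigma> - {v} = \<rho> then vertex_sign r v \<rho> * c \<sigma> else 0) * lookup (frag_of (?A \<rho>)) g)
            = (\<Sum>\<rho>\<in>R. if \<sigma> - {v} = \<rho> then vertex_sign r v \<rho> * c \<sigma> * lookup (frag_of (?A \<rho>)) g else 0)"
          by (intro sum.cong) auto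
        then show "vertex_sign r v (\<sigma> - {v}) * c \<sigma> * lookup (frag_of (?A (\<sigma> - {v}))) g
          = (\<Sum>\<rho>\<in>R. (if \<sigma> - {v} = \<rho> then vertex_sign r v \<rho> * c \<sigma> else 0) * lookup (frag_of (?A \<rho>)) g)"
          using R \<open>\<sigma> - {v} \<in> R\<close> by simp
      qed
      also have "\<dots> = (\<Sum>\<sigma>\<in>S. \<Sum>\<rho>\<in>R. \<Sum>v\<in>\<sigma>. (if \<sigma> - {v} = \<rho> then vertex_sign r v \<rho> * c \<sigma> else 0) * lookup (frag_of (?A \<rho>)) g)"
        by (intro sum.cong refl sum.swap)
      also have "\<dots> = (\<Sum>\<rho>\<in>R. \<Sum>\<sigma>\<in>S. \<Sum>v\<in>\<sigma>. (if \<sigma> - {v} = \<rho> then vertex_sign r v \<rho> * c \<sigma> else 0) * lookup (frag_of (?A \<rho>)) g)"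
        by (rule sum.swap)
      also have "\<dots> = 0" by (simp only: sum_distrib_right[symmetric] cycle mult_zero_left sum.neutral_const)
      finally show "lookup (chain_boundary p z) g = lookup 0 g" by simp
    qed
  qed
  then have "pairing ?w p z = 0"
    using affine_cycle_pairing_eq_0[where f = f, OF contr p inj] cocycle keys by blast
  moreover have "pairing ?w p z = (\<Sum>\<sigma>\<in>S. of_int (c \<sigma>) * f \<sigma>)"
    unfolding z_def pairing_sum pairing_cmul_of
    by (intro sum.cong refl)
      (simp add: vertex_list_affine len o(1) list_sign_ordered_list SK(2,3))
  ultimately show ?thesis by simp
qed

end

section \<open>From integral to real coefficients\<close>

lemma common_denominator:
  fixes q :: "'i \<Rightarrow> rat"
  assumes "finite S"
  shows "\<exists>D::int. D \<noteq> 0 \<and> (\<forall>i\<in>S. \<exists>m::int. of_int D * q i = of_int m)"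
  using assms
proof (induction S)
  case (insert i S)
  then obtain D where D: "D \<noteq> 0" "\<And>j. j \<in> S \<Longrightarrow> \<exists>m::int. of_int D * q j = of_int m" by auto
  obtain a b where ab: "q i = Rat.Fract a b" "b > 0" by (cases "q i") auto
  have "of_int (D * b) * q j = of_int b * (of_int D * q j)" for j by simp
  moreover have "of_int b * q i = of_int a" using ab by (simp add: Fract_of_int_quotient)
  ultimately have "\<exists>m::int. of_int (D * b) * q j = of_int m" if "j \<in> insert i S" for j
  proof (cases "j = i")
    case True
    have "of_int (D * b) * q i = of_int (D * a)" using \<open>of_int b * q i = of_int a\<close> by simp
    then show ?thesis using True by blast
  next
    case False
    then have "j \<in> S" using that by simp
    then obtain m where "of_int D * q j = of_int m" using D(2) by blast
    then have "of_int (D * b) * q j = of_int (b * m)" by simp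
    then show ?thesis by blast
  qed
  moreover have "D * b \<noteq> 0" using D(1) ab(2) by simp
  ultimately have "D * b \<noteq> 0 \<and> (\<forall>j\<in>insert i S. \<exists>m::int. of_int (D * b) * q j = of_int m)"
    by (intro conjI ballI)
  then show ?case by (rule exI)
next
  case empty
  have "(1::int) \<noteq> 0 \<and> (\<forall>i\<in>{}. \<exists>m::int. of_int 1 * q i = of_int m)"
    by (rule conjI, rule one_neq_zero, rule ballI, erule emptyE)
  then show ?case by (rule exI)
qed

lemma vector_space_rat_real: "vector_space (\<lambda>(q::rat) (x::real). of_rat q * x)"
  by unfold_locales (simp_all add: distrib_left distrib_right of_rat_add of_rat_mult)

text \<open>Coordinates with respect to a basis of the reals over the rationals reduce real solutions of an
  integral linear system to integral ones.\<close>

lemma real_solution_of_integral_solutions: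
  fixes c :: "'i \<Rightarrow> real" and M :: "'i \<Rightarrow> 'j \<Rightarrow> int" and f :: "'i \<Rightarrow> real"
  assumes S: "finite S"
    and int: "\<And>c' :: 'i \<Rightarrow> int. (\<And>j. (\<Sum>i\<in>S. M i j * c' i) = 0) \<Longrightarrow> (\<Sum>i\<in>S. of_int (c' i) * f i) = 0"
    and c: "\<And>j. (\<Sum>i\<in>S. of_int (M i j) * c i) = 0"
  shows "(\<Sum>i\<in>S. c i * f i) = 0"
proof -
  interpret Q: vector_space "\<lambda>(q::rat) (x::real). of_rat q * x"
    by (rule vector_space_rat_real)
  \<comment> \<open>A Hamel basis. The system has integral coefficients, so it holds in each
    rational coordinate separately.\<close>
  obtain B where B: "Q.independent B" "UNIV \<subseteq> Q.span B"
    using Q.basis_exists[of UNIV] by metis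
  have sp: "x \<in> Q.span B" for x using B(2) by blast
  define \<rho> where "\<rho> x b = Q.representation B x b" for x b
  have add: "\<rho> (x + y) b = \<rho> x b + \<rho> y b" for x y b
    unfolding \<rho>_def using Q.representation_add[OF B(1) sp sp] by (simp add: fun_eq_iff)
  have sc: "\<rho> (of_rat q * x) b = q * \<rho> x b" for q x b
    unfolding \<rho>_def using Q.representation_scale[OF B(1) sp] by (simp add: fun_eq_iff)
  have zero: "\<rho> 0 b = 0" for b using sc[of 0 0 b] by simp
  have sum: "\<rho> (sum g A) b = (\<Sum>a\<in>A. \<rho> (g a) b)" for g :: "'i \<Rightarrow> real" and A b
    by (induction A rule: infinite_finite_induct) (auto simp: add zero)
  have fin: "finite {b. \<rho> x b \<noteq> 0}" for x unfolding \<rho>_def by (rule Q.finite_representation)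
  have zero_b: "(\<Sum>i\<in>S. of_rat (\<rho> (c i) b) * f i) = 0" for b
  proof -
    \<comment> \<open>Clearing denominators turns the coordinates at \<open>b\<close> into an
      integral solution, to which \<open>int\<close> applies.\<close>
    obtain D :: int where D: "D \<noteq> 0" "\<And>i. i \<in> S \<Longrightarrow> \<exists>m::int. of_int D * \<rho> (c i) b = of_int m"
      using common_denominator[OF S, of "\<lambda>i. \<rho> (c i) b"] by blast
    then obtain m :: "'i \<Rightarrow> int" where m: "\<And>i. i \<in> S \<Longrightarrow> of_int D * \<rho> (c i) b = of_int (m i)" by metis
    have "(\<Sum>i\<in>S. M i j * m i) = 0" for j
    proof -
      have "\<rho> (of_int (M i j) * c i) b = of_int (M i j) * \<rho> (c i) b" for i
        using sc[of "of_int (M i j)" "c i" b] by simp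
      then have "(\<Sum>i\<in>S. of_int (M i j) * \<rho> (c i) b) = 0"
        using arg_cong[OF c[of j], of "\<lambda>x. \<rho> x b"] by (simp add: sum zero)
      then have "(\<Sum>i\<in>S. of_int (M i j) * (of_int D * \<rho> (c i) b)) = 0"
        by (simp add: mult.left_commute flip: sum_distrib_left)
      then have "(of_int (\<Sum>i\<in>S. M i j * m i) :: rat) = 0" by (simp add: m)
      then show ?thesis by (simp only: of_int_eq_0_iff)
    qed
    then have "(\<Sum>i\<in>S. of_int (m i) * f i) = 0" by (rule int)
    moreover have "of_int (m i) = of_int D * (of_rat (\<rho> (c i) b) :: real)" if "i \<in> S" for i
      using arg_cong[OF m[OF that], of "of_rat :: rat \<Rightarrow> real"] by (simp add: of_rat_mult)
    ultimately have "of_int D * (\<Sum>i\<in>S. of_rat (\<rho> (c i) b) * f i) = 0"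
      by (simp add: sum_distrib_left mult.assoc)
    then show ?thesis using D(1) by simp
  qed
  \<comment> \<open>The finitely many basis elements involved in the given reals.\<close>
  define T where "T = (\<Union>i\<in>S. {b. \<rho> (c i) b \<noteq> 0})"
  have T: "finite T" using S fin by (auto simp: T_def)
  have "c i = (\<Sum>b\<in>T. of_rat (\<rho> (c i) b) * b)" if "i \<in> S" for i
  proof -
    have "c i = (\<Sum>b | \<rho> (c i) b \<noteq> 0. of_rat (\<rho> (c i) b) * b)"
      unfolding \<rho>_def using Q.sum_nonzero_representation_eq[OF B(1) sp[of "c i"]] by simp
    also have "\<dots> = (\<Sum>b\<in>T. of_rat (\<rho> (c i) b) * b)"
      using T that by (intro sum.mono_neutral_left) (auto simp: T_def)
    finally show ?thesis .
  qed
  then have "c i * f i = (\<Sum>b\<in>T. of_rat (\<rho> (c i) b) * b) * f i" if "i \<in> S" for i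
    using that by (intro arg_cong[of _ _ "\<lambda>x. x * f i"])
  then have "(\<Sum>i\<in>S. c i * f i) = (\<Sum>i\<in>S. \<Sum>b\<in>T. of_rat (\<rho> (c i) b) * b * f i)"
    unfolding sum_distrib_right by (rule sum.cong[OF refl])
  also have "\<dots> = (\<Sum>b\<in>T. \<Sum>i\<in>S. b * (of_rat (\<rho> (c i) b) * f i))"
    by (subst sum.swap) (simp add: mult_ac)
  also have "\<dots> = 0" by (simp add: zero_b flip: sum_distrib_left)
  finally show ?thesis .
qed

context simplicial_complex
begin

lemma cycle_pairing_eq_0:
  fixes c f :: "'v set \<Rightarrow> real"
  assumes contr: "contractible_space X" and p: "1 \<le> p" and inj: "inj_on r (\<Union>K)"
    and cocycle: "\<And>\<sigma>. \<sigma> \<in> simplices K (Suc p) \<Longrightarrow> (\<Sum>v\<in>\<sigma>. of_int (vertex_sign r v (\<sigma> - {v})) * f (\<sigma> - {v})) = 0"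
    and S: "finite S" "S \<subseteq> simplices K p"
    and cycle: "\<And>\<rho>. (\<Sum>\<sigma>\<in>S. \<Sum>v\<in>\<sigma>. if \<sigma> - {v} = \<rho> then of_int (vertex_sign r v \<rho>) * c \<sigma> else 0) = 0"
  shows "(\<Sum>\<sigma>\<in>S. c \<sigma> * f \<sigma>) = 0"
proof (rule real_solution_of_integral_solutions[OF S(1),
      where M = "\<lambda>\<sigma> \<rho>. \<Sum>v\<in>\<sigma>. if \<sigma> - {v} = \<rho> then vertex_sign r v \<rho> else 0"])
  fix \<rho>
  have "(\<Sum>\<sigma>\<in>S. of_int (\<Sum>v\<in>\<sigma>. if \<sigma> - {v} = \<rho> then vertex_sign r v \<rho> else 0) * c \<sigma>)
      = (\<Sum>\<sigma>\<in>S. \<Sum>v\<in>\<sigma>. if \<sigma> - {v} = \<rho> then of_int (vertex_sign r v \<rho>) * c \<sigma> else 0)"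
    unfolding of_int_sum sum_distrib_right by (intro sum.cong refl) auto
  then show "(\<Sum>\<sigma>\<in>S. of_int (\<Sum>v\<in>\<sigma>. if \<sigma> - {v} = \<rho> then vertex_sign r v \<rho> else 0) * c \<sigma>) = 0"
    using cycle[of \<rho>] by simp
next
  fix c' :: "'v set \<Rightarrow> int"
  assume *: "\<And>\<rho>. (\<Sum>\<sigma>\<in>S. (\<Sum>v\<in>\<sigma>. if \<sigma> - {v} = \<rho> then vertex_sign r v \<rho> else 0) * c' \<sigma>) = 0"
  have "(\<Sum>\<sigma>\<in>S. \<Sum>v\<in>\<sigma>. if \<sigma> - {v} = \<rho> then vertex_sign r v \<rho> * c' \<sigma> else 0) = 0" for \<rho>
  proof -
    have "(\<Sum>\<sigma>\<in>S. \<Sum>v\<in>\<sigma>. if \<sigma> - {v} = \<rho> then vertex_sign r v \<rho> * c' \<sigma> else 0)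
      = (\<Sum>\<sigma>\<in>S. (\<Sum>v\<in>\<sigma>. if \<sigma> - {v} = \<rho> then vertex_sign r v \<rho> else 0) * c' \<sigma>)"
      unfolding sum_distrib_right by (intro sum.cong refl) auto
    then show ?thesis using * by simp
  qed
  then show "(\<Sum>\<sigma>\<in>S. of_int (c' \<sigma>) * f \<sigma>) = 0"
    using integral_cycle_pairing_eq_0[where f = f, OF contr p inj _ S] cocycle by blast
qed

text \<open>A cocycle in degree zero has equal values at the ends of each edge, so by connectedness
  it is constant, and chains with coefficient sum zero annihilate it.\<close>

lemma cycle_pairing_eq_0_dim_0:
  fixes c f :: "'v set \<Rightarrow> real"
  assumes conn: "connected_space X" and inj: "inj_on r (\<Union>K)"
    and cocycle: "\<And>\<sigma>. \<sigma> \<in> simplices K 1 \<Longrightarrow> (\<Sum>v\<in>\<sigma>. of_int (vertex_sign r v (\<sigma> - {v})) * f (\<sigma> - {v})) = 0"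
    and S: "finite S" "S \<subseteq> simplices K 0" and cycle: "(\<Sum>\<sigma>\<in>S. c \<sigma>) = 0"
  shows "(\<Sum>\<sigma>\<in>S. c \<sigma> * f \<sigma>) = 0"
proof -
  have edge: "f {u} = f {v}" if uv: "{u, v} \<in> K" for u v
  proof (cases "u = v")
    case False
    have "u \<in> \<Union>K" "v \<in> \<Union>K" using uv by blast+
    then have "r u \<noteq> r v" using inj_onD[OF inj] False by metis
    have "card {u, v} = Suc 1" using False by simp
    then have "{u, v} \<in> simplices K 1" using uv unfolding simplices_def by blast
    from cocycle[OF this] have "of_int (vertex_sign r u {v}) * f {v} + of_int (vertex_sign r v {u}) * f {u} = 0"
      using False by (simp add: insert_Diff_if)
    then show ?thesis using \<open>r u \<noteq> r v\<close>
      by (cases "r u < r v") (simp_all only: vertex_sign_def rank_sign_def sgn_if prod.insert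
        finite.emptyI prod.empty empty_iff not_False_eq_True mult_1_right, simp_all)
  qed simp
  have const: "f {u} = f {v}" if "u \<in> \<Union>K" "v \<in> \<Union>K" for u v
    by (rule constant_on_vertices[OF conn, of "\<lambda>v. f {v}", OF edge that])
  have ver: "\<exists>v\<in>\<Union>K. \<sigma> = {v}" if "\<sigma> \<in> S" for \<sigma>
  proof -
    have "\<sigma> \<in> K" "card \<sigma> = 1" using that S(2) by (auto simp: simplices_def)
    then obtain v where "\<sigma> = {v}" using card_1_singletonE by metis
    then show ?thesis using \<open>\<sigma> \<in> K\<close> by blast
  qed
  show ?thesis
  proof (cases "S = {}")
    case False
    then obtain \<sigma>0 where "\<sigma>0 \<in> S" by blast
    then have "f \<sigma> = f \<sigma>0" if "\<sigma> \<in> S" for \<sigma> 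
    proof -
      obtain u v where "u \<in> \<Union>K" "\<sigma> = {u}" "v \<in> \<Union>K" "\<sigma>0 = {v}"
        using ver[OF \<open>\<sigma> \<in> S\<close>] ver[OF \<open>\<sigma>0 \<in> S\<close>] by blast
      then show ?thesis using const[of u v] by (simp only:)
    qed
    then have "(\<Sum>\<sigma>\<in>S. c \<sigma> * f \<sigma>) = (\<Sum>\<sigma>\<in>S. c \<sigma>) * f \<sigma>0"
      unfolding sum_distrib_right by (intro sum.cong refl) (rule arg_cong)
    then show ?thesis using cycle by simp
  qed simp
qed

text \<open>Starting from one vertex, adding all neighbours repeatedly gives countable sets by local
  finiteness. Their union is closed under edges, so by connectedness it contains every
  vertex.\<close>

lemma countable_vertices:
  assumes conn: "connected_space X" and lf: "locally_finite_complex K"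
  shows "countable (\<Union>K)"
proof (cases "\<Union>K = {}")
  case False
  then obtain v0 where v0: "v0 \<in> \<Union>K" by blast
  define N where "N W = W \<union> \<Union>{\<sigma> \<in> K. \<sigma> \<inter> W \<noteq> {}}" for W
  define C where "C = (\<Union>n. (N ^^ n) {v0})"
  have sub: "(N ^^ n) {v0} \<subseteq> \<Union>K" for n by (induction n) (use v0 in \<open>auto simp: N_def\<close>)
  have "countable ((N ^^ n) {v0})" for n
  proof (induction n)
    case (Suc n)
    have "\<Union>{\<sigma> \<in> K. \<sigma> \<inter> (N ^^ n) {v0} \<noteq> {}} = (\<Union>v\<in>(N ^^ n) {v0}. \<Union>{\<sigma> \<in> K. v \<in> \<sigma>})" by blast
    moreover have "finite (\<Union>{\<sigma> \<in> K. v \<in> \<sigma>})" if "v \<in> (N ^^ n) {v0}" for v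
    proof -
      have "v \<in> \<Union>K" using that sub by blast
      then have "finite {\<sigma> \<in> K. v \<in> \<sigma>}" using lf unfolding locally_finite_complex_def by (rule bspec[rotated])
      then show ?thesis by (rule finite_Union) (use finite_simplex in blast)
    qed
    ultimately have "countable (\<Union>{\<sigma> \<in> K. \<sigma> \<inter> (N ^^ n) {v0} \<noteq> {}})"
      using Suc by (simp add: countable_UN countable_finite)
    then have "countable ((N ^^ n) {v0} \<union> \<Union>{\<sigma> \<in> K. \<sigma> \<inter> (N ^^ n) {v0} \<noteq> {}})"
      using Suc by (simp only: countable_Un_iff)
    then show ?case unfolding funpow.simps o_apply N_def[of "(N ^^ n) {v0}"] .
  qed simp
  then have "countable C" by (simp add: C_def)
  have step: "v \<in> C" if u: "u \<in> C" and uv: "{u, v} \<in> K" for u v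
  proof -
    obtain n where "u \<in> (N ^^ n) {v0}" using u by (auto simp: C_def)
    then have "v \<in> N ((N ^^ n) {v0})" using uv unfolding N_def[of "(N ^^ n) {v0}"] by blast
    then have "v \<in> (N ^^ Suc n) {v0}" by (simp only: funpow.simps o_apply)
    then show ?thesis unfolding C_def by blast
  qed
  have edge: "(u \<in> C) = (v \<in> C)" if uv: "{u, v} \<in> K" for u v
    using step[of u v] step[of v u] uv by (metis insert_commute)
  have "v0 \<in> (N ^^ 0) {v0}" by simp
  then have "v0 \<in> C" unfolding C_def by blast
  then have "\<Union>K \<subseteq> C" using constant_on_vertices[OF conn, of "\<lambda>v. v \<in> C", OF edge] v0 by (metis subsetI)
  then show ?thesis using \<open>countable C\<close> by (rule countable_subset)
next
  case True
  then show ?thesis by (simp only: countable_empty)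
qed

end

section \<open>Codifferentials as coboundaries\<close>

text \<open>The ring homomorphism to the reals sending each group element to \<open>1\<close>; it
  plays the part of a boundary map out of degree zero.\<close>

definition augmentation :: "'g::group_add group_algebra \<Rightarrow> real" where
  "augmentation a = (\<Sum>\<gamma>\<in>keys a. lookup a \<gamma>)"

lemma augmentation_superset:
  assumes "finite S" "keys a \<subseteq> S"
  shows "augmentation a = (\<Sum>\<gamma>\<in>S. lookup a \<gamma>)"
  unfolding augmentation_def using assms by (intro sum.mono_neutral_left) (auto simp: in_keys_iff)

lemma augmentation_simps [simp]:
  "augmentation 0 = 0"
  "augmentation (single g c) = c"
  "augmentation (a + b) = augmentation a + augmentation b"
proof -
  show "augmentation 0 = 0" by (simp add: augmentation_def)
  show "augmentation (single g c) = c"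
    using augmentation_superset[of "{g}" "single g c"] by simp
  have S: "finite (keys a \<union> keys b)" by simp
  show "augmentation (a + b) = augmentation a + augmentation b"
    using augmentation_superset[OF S, of a] augmentation_superset[OF S, of b]
      augmentation_superset[OF S, of "a + b"] keys_add[of a b]
    by (simp add: lookup_add sum.distrib)
qed

lemma augmentation_mult: "augmentation (a * b) = augmentation a * augmentation b"
proof (induction a rule: group_algebra_induct)
  case (single g c)
  show ?case
    by (induction b rule: group_algebra_induct) (simp_all add: mult_single distrib_left)
qed (simp_all add: distrib_right)

lemma augmentation_involution [simp]: "augmentation (involution a) = augmentation a"
  by (induction a rule: group_algebra_induct) simp_all

lemma augmentation_sum: "augmentation (sum f A) = (\<Sum>x\<in>A. augmentation (f x))"
  by (induction A rule: infinite_finite_induct) simp_all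

text \<open>For a matrix with \<open>k 0\<close> columns, the coefficient sum of the row regarded as
  a chain of vertices.\<close>

definition row_sum :: "'g::group_add group_algebra mat \<Rightarrow> nat \<Rightarrow> real" where
  "row_sum A i = (\<Sum>j<dim_col A. augmentation (A $$ (i, j)))"

lemma row_sum_mult:
  assumes A: "A \<in> carrier_mat m n" and B: "B \<in> carrier_mat n l" and i: "i < m"
  shows "row_sum (A * B) i = (\<Sum>h<n. augmentation (A $$ (i, h)) * row_sum B h)"
proof -
  have "row_sum (A * B) i = (\<Sum>j<l. \<Sum>h<n. augmentation (A $$ (i, h)) * augmentation (B $$ (h, j)))"
    using A B i unfolding row_sum_def
    by (intro sum.cong) (auto simp: scalar_prod_def augmentation_sum augmentation_mult lessThan_atLeast0)
  also have "\<dots> = (\<Sum>h<n. \<Sum>j<l. augmentation (A $$ (i, h)) * augmentation (B $$ (h, j)))"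
    by (rule sum.swap)
  finally show ?thesis using B by (simp add: row_sum_def sum_distrib_left)
qed

text \<open>Evaluates the quadratic form at the all-ones vector in the trivial representation, where
  each root contributes the squared norm of its vector of row sums.\<close>

lemma row_sum_sum_squares:
  assumes "set as \<subseteq> carrier_mat m n"
  shows "(\<Sum>i<n. row_sum (sum_squares n as) i) = (\<Sum>a\<leftarrow>as. \<Sum>h<m. (row_sum a h)\<^sup>2)"
  using assms
proof (induction as)
  case Nil
  then show ?case by (simp add: sum_squares_def row_sum_def)
next
  case (Cons a as)
  then have a: "a \<in> carrier_mat m n" and as: "set as \<subseteq> carrier_mat m n" by auto
  have c: "sum_squares n as \<in> carrier_mat n n" using as by (rule sum_squares_carrier)
  have "(\<Sum>i<n. row_sum (mat_star a * a) i) = (\<Sum>i<n. \<Sum>h<m. augmentation (a $$ (h, i)) * row_sum a h)"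
    using a by (intro sum.cong refl) (simp add: row_sum_mult[of _ n m _ n])
  also have "\<dots> = (\<Sum>h<m. \<Sum>i<n. augmentation (a $$ (h, i)) * row_sum a h)" by (rule sum.swap)
  also have "\<dots> = (\<Sum>h<m. (row_sum a h)\<^sup>2)"
    using a by (simp add: row_sum_def power2_eq_square flip: sum_distrib_right)
  finally have 1: "(\<Sum>i<n. row_sum (mat_star a * a) i) = (\<Sum>h<m. (row_sum a h)\<^sup>2)" .
  have "row_sum (mat_star a * a + sum_squares n as) i = row_sum (mat_star a * a) i + row_sum (sum_squares n as) i"
    if "i < n" for i
    using a c that by (simp add: row_sum_def sum.distrib)
  then have "(\<Sum>i<n. row_sum (mat_star a * a + sum_squares n as) i)
      = (\<Sum>i<n. row_sum (mat_star a * a) i) + (\<Sum>i<n. row_sum (sum_squares n as) i)"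
    by (simp add: sum.distrib)
  moreover have "sum_squares n (a # as) = mat_star a * a + sum_squares n as" by (simp add: sum_squares_def)
  ultimately show ?case using 1 Cons.IH[OF as] by simp
qed

lemma list_sign_map: "list_sign r (map h l) = list_sign (r \<circ> h) l"
  by (induction l) (simp_all add: rank_sign_def [abs_def] o_def)

lemma vertex_sign_image: "inj_on h \<rho> \<Longrightarrow> vertex_sign r (h v) (h ` \<rho>) = vertex_sign (r \<circ> h) v \<rho>"
  by (simp add: vertex_sign_def prod.reindex rank_sign_def)

lemma sum_faces:
  fixes A :: "'v \<Rightarrow> 'v set \<Rightarrow> 'a::comm_ring_1"
  assumes "finite \<tau>"
  shows "(\<Sum>\<rho>\<in>(\<lambda>v. \<tau> - {v}) ` \<tau>. (\<Sum>v\<in>\<tau>. if \<tau> - {v} = \<rho> then A v \<rho> else 0) * B \<rho>)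
    = (\<Sum>v\<in>\<tau>. A v (\<tau> - {v}) * B (\<tau> - {v}))"
proof -
  have "(\<Sum>\<rho>\<in>(\<lambda>v. \<tau> - {v}) ` \<tau>. (\<Sum>v\<in>\<tau>. if \<tau> - {v} = \<rho> then A v \<rho> else 0) * B \<rho>)
      = (\<Sum>\<rho>\<in>(\<lambda>v. \<tau> - {v}) ` \<tau>. \<Sum>v\<in>\<tau>. if \<tau> - {v} = \<rho> then A v \<rho> * B \<rho> else 0)"
    unfolding sum_distrib_right by (intro sum.cong refl) simp
  also have "\<dots> = (\<Sum>v\<in>\<tau>. \<Sum>\<rho>\<in>(\<lambda>v. \<tau> - {v}) ` \<tau>. if \<tau> - {v} = \<rho> then A v \<rho> * B \<rho> else 0)"
    by (rule sum.swap)
  also have "\<dots> = (\<Sum>v\<in>\<tau>. A v (\<tau> - {v}) * B (\<tau> - {v}))"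
  proof (rule sum.cong[OF refl])
    fix v assume "v \<in> \<tau>"
    then have "\<tau> - {v} \<in> (\<lambda>v. \<tau> - {v}) ` \<tau>" by (rule imageI)
    moreover have "finite ((\<lambda>v. \<tau> - {v}) ` \<tau>)" using assms by simp
    ultimately show "(\<Sum>\<rho>\<in>(\<lambda>v. \<tau> - {v}) ` \<tau>. if \<tau> - {v} = \<rho> then A v \<rho> * B \<rho> else 0)
      = A v (\<tau> - {v}) * B (\<tau> - {v})" by (simp only: sum.delta' if_True)
  qed
  finally show ?thesis .
qed

lemma sum_faces_nonzero:
  assumes "(\<Sum>v\<in>\<tau>. if \<tau> - {v} = \<rho> then A v else 0) \<noteq> 0"
  shows "\<exists>v\<in>\<tau>. \<tau> - {v} = \<rho>"
  using assms by (rule contrapos_np) (rule sum.neutral, simp)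

lemma antisymmetric_sum_eq_0:
  fixes t :: "'v \<Rightarrow> 'v \<Rightarrow> real"
  assumes "\<And>u v. t v u = - t u v"
  shows "(\<Sum>v\<in>\<tau>. \<Sum>u\<in>\<tau>. t v u) = 0"
proof -
  have "(\<Sum>v\<in>\<tau>. \<Sum>u\<in>\<tau>. t v u) = (\<Sum>u\<in>\<tau>. \<Sum>v\<in>\<tau>. t v u)" by (rule sum.swap)
  also have "\<dots> = (\<Sum>u\<in>\<tau>. \<Sum>v\<in>\<tau>. - t u v)" by (intro sum.cong refl assms)
  also have "\<dots> = - (\<Sum>v\<in>\<tau>. \<Sum>u\<in>\<tau>. t v u)" by (simp only: sum_negf)
  finally show ?thesis by linarith
qed

section \<open>Freeness, translates and signs for the given action\<close>

locale equivariant_complex = simplicial_complex K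
  for K :: "'v set set" and m :: nat and act :: "'g::group_add \<Rightarrow> 'v \<Rightarrow> 'v"
    and ori :: "'v set \<Rightarrow> 'v list" and tau :: "nat \<Rightarrow> nat \<Rightarrow> 'v set" +
  assumes type_F: "type_F_complex m K act"
    and orientation: "invariant_orientation K act ori"
    and representatives: "orbit_representatives m K act tau"
begin

abbreviation k :: "nat \<Rightarrow> nat" where "k p \<equiv> card (orbits K act p)"
abbreviation d :: "nat \<Rightarrow> 'g group_algebra mat" where "d \<equiv> codifferential K act ori tau"

lemma contractible: "contractible_space X" and loc_finite: "locally_finite_complex K"
  and K_nonempty: "K \<noteq> {}" and action: "simplicial_action K act" and free: "free_action K act"
  using type_F unfolding type_F_complex_def by blast+

lemma connected: "connected_space X"
  using contractible by (intro path_connected_imp_connected_space contractible_imp_path_connected_space)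

text \<open>A global numbering of the vertices, relative to which all signs are computed. It is
  chosen without regard to the action; invariance is carried by \<open>ori\<close>.\<close>

definition rank :: "'v \<Rightarrow> nat" where "rank = to_nat_on (\<Union>K)"

lemma inj_rank: "inj_on rank (\<Union>K)"
  unfolding rank_def by (rule inj_on_to_nat_on[OF countable_vertices[OF connected loc_finite]])

lemma inj_rank_simplex: "\<sigma> \<in> K \<Longrightarrow> inj_on rank \<sigma>"
  by (rule inj_on_subset[OF inj_rank]) blast

lemma act_0: "v \<in> \<Union>K \<Longrightarrow> act 0 v = v"
  and act_add: "v \<in> \<Union>K \<Longrightarrow> act (g + h) v = act g (act h v)"
  and act_simplex: "\<sigma> \<in> K \<Longrightarrow> act g ` \<sigma> \<in> K"
  using action unfolding simplicial_action_def by blast+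

lemma act_vertex: "v \<in> \<Union>K \<Longrightarrow> act g v \<in> \<Union>K"
  using act_simplex by blast

lemma act_neg: "v \<in> \<Union>K \<Longrightarrow> act (- g) (act g v) = v"
  using act_add[of v "- g" g] act_0[of v] by (simp only: left_minus)

lemma inj_act: "inj_on (act g) (\<Union>K)"
  by (rule inj_on_inverseI[where g = "act (- g)"]) (rule act_neg)

lemma inj_act_simplex: "\<sigma> \<in> K \<Longrightarrow> inj_on (act g) \<sigma>"
  by (rule inj_on_subset[OF inj_act]) blast

lemma act_0_image: "\<sigma> \<in> K \<Longrightarrow> act 0 ` \<sigma> = \<sigma>"
proof -
  assume "\<sigma> \<in> K"
  then have "act 0 ` \<sigma> = (\<lambda>v. v) ` \<sigma>" by (intro image_cong refl act_0) blast
  then show ?thesis by (simp only: image_ident)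
qed

lemma act_add_image: "\<sigma> \<in> K \<Longrightarrow> act (g + h) ` \<sigma> = act g ` act h ` \<sigma>"
proof -
  assume "\<sigma> \<in> K"
  then have "act (g + h) ` \<sigma> = (\<lambda>v. act g (act h v)) ` \<sigma>" by (intro image_cong refl act_add) blast
  then show ?thesis by (simp only: image_image)
qed

lemma simplices_K: "\<sigma> \<in> simplices K p \<Longrightarrow> \<sigma> \<in> K"
  by (simp add: simplices_def)

lemma act_simplices: "\<sigma> \<in> simplices K p \<Longrightarrow> act g ` \<sigma> \<in> simplices K p"
  using act_simplex inj_act_simplex by (simp add: simplices_def card_image)

lemma face_simplices:
  assumes "\<sigma> \<in> simplices K (Suc p)" "v \<in> \<sigma>"
  shows "\<sigma> - {v} \<in> simplices K p"
proof -
  have \<sigma>: "\<sigma> \<in> K" "card \<sigma> = Suc (Suc p)" using assms(1) unfolding simplices_def by blast+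
  have c: "card (\<sigma> - {v}) = Suc p"
    using card_Diff_singleton[OF assms(2)] \<sigma>(2) by (simp only: diff_Suc_1)
  have "\<sigma> - {v} \<noteq> {}"
  proof
    assume "\<sigma> - {v} = {}"
    then show False using c by (simp only: card.empty nat.simps(3))
  qed
  then have "\<sigma> - {v} \<in> K" by (rule face_simplex[OF \<sigma>(1) Diff_subset])
  then show ?thesis using c unfolding simplices_def by blast
qed

text \<open>A group element preserving a simplex as a set fixes its barycentre, and the action is
  free on all points of the realization.\<close>

lemma act_simplex_eq:
  assumes \<sigma>: "\<sigma> \<in> K" and fixed: "act g ` \<sigma> = \<sigma>"
  shows "g = 0"
proof -
  define x :: "'v \<Rightarrow> real" where "x v = (if v \<in> \<sigma> then 1 / real (card \<sigma>) else 0)" for v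
  have "0 < card \<sigma>" using finite_simplex[OF \<sigma>] nonempty_simplex[OF \<sigma>] by (simp add: card_gt_0_iff)
  then have "sum x \<sigma> = 1" by (simp add: x_def)
  then have "x \<in> closed_simplex \<sigma>" by (simp add: closed_simplex_def x_def)
  then have "x \<in> topspace X" using \<sigma> in_topspace_iff by blast
  moreover have "x (act g v) = x v" if v: "v \<in> \<Union>K" for v
  proof -
    have "v \<in> \<sigma>" if gv: "act g v \<in> \<sigma>"
    proof -
      have "act g v \<in> act g ` \<sigma>" unfolding fixed by (rule gv)
      then obtain w where w: "act g v = act g w" "w \<in> \<sigma>" by (rule imageE)
      have "w \<in> \<Union>K" using w(2) \<sigma> by (rule UnionI[rotated])
      then have "v = w" by (rule inj_onD[OF inj_act w(1) v])
      then show ?thesis using w(2) by simp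
    qed
    moreover have "act g v \<in> \<sigma>" if "v \<in> \<sigma>" using imageI[OF that, of "act g"] unfolding fixed .
    ultimately have "(act g v \<in> \<sigma>) = (v \<in> \<sigma>)" by blast
    then show ?thesis by (simp only: x_def)
  qed
  ultimately show ?thesis by (rule free[unfolded free_action_def, rule_format])
qed

lemma act_simplex_inj:
  assumes \<sigma>: "\<sigma> \<in> K" and eq: "act g ` \<sigma> = act h ` \<sigma>"
  shows "g = h"
proof -
  have "act (- h + g) ` \<sigma> = act (- h + h) ` \<sigma>" unfolding act_add_image[OF \<sigma>] eq ..
  then have "act (- h + g) ` \<sigma> = \<sigma>" using act_0_image[OF \<sigma>] by simp
  then have "- h + g = 0" by (rule act_simplex_eq[OF \<sigma>])
  then show ?thesis using neg_eq_iff_add_eq_0[of "- h" g] by simp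
qed

text \<open>By freeness, the orbit map of a vertex embeds the group into the countable set of
  vertices.\<close>

lemma countable_group: "countable (UNIV :: 'g set)"
proof -
  obtain \<sigma> where "\<sigma> \<in> K" using K_nonempty by blast
  then obtain v where v: "v \<in> \<Union>K" using nonempty_simplex by blast
  then have "inj (\<lambda>g. act g v)"
    by (intro injI act_simplex_inj[OF vertex_simplex[OF v]]) (simp only: image_insert image_empty)
  moreover have "countable (range (\<lambda>g. act g v))"
    by (rule countable_subset[OF _ countable_vertices[OF connected loc_finite]])
      (rule image_subsetI, rule act_vertex[OF v])
  ultimately show ?thesis by (rule countable_image_inj_on[rotated])
qed

lemma tau_simplex: "p \<le> m \<Longrightarrow> j < k p \<Longrightarrow> tau p j \<in> simplices K p"
  using representatives unfolding orbit_representatives_def by blast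

lemma tau_K: "p \<le> m \<Longrightarrow> j < k p \<Longrightarrow> tau p j \<in> K"
  using tau_simplex simplices_K by blast

lemma simplex_orbit_act:
  assumes \<sigma>: "\<sigma> \<in> K"
  shows "simplex_orbit act (act \<gamma> ` \<sigma>) = simplex_orbit act \<sigma>"
proof (intro subset_antisym subsetI)
  fix \<rho> assume "\<rho> \<in> simplex_orbit act (act \<gamma> ` \<sigma>)"
  then obtain g where "\<rho> = act g ` act \<gamma> ` \<sigma>" unfolding simplex_orbit_def by blast
  then have "\<rho> = act (g + \<gamma>) ` \<sigma>" using act_add_image[OF \<sigma>] by simp
  then show "\<rho> \<in> simplex_orbit act \<sigma>" unfolding simplex_orbit_def by blast
next
  fix \<rho> assume "\<rho> \<in> simplex_orbit act \<sigma>"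
  then obtain g where "\<rho> = act g ` \<sigma>" unfolding simplex_orbit_def by blast
  then have "\<rho> = act (g - \<gamma>) ` act \<gamma> ` \<sigma>" using act_add_image[OF \<sigma>, of "g - \<gamma>" \<gamma>] by simp
  then show "\<rho> \<in> simplex_orbit act (act \<gamma> ` \<sigma>)" unfolding simplex_orbit_def by blast
qed

text \<open>Indexes a simplex by its orbit and the group element moving the representative to it. By
  freeness the indexing is bijective, so the chains form a free module over the group algebra on the
  representatives.\<close>

definition translate :: "nat \<Rightarrow> nat \<times> 'g \<Rightarrow> 'v set" where
  "translate p = (\<lambda>(j, \<gamma>). act \<gamma> ` tau p j)"

lemma bij_translate:
  assumes p: "p \<le> m"
  shows "bij_betw (translate p) ({..<k p} \<times> UNIV) (simplices K p)"
  unfolding bij_betw_def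
proof
  have bij: "bij_betw (\<lambda>i. simplex_orbit act (tau p i)) {..<k p} (orbits K act p)"
    using representatives p unfolding orbit_representatives_def by blast
  show "inj_on (translate p) ({..<k p} \<times> UNIV)"
  proof (rule inj_onI)
    fix x y assume xy: "x \<in> {..<k p} \<times> UNIV" "y \<in> {..<k p} \<times> UNIV" and eq: "translate p x = translate p y"
    obtain i \<gamma> where x: "x = (i, \<gamma>)" by (rule prod.exhaust)
    obtain j \<delta> where y: "y = (j, \<delta>)" by (rule prod.exhaust)
    note * = x y
    have ij: "i < k p" "j < k p" using xy unfolding * by simp_all
    have eq': "act \<gamma> ` tau p i = act \<delta> ` tau p j" using eq * by (simp add: translate_def)
    then have "simplex_orbit act (tau p i) = simplex_orbit act (tau p j)"
      using simplex_orbit_act[OF tau_K[OF p ij(1)], of \<gamma>] simplex_orbit_act[OF tau_K[OF p ij(2)], of \<delta>] by simp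
    then have "i = j" using bij ij unfolding bij_betw_def inj_on_def by blast
    then show "x = y" using act_simplex_inj[OF tau_K[OF p ij(1)]] eq' * by simp
  qed
  show "translate p ` ({..<k p} \<times> UNIV) = simplices K p"
  proof (intro subset_antisym subsetI)
    fix \<sigma> assume "\<sigma> \<in> translate p ` ({..<k p} \<times> UNIV)"
    then obtain j \<gamma> where "j < k p" "\<sigma> = act \<gamma> ` tau p j" by (auto simp: translate_def)
    then show "\<sigma> \<in> simplices K p" using act_simplices[OF tau_simplex[OF p]] by blast
  next
    fix \<sigma> assume \<sigma>: "\<sigma> \<in> simplices K p"
    then have "simplex_orbit act \<sigma> \<in> orbits K act p" unfolding orbits_def by (rule imageI)
    then have "simplex_orbit act \<sigma> \<in> (\<lambda>i. simplex_orbit act (tau p i)) ` {..<k p}"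
      using bij unfolding bij_betw_def by simp
    then obtain j where j: "j < k p" "simplex_orbit act \<sigma> = simplex_orbit act (tau p j)" by blast
    have "\<sigma> \<in> simplex_orbit act \<sigma>"
      unfolding simplex_orbit_def using act_0_image[OF simplices_K[OF \<sigma>]] by blast
    then have "\<sigma> \<in> simplex_orbit act (tau p j)" by (simp only: j(2))
    then obtain \<gamma> where "\<sigma> = act \<gamma> ` tau p j" unfolding simplex_orbit_def by blast
    then have "\<sigma> = translate p (j, \<gamma>)" by (simp add: translate_def)
    then show "\<sigma> \<in> translate p ` ({..<k p} \<times> UNIV)" using j(1) by blast
  qed
qed

text \<open>Compares the chosen orientation with the one given by increasing
  \<open>rank\<close>.\<close>

definition orientation_sign :: "'v set \<Rightarrow> int" where
  "orientation_sign \<sigma> = list_sign rank (ori \<sigma>)"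

lemma ori: "\<sigma> \<in> K \<Longrightarrow> distinct (ori \<sigma>)" "\<sigma> \<in> K \<Longrightarrow> set (ori \<sigma>) = \<sigma>"
  and ori_act: "\<sigma> \<in> K \<Longrightarrow> order_sign (map (act g) (ori \<sigma>)) (ori (act g ` \<sigma>)) = 1"
  using orientation unfolding invariant_orientation_def by blast+

lemma orientation_sign_square: "\<sigma> \<in> K \<Longrightarrow> orientation_sign \<sigma> * orientation_sign \<sigma> = 1"
  unfolding orientation_sign_def using ori inj_rank_simplex by (intro list_sign_square) simp_all

lemma boundary_coeff:
  assumes "\<sigma> \<in> K" "\<rho> \<in> K"
  shows "boundary_coeff ori \<sigma> \<rho> =
    (\<Sum>v\<in>\<sigma>. if \<sigma> - {v} = \<rho> then orientation_sign \<sigma> * orientation_sign \<rho> * vertex_sign rank v \<rho> else 0)"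
  unfolding orientation_sign_def using assms ori inj_rank_simplex by (intro boundary_coeff_eq) simp_all

text \<open>The boundary coefficient can be computed with any injective order. Using
  \<open>rank\<close> for the translated simplices amounts to using
  \<open>rank \<circ> act g\<close> for the original ones, and invariance of \<open>ori\<close>
  matches the orientation signs.\<close>

lemma boundary_coeff_act:
  assumes \<sigma>: "\<sigma> \<in> K" and \<rho>: "\<rho> \<in> K"
  shows "boundary_coeff ori (act g ` \<sigma>) (act g ` \<rho>) = boundary_coeff ori \<sigma> \<rho>"
proof -
  let ?r = "rank \<circ> act g"
  have inj: "inj_on ?r \<sigma>" if "\<sigma> \<in> K" for \<sigma>
    using inj_act_simplex[OF that] inj_rank_simplex[OF act_simplex[OF that]] by (rule comp_inj_on)
  have sign: "orientation_sign (act g ` \<sigma>) = list_sign ?r (ori \<sigma>)" if \<sigma>: "\<sigma> \<in> K" for \<sigma>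
  proof -
    have 1: "list_sign rank (map (act g) (ori \<sigma>)) * orientation_sign (act g ` \<sigma>) = 1"
      unfolding orientation_sign_def ori_act[OF \<sigma>, of g, symmetric]
      using ori[OF \<sigma>] ori[OF act_simplex[OF \<sigma>]] inj_act_simplex[OF \<sigma>] inj_rank_simplex[OF act_simplex[OF \<sigma>]]
      by (intro order_sign_eq[symmetric]) (simp_all add: distinct_map)
    have "list_sign ?r (ori \<sigma>) = list_sign ?r (ori \<sigma>) * (orientation_sign (act g ` \<sigma>) * orientation_sign (act g ` \<sigma>))"
      using orientation_sign_square[OF act_simplex[OF \<sigma>]] by simp
    also have "\<dots> = orientation_sign (act g ` \<sigma>)" using 1 unfolding list_sign_map by (simp flip: mult.assoc)
    finally show ?thesis ..
  qed
  have "boundary_coeff ori (act g ` \<sigma>) (act g ` \<rho>) = (\<Sum>v\<in>\<sigma>. if act g ` \<sigma> - {act g v} = act g ` \<rho>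
      then list_sign ?r (ori \<sigma>) * list_sign ?r (ori \<rho>) * vertex_sign rank (act g v) (act g ` \<rho>) else 0)"
    unfolding boundary_coeff[OF act_simplex[OF \<sigma>] act_simplex[OF \<rho>]] sum.reindex[OF inj_act_simplex[OF \<sigma>]]
      sign[OF \<sigma>] sign[OF \<rho>] by (simp add: o_def)
  also have "\<dots> = (\<Sum>v\<in>\<sigma>. if \<sigma> - {v} = \<rho>
      then list_sign ?r (ori \<sigma>) * list_sign ?r (ori \<rho>) * vertex_sign ?r v \<rho> else 0)"
  proof (rule sum.cong[OF refl])
    fix v assume v: "v \<in> \<sigma>"
    have "act g ` \<sigma> - {act g v} = act g ` (\<sigma> - {v})"
      using inj_on_image_set_diff[OF inj_act_simplex[OF \<sigma>], of \<sigma> "{v}" g] v by simp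
    moreover have "act g ` (\<sigma> - {v}) = act g ` \<rho> \<longleftrightarrow> \<sigma> - {v} = \<rho>"
      by (rule inj_on_image_eq_iff[OF inj_act]) (use \<sigma> \<rho> in blast)+
    ultimately show "(if act g ` \<sigma> - {act g v} = act g ` \<rho>
        then list_sign ?r (ori \<sigma>) * list_sign ?r (ori \<rho>) * vertex_sign rank (act g v) (act g ` \<rho>) else 0)
      = (if \<sigma> - {v} = \<rho> then list_sign ?r (ori \<sigma>) * list_sign ?r (ori \<rho>) * vertex_sign ?r v \<rho> else 0)"
      unfolding vertex_sign_image[OF inj_act_simplex[OF \<rho>]] by simp
  qed
  also have "\<dots> = boundary_coeff ori \<sigma> \<rho>"
    using ori[OF \<sigma>] ori[OF \<rho>] inj[OF \<sigma>] by (rule boundary_coeff_eq[symmetric])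
  finally show ?thesis .
qed

section \<open>Codifferentials as boundary matrices\<close>

lemma codifferential_carrier: "d p \<in> carrier_mat (k (Suc p)) (k p)"
  by (simp add: codifferential_def)

lemma lookup_codifferential:
  assumes p: "Suc p \<le> m" and i: "i < k (Suc p)" and j: "j < k p"
  shows "lookup (d p $$ (i, j)) \<gamma> = of_int (boundary_coeff ori (tau (Suc p) i) (act \<gamma> ` tau p j))"
proof -
  let ?\<epsilon> = "\<lambda>\<gamma>. boundary_coeff ori (tau (Suc p) i) (act \<gamma> ` tau p j)"
  have \<sigma>: "tau (Suc p) i \<in> K" and \<rho>: "tau p j \<in> K" using tau_K p i j by auto
  \<comment> \<open>Only faces of one simplex have nonzero coefficient, and by freeness each arises
    from one group element. So the sum in \<open>codifferential\<close> is over a finite set and has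
    its intended value.\<close>
  have "(\<lambda>\<gamma>. act \<gamma> ` tau p j) ` {\<gamma>. ?\<epsilon> \<gamma> \<noteq> 0} \<subseteq> Pow (tau (Suc p) i)"
  proof (rule image_subsetI)
    fix \<gamma> assume "\<gamma> \<in> {\<gamma>. ?\<epsilon> \<gamma> \<noteq> 0}"
    then have "?\<epsilon> \<gamma> \<noteq> 0" by simp
    then have "\<exists>v\<in>tau (Suc p) i. tau (Suc p) i - {v} = act \<gamma> ` tau p j"
      unfolding boundary_coeff[OF \<sigma> act_simplex[OF \<rho>]] by (rule sum_faces_nonzero)
    then show "act \<gamma> ` tau p j \<in> Pow (tau (Suc p) i)" by blast
  qed
  then have "finite ((\<lambda>\<gamma>. act \<gamma> ` tau p j) ` {\<gamma>. ?\<epsilon> \<gamma> \<noteq> 0})"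
    using finite_simplex[OF \<sigma>] by (rule finite_subset[OF _ finite_Pow_iff[THEN iffD2]])
  then have fin: "finite {\<gamma>. ?\<epsilon> \<gamma> \<noteq> 0}"
    by (rule finite_imageD) (rule inj_onI, rule act_simplex_inj[OF \<rho>])
  have "d p $$ (i, j) = (\<Sum>\<delta> | ?\<epsilon> \<delta> \<noteq> 0. single \<delta> (of_int (?\<epsilon> \<delta>)))"
    using i j by (simp add: codifferential_def)
  then have "lookup (d p $$ (i, j)) \<gamma> = (\<Sum>\<delta> | ?\<epsilon> \<delta> \<noteq> 0. lookup (single \<delta> (of_int (?\<epsilon> \<delta>))) \<gamma>)"
    by (simp only: lookup_sum)
  also have "\<dots> = (\<Sum>\<delta> | ?\<epsilon> \<delta> \<noteq> 0. if \<delta> = \<gamma> then of_int (?\<epsilon> \<gamma>) else 0)"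
    by (intro sum.cong refl) (simp add: lookup_single when_def)
  also have "\<dots> = of_int (?\<epsilon> \<gamma>)" using fin by (simp add: sum.delta)
  finally show ?thesis .
qed

text \<open>A row \<open>F\<close> over the group algebra is read as the chain with value
  \<open>lookup (F l) \<alpha>\<close> on the translate by \<open>\<alpha>\<close> of the
  \<open>l\<close>-th representative.\<close>

definition coefficient :: "nat \<Rightarrow> (nat \<Rightarrow> 'g group_algebra) \<Rightarrow> 'v set \<Rightarrow> real" where
  "coefficient p F \<sigma> =
    (case inv_into ({..<k p} \<times> UNIV) (translate p) \<sigma> of (l, \<alpha>) \<Rightarrow> lookup (F l) \<alpha>)"

lemma inv_translate:
  "p \<le> m \<Longrightarrow> l < k p \<Longrightarrow> inv_into ({..<k p} \<times> UNIV) (translate p) (act \<alpha> ` tau p l) = (l, \<alpha>)"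
  using inv_into_f_f[OF bij_betw_imp_inj_on[OF bij_translate], of p "(l, \<alpha>)"] by (simp add: translate_def)

lemma coefficient: "p \<le> m \<Longrightarrow> l < k p \<Longrightarrow> coefficient p F (act \<alpha> ` tau p l) = lookup (F l) \<alpha>"
  by (simp add: coefficient_def inv_translate)

lemma simplices_cases:
  assumes "p \<le> m" "\<sigma> \<in> simplices K p"
  obtains l \<alpha> where "l < k p" "\<sigma> = act \<alpha> ` tau p l"
proof -
  have "\<sigma> \<in> translate p ` ({..<k p} \<times> UNIV)"
    using bij_translate[OF assms(1)] assms(2) unfolding bij_betw_def by simp
  then show thesis using that by (auto simp: translate_def)
qed

lemma sum_coefficient:
  assumes p: "p \<le> m" and R: "finite R" "R \<subseteq> simplices K p"
    and supp: "\<And>l \<alpha>. l < k p \<Longrightarrow> \<alpha> \<in> keys (F l) \<Longrightarrow> act \<alpha> ` tau p l \<in> R"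
  shows "(\<Sum>l<k p. \<Sum>\<alpha>\<in>keys (F l). lookup (F l) \<alpha> * H (act \<alpha> ` tau p l))
    = (\<Sum>\<rho>\<in>R. coefficient p F \<rho> * H \<rho>)"
proof -
  define P where "P = {x \<in> {..<k p} \<times> UNIV. translate p x \<in> R}"
  note bij = bij_translate[OF p]
  have inj: "inj_on (translate p) P"
    by (rule inj_on_subset[OF bij_betw_imp_inj_on[OF bij]]) (auto simp: P_def)
  have im: "translate p ` P = R"
  proof (intro subset_antisym subsetI)
    fix \<rho> assume "\<rho> \<in> R"
    then have "\<rho> \<in> translate p ` ({..<k p} \<times> UNIV)" using R(2) bij_betw_imp_surj_on[OF bij] by blast
    then obtain x where "x \<in> {..<k p} \<times> UNIV" "\<rho> = translate p x" by (rule imageE)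
    then show "\<rho> \<in> translate p ` P" using \<open>\<rho> \<in> R\<close> unfolding P_def by blast
  qed (auto simp: P_def)
  have fin: "finite P" by (rule finite_imageD[OF _ inj]) (simp only: im R(1))
  have "(\<Sum>l<k p. \<Sum>\<alpha>\<in>keys (F l). lookup (F l) \<alpha> * H (act \<alpha> ` tau p l))
    = (\<Sum>(l, \<alpha>)\<in>Sigma {..<k p} (\<lambda>l. keys (F l)). lookup (F l) \<alpha> * H (act \<alpha> ` tau p l))"
    by (rule sum.Sigma) simp_all
  also have "\<dots> = (\<Sum>(l, \<alpha>)\<in>P. lookup (F l) \<alpha> * H (act \<alpha> ` tau p l))"
    using fin supp by (intro sum.mono_neutral_left) (auto simp: P_def translate_def in_keys_iff)
  also have "\<dots> = (\<Sum>x\<in>P. coefficient p F (translate p x) * H (translate p x))"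
    by (intro sum.cong refl) (auto simp: P_def translate_def coefficient[OF p])
  also have "\<dots> = (\<Sum>\<rho>\<in>R. coefficient p F \<rho> * H \<rho>)"
    unfolding im[symmetric] by (simp add: sum.reindex[OF inj])
  finally show ?thesis .
qed

definition support :: "nat \<Rightarrow> (nat \<Rightarrow> 'g group_algebra) \<Rightarrow> 'v set set" where
  "support p F = (\<Union>l<k p. (\<lambda>\<alpha>. act \<alpha> ` tau p l) ` keys (F l))"

lemma support:
  assumes "p \<le> m"
  shows "finite (support p F)" "support p F \<subseteq> simplices K p"
    "\<And>l \<alpha>. l < k p \<Longrightarrow> \<alpha> \<in> keys (F l) \<Longrightarrow> act \<alpha> ` tau p l \<in> support p F"
  using act_simplices[OF tau_simplex[OF assms]] by (auto simp: support_def)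

text \<open>Multiplying a row by the codifferential on the right is the boundary map on the
  corresponding chain; invariance of the boundary coefficients absorbs the group elements of the
  convolution.\<close>

lemma lookup_row_mult_codifferential:
  assumes p: "Suc p \<le> m" and j: "j < k p"
  shows "lookup (\<Sum>l<k (Suc p). F l * d p $$ (l, j)) \<gamma> =
    (\<Sum>l<k (Suc p). \<Sum>\<alpha>\<in>keys (F l). lookup (F l) \<alpha> *
      of_int (boundary_coeff ori (act \<alpha> ` tau (Suc p) l) (act \<gamma> ` tau p j)))"
  unfolding lookup_sum
proof (rule sum.cong[OF refl])
  fix l assume "l \<in> {..<k (Suc p)}"
  then have l: "l < k (Suc p)" by simp
  have \<sigma>: "tau (Suc p) l \<in> K" and \<rho>: "tau p j \<in> K" using tau_K p l j by auto
  have "boundary_coeff ori (tau (Suc p) l) (act (- \<alpha> + \<gamma>) ` tau p j)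
      = boundary_coeff ori (act \<alpha> ` tau (Suc p) l) (act \<gamma> ` tau p j)" for \<alpha>
    using boundary_coeff_act[OF \<sigma> act_simplex[OF \<rho>], of \<alpha> "- \<alpha> + \<gamma>"]
      act_add_image[OF \<rho>, of \<alpha> "- \<alpha> + \<gamma>"] by (simp flip: add.assoc)
  then show "lookup (F l * d p $$ (l, j)) \<gamma> = (\<Sum>\<alpha>\<in>keys (F l). lookup (F l) \<alpha> *
      of_int (boundary_coeff ori (act \<alpha> ` tau (Suc p) l) (act \<gamma> ` tau p j)))"
    unfolding lookup_mult_sum[OF finite_keys subset_refl] lookup_codifferential[OF p l j] by simp
qed

lemma coefficient_codifferential_row:
  assumes p: "Suc p \<le> m" and i: "i < k (Suc p)" and \<rho>: "\<rho> \<in> simplices K p"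
  shows "coefficient p (\<lambda>l. single \<beta> 1 * d p $$ (i, l)) \<rho> = of_int (boundary_coeff ori (act \<beta> ` tau (Suc p) i) \<rho>)"
proof -
  have p': "p \<le> m" using p by simp
  obtain l \<alpha> where l: "l < k p" "\<rho> = act \<alpha> ` tau p l" using simplices_cases[OF p' \<rho>] by blast
  have \<sigma>: "tau (Suc p) i \<in> K" and \<tau>: "tau p l \<in> K" using tau_K p p' i l by auto
  have "boundary_coeff ori (tau (Suc p) i) (act (- \<beta> + \<alpha>) ` tau p l)
      = boundary_coeff ori (act \<beta> ` tau (Suc p) i) (act \<alpha> ` tau p l)"
    using boundary_coeff_act[OF \<sigma> act_simplex[OF \<tau>], of \<beta> "- \<beta> + \<alpha>"]
      act_add_image[OF \<tau>, of \<beta> "- \<beta> + \<alpha>"] by (simp flip: add.assoc)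
  then show ?thesis
    unfolding l(2) coefficient[OF p' l(1)] lookup_single_mult lookup_codifferential[OF p i l(1)] by simp
qed

text \<open>Pairing a translated row of the codifferential with a function on simplices gives its coboundary.\<close>

lemma pairing_codifferential_row:
  assumes p: "Suc p \<le> m" and i: "i < k (Suc p)"
    and \<tau>: "\<tau> = act \<beta> ` tau (Suc p) i" and F: "F = (\<lambda>l. single \<beta> 1 * d p $$ (i, l))"
  shows "(\<Sum>l<k p. \<Sum>\<alpha>\<in>keys (F l). lookup (F l) \<alpha> * H (act \<alpha> ` tau p l)) =
    (\<Sum>v\<in>\<tau>. of_int (orientation_sign \<tau> * orientation_sign (\<tau> - {v}) * vertex_sign rank v (\<tau> - {v})) * H (\<tau> - {v}))"
proof -
  let ?R = "(\<lambda>v. \<tau> - {v}) ` \<tau>"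
  have p': "p \<le> m" using p by simp
  have \<tau>S: "\<tau> \<in> simplices K (Suc p)" unfolding \<tau> by (rule act_simplices[OF tau_simplex[OF p i]])
  then have \<tau>K: "\<tau> \<in> K" and fin: "finite \<tau>" using simplices_K finite_simplex by blast+
  have R: "finite ?R" "?R \<subseteq> simplices K p" using fin face_simplices[OF \<tau>S] by auto
  have co: "coefficient p F \<rho> = (\<Sum>v\<in>\<tau>. if \<tau> - {v} = \<rho> then
      of_int (orientation_sign \<tau> * orientation_sign \<rho> * vertex_sign rank v \<rho>) else 0)" if "\<rho> \<in> simplices K p" for \<rho>
    unfolding F coefficient_codifferential_row[OF p i that] \<tau>[symmetric] boundary_coeff[OF \<tau>K simplices_K[OF that]]
      of_int_sum by (intro sum.cong refl) simp
  have supp: "act \<alpha> ` tau p l \<in> ?R" if l: "l < k p" and \<alpha>: "\<alpha> \<in> keys (F l)" for l \<alpha>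
  proof -
    let ?\<rho> = "act \<alpha> ` tau p l"
    have S: "?\<rho> \<in> simplices K p" by (rule act_simplices[OF tau_simplex[OF p' l]])
    have "coefficient p F ?\<rho> \<noteq> 0" using coefficient[OF p' l] \<alpha> by (simp add: in_keys_iff)
    then have "\<exists>v\<in>\<tau>. \<tau> - {v} = ?\<rho>" unfolding co[OF S] by (rule sum_faces_nonzero)
    then show ?thesis by blast
  qed
  have "(\<Sum>l<k p. \<Sum>\<alpha>\<in>keys (F l). lookup (F l) \<alpha> * H (act \<alpha> ` tau p l)) = (\<Sum>\<rho>\<in>?R. coefficient p F \<rho> * H \<rho>)"
    using sum_coefficient[OF p' R supp] .
  also have "\<dots> = (\<Sum>\<rho>\<in>?R. (\<Sum>v\<in>\<tau>. if \<tau> - {v} = \<rho> then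
      of_int (orientation_sign \<tau> * orientation_sign \<rho> * vertex_sign rank v \<rho>) else 0) * H \<rho>)"
    using R(2) co by (intro sum.cong refl) (simp only: subset_iff)
  also have "\<dots> = (\<Sum>v\<in>\<tau>. of_int (orientation_sign \<tau> * orientation_sign (\<tau> - {v}) * vertex_sign rank v (\<tau> - {v})) * H (\<tau> - {v}))"
    by (rule sum_faces[OF fin])
  finally show ?thesis .
qed

text \<open>Two vertices can be removed in either order, giving the same face with opposite
  signs.\<close>

lemma codifferential_square:
  assumes p: "Suc (Suc p) \<le> m"
  shows "d (Suc p) * d p = 0\<^sub>m (k (Suc (Suc p))) (k p)"
proof (rule eq_matI)
  fix i j assume "i < dim_row (0\<^sub>m (k (Suc (Suc p))) (k p) :: 'g group_algebra mat)"
    "j < dim_col (0\<^sub>m (k (Suc (Suc p))) (k p) :: 'g group_algebra mat)"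
  then have i: "i < k (Suc (Suc p))" and j: "j < k p" by simp_all
  let ?F = "\<lambda>l. single 0 1 * d (Suc p) $$ (i, l)"
  let ?\<tau> = "tau (Suc (Suc p)) i"
  have \<tau>K: "?\<tau> \<in> K" and \<tau>S: "?\<tau> \<in> simplices K (Suc (Suc p))" using tau_K tau_simplex p i by auto
  have p': "Suc p \<le> m" "p \<le> m" using p by simp_all
  have fin: "finite ?\<tau>" using finite_simplex[OF \<tau>K] .
  have "(d (Suc p) * d p) $$ (i, j) = (\<Sum>l<k (Suc p). ?F l * d p $$ (l, j))"
    using codifferential_carrier[of "Suc p"] codifferential_carrier[of p] i j
    by (simp add: scalar_prod_def lessThan_atLeast0)
  also have "\<dots> = 0"
  proof (rule poly_mapping_eqI)
    fix \<gamma>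
    let ?\<rho> = "act \<gamma> ` tau p j"
    have \<rho>: "?\<rho> \<in> K" by (rule act_simplex[OF tau_K[OF p'(2) j]])
    \<comment> \<open>The contribution of removing \<open>v\<close> and then \<open>u\<close>. The
      vertex signs relative to the final face are symmetric in \<open>u\<close> and
      \<open>v\<close>; only \<open>rank_sign\<close> changes sign.\<close>
    define t where "t v u = (if u \<noteq> v \<and> ?\<tau> - {v} - {u} = ?\<rho> then
      real_of_int (orientation_sign ?\<tau> * orientation_sign ?\<rho> * (rank_sign rank v u * (vertex_sign rank v ?\<rho> * vertex_sign rank u ?\<rho>))) else 0)" for v u
    have inner: "of_int (orientation_sign ?\<tau> * orientation_sign (?\<tau> - {v}) * vertex_sign rank v (?\<tau> - {v}))
        * of_int (boundary_coeff ori (?\<tau> - {v}) ?\<rho>) = (\<Sum>u\<in>?\<tau>. t v u)" if v: "v \<in> ?\<tau>" for v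
    proof -
      have fK: "?\<tau> - {v} \<in> K" using face_simplices[OF \<tau>S v] by (rule simplices_K)
      have sq: "orientation_sign (?\<tau> - {v}) * orientation_sign (?\<tau> - {v}) = 1" using orientation_sign_square[OF fK] .
      have "of_int (orientation_sign ?\<tau> * orientation_sign (?\<tau> - {v}) * vertex_sign rank v (?\<tau> - {v}))
          * of_int (boundary_coeff ori (?\<tau> - {v}) ?\<rho>) = (\<Sum>u\<in>?\<tau> - {v}. t v u)"
        unfolding boundary_coeff[OF fK \<rho>] of_int_sum sum_distrib_left
      proof (rule sum.cong[OF refl])
        fix u assume u: "u \<in> ?\<tau> - {v}"
        show "real_of_int (orientation_sign ?\<tau> * orientation_sign (?\<tau> - {v}) * vertex_sign rank v (?\<tau> - {v})) *
          of_int (if ?\<tau> - {v} - {u} = ?\<rho> then orientation_sign (?\<tau> - {v}) * orientation_sign ?\<rho> * vertex_sign rank u ?\<rho> else 0) = t v u"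
        proof (cases "?\<tau> - {v} - {u} = ?\<rho>")
          case True
          have "?\<tau> - {v} = insert u ?\<rho>" "u \<notin> ?\<rho>" using True u by blast+
          then have vs: "vertex_sign rank v (?\<tau> - {v}) = rank_sign rank v u * vertex_sign rank v ?\<rho>"
            using finite_simplex[OF \<rho>] by (simp add: vertex_sign_def)
          have "orientation_sign ?\<tau> * orientation_sign (?\<tau> - {v}) * vertex_sign rank v (?\<tau> - {v})
              * (orientation_sign (?\<tau> - {v}) * orientation_sign ?\<rho> * vertex_sign rank u ?\<rho>)
            = (orientation_sign (?\<tau> - {v}) * orientation_sign (?\<tau> - {v})) *
              (orientation_sign ?\<tau> * orientation_sign ?\<rho> * (rank_sign rank v u * (vertex_sign rank v ?\<rho> * vertex_sign rank u ?\<rho>)))"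
            unfolding vs by (simp only: ac_simps)
          then show ?thesis using True u unfolding sq t_def by (simp flip: of_int_mult)
        next
          case False
          then show ?thesis by (simp add: t_def)
        qed
      qed
      also have "\<dots> = (\<Sum>u\<in>?\<tau>. t v u)"
        using fin by (intro sum.mono_neutral_left) (auto simp: t_def)
      finally show ?thesis .
    qed
    have anti: "t v u = - t u v" for u v
    proof -
      have "?\<tau> - {v} - {u} = ?\<tau> - {u} - {v}" by blast
      then show ?thesis unfolding t_def rank_sign_swap[of rank u v] by (simp add: ac_simps)
    qed
    have one: "act 0 ` ?\<tau> = ?\<tau>" using act_0_image[OF \<tau>K] .
    have "lookup (\<Sum>l<k (Suc p). ?F l * d p $$ (l, j)) \<gamma> =
        (\<Sum>l<k (Suc p). \<Sum>\<alpha>\<in>keys (?F l). lookup (?F l) \<alpha> * of_int (boundary_coeff ori (act \<alpha> ` tau (Suc p) l) ?\<rho>))"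
      by (rule lookup_row_mult_codifferential[OF p'(1) j])
    also have "\<dots> = (\<Sum>v\<in>?\<tau>. of_int (orientation_sign ?\<tau> * orientation_sign (?\<tau> - {v}) * vertex_sign rank v (?\<tau> - {v}))
        * of_int (boundary_coeff ori (?\<tau> - {v}) ?\<rho>))"
      by (rule pairing_codifferential_row[OF p i one[symmetric] refl, where H = "\<lambda>\<sigma>. of_int (boundary_coeff ori \<sigma> ?\<rho>)"])
    also have "\<dots> = (\<Sum>v\<in>?\<tau>. \<Sum>u\<in>?\<tau>. t v u)" by (intro sum.cong refl inner)
    also have "\<dots> = 0" by (rule antisymmetric_sum_eq_0) (rule anti)
    finally show "lookup (\<Sum>l<k (Suc p). ?F l * d p $$ (l, j)) \<gamma> = lookup 0 \<gamma>" by simp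
  qed
  finally show "(d (Suc p) * d p) $$ (i, j) = 0\<^sub>m (k (Suc (Suc p))) (k p) $$ (i, j)" using i j by simp
qed (simp_all add: codifferential_def)

end

section \<open>Duality between rows of the codifferential and cocycles\<close>

lemma separating_functional:
  fixes W :: "('i \<Rightarrow> 'g::group_add group_algebra) set"
  assumes W: "(\<lambda>_. 0) \<in> W" "\<And>F G. F \<in> W \<Longrightarrow> G \<in> W \<Longrightarrow> F + G \<in> W" "\<And>c F. F \<in> W \<Longrightarrow> scale_fun c F \<in> W"
    and F: "F \<notin> W"
  obtains \<phi> :: "('i \<Rightarrow> 'g group_algebra) \<Rightarrow> real" where "\<And>F G. \<phi> (F + G) = \<phi> F + \<phi> G"
    "\<And>c F. \<phi> (scale_fun c F) = c * \<phi> F" "\<And>G. G \<in> W \<Longrightarrow> \<phi> G = 0" "\<phi> F = 1"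
proof -
  have field: "vector_space ((*) :: real \<Rightarrow> real \<Rightarrow> real)"
    by unfold_locales (simp_all add: distrib_left distrib_right)
  interpret V: vector_space_pair "scale_fun :: real \<Rightarrow> ('i \<Rightarrow> 'g group_algebra) \<Rightarrow> _" "(*) :: real \<Rightarrow> real \<Rightarrow> real"
    by (intro vector_space_pair.intro vector_space_scale_fun field)
  have sub: "V.vs1.subspace W"
    unfolding V.vs1.subspace_def zero_fun_def using W by simp
  obtain B where B: "B \<subseteq> W" "V.vs1.independent B" "W \<subseteq> V.vs1.span B"
    using V.vs1.maximal_independent_subset[of W] by metis
  have "V.vs1.span B \<subseteq> W" by (rule V.vs1.span_minimal[OF B(1) sub])
  then have "F \<notin> V.vs1.span B" using F by (rule contra_subsetD)
  then have ind: "V.vs1.independent (insert F B)" using B(2) by (rule V.vs1.independent_insertI)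
  obtain \<phi> where \<phi>: "Vector_Spaces.linear scale_fun (*) \<phi>" "\<And>x. x \<in> insert F B \<Longrightarrow> \<phi> x = (if x = F then 1 else 0)"
    using V.linear_independent_extend[OF ind, of "\<lambda>x. if x = F then 1 else 0"] by metis
  have B0: "\<phi> x = 0" if x: "x \<in> B" for x
  proof -
    have "x \<noteq> F" using x B(1) F by (metis subsetD)
    then show ?thesis using \<phi>(2)[of x] x by simp
  qed
  show thesis
  proof (rule that[of \<phi>])
    show "\<phi> (F + G) = \<phi> F + \<phi> G" for F G by (rule V.linear_add[OF \<phi>(1)])
    show "\<phi> (scale_fun c F) = c * \<phi> F" for c F by (rule V.linear_scale[OF \<phi>(1)])
    show "\<phi> G = 0" if "G \<in> W" for G
      by (rule V.linear_eq_0_on_span[OF \<phi>(1) B0]) (use that B(3) in blast)+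
    show "\<phi> F = 1" using \<phi>(2)[of F] by simp
  qed
qed

lemma functional_expansion:
  fixes \<phi> :: "(nat \<Rightarrow> 'g::group_add group_algebra) \<Rightarrow> real"
  assumes add: "\<And>F G. \<phi> (F + G) = \<phi> F + \<phi> G" and scale: "\<And>c F. \<phi> (scale_fun c F) = c * \<phi> F"
  shows "\<phi> (\<lambda>j. if j < N then G j else 0) =
    (\<Sum>l<N. \<Sum>\<alpha>\<in>keys (G l). lookup (G l) \<alpha> * \<phi> (\<lambda>j. if j = l then single \<alpha> 1 else 0))"
proof -
  have zero: "\<phi> (\<lambda>_. 0) = 0" using scale[of 0 "\<lambda>_. 0"] by (simp add: scale_fun_def)
  have one: "\<phi> (\<lambda>j. if j = l then a else 0) = (\<Sum>\<alpha>\<in>keys a. lookup a \<alpha> * \<phi> (\<lambda>j. if j = l then single \<alpha> 1 else 0))" for l a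
  proof -
    have "\<phi> (\<lambda>j. if j = l then \<Sum>\<alpha>\<in>S. single \<alpha> (c \<alpha>) else 0) = (\<Sum>\<alpha>\<in>S. c \<alpha> * \<phi> (\<lambda>j. if j = l then single \<alpha> 1 else 0))"
      if "finite S" for S and c :: "'g \<Rightarrow> real"
      using that
    proof induction
      case empty
      then show ?case using zero by (simp cong: if_cong)
    next
      case (insert \<alpha> S)
      have "(\<lambda>j. if j = l then \<Sum>\<alpha>\<in>insert \<alpha> S. single \<alpha> (c \<alpha>) else 0) =
        scale_fun (c \<alpha>) (\<lambda>j. if j = l then single \<alpha> 1 else 0) + (\<lambda>j. if j = l then \<Sum>\<alpha>\<in>S. single \<alpha> (c \<alpha>) else 0)"
        using insert.hyps by (simp add: fun_eq_iff scale_fun_def mult_single)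
      then show ?case using insert by (simp add: add scale)
    qed
    from this[of "keys a" "lookup a"] show ?thesis
      unfolding sum_single_keys[OF finite_keys subset_refl] by simp
  qed
  show ?thesis
  proof (induction N)
    case 0
    then show ?case using zero by simp
  next
    case (Suc N)
    have "(\<lambda>j. if j < Suc N then G j else 0) = (\<lambda>j. if j < N then G j else 0) + (\<lambda>j. if j = N then G N else 0)"
      by (simp add: fun_eq_iff less_Suc_eq)
    then have "\<phi> (\<lambda>j. if j < Suc N then G j else 0) = \<phi> (\<lambda>j. if j < N then G j else 0) + \<phi> (\<lambda>j. if j = N then G N else 0)"
      by (simp only: add)
    then show ?case unfolding Suc.IH one[of N "G N"] sum.lessThan_Suc .
  qed
qed

context equivariant_complex
begin

lemma orientation_sign_vertex:
  assumes "\<sigma> \<in> simplices K 0"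
  shows "orientation_sign \<sigma> = 1"
proof -
  have \<sigma>: "\<sigma> \<in> K" "card \<sigma> = Suc 0" using assms unfolding simplices_def by blast+
  have "length (ori \<sigma>) = Suc 0" using distinct_card[OF ori(1)[OF \<sigma>(1)]] ori(2)[OF \<sigma>(1)] \<sigma>(2) by simp
  then obtain v where "ori \<sigma> = [v]" by (metis length_0_conv length_Suc_conv)
  then show ?thesis by (simp add: orientation_sign_def)
qed

text \<open>A row killed by right multiplication with \<open>d q\<close> is a cycle, and on a
  contractible complex cycles pair to zero with cocycles. The orientation signs pass between the
  chosen orientations and those given by \<open>rank\<close>.\<close>

lemma cycle_annihilates_cocycles:
  assumes p: "Suc q \<le> m"
    and cocycle: "\<And>\<tau>. \<tau> \<in> simplices K (Suc (Suc q)) \<Longrightarrow>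
      (\<Sum>v\<in>\<tau>. of_int (vertex_sign rank v (\<tau> - {v})) * f (\<tau> - {v})) = 0"
    and cycle: "\<And>j. j < k q \<Longrightarrow> (\<Sum>l<k (Suc q). F l * d q $$ (l, j)) = 0"
  shows "(\<Sum>l<k (Suc q). \<Sum>\<alpha>\<in>keys (F l). lookup (F l) \<alpha> *
    (of_int (orientation_sign (act \<alpha> ` tau (Suc q) l)) * f (act \<alpha> ` tau (Suc q) l))) = 0"
proof -
  let ?R = "support (Suc q) F"
  note R = support[where F = F, OF p]
  let ?c = "\<lambda>\<sigma>. of_int (orientation_sign \<sigma>) * coefficient (Suc q) F \<sigma>"
  have "(\<Sum>\<sigma>\<in>?R. \<Sum>v\<in>\<sigma>. if \<sigma> - {v} = \<rho> then of_int (vertex_sign rank v \<rho>) * ?c \<sigma> else 0) = 0" for \<rho>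
  proof (cases "\<rho> \<in> simplices K q")
    case False
    have "(\<Sum>v\<in>\<sigma>. if \<sigma> - {v} = \<rho> then of_int (vertex_sign rank v \<rho>) * ?c \<sigma> else 0) = 0" if "\<sigma> \<in> ?R" for \<sigma>
    proof (rule sum.neutral, rule ballI)
      fix v assume "v \<in> \<sigma>"
      then have "\<sigma> - {v} \<in> simplices K q" using that R(2) face_simplices by blast
      then have "\<sigma> - {v} \<noteq> \<rho>" using False by metis
      then show "(if \<sigma> - {v} = \<rho> then of_int (vertex_sign rank v \<rho>) * ?c \<sigma> else 0) = 0" by simp
    qed
    then show ?thesis by (rule sum.neutral[OF ballI])
  next
    case True
    have q: "q \<le> m" using p by simp
    obtain j \<gamma> where j: "j < k q" "\<rho> = act \<gamma> ` tau q j" using simplices_cases[OF q True] by blast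
    have \<rho>: "\<rho> \<in> K" using True by (rule simplices_K)
    have "0 = lookup (\<Sum>l<k (Suc q). F l * d q $$ (l, j)) \<gamma>" using cycle[OF j(1)] by simp
    also have "\<dots> = (\<Sum>\<sigma>\<in>?R. coefficient (Suc q) F \<sigma> * of_int (boundary_coeff ori \<sigma> \<rho>))"
      unfolding lookup_row_mult_codifferential[OF p j(1)] j(2)[symmetric]
      by (rule sum_coefficient[OF p R, where H = "\<lambda>\<sigma>. of_int (boundary_coeff ori \<sigma> \<rho>)"])
    also have "\<dots> = (\<Sum>\<sigma>\<in>?R. of_int (orientation_sign \<rho>) *
        (\<Sum>v\<in>\<sigma>. if \<sigma> - {v} = \<rho> then of_int (vertex_sign rank v \<rho>) * ?c \<sigma> else 0))"
    proof (rule sum.cong[OF refl])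
      fix \<sigma> assume "\<sigma> \<in> ?R"
      then have \<sigma>: "\<sigma> \<in> K" using R(2) simplices_K by blast
      show "coefficient (Suc q) F \<sigma> * of_int (boundary_coeff ori \<sigma> \<rho>) = of_int (orientation_sign \<rho>) *
        (\<Sum>v\<in>\<sigma>. if \<sigma> - {v} = \<rho> then of_int (vertex_sign rank v \<rho>) * ?c \<sigma> else 0)"
        unfolding boundary_coeff[OF \<sigma> \<rho>] of_int_sum sum_distrib_left by (intro sum.cong refl) simp
    qed
    finally have "of_int (orientation_sign \<rho>) *
        (\<Sum>\<sigma>\<in>?R. \<Sum>v\<in>\<sigma>. if \<sigma> - {v} = \<rho> then of_int (vertex_sign rank v \<rho>) * ?c \<sigma> else 0) = 0"
      unfolding sum_distrib_left[symmetric] by (rule sym)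
    moreover have "orientation_sign \<rho> \<noteq> 0" using orientation_sign_square[OF \<rho>] by auto
    ultimately show ?thesis by simp
  qed
  then have "(\<Sum>\<sigma>\<in>?R. ?c \<sigma> * f \<sigma>) = 0"
    by (intro cycle_pairing_eq_0[where p = "Suc q", OF contractible _ inj_rank cocycle R(1,2)]) simp_all
  moreover have "(\<Sum>l<k (Suc q). \<Sum>\<alpha>\<in>keys (F l). lookup (F l) \<alpha> *
      (of_int (orientation_sign (act \<alpha> ` tau (Suc q) l)) * f (act \<alpha> ` tau (Suc q) l)))
    = (\<Sum>\<sigma>\<in>?R. coefficient (Suc q) F \<sigma> * (of_int (orientation_sign \<sigma>) * f \<sigma>))"
    by (rule sum_coefficient[OF p R, where H = "\<lambda>\<sigma>. of_int (orientation_sign \<sigma>) * f \<sigma>"])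
  ultimately show ?thesis by (simp only: ac_simps)
qed

text \<open>In degree zero there is no boundary to vanish; vanishing augmentation is the condition
  under which connectedness gives the conclusion.\<close>

lemma cycle_annihilates_cocycles_dim_0:
  assumes cocycle: "\<And>\<tau>. \<tau> \<in> simplices K (Suc 0) \<Longrightarrow>
      (\<Sum>v\<in>\<tau>. of_int (vertex_sign rank v (\<tau> - {v})) * f (\<tau> - {v})) = 0"
    and cycle: "(\<Sum>l<k 0. augmentation (F l)) = 0"
  shows "(\<Sum>l<k 0. \<Sum>\<alpha>\<in>keys (F l). lookup (F l) \<alpha> *
    (of_int (orientation_sign (act \<alpha> ` tau 0 l)) * f (act \<alpha> ` tau 0 l))) = 0"
proof -
  let ?R = "support 0 F"
  note R = support[where F = F, OF le0]
  have "(\<Sum>l<k 0. \<Sum>\<alpha>\<in>keys (F l). lookup (F l) \<alpha> * 1) = (\<Sum>\<sigma>\<in>?R. coefficient 0 F \<sigma> * 1)"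
    by (rule sum_coefficient[OF le0 R, where H = "\<lambda>_. 1"])
  then have "(\<Sum>\<sigma>\<in>?R. coefficient 0 F \<sigma>) = 0" using cycle by (simp add: augmentation_def)
  then have "(\<Sum>\<sigma>\<in>?R. coefficient 0 F \<sigma> * f \<sigma>) = 0"
    by (intro cycle_pairing_eq_0_dim_0[OF connected inj_rank _ R(1,2)]) (simp_all add: cocycle)
  moreover have "(\<Sum>l<k 0. \<Sum>\<alpha>\<in>keys (F l). lookup (F l) \<alpha> *
      (of_int (orientation_sign (act \<alpha> ` tau 0 l)) * f (act \<alpha> ` tau 0 l)))
    = (\<Sum>\<sigma>\<in>?R. coefficient 0 F \<sigma> * (of_int (orientation_sign \<sigma>) * f \<sigma>))"
    by (rule sum_coefficient[OF le0 R, where H = "\<lambda>\<sigma>. of_int (orientation_sign \<sigma>) * f \<sigma>"])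
  moreover have "\<dots> = (\<Sum>\<sigma>\<in>?R. coefficient 0 F \<sigma> * f \<sigma>)"
    using R(2) orientation_sign_vertex by (intro sum.cong refl) (simp add: subset_iff)
  ultimately show ?thesis by simp
qed

text \<open>If the row is outside the row space, a linear functional separates it. Its values on the
  unit rows form a function on simplices, a cocycle because the functional kills all translated rows
  of \<open>d p\<close>; yet it does not annihilate the row.\<close>

lemma row_space_of_annihilator:
  assumes p: "Suc p \<le> m"
    and ann: "\<And>f. (\<And>\<tau>. \<tau> \<in> simplices K (Suc p) \<Longrightarrow>
        (\<Sum>v\<in>\<tau>. of_int (vertex_sign rank v (\<tau> - {v})) * f (\<tau> - {v})) = 0) \<Longrightarrow>
      (\<Sum>l<k p. \<Sum>\<alpha>\<in>keys (F l). lookup (F l) \<alpha> *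
        (real_of_int (orientation_sign (act \<alpha> ` tau p l)) * f (act \<alpha> ` tau p l))) = 0"
  shows "\<exists>y. \<forall>j<k p. F j = (\<Sum>l<k (Suc p). y l * d p $$ (l, j))"
proof (rule ccontr)
  assume no: "\<nexists>y. \<forall>j<k p. F j = (\<Sum>l<k (Suc p). y l * d p $$ (l, j))"
  have p': "p \<le> m" using p by simp
  let ?row = "\<lambda>y j. if j < k p then \<Sum>l<k (Suc p). y l * d p $$ (l, j) else 0"
  let ?F = "\<lambda>j. if j < k p then F j else 0"
  have notin: "?F \<notin> range ?row"
  proof
    assume "?F \<in> range ?row"
    then obtain y where y: "?F = ?row y" by blast
    have "F j = (\<Sum>l<k (Suc p). y l * d p $$ (l, j))" if "j < k p" for j
      using fun_cong[OF y, of j] that by simp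
    then show False using no by blast
  qed
  have zero: "(\<lambda>_. 0) \<in> range ?row"
    by (rule range_eqI[where x = "\<lambda>_. 0"]) (simp add: fun_eq_iff)
  have add: "G + H \<in> range ?row" if GH: "G \<in> range ?row" "H \<in> range ?row" for G H
  proof -
    obtain y z where "G = ?row y" "H = ?row z" using GH by blast
    then show ?thesis
      by (intro range_eqI[where x = "\<lambda>l. y l + z l"]) (simp add: fun_eq_iff distrib_right sum.distrib)
  qed
  have scale: "scale_fun c G \<in> range ?row" if G: "G \<in> range ?row" for c G
  proof -
    obtain y where "G = ?row y" using G by blast
    then show ?thesis
      by (intro range_eqI[where x = "\<lambda>l. single 0 c * y l"])
        (simp add: fun_eq_iff scale_fun_def sum_distrib_left mult.assoc)
  qed
  obtain \<phi> :: "(nat \<Rightarrow> 'g group_algebra) \<Rightarrow> real" where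
    \<phi>: "\<And>F G. \<phi> (F + G) = \<phi> F + \<phi> G" "\<And>c F. \<phi> (scale_fun c F) = c * \<phi> F"
      "\<And>G. G \<in> range ?row \<Longrightarrow> \<phi> G = 0" "\<phi> ?F = 1"
    by (rule separating_functional[OF zero add scale notin], assumption+, rule that)
  let ?u = "\<lambda>(l::nat, \<alpha>) j. if j = l then single \<alpha> (1::real) else 0"
  \<comment> \<open>The sign converts the values of \<open>\<phi>\<close>, which refer to the
    orientations \<open>ori\<close>, to the orientations by \<open>rank\<close> in which cocycles
    are stated.\<close>
  define f where "f \<sigma> = of_int (orientation_sign \<sigma>) *
    \<phi> (?u (inv_into ({..<k p} \<times> UNIV) (translate p) \<sigma>))" for \<sigma>
  have f: "of_int (orientation_sign (act \<alpha> ` tau p l)) * f (act \<alpha> ` tau p l) = \<phi> (\<lambda>j. if j = l then single \<alpha> 1 else 0)"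
    if l: "l < k p" for l \<alpha>
  proof -
    have "real_of_int (orientation_sign (act \<alpha> ` tau p l)) * of_int (orientation_sign (act \<alpha> ` tau p l)) = 1"
      using orientation_sign_square[OF act_simplex[OF tau_K[OF p' l]]] by (simp flip: of_int_mult)
    then show ?thesis unfolding f_def inv_translate[OF p' l] by (simp flip: mult.assoc)
  qed
  have expand: "\<phi> (\<lambda>j. if j < k p then G j else 0) = (\<Sum>l<k p. \<Sum>\<alpha>\<in>keys (G l). lookup (G l) \<alpha> *
      (of_int (orientation_sign (act \<alpha> ` tau p l)) * f (act \<alpha> ` tau p l)))" for G
    unfolding functional_expansion[of \<phi>, OF \<phi>(1,2)] by (intro sum.cong refl) (simp add: f)
  have "(\<Sum>v\<in>\<tau>. of_int (vertex_sign rank v (\<tau> - {v})) * f (\<tau> - {v})) = 0" if \<tau>: "\<tau> \<in> simplices K (Suc p)" for \<tau>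
  proof -
    obtain i \<beta> where i: "i < k (Suc p)" "\<tau> = act \<beta> ` tau (Suc p) i" using simplices_cases[OF p \<tau>] by blast
    let ?G = "\<lambda>j. single \<beta> 1 * d p $$ (i, j)"
    have "(\<Sum>l<k (Suc p). (if l = i then single \<beta> 1 else 0) * d p $$ (l, j)) = ?G j" for j
    proof -
      have "(\<Sum>l<k (Suc p). (if l = i then single \<beta> 1 else 0) * d p $$ (l, j))
          = (\<Sum>l<k (Suc p). if l = i then ?G j else 0)" by (intro sum.cong refl) simp
      then show ?thesis using i(1) by simp
    qed
    then have "(\<lambda>j. if j < k p then ?G j else 0) \<in> range ?row"
      by (intro range_eqI[where x = "\<lambda>l. if l = i then single \<beta> 1 else 0"]) (simp only:)
    then have "0 = \<phi> (\<lambda>j. if j < k p then ?G j else 0)" using \<phi>(3) by simp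
    also have "\<dots> = (\<Sum>v\<in>\<tau>. of_int (orientation_sign \<tau> * orientation_sign (\<tau> - {v}) * vertex_sign rank v (\<tau> - {v}))
        * (of_int (orientation_sign (\<tau> - {v})) * f (\<tau> - {v})))"
      unfolding expand
      by (rule pairing_codifferential_row[OF p i refl, where H = "\<lambda>\<sigma>. of_int (orientation_sign \<sigma>) * f \<sigma>"])
    also have "\<dots> = (\<Sum>v\<in>\<tau>. of_int (orientation_sign \<tau>) * (of_int (vertex_sign rank v (\<tau> - {v})) * f (\<tau> - {v})))"
    proof (rule sum.cong[OF refl])
      fix v assume "v \<in> \<tau>"
      then have "\<tau> - {v} \<in> K" using face_simplices[OF \<tau>] simplices_K by blast
      then have sq: "real_of_int (orientation_sign (\<tau> - {v})) * of_int (orientation_sign (\<tau> - {v})) = 1"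
        using orientation_sign_square by (simp flip: of_int_mult)
      have "real_of_int (orientation_sign \<tau> * orientation_sign (\<tau> - {v}) * vertex_sign rank v (\<tau> - {v}))
          * (of_int (orientation_sign (\<tau> - {v})) * f (\<tau> - {v}))
        = (of_int (orientation_sign (\<tau> - {v})) * of_int (orientation_sign (\<tau> - {v}))) *
          (of_int (orientation_sign \<tau>) * (of_int (vertex_sign rank v (\<tau> - {v})) * f (\<tau> - {v})))"
        by (simp only: of_int_mult ac_simps)
      then show "real_of_int (orientation_sign \<tau> * orientation_sign (\<tau> - {v}) * vertex_sign rank v (\<tau> - {v}))
          * (of_int (orientation_sign (\<tau> - {v})) * f (\<tau> - {v}))
        = of_int (orientation_sign \<tau>) * (of_int (vertex_sign rank v (\<tau> - {v})) * f (\<tau> - {v}))"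
        unfolding sq by simp
    qed
    finally have "of_int (orientation_sign \<tau>) * (\<Sum>v\<in>\<tau>. of_int (vertex_sign rank v (\<tau> - {v})) * f (\<tau> - {v})) = 0"
      unfolding sum_distrib_left by (rule sym)
    moreover have "orientation_sign \<tau> \<noteq> 0" using orientation_sign_square[OF simplices_K[OF \<tau>]] by auto
    ultimately show ?thesis by simp
  qed
  then have "\<phi> ?F = 0" unfolding expand by (rule ann)
  then show False using \<phi>(4) by simp
qed

text \<open>Each row is the boundary of an edge, whose two ends carry opposite signs.\<close>

lemma row_sum_codifferential:
  assumes m: "Suc 0 \<le> m" and i: "i < k (Suc 0)"
  shows "row_sum (d 0) i = 0"
proof -
  let ?\<tau> = "tau (Suc 0) i"
  have \<tau>: "?\<tau> \<in> simplices K (Suc 0)" "?\<tau> \<in> K" using tau_simplex tau_K m i by auto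
  let ?F = "\<lambda>l. single 0 1 * d 0 $$ (i, l)"
  have one: "?\<tau> = act 0 ` ?\<tau>" using act_0_image[OF \<tau>(2)] by (rule sym)
  have s1: "orientation_sign (?\<tau> - {v}) = 1" if "v \<in> ?\<tau>" for v
    by (rule orientation_sign_vertex[OF face_simplices[OF \<tau>(1) that]])
  have "row_sum (d 0) i = (\<Sum>l<k 0. \<Sum>\<alpha>\<in>keys (?F l). lookup (?F l) \<alpha> * 1)"
    using codifferential_carrier[of 0] by (simp add: row_sum_def augmentation_def)
  also have "\<dots> = (\<Sum>v\<in>?\<tau>. of_int (orientation_sign ?\<tau> * orientation_sign (?\<tau> - {v}) * vertex_sign rank v (?\<tau> - {v})) * 1)"
    by (rule pairing_codifferential_row[OF m i one refl, where H = "\<lambda>_. 1"])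
  also have "\<dots> = (\<Sum>v\<in>?\<tau>. of_int (orientation_sign ?\<tau>) * of_int (vertex_sign rank v (?\<tau> - {v})))"
    by (intro sum.cong refl) (simp add: s1)
  also have "\<dots> = of_int (orientation_sign ?\<tau>) * of_int (\<Sum>v\<in>?\<tau>. vertex_sign rank v (?\<tau> - {v}))"
    by (simp add: sum_distrib_left)
  also have "(\<Sum>v\<in>?\<tau>. vertex_sign rank v (?\<tau> - {v})) = 0"
  proof -
    have "card ?\<tau> = 2" using \<tau>(1) by (simp add: simplices_def)
    then obtain u v where uv: "?\<tau> = {u, v}" "u \<noteq> v" by (meson card_2_iff)
    have "{u, v} - {u} = {v}" "{u, v} - {v} = {u}" using uv(2) by blast+
    then have "(\<Sum>v\<in>?\<tau>. vertex_sign rank v (?\<tau> - {v})) = vertex_sign rank u {v} + vertex_sign rank v {u}"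
      unfolding uv(1) using uv(2) by simp
    also have "\<dots> = 0" using rank_sign_swap[of rank u v] by (simp add: vertex_sign_def)
    finally show ?thesis .
  qed
  finally show ?thesis by simp
qed

text \<open>If a sum of squares factors through the codifferential, so does each of its roots: their rows are
  cycles, and cycles are boundaries.\<close>

lemma factor_of_sum_squares:
  assumes p: "Suc p \<le> m" and as: "set as \<subseteq> carrier_mat (k p) (k p)"
    and b: "b \<in> carrier_mat (k (Suc p)) (k (Suc p))"
    and eq: "sum_squares (k p) as = mat_star (d p) * b * d p" and a: "a \<in> set as"
  shows "\<exists>c\<in>carrier_mat (k p) (k (Suc p)). a = c * d p"
proof -
  note D = codifferential_carrier[of p]
  have ac: "a \<in> carrier_mat (k p) (k p)" using a as by blast
  have row: "\<exists>y. \<forall>j<k p. a $$ (i, j) = (\<Sum>l<k (Suc p). y l * d p $$ (l, j))" if i: "i < k p" for i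
  proof (rule row_space_of_annihilator[OF p])
    fix f :: "'v set \<Rightarrow> real"
    assume cocycle: "\<And>\<tau>. \<tau> \<in> simplices K (Suc p) \<Longrightarrow>
      (\<Sum>v\<in>\<tau>. of_int (vertex_sign rank v (\<tau> - {v})) * f (\<tau> - {v})) = 0"
    show "(\<Sum>l<k p. \<Sum>\<alpha>\<in>keys (a $$ (i, l)). lookup (a $$ (i, l)) \<alpha> *
      (real_of_int (orientation_sign (act \<alpha> ` tau p l)) * f (act \<alpha> ` tau p l))) = 0"
    proof (cases p)
      case 0
      \<comment> \<open>The factor \<open>d 0\<close> on the right has vanishing row sums. Hence the
        squared row sums of all roots add up to zero, and each row of \<open>a\<close> has
        augmentation zero.\<close>
      have "(\<Sum>i<k 0. row_sum (sum_squares (k 0) as) i) = 0"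
      proof (rule sum.neutral, rule ballI)
        fix i assume "i \<in> {..<k 0}"
        then have "row_sum (mat_star (d 0) * b * d 0) i =
            (\<Sum>h<k (Suc 0). augmentation ((mat_star (d 0) * b) $$ (i, h)) * row_sum (d 0) h)"
          using D b unfolding 0
          by (intro row_sum_mult[where m = "k 0"] mult_carrier_mat[where n = "k (Suc 0)"]) simp_all
        also have "\<dots> = 0" using row_sum_codifferential p unfolding 0 by (intro sum.neutral ballI) simp
        finally show "row_sum (sum_squares (k 0) as) i = 0" using eq unfolding 0 by simp
      qed
      then have "(\<Sum>a\<leftarrow>as. \<Sum>h<k 0. (row_sum a h)\<^sup>2) = 0"
        using row_sum_sum_squares[of as "k 0" "k 0"] as unfolding 0 by simp
      then have "\<forall>x\<in>set (map (\<lambda>a. \<Sum>h<k 0. (row_sum a h)\<^sup>2) as). x = 0"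
        by (subst (asm) sum_list_nonneg_eq_0_iff) (auto intro: sum_nonneg)
      then have "(\<Sum>h<k 0. (row_sum a h)\<^sup>2) = 0" using a by simp
      then have "row_sum a i = 0" using i unfolding 0 by (subst (asm) sum_nonneg_eq_0_iff) auto
      then have "(\<Sum>l<k 0. augmentation (a $$ (i, l))) = 0" using ac unfolding 0 by (simp add: row_sum_def)
      then show ?thesis using cocycle unfolding 0 by (intro cycle_annihilates_cocycles_dim_0)
    next
      case (Suc q)
      note E = codifferential_carrier[of q]
      have E': "d q \<in> carrier_mat (k p) (k q)" using E unfolding Suc .
      have Dp: "d p \<in> carrier_mat (k (Suc p)) (k p)" by (rule D)
      have DE: "d p * d q = 0\<^sub>m (k (Suc p)) (k q)" using codifferential_square[of q] p unfolding Suc by simp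
      have M: "mat_star (d q) * (mat_star (d p) * b) \<in> carrier_mat (k q) (k (Suc p))"
        using E' D b by simp
      \<comment> \<open>Conjugation by \<open>d q\<close> annihilates the right side of
        \<open>eq\<close> because \<open>d p * d q\<close> is zero. A vanishing sum of squares has
        vanishing roots, so the rows of \<open>a\<close> are cycles.\<close>
      have "sum_squares (k q) (map (\<lambda>a. a * d q) as) = mat_star (d q) * sum_squares (k p) as * d q"
        using conjugate_sum_squares[OF E' as] by (rule sym)
      also have "\<dots> = mat_star (d q) * (mat_star (d p) * b) * (d p * d q)"
      proof -
        have 1: "mat_star (d p) * b \<in> carrier_mat (k p) (k (Suc p))" using D b by simp
        have 2: "mat_star (d q) \<in> carrier_mat (k q) (k p)" using E' by simp
        show ?thesis unfolding eq assoc_mult_mat[OF M Dp E', symmetric] assoc_mult_mat[OF 2 1 Dp, symmetric] ..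
      qed
      also have "\<dots> = 0\<^sub>m (k q) (k q)" unfolding DE using M by (rule right_mult_zero_mat)
      finally have "sum_squares (k q) (map (\<lambda>a. a * d q) as) = 0\<^sub>m (k q) (k q)" .
      moreover have "set (map (\<lambda>a. a * d q) as) \<subseteq> carrier_mat (k p) (k q)" using as E' by auto
      ultimately have aE: "a * d q = 0\<^sub>m (k p) (k q)" using a
        by (intro sum_squares_eq_0[of "map (\<lambda>a. a * d q) as" "k p" "k q"]) simp_all
      have "(\<Sum>l<k (Suc q). a $$ (i, l) * d q $$ (l, j)) = 0" if j: "j < k q" for j
      proof -
        have "(a * d q) $$ (i, j) = (\<Sum>l<k p. a $$ (i, l) * d q $$ (l, j))"
          using ac E' i j by (simp add: scalar_prod_def lessThan_atLeast0)
        then show ?thesis using aE i j unfolding Suc by simp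
      qed
      then show ?thesis using cocycle p unfolding Suc by (intro cycle_annihilates_cocycles) simp_all
    qed
  qed
  have "\<exists>y. \<forall>i\<in>{..<k p}. \<forall>j<k p. a $$ (i, j) = (\<Sum>l<k (Suc p). y i l * d p $$ (l, j))"
    by (intro bchoice ballI row) (simp only: lessThan_iff)
  then obtain y where y: "\<forall>i\<in>{..<k p}. \<forall>j<k p. a $$ (i, j) = (\<Sum>l<k (Suc p). y i l * d p $$ (l, j))"
    by (rule exE)
  let ?c = "mat (k p) (k (Suc p)) (\<lambda>(i, l). y i l)"
  have "a = ?c * d p"
  proof (rule eq_matI)
    fix i j assume "i < dim_row (?c * d p)" "j < dim_col (?c * d p)"
    then have "i < k p" "j < k p" using D by simp_all
    then show "a $$ (i, j) = (?c * d p) $$ (i, j)"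
      using bspec[OF y, of i] D by (simp add: scalar_prod_def lessThan_atLeast0)
  qed (use ac D in simp_all)
  then show ?thesis by (intro bexI[where x = ?c]) simp_all
qed

end

theorem theorem5p2:
  fixes K :: "'v set set"
    and act :: "'g::group_add \<Rightarrow> 'v \<Rightarrow> 'v"
    and ori :: "'v set \<Rightarrow> 'v list"
    and tau :: "nat \<Rightarrow> nat \<Rightarrow> 'v set"
    and n :: nat
    and k :: "nat \<Rightarrow> nat"
    and d :: "nat \<Rightarrow> 'g group_algebra mat"
  assumes "n \<ge> 1"
    and "type_F_complex (n + 1) K act"
    and "invariant_orientation K act ori"
    and "orbit_representatives (n + 1) K act tau"
    and "k = (\<lambda>p. card (orbits K act p))"
    and "d = codifferential K act ori tau"
    and "{a \<in> carrier_mat (k n) (k n). conjugation d (n - 1) a = 0\<^sub>m (k (n - 1)) (k (n - 1))}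
           = split_conjugation_space k d n"
    \<comment> \<open>Hilbert spaces are taken on subsets of an arbitrary type \<open>'h\<close> that is not too small to
       carry a nonzero one.\<close>
    and "(UNIV :: real set) \<lesssim> (UNIV :: 'h set)"
  shows
    "((\<forall>(H :: 'h hilbert) \<pi>. hilbert_space H \<and> unitary_rep H \<pi> \<longrightarrow> cohomology_vanishes H \<pi> d n)
        \<longleftrightarrow> (\<exists>c>0. laplacian d n - scalar_times c (1\<^sub>m (k n)) \<in> sums_of_squares (k n)))
     \<and>
     ((\<exists>c>0. laplacian d n - scalar_times c (1\<^sub>m (k n)) \<in> sums_of_squares (k n))
        \<longleftrightarrow> (\<exists>c>0. upper_laplacian d (n - 1) * upper_laplacian d (n - 1)
                      - scalar_times c (upper_laplacian d (n - 1))
                    \<in> sums_of_squares (k (n - 1))))"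
proof -
  have "abstract_complex K" using assms(2) unfolding type_F_complex_def by (rule conjunct1)
  then interpret E: equivariant_complex K "n + 1" act ori tau
    using assms(2-4) by (simp add: equivariant_complex_def simplicial_complex_def equivariant_complex_axioms_def)
  obtain p where n: "n = Suc p" using assms(1) by (cases n) auto
  note k = assms(5) and d = assms(6)
  have d0: "d p \<in> carrier_mat (k n) (k p)" and d1: "d n \<in> carrier_mat (k (Suc n)) (k n)"
    unfolding k d n by (rule E.codifferential_carrier)+
  have p: "n - 1 = p" using n by simp
  have ker: "a \<in> carrier_mat (k n) (k n) \<and> mat_star (d p) * a * d p = 0\<^sub>m (k p) (k p) \<longleftrightarrow>
      (\<exists>x\<in>carrier_mat (k (Suc n)) (k n). \<exists>y\<in>carrier_mat (k n) (k (Suc n)). a = mat_star (d n) * x + y * d n)" for a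
  proof -
    have "a \<in> {a \<in> carrier_mat (k n) (k n). conjugation d (n - 1) a = 0\<^sub>m (k (n - 1)) (k (n - 1))}
        \<longleftrightarrow> a \<in> split_conjugation_space k d n" by (simp only: assms(7))
    then show ?thesis unfolding conjugation_def split_conjugation_space_def p mem_Collect_eq by blast
  qed
  have d0': "mat_star (d p) \<in> carrier_mat (k p) (k n)" and d1': "mat_star (d n) \<in> carrier_mat (k n) (k (Suc n))"
    using d0 d1 by simp_all
  have dd_c: "d n * d p \<in> carrier_mat (k (Suc n)) (k p)" using d1 d0 by (rule mult_carrier_mat)
  have dd: "d n * d p = 0\<^sub>m (k (Suc n)) (k p)"
  proof (rule star_mult_self_eq_0[OF _ dd_c])
    \<comment> \<open>This places \<open>mat_star (d n) * d n\<close> in the split conjugation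
      space, with \<open>x = d n\<close> and \<open>y = 0\<close>. By the kernel hypothesis its
      conjugate by \<open>d p\<close> vanishes, and that conjugate is
      \<open>mat_star (d n * d p) * (d n * d p)\<close>.\<close>
    have "mat_star (d n) * d n + 0\<^sub>m (k n) (k (Suc n)) * d n = mat_star (d n) * d n"
      using d1 mult_carrier_mat[OF d1' d1] by simp
    then have "mat_star (d p) * (mat_star (d n) * d n) * d p = 0\<^sub>m (k p) (k p)"
      using ker[of "mat_star (d n) * d n"] d1 zero_carrier_mat by metis
    moreover have "mat_star (d p) * (mat_star (d n) * d n) * d p = mat_star (d n * d p) * (d n * d p)"
    proof -
      have "mat_star (d p) * (mat_star (d n) * d n) = mat_star (d p) * mat_star (d n) * d n"
        using assoc_mult_mat[OF d0' d1' d1] by (rule sym)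
      then show ?thesis
        unfolding mat_star_mult[OF d1 d0]
        using assoc_mult_mat[OF mult_carrier_mat[OF d0' d1'] d1 d0] by simp
    qed
    ultimately show "mat_star (d n * d p) * (d n * d p) = 0\<^sub>m (k p) (k p)" by simp
  qed
  have lap: "laplacian d n = mat_star (d n) * d n + d p * mat_star (d p)"
    by (simp only: laplacian_def p)
  have up: "upper_laplacian d p = mat_star (d p) * d p"
    by (simp only: upper_laplacian_def)
  have vanish: "cohomology_vanishes H \<pi> d n \<longleftrightarrow> rep_ker H \<pi> (d n) \<subseteq> rep_im H \<pi> (d p)"
    if H: "hilbert_space H" "unitary_rep H \<pi>" for H :: "'h hilbert" and \<pi> :: "'g \<Rightarrow> 'h \<Rightarrow> 'h"
  proof -
    interpret unitary_representation H \<pi>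
      using H by (simp add: unitary_representation_def unitary_representation_axioms_def)
    have "d (n - 1) \<in> carrier_mat (k n) (k p)" using d0 by (simp only: p)
    then have "cohomology_vanishes H \<pi> d n \<longleftrightarrow> rep_ker H \<pi> (d n) \<subseteq> rep_im H \<pi> (d (n - 1))"
      using d1 by (rule cohomology_vanishes_iff)
    then show ?thesis by (simp only: p)
  qed
  have "cohomology_vanishes H \<pi> d n"
    if c: "c > 0" "laplacian d n - scalar_times c (1\<^sub>m (k n)) \<in> sums_of_squares (k n)"
      and H: "hilbert_space H" "unitary_rep H \<pi>" for c and H :: "'h hilbert" and \<pi> :: "'g \<Rightarrow> 'h \<Rightarrow> 'h"
  proof -
    interpret unitary_representation H \<pi>
      using H by (simp add: unitary_representation_def unitary_representation_axioms_def)
    show ?thesis unfolding vanish[OF H]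
      by (rule ker_subset_im_of_gap[OF d0 d1 dd c(1)]) (use c(2) in \<open>simp only: lap\<close>)
  qed
  moreover have "\<exists>c>0. laplacian d n - scalar_times c (1\<^sub>m (k n)) \<in> sums_of_squares (k n)"
    if all: "\<forall>(H :: 'h hilbert) \<pi>. hilbert_space H \<and> unitary_rep H \<pi> \<longrightarrow> cohomology_vanishes H \<pi> d n"
  proof (rule ccontr)
    assume "\<not> ?thesis"
    then have no_gap: "mat_star (d n) * d n + d p * mat_star (d p) - scalar_times c (1\<^sub>m (k n)) \<notin> sums_of_squares (k n)"
      if "c > 0" for c
      using that unfolding lap by blast
    obtain H :: "'h hilbert" and \<pi> :: "'g \<Rightarrow> 'h \<Rightarrow> 'h" where
      H: "hilbert_space H" "unitary_rep H \<pi>" "\<not> rep_ker H \<pi> (d n) \<subseteq> rep_im H \<pi> (d p)"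
      by (rule harmonic_vector_of_no_gap[OF d0 d1 no_gap E.countable_group assms(8)], assumption, rule that)
    then show False using all vanish[OF H(1,2)] by blast
  qed
  moreover have "\<exists>c>0. upper_laplacian d (n - 1) * upper_laplacian d (n - 1)
      - scalar_times c (upper_laplacian d (n - 1)) \<in> sums_of_squares (k (n - 1))"
    if "\<exists>c>0. laplacian d n - scalar_times c (1\<^sub>m (k n)) \<in> sums_of_squares (k n)"
    using upper_gap_of_laplacian_gap[OF d0 d1 dd] that unfolding p up lap by blast
  moreover have "\<exists>c>0. laplacian d n - scalar_times c (1\<^sub>m (k n)) \<in> sums_of_squares (k n)"
    if up_gap: "\<exists>c>0. upper_laplacian d (n - 1) * upper_laplacian d (n - 1)
      - scalar_times c (upper_laplacian d (n - 1)) \<in> sums_of_squares (k (n - 1))"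
  proof -
    obtain c where c: "c > 0" "mat_star (d p) * d p * (mat_star (d p) * d p) - scalar_times c (mat_star (d p) * d p)
        \<in> sums_of_squares (k p)"
      using up_gap unfolding p up by blast
    show ?thesis unfolding lap
    proof (rule laplacian_gap_of_upper_gap[OF d0 d1 _ _ c])
      fix a assume "a \<in> carrier_mat (k n) (k n)" "mat_star (d p) * a * d p = 0\<^sub>m (k p) (k p)"
      then show "\<exists>x\<in>carrier_mat (k (Suc n)) (k n). \<exists>y\<in>carrier_mat (k n) (k (Suc n)). a = mat_star (d n) * x + y * d n"
        using ker[of a] by (simp only: simp_thms)
    next
      fix as b a
      assume "set as \<subseteq> carrier_mat (k p) (k p)" "b \<in> carrier_mat (k n) (k n)"
        "sum_squares (k p) as = mat_star (d p) * b * d p" "a \<in> set as"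
      then show "\<exists>c\<in>carrier_mat (k p) (k n). a = c * d p"
        unfolding k d n by (intro E.factor_of_sum_squares) (simp_all add: n)
    qed
  qed
  ultimately show ?thesis by blast
qed

end
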